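(* Let $G$ be a connected Lie group with Lie algebra $\mathfrak{g}=T_eG$, endowed with a left invariant spray structure $\mathbf{G}$ with connection operator $N$. Let $w\in\mathfrak{g}$ be arbitrary and let $c(t)=\exp tw$ be the corresponding one-parameter subgroup of $G$. Denote by $\mathbf{P}^{\mathrm{nl}}_{c(0),c(t);c}:T_{c(0)}G\backslash\{0\}\to T_{c(t)}G\backslash\{0\}$ the nonlinearly parallel translation along $c(\cdot)$ from $c(0)$ to $c(t)$. Then $$\rho_t=(L_{c(t)^{-1}})_*\circ\mathbf{P}^{\mathrm{nl}}_{c(0),c(t);c}$$ is the one-parameter subgroup of diffeomorphisms of $\mathfrak{g}\backslash\{0\}$ generated by the smooth vector field $-N(\cdot,w)$ on $\mathfrak{g}\backslash\{0\}$.
   Context: Summation convention is used. A spray structure on a smooth manifold $M$ is a smooth vector field $\mathbf{G}$ on the slit tangent bundle $TM\backslash 0$ which, in every standard local coordinate system $(x^i,y^i)$ of $TM$ (i.e. $x=(x^i)\in M$, $y=y^i\partial_{x^i}\in T_xM$), has the form $\mathbf{G}=y^i\partial_{x^i}-2\mathbf{G}^i\partial_{y^i}$ with $\mathbf{G}^i=\mathbf{G}^i(x,y)$ positively 2-homogeneous in $y$. Put $N^i_j=\partial\mathbf{G}^i/\partial y^j$. Nonlinear parallel translation: for a smooth curve $c(t)$ and a nowhere vanishing smooth vector field $Y(t)=z^i(t)\partial_{x^i}|_{c(t)}$ along it, the nonlinearly covariant derivative is $\widetilde D_{\dot c(t)}Y(t)=\big(\tfrac{\mathrm{d}z^i(t)}{\mathrm{d}t}+\dot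 c^j(t)N^i_j(c(t),Y(t))\big)\partial_{x^i}|_{c(t)}$, and $Y(t)$ is nonlinearly parallel along $c(t)$ if $\widetilde D_{\dot c(t)}Y(t)\equiv0$. The map $\mathbf{P}^{\mathrm{nl}}_{c(t_0),c(t_1);c}:T_{c(t_0)}M\backslash\{0\}\to T_{c(t_1)}M\backslash\{0\}$ sends $y$ to $Y(t_1)$, where $Y(t)$ is the nonlinearly parallel vector field along $c$ with $Y(t_0)=y$. Lie group notation: $L_g(g')=gg'$; $[\cdot,\cdot]_{\mathfrak{g}}$ is the Lie bracket of $\mathfrak{g}$ (defined through left invariant vector fields). Fix a basis $e_1,\dots,e_n$ of $\mathfrak{g}$ and let $U_i(g)=(L_g)_*(e_i)$. Let $\widetilde U_i$ be the complete lift of $U_i$ to $TG$ (the complete lift of $X=X^i\partial_{x^i}$ is $X^i\partial_{x^i}+y^j\tfrac{\partial X^i}{\partial x^j}\partial_{y^i}$). Writing $y=u^iU_i(g)\in T_gG$ defines functions $u^i$ on $TG$, and $\partial_{u^i}$ denotes the vector field on $TG$ tangent to each $T_gG$ and equal there to the coordinate field of the linear coordinate $u^i$. Left invariant sprays: $\mathbf{G}$ on $G$ is left invariant if it is preserved by (the maps on $TG\backslash 0$ induced by) all left translations. Put $\mathbf{G}_0=u^i\widetilde U_i$. Every left invariant spray structure can be written $\mathbf{G}=\mathbf{G}_0-\mathbf{H}^i\partial_{u^i}$, where the $\mathbf{H}^i$ are left invariant smooth functions on $TG\backslash 0$, positively 2-homogeneous on each $T_gG$. The spray vector field is the smooth map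 $\eta:\mathfrak{g}\backslash\{0\}\to\mathfrak{g}$, $\eta(y)=\mathbf{H}^i(e,y)e_i$. The connection operator is $N:(\mathfrak{g}\backslash\{0\})\times\mathfrak{g}\to\mathfrak{g}$, $N(y,w)=\tfrac12D\eta(y,w)-\tfrac12[y,w]_{\mathfrak{g}}$, where $D\eta(y,w)$ is the derivative of $\eta$ at $y$ in the direction $w$. For fixed $w$, $N(\cdot,w)$ is viewed as a vector field on $\mathfrak{g}\backslash\{0\}$ by identifying tangent spaces of $\mathfrak{g}\backslash\{0\}$ with $\mathfrak{g}$. *)

theory Defs
  imports "HOL-Analysis.Analysis" "HOL-Algebra.Group"
begin

section \<open>Smooth maps between open subsets of Euclidean spaces\<close>

text \<open>Only meant for open sets \<open>S\<close>: the derivatives are taken at interior points.\<close>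

primrec Ck_on :: "nat \<Rightarrow> 'a::euclidean_space set \<Rightarrow> ('a \<Rightarrow> 'b::euclidean_space) \<Rightarrow> bool" where
  "Ck_on 0 S f \<longleftrightarrow> continuous_on S f"
| "Ck_on (Suc k) S f \<longleftrightarrow> (\<forall>x\<in>S. f differentiable (at x)) \<and>
     (\<forall>v. Ck_on k S (\<lambda>x. frechet_derivative f (at x) v))"

definition smooth_on :: "'a::euclidean_space set \<Rightarrow> ('a \<Rightarrow> 'b::euclidean_space) \<Rightarrow> bool" where
  "smooth_on S f \<longleftrightarrow> (\<forall>k. Ck_on k S f)"

section \<open>Smooth manifolds\<close>

text \<open>A chart is a pair of its domain and its coordinate map; only the values of the
  coordinate map on the domain matter. A manifold is given by an atlas, which determines
  its underlying set and its topology. The atlas is arbitrary, so it may be the maximal one.\<close>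

type_synonym ('a, 'e) chart = "'a set \<times> ('a \<Rightarrow> 'e)"
type_synonym ('a, 'e) atlas = "('a, 'e) chart set"

definition chart_inv :: "('a, 'e) chart \<Rightarrow> 'e \<Rightarrow> 'a" where
  "chart_inv c = inv_into (fst c) (snd c)"

definition points :: "('a, 'e) atlas \<Rightarrow> 'a set" where
  "points A = (\<Union>c\<in>A. fst c)"

definition atlas_topology :: "('a, 'e::euclidean_space) atlas \<Rightarrow> 'a topology" where
  "atlas_topology A =
     topology (\<lambda>W. W \<subseteq> points A \<and> (\<forall>c\<in>A. open (snd c ` (W \<inter> fst c))))"

lemma openin_atlas_topology:
  assumes "\<And>c. c \<in> A \<Longrightarrow> inj_on (snd c) (fst c)"
  shows "openin (atlas_topology A) W \<longleftrightarrow>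
           W \<subseteq> points A \<and> (\<forall>c\<in>A. open (snd c ` (W \<inter> fst c)))"
proof -
  have "istopology (\<lambda>W. W \<subseteq> points A \<and> (\<forall>c\<in>A. open (snd c ` (W \<inter> fst c))))"
    unfolding istopology_def
  proof (intro conjI allI impI)
    fix S T
    assume S: "S \<subseteq> points A \<and> (\<forall>c\<in>A. open (snd c ` (S \<inter> fst c)))"
      and T: "T \<subseteq> points A \<and> (\<forall>c\<in>A. open (snd c ` (T \<inter> fst c)))"
    show "S \<inter> T \<subseteq> points A" using S by blast
    show "\<forall>c\<in>A. open (snd c ` (S \<inter> T \<inter> fst c))"
    proof
      fix c assume c: "c \<in> A"
      have "snd c ` (S \<inter> T \<inter> fst c) = snd c ` (S \<inter> fst c) \<inter> snd c ` (T \<inter> fst c)"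
        using assms[OF c] unfolding inj_on_def by blast
      then show "open (snd c ` (S \<inter> T \<inter> fst c))" using S T c by auto
    qed
  next
    fix K
    assume K: "\<forall>S\<in>K. S \<subseteq> points A \<and> (\<forall>c\<in>A. open (snd c ` (S \<inter> fst c)))"
    show "\<Union>K \<subseteq> points A" using K by blast
    show "\<forall>c\<in>A. open (snd c ` (\<Union>K \<inter> fst c))"
    proof
      fix c assume c: "c \<in> A"
      have "snd c ` (\<Union>K \<inter> fst c) = (\<Union>S\<in>K. snd c ` (S \<inter> fst c))" by blast
      then show "open (snd c ` (\<Union>K \<inter> fst c))" using K c by auto
    qed
  qed
  then show ?thesis unfolding atlas_topology_def by simp
qed

definition smooth_manifold :: "('a, 'e::euclidean_space) atlas \<Rightarrow> bool" where
  "smooth_manifold A \<longleftrightarrow>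
     (\<forall>c\<in>A. inj_on (snd c) (fst c)) \<and>
     (\<forall>c\<in>A. \<forall>d\<in>A. open (snd c ` (fst c \<inter> fst d)) \<and>
                smooth_on (snd c ` (fst c \<inter> fst d)) (snd d \<circ> chart_inv c)) \<and>
     Hausdorff_space (atlas_topology A) \<and> second_countable (atlas_topology A)"

definition euclidean_atlas :: "'e::euclidean_space set \<Rightarrow> ('e, 'e) atlas" where
  "euclidean_atlas S = {(S, \<lambda>x. x)}"

definition prod_atlas :: "('a, 'e) atlas \<Rightarrow> ('b, 'f) atlas \<Rightarrow> ('a \<times> 'b, 'e \<times> 'f) atlas" where
  "prod_atlas A B = {(fst c \<times> fst d, \<lambda>(p, q). (snd c p, snd d q)) | c d. c \<in> A \<and> d \<in> B}"

definition smooth_map ::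
    "('a, 'e::euclidean_space) atlas \<Rightarrow> ('b, 'f::euclidean_space) atlas \<Rightarrow> ('a \<Rightarrow> 'b) \<Rightarrow> bool" where
  "smooth_map A B f \<longleftrightarrow>
     continuous_map (atlas_topology A) (atlas_topology B) f \<and>
     (\<forall>c\<in>A. \<forall>d\<in>B. smooth_on (snd c ` {p \<in> fst c. f p \<in> fst d}) (snd d \<circ> f \<circ> chart_inv c))"

definition diffeomorphism ::
    "('a, 'e::euclidean_space) atlas \<Rightarrow> ('b, 'f::euclidean_space) atlas \<Rightarrow> ('a \<Rightarrow> 'b) \<Rightarrow> bool" where
  "diffeomorphism A B f \<longleftrightarrow> bij_betw f (points A) (points B) \<and>
     smooth_map A B f \<and> smooth_map B A (inv_into (points A) f)"

section \<open>Tangent vectors and vector fields\<close>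

text \<open>A tangent vector at \<open>p\<close> is the family of its components in all charts around \<open>p\<close>,
  transforming by the derivatives of the coordinate changes. Families are set to \<open>0\<close> at all
  other indices, so that equality of tangent vectors is equality of functions. The linear
  structure is pointwise.\<close>

type_synonym ('a, 'e) tvec = "('a, 'e) chart \<Rightarrow> 'e"

definition tangent_space :: "('a, 'e::euclidean_space) atlas \<Rightarrow> 'a \<Rightarrow> ('a, 'e) tvec set" where
  "tangent_space A p = {v.
     (\<forall>c\<in>A. \<forall>d\<in>A. p \<in> fst c \<and> p \<in> fst d \<longrightarrow>
        v d = frechet_derivative (snd d \<circ> chart_inv c) (at (snd c p)) (v c)) \<and>
     (\<forall>c. c \<notin> A \<or> p \<notin> fst c \<longrightarrow> v c = 0)}"

definition slit_tangent_space :: "('a, 'e::euclidean_space) atlas \<Rightarrow> 'a \<Rightarrow> ('a, 'e) tvec set" where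
  "slit_tangent_space A p = tangent_space A p - {\<lambda>_. 0}"

definition lin_comb :: "nat \<Rightarrow> (nat \<Rightarrow> real) \<Rightarrow> (nat \<Rightarrow> ('a, 'e::euclidean_space) tvec) \<Rightarrow> ('a, 'e) tvec" where
  "lin_comb n a b = (\<lambda>d. \<Sum>i=1..n. a i *\<^sub>R b i d)"

definition is_basis :: "('a, 'e::euclidean_space) tvec set \<Rightarrow> nat \<Rightarrow> (nat \<Rightarrow> ('a, 'e) tvec) \<Rightarrow> bool" where
  "is_basis V n b \<longleftrightarrow>
     (\<forall>i\<in>{1..n}. b i \<in> V) \<and>
     (\<forall>a. lin_comb n a b = (\<lambda>_. 0) \<longrightarrow> (\<forall>i\<in>{1..n}. a i = 0)) \<and>
     (\<forall>v\<in>V. \<exists>a. v = lin_comb n a b)"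

definition basis_coord :: "nat \<Rightarrow> (nat \<Rightarrow> ('a, 'e::euclidean_space) tvec) \<Rightarrow> ('a, 'e) tvec \<Rightarrow> nat \<Rightarrow> real" where
  "basis_coord n b v = (THE a. v = lin_comb n a b \<and> (\<forall>i. i \<notin> {1..n} \<longrightarrow> a i = 0))"

text \<open>A tangent space is a manifold through the linear coordinates that the charts around the
  base point induce on it; \<open>S\<close> is the full tangent space or the slit one.\<close>

definition tangent_space_atlas ::
    "('a, 'e::euclidean_space) atlas \<Rightarrow> 'a \<Rightarrow> ('a, 'e) tvec set \<Rightarrow> (('a, 'e) tvec, 'e) atlas" where
  "tangent_space_atlas A p S = {(S, \<lambda>v. v c) | c. c \<in> A \<and> p \<in> fst c}"

definition velocity :: "('a, 'e::euclidean_space) atlas \<Rightarrow> (real \<Rightarrow> 'a) \<Rightarrow> real \<Rightarrow> ('a, 'e) tvec" where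
  "velocity A \<gamma> t =
     (\<lambda>d. if d \<in> A \<and> \<gamma> t \<in> fst d then vector_derivative (\<lambda>s. snd d (\<gamma> s)) (at t) else 0)"

text \<open>The value of the differential does not depend on the chart chosen around \<open>p\<close>.\<close>

definition differential ::
    "('a, 'e::euclidean_space) atlas \<Rightarrow> ('b, 'f::euclidean_space) atlas \<Rightarrow> ('a \<Rightarrow> 'b) \<Rightarrow>
     'a \<Rightarrow> ('a, 'e) tvec \<Rightarrow> ('b, 'f) tvec" where
  "differential A B f p v =
     (\<lambda>d. if d \<in> B \<and> f p \<in> fst d
          then (let c = (SOME c. c \<in> A \<and> p \<in> fst c)
                in frechet_derivative (snd d \<circ> f \<circ> chart_inv c) (at (snd c p)) (v c))
          else 0)"

definition field_rep :: "('a \<Rightarrow> ('a, 'e) tvec) \<Rightarrow> ('a, 'e) chart \<Rightarrow> 'e \<Rightarrow> 'e" where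
  "field_rep X c = (\<lambda>x. X (chart_inv c x) c)"

definition smooth_vector_field :: "('a, 'e::euclidean_space) atlas \<Rightarrow> ('a \<Rightarrow> ('a, 'e) tvec) \<Rightarrow> bool" where
  "smooth_vector_field A X \<longleftrightarrow>
     (\<forall>p\<in>points A. X p \<in> tangent_space A p) \<and>
     (\<forall>c\<in>A. smooth_on (snd c ` fst c) (field_rep X c))"

definition field_bracket ::
    "('a, 'e::euclidean_space) atlas \<Rightarrow> ('a \<Rightarrow> ('a, 'e) tvec) \<Rightarrow> ('a \<Rightarrow> ('a, 'e) tvec) \<Rightarrow> 'a \<Rightarrow> ('a, 'e) tvec" where
  "field_bracket A X Y p =
     (\<lambda>d. if d \<in> A \<and> p \<in> fst d
          then frechet_derivative (field_rep Y d) (at (snd d p)) (X p d)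
             - frechet_derivative (field_rep X d) (at (snd d p)) (Y p d)
          else 0)"

section \<open>The slit tangent bundle\<close>

text \<open>The point \<open>(p, v)\<close> of the bundle has standard coordinates \<open>x = snd c p\<close> and \<open>y = v c\<close>.\<close>

definition slit_chart ::
    "('a, 'e::euclidean_space) atlas \<Rightarrow> ('a, 'e) chart \<Rightarrow> ('a \<times> ('a, 'e) tvec, 'e \<times> 'e) chart" where
  "slit_chart A c =
     ({(p, v). p \<in> fst c \<and> v \<in> slit_tangent_space A p}, \<lambda>(p, v). (snd c p, v c))"

definition slit_bundle ::
    "('a, 'e::euclidean_space) atlas \<Rightarrow> ('a \<times> ('a, 'e) tvec, 'e \<times> 'e) atlas" where
  "slit_bundle A = slit_chart A ` A"

text \<open>The map \<open>slit_chart A\<close> is injective, because the second component \<open>\<lambda>(p, v). (snd c p, v c)\<close>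
  is a total function; hence \<open>inv_into\<close> recovers the base chart.\<close>

definition complete_lift ::
    "('a, 'e::euclidean_space) atlas \<Rightarrow> ('a \<Rightarrow> ('a, 'e) tvec) \<Rightarrow>
     'a \<times> ('a, 'e) tvec \<Rightarrow> ('a \<times> ('a, 'e) tvec, 'e \<times> 'e) tvec" where
  "complete_lift A X q =
     (\<lambda>d. if d \<in> slit_bundle A \<and> q \<in> fst d
          then (let c = inv_into A (slit_chart A) d; p = fst q; v = snd q
                in (X p c, frechet_derivative (field_rep X c) (at (snd c p)) (v c)))
          else 0)"

section \<open>Spray structures and nonlinear parallel translation\<close>

text \<open>The function \<open>G\<^sup>i(x, y)\<close> of the local expression \<open>y\<^sup>i \<partial>\<^sub>x - 2 G\<^sup>i \<partial>\<^sub>y\<close> in the chart \<open>c\<close>.\<close>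

definition spray_coeff ::
    "('a, 'e::euclidean_space) atlas \<Rightarrow>
     ('a \<times> ('a, 'e) tvec \<Rightarrow> ('a \<times> ('a, 'e) tvec, 'e \<times> 'e) tvec) \<Rightarrow>
     ('a, 'e) chart \<Rightarrow> 'e \<Rightarrow> 'e \<Rightarrow> 'e" where
  "spray_coeff A S c x y =
     - (1/2) *\<^sub>R snd (S (chart_inv (slit_chart A c) (x, y)) (slit_chart A c))"

definition spray_structure ::
    "('a, 'e::euclidean_space) atlas \<Rightarrow>
     ('a \<times> ('a, 'e) tvec \<Rightarrow> ('a \<times> ('a, 'e) tvec, 'e \<times> 'e) tvec) \<Rightarrow> bool" where
  "spray_structure A S \<longleftrightarrow>
     smooth_vector_field (slit_bundle A) S \<and>
     (\<forall>c\<in>A. \<forall>p\<in>fst c. \<forall>v\<in>slit_tangent_space A p. fst (S (p, v) (slit_chart A c)) = v c) \<and>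
     (\<forall>c\<in>A. \<forall>x\<in>snd c ` fst c. \<forall>y. \<forall>r>0. y \<noteq> 0 \<longrightarrow>
        spray_coeff A S c x (r *\<^sub>R y) = r\<^sup>2 *\<^sub>R spray_coeff A S c x y)"

text \<open>\<open>N\<^sup>i\<^sub>j(x, y) w\<^sup>j\<close> with \<open>N\<^sup>i\<^sub>j = \<partial>G\<^sup>i/\<partial>y\<^sup>j\<close>.\<close>

definition spray_N ::
    "('a, 'e::euclidean_space) atlas \<Rightarrow>
     ('a \<times> ('a, 'e) tvec \<Rightarrow> ('a \<times> ('a, 'e) tvec, 'e \<times> 'e) tvec) \<Rightarrow>
     ('a, 'e) chart \<Rightarrow> 'e \<Rightarrow> 'e \<Rightarrow> 'e \<Rightarrow> 'e" where
  "spray_N A S c x y w = frechet_derivative (spray_coeff A S c x) (at y) w"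

definition nl_covariant_derivative ::
    "('a, 'e::euclidean_space) atlas \<Rightarrow>
     ('a \<times> ('a, 'e) tvec \<Rightarrow> ('a \<times> ('a, 'e) tvec, 'e \<times> 'e) tvec) \<Rightarrow>
     (real \<Rightarrow> 'a) \<Rightarrow> (real \<Rightarrow> ('a, 'e) tvec) \<Rightarrow> real \<Rightarrow> ('a, 'e) tvec" where
  "nl_covariant_derivative A S c Y t =
     (\<lambda>d. if d \<in> A \<and> c t \<in> fst d
          then vector_derivative (\<lambda>s. Y s d) (at t)
             + spray_N A S d (snd d (c t)) (Y t d) (velocity A c t d)
          else 0)"

text \<open>The curve \<open>c\<close> is defined on the open interval \<open>J\<close>; \<open>Y\<close> is a nowhere vanishing smooth
  vector field along it, that is, \<open>(c, Y)\<close> is a smooth curve in the slit tangent bundle.\<close>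

definition nl_parallel ::
    "('a, 'e::euclidean_space) atlas \<Rightarrow>
     ('a \<times> ('a, 'e) tvec \<Rightarrow> ('a \<times> ('a, 'e) tvec, 'e \<times> 'e) tvec) \<Rightarrow>
     real set \<Rightarrow> (real \<Rightarrow> 'a) \<Rightarrow> (real \<Rightarrow> ('a, 'e) tvec) \<Rightarrow> bool" where
  "nl_parallel A S J c Y \<longleftrightarrow>
     smooth_map (euclidean_atlas J) (slit_bundle A) (\<lambda>t. (c t, Y t)) \<and>
     (\<forall>t\<in>J. nl_covariant_derivative A S c Y t = (\<lambda>_. 0))"

definition nl_parallel_translation ::
    "('a, 'e::euclidean_space) atlas \<Rightarrow>
     ('a \<times> ('a, 'e) tvec \<Rightarrow> ('a \<times> ('a, 'e) tvec, 'e \<times> 'e) tvec) \<Rightarrow>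
     real set \<Rightarrow> (real \<Rightarrow> 'a) \<Rightarrow> real \<Rightarrow> real \<Rightarrow> ('a, 'e) tvec \<Rightarrow> ('a, 'e) tvec" where
  "nl_parallel_translation A S J c t0 t1 y =
     (THE v. \<exists>Y. nl_parallel A S J c Y \<and> Y t0 = y \<and> Y t1 = v)"

section \<open>Lie groups\<close>

definition lie_group :: "('a, 'm) monoid_scheme \<Rightarrow> ('a, 'e::euclidean_space) atlas \<Rightarrow> bool" where
  "lie_group G A \<longleftrightarrow>
     group G \<and> smooth_manifold A \<and> points A = carrier G \<and>
     smooth_map (prod_atlas A A) A (\<lambda>(g, h). g \<otimes>\<^bsub>G\<^esub> h) \<and>
     smooth_map A A (\<lambda>g. inv\<^bsub>G\<^esub> g)"

definition left_translation :: "('a, 'm) monoid_scheme \<Rightarrow> 'a \<Rightarrow> 'a \<Rightarrow> 'a" where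
  "left_translation G g = (\<lambda>h. g \<otimes>\<^bsub>G\<^esub> h)"

definition lie_algebra :: "('a, 'm) monoid_scheme \<Rightarrow> ('a, 'e::euclidean_space) atlas \<Rightarrow> ('a, 'e) tvec set" where
  "lie_algebra G A = tangent_space A \<one>\<^bsub>G\<^esub>"

definition lie_algebra_atlas ::
    "('a, 'm) monoid_scheme \<Rightarrow> ('a, 'e::euclidean_space) atlas \<Rightarrow> (('a, 'e) tvec, 'e) atlas" where
  "lie_algebra_atlas G A = tangent_space_atlas A \<one>\<^bsub>G\<^esub> (tangent_space A \<one>\<^bsub>G\<^esub>)"

definition slit_lie_algebra_atlas ::
    "('a, 'm) monoid_scheme \<Rightarrow> ('a, 'e::euclidean_space) atlas \<Rightarrow> (('a, 'e) tvec, 'e) atlas" where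
  "slit_lie_algebra_atlas G A = tangent_space_atlas A \<one>\<^bsub>G\<^esub> (slit_tangent_space A \<one>\<^bsub>G\<^esub>)"

definition left_invariant_field ::
    "('a, 'm) monoid_scheme \<Rightarrow> ('a, 'e::euclidean_space) atlas \<Rightarrow> ('a, 'e) tvec \<Rightarrow> 'a \<Rightarrow> ('a, 'e) tvec" where
  "left_invariant_field G A v g = differential A A (left_translation G g) \<one>\<^bsub>G\<^esub> v"

definition lie_bracket ::
    "('a, 'm) monoid_scheme \<Rightarrow> ('a, 'e::euclidean_space) atlas \<Rightarrow>
     ('a, 'e) tvec \<Rightarrow> ('a, 'e) tvec \<Rightarrow> ('a, 'e) tvec" where
  "lie_bracket G A v w =
     field_bracket A (left_invariant_field G A v) (left_invariant_field G A w) \<one>\<^bsub>G\<^esub>"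

definition one_parameter_subgroup ::
    "('a, 'm) monoid_scheme \<Rightarrow> ('a, 'e::euclidean_space) atlas \<Rightarrow> (real \<Rightarrow> 'a) \<Rightarrow> bool" where
  "one_parameter_subgroup G A \<gamma> \<longleftrightarrow>
     smooth_map (euclidean_atlas UNIV) A \<gamma> \<and> (\<forall>s t. \<gamma> (s + t) = \<gamma> s \<otimes>\<^bsub>G\<^esub> \<gamma> t)"

definition lie_exp ::
    "('a, 'm) monoid_scheme \<Rightarrow> ('a, 'e::euclidean_space) atlas \<Rightarrow> ('a, 'e) tvec \<Rightarrow> 'a" where
  "lie_exp G A w = (THE \<gamma>. one_parameter_subgroup G A \<gamma> \<and> velocity A \<gamma> 0 = w) 1"

section \<open>Left invariant sprays\<close>

text \<open>The map on the slit tangent bundle induced by a left translation.\<close>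

definition left_translation_bundle ::
    "('a, 'm) monoid_scheme \<Rightarrow> ('a, 'e::euclidean_space) atlas \<Rightarrow> 'a \<Rightarrow>
     'a \<times> ('a, 'e) tvec \<Rightarrow> 'a \<times> ('a, 'e) tvec" where
  "left_translation_bundle G A g =
     (\<lambda>(p, v). (left_translation G g p, differential A A (left_translation G g) p v))"

definition left_invariant_spray ::
    "('a, 'm) monoid_scheme \<Rightarrow> ('a, 'e::euclidean_space) atlas \<Rightarrow>
     ('a \<times> ('a, 'e) tvec \<Rightarrow> ('a \<times> ('a, 'e) tvec, 'e \<times> 'e) tvec) \<Rightarrow> bool" where
  "left_invariant_spray G A S \<longleftrightarrow>
     spray_structure A S \<and>
     (\<forall>g\<in>carrier G. \<forall>q\<in>points (slit_bundle A).
        differential (slit_bundle A) (slit_bundle A) (left_translation_bundle G A g) q (S q)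
          = S (left_translation_bundle G A g q))"

text \<open>The frame \<open>U\<^sub>i\<close>, the functions \<open>u\<^sup>i\<close>, and the vertical fields \<open>\<partial>\<^sub>u\<close>; the last are
  the velocities of the coordinate lines \<open>s \<mapsto> y + s U\<^sub>i(g)\<close> in the fibre over \<open>g\<close>.\<close>

definition frame ::
    "('a, 'm) monoid_scheme \<Rightarrow> ('a, 'e::euclidean_space) atlas \<Rightarrow> (nat \<Rightarrow> ('a, 'e) tvec) \<Rightarrow>
     nat \<Rightarrow> 'a \<Rightarrow> ('a, 'e) tvec" where
  "frame G A e i = left_invariant_field G A (e i)"

definition frame_coord ::
    "('a, 'm) monoid_scheme \<Rightarrow> ('a, 'e::euclidean_space) atlas \<Rightarrow> nat \<Rightarrow> (nat \<Rightarrow> ('a, 'e) tvec) \<Rightarrow>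
     nat \<Rightarrow> 'a \<times> ('a, 'e) tvec \<Rightarrow> real" where
  "frame_coord G A n e i = (\<lambda>(g, y). basis_coord n (\<lambda>j. frame G A e j g) y i)"

definition frame_vertical ::
    "('a, 'm) monoid_scheme \<Rightarrow> ('a, 'e::euclidean_space) atlas \<Rightarrow> (nat \<Rightarrow> ('a, 'e) tvec) \<Rightarrow>
     nat \<Rightarrow> 'a \<times> ('a, 'e) tvec \<Rightarrow> ('a \<times> ('a, 'e) tvec, 'e \<times> 'e) tvec" where
  "frame_vertical G A e i =
     (\<lambda>(g, y). velocity (slit_bundle A) (\<lambda>s. (g, \<lambda>d. y d + s *\<^sub>R frame G A e i g d)) 0)"

definition canonical_spray ::
    "('a, 'm) monoid_scheme \<Rightarrow> ('a, 'e::euclidean_space) atlas \<Rightarrow> nat \<Rightarrow> (nat \<Rightarrow> ('a, 'e) tvec) \<Rightarrow>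
     'a \<times> ('a, 'e) tvec \<Rightarrow> ('a \<times> ('a, 'e) tvec, 'e \<times> 'e) tvec" where
  "canonical_spray G A n e q =
     lin_comb n (\<lambda>i. frame_coord G A n e i q) (\<lambda>i. complete_lift A (frame G A e i) q)"

definition spray_decomposition ::
    "('a, 'm) monoid_scheme \<Rightarrow> ('a, 'e::euclidean_space) atlas \<Rightarrow> nat \<Rightarrow> (nat \<Rightarrow> ('a, 'e) tvec) \<Rightarrow>
     ('a \<times> ('a, 'e) tvec \<Rightarrow> ('a \<times> ('a, 'e) tvec, 'e \<times> 'e) tvec) \<Rightarrow>
     (nat \<Rightarrow> 'a \<times> ('a, 'e) tvec \<Rightarrow> real) \<Rightarrow> bool" where
  "spray_decomposition G A n e S H \<longleftrightarrow>
     (\<forall>i\<in>{1..n}.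
        smooth_map (slit_bundle A) (euclidean_atlas UNIV) (H i) \<and>
        (\<forall>g\<in>carrier G. \<forall>q\<in>points (slit_bundle A).
           H i (left_translation_bundle G A g q) = H i q) \<and>
        (\<forall>(p, v)\<in>points (slit_bundle A). \<forall>r>0. H i (p, \<lambda>d. r *\<^sub>R v d) = r\<^sup>2 * H i (p, v))) \<and>
     (\<forall>q\<in>points (slit_bundle A). \<forall>d.
        S q d = canonical_spray G A n e q d
                - lin_comb n (\<lambda>i. H i q) (\<lambda>i. frame_vertical G A e i q) d)"

text \<open>The functions \<open>H\<^sup>i\<close> of a left invariant spray exist and are determined on the slit tangent
  bundle by the decomposition, so the choice is immaterial.\<close>

definition spray_vector_field ::
    "('a, 'm) monoid_scheme \<Rightarrow> ('a, 'e::euclidean_space) atlas \<Rightarrow> nat \<Rightarrow> (nat \<Rightarrow> ('a, 'e) tvec) \<Rightarrow>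
     ('a \<times> ('a, 'e) tvec \<Rightarrow> ('a \<times> ('a, 'e) tvec, 'e \<times> 'e) tvec) \<Rightarrow>
     ('a, 'e) tvec \<Rightarrow> ('a, 'e) tvec" where
  "spray_vector_field G A n e S y =
     (let H = (SOME H. spray_decomposition G A n e S H)
      in lin_comb n (\<lambda>i. H i (\<one>\<^bsub>G\<^esub>, y)) e)"

text \<open>The derivative \<open>D\<eta>(y, w)\<close> is taken componentwise in the linear coordinates of the Lie
  algebra.\<close>

definition connection_operator ::
    "('a, 'm) monoid_scheme \<Rightarrow> ('a, 'e::euclidean_space) atlas \<Rightarrow> nat \<Rightarrow> (nat \<Rightarrow> ('a, 'e) tvec) \<Rightarrow>
     ('a \<times> ('a, 'e) tvec \<Rightarrow> ('a \<times> ('a, 'e) tvec, 'e \<times> 'e) tvec) \<Rightarrow>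
     ('a, 'e) tvec \<Rightarrow> ('a, 'e) tvec \<Rightarrow> ('a, 'e) tvec" where
  "connection_operator G A n e S y w =
     (\<lambda>d. (1/2) *\<^sub>R vector_derivative
                      (\<lambda>s. spray_vector_field G A n e S (\<lambda>c. y c + s *\<^sub>R w c) d) (at 0)
        - (1/2) *\<^sub>R lie_bracket G A y w d)"

section \<open>One-parameter groups of diffeomorphisms\<close>

definition one_parameter_diffeo_group ::
    "('a, 'e::euclidean_space) atlas \<Rightarrow> (real \<Rightarrow> 'a \<Rightarrow> 'a) \<Rightarrow> bool" where
  "one_parameter_diffeo_group A \<rho> \<longleftrightarrow>
     (\<forall>t. diffeomorphism A A (\<rho> t)) \<and>
     smooth_map (prod_atlas (euclidean_atlas UNIV) A) A (\<lambda>(t, p). \<rho> t p) \<and>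
     (\<forall>p\<in>points A. \<rho> 0 p = p) \<and>
     (\<forall>s t. \<forall>p\<in>points A. \<rho> (s + t) p = \<rho> s (\<rho> t p))"

text \<open>On the slit Lie algebra, a vector field has values in the Lie algebra itself, by the
  identification of the tangent spaces of an open subset of a vector space with that space; the
  velocity of a curve is then taken componentwise.\<close>

definition generated_by_on_slit_lie_algebra ::
    "('a, 'm) monoid_scheme \<Rightarrow> ('a, 'e::euclidean_space) atlas \<Rightarrow>
     (real \<Rightarrow> ('a, 'e) tvec \<Rightarrow> ('a, 'e) tvec) \<Rightarrow> (('a, 'e) tvec \<Rightarrow> ('a, 'e) tvec) \<Rightarrow> bool" where
  "generated_by_on_slit_lie_algebra G A \<rho> X \<longleftrightarrow>
     smooth_map (slit_lie_algebra_atlas G A) (lie_algebra_atlas G A) X \<and>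
     one_parameter_diffeo_group (slit_lie_algebra_atlas G A) \<rho> \<and>
     (\<forall>y\<in>slit_tangent_space A \<one>\<^bsub>G\<^esub>. \<forall>t d.
        ((\<lambda>s. \<rho> s y d) has_vector_derivative X (\<rho> t y) d) (at t))"

end

theory Submission
  imports Defs
begin

text \<open>Identify the Lie algebra with the model space by a chart \<open>c0\<close> around the identity and let
  \<open>F(x)\<close> be the matrix of the left translation by the point with coordinate \<open>x\<close>. A vector field along
  \<open>c(t) = exp tw\<close> is \<open>y(t) = F(x(t)) u(t)\<close>, and \<open>u(t)\<close> is its pullback to the Lie algebra. The left
  invariance of the spray gives \<open>2 G(x, y) = F(x) \<eta>(u) - DF(x)[y] u\<close> in every chart. Since
  \<open>x' = F(x) w\<close>, the equation of parallel fields becomes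
  \<open>F(x) (u' + D\<eta>(u) w / 2) + (DF(x)[F(x) w] u - DF(x)[F(x) u] w) / 2 = 0\<close>. The last bracket is
  \<open>F(x) [w, u]\<close> by the symmetry of the second derivatives of left translations, and what remains is
  \<open>u' = - N(u, w)\<close>.

  The field \<open>- N(\<cdot>, w)\<close> is positively homogeneous of degree 1 and smooth off the origin, hence globally
  Lipschitz when extended by 0. So Picard iteration on the whole line yields a complete flow, which
  preserves the complement of the origin by uniqueness, and whose smoothness is bootstrapped from
  the variational equation. The one-parameter subgroup is obtained from a local integral curve
  \<open>\<gamma>\<close> of a left invariant field by \<open>\<gamma>(t/n)\<^sup>n\<close>.\<close>

section \<open>Calculus of smooth maps\<close>

text \<open>Both \<open>nl_parallel_translation\<close> and \<open>lie_exp\<close> are definite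
  descriptions, so each needs existence on the whole real line together with uniqueness; this is why
  completeness of the flow, and not just a local solution, is at stake.
  \<open>spray_vector_field\<close> picks a decomposition by choice, so one has to be exhibited, and
  its value over the identity has to be forced. Degree 1 has a simple origin: \<eta> has degree 2
  because the spray coefficients do, hence its derivative in the fixed direction w has degree 1, and
  the bracket with w is linear. The obstacle is that such a field is in general not differentiable
  at 0. The extension by 0 gives existence and uniqueness, but smoothness of the flow must be proved
  on the invariant open set off the origin. A second constraint is the meaning of smoothness, by
  iterated directional derivatives in constant directions. A linear map depending on a point is
  visible only through its values on fixed vectors, so estimates for it are assembled from a
  basis.\<close>

lemma frechet_derivative_cong_open:
  assumes "open U" "x \<in> U" "\<And>y. y \<in> U \<Longrightarrow> f y = g y"
  shows "frechet_derivative f (at x) = frechet_derivative g (at x)"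
proof -
  \<comment> \<open>The predicate is the same for every candidate D, so the choice inside
    \<open>frechet_derivative\<close> returns the same map, differentiable or not.\<close>
  have "(f has_derivative D) (at x) \<longleftrightarrow> (g has_derivative D) (at x)" for D
    using assms has_derivative_transform_within_open[of f D x UNIV U g]
      has_derivative_transform_within_open[of g D x UNIV U f] by auto
  then show ?thesis unfolding frechet_derivative_def by simp
qed

lemma differentiable_cong_open:
  assumes "open U" "x \<in> U" "\<And>y. y \<in> U \<Longrightarrow> f y = g y"
  shows "f differentiable (at x) \<longleftrightarrow> g differentiable (at x)"
proof -
  have "(f has_derivative D) (at x) \<longleftrightarrow> (g has_derivative D) (at x)" for D
    using assms has_derivative_transform_within_open[of f D x UNIV U g]
      has_derivative_transform_within_open[of g D x UNIV U f] by auto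
  then show ?thesis unfolding differentiable_def by simp
qed

lemma has_derivative_frechet_eq:
  "(f has_derivative f') (at x) \<Longrightarrow> frechet_derivative f (at x) = f'"
  using frechet_derivative_at by metis

section \<open>Closure properties of maps of class C^k\<close>

lemma Ck_on_cong:
  assumes "open S" "\<And>x. x \<in> S \<Longrightarrow> f x = g x"
  shows "Ck_on k S f \<longleftrightarrow> Ck_on k S g"
  using assms(2)
proof (induction k arbitrary: f g)
  case 0
  then show ?case by (simp cong: continuous_on_cong)
next
  case (Suc k)
  have d: "f differentiable (at x) \<longleftrightarrow> g differentiable (at x)" if "x \<in> S" for x
    using differentiable_cong_open[OF assms(1) that Suc.prems] by simp
  have "Ck_on k S (\<lambda>x. frechet_derivative f (at x) v) \<longleftrightarrow> Ck_on k S (\<lambda>x. frechet_derivative g (at x) v)" for v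
    by (rule Suc.IH) (simp add: frechet_derivative_cong_open[OF assms(1) _ Suc.prems])
  then show ?case using d by simp
qed

lemma Ck_on_subset: "Ck_on k S f \<Longrightarrow> T \<subseteq> S \<Longrightarrow> Ck_on k T f"
proof (induction k arbitrary: f)
  case 0
  then show ?case using continuous_on_subset by auto
next
  case (Suc k)
  then show ?case by auto
qed

text \<open>The recursion lowers the order by passing to derivatives, so the induction runs over the
  directional derivatives; only the base case uses that differentiability implies
  continuity.\<close>

lemma Ck_on_Suc_imp: "Ck_on (Suc k) S f \<Longrightarrow> Ck_on k S f"
proof (induction k arbitrary: f)
  case 0
  then have "f differentiable_on S"
    by (auto simp: differentiable_on_def intro: differentiable_at_withinI)
  then show ?case by (simp add: differentiable_imp_continuous_on)
next
  case (Suc k)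
  have "Ck_on k S (\<lambda>x. frechet_derivative f (at x) v)" for v
    by (intro Suc.IH spec[OF conjunct2[OF iffD1[OF Ck_on.simps(2) Suc.prems]]])
  moreover have "\<forall>x\<in>S. f differentiable (at x)"
    by (rule conjunct1[OF iffD1[OF Ck_on.simps(2) Suc.prems]])
  ultimately show ?case by simp
qed

lemma Ck_on_local:
  assumes "\<And>x. x \<in> S \<Longrightarrow> \<exists>U. open U \<and> x \<in> U \<and> Ck_on k U f"
  shows "Ck_on k S f"
  using assms
proof (induction k arbitrary: f)
  case 0
  have "continuous (at x) f" if "x \<in> S" for x
    using 0[OF that] continuous_on_eq_continuous_at by auto
  then show ?case by (simp add: continuous_at_imp_continuous_on)
next
  case (Suc k)
  have "f differentiable (at x)" if "x \<in> S" for x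
    using Suc.prems[OF that] by auto
  moreover have "Ck_on k S (\<lambda>x. frechet_derivative f (at x) v)" for v
  proof (rule Suc.IH)
    fix x assume "x \<in> S"
    then obtain U where "open U" "x \<in> U" "Ck_on (Suc k) U f" using Suc.prems by blast
    then show "\<exists>U. open U \<and> x \<in> U \<and> Ck_on k U (\<lambda>x. frechet_derivative f (at x) v)" by auto
  qed
  ultimately show ?case by simp
qed

lemma Ck_on_const: "Ck_on k S (\<lambda>x. c)"
proof (induction k arbitrary: c)
  case (Suc k)
  have "frechet_derivative (\<lambda>x. c) (at x) = (\<lambda>v. 0)" for x
    by (rule has_derivative_frechet_eq) simp
  then show ?case using Suc by simp
qed simp

lemma Ck_on_bounded_linear:
  assumes "bounded_linear f" shows "Ck_on k S f"
proof (cases k)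
  case 0
  then show ?thesis using linear_continuous_on[OF assms] by simp
next
  case (Suc m)
  have "(f has_derivative f) (at x)" for x
    by (rule bounded_linear_imp_has_derivative[OF assms])
  then have "frechet_derivative f (at x) = f" "f differentiable (at x)" for x
    using has_derivative_frechet_eq differentiable_def by blast+
  then show ?thesis by (simp add: Suc Ck_on_const)
qed

lemma frechet_derivative_has:
  "f differentiable (at x) \<Longrightarrow> (f has_derivative frechet_derivative f (at x)) (at x)"
  using frechet_derivative_works by blast

lemma Ck_on_add:
  assumes "open S" "Ck_on k S f" "Ck_on k S g"
  shows "Ck_on k S (\<lambda>x. f x + g x)"
  using assms(2,3)
proof (induction k arbitrary: f g)
  case 0
  then show ?case by (auto intro: continuous_on_add)
next
  case (Suc k)
  have d: "((\<lambda>x. f x + g x) has_derivative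
      (\<lambda>v. frechet_derivative f (at x) v + frechet_derivative g (at x) v)) (at x)" if "x \<in> S" for x
    using Suc.prems that by (intro has_derivative_add frechet_derivative_has) auto
  have "Ck_on k S (\<lambda>x. frechet_derivative (\<lambda>x. f x + g x) (at x) v)" for v
  proof (subst Ck_on_cong[OF assms(1)])
    show "frechet_derivative (\<lambda>x. f x + g x) (at x) v =
        frechet_derivative f (at x) v + frechet_derivative g (at x) v" if "x \<in> S" for x
      using has_derivative_frechet_eq[OF d[OF that]] by simp
    show "Ck_on k S (\<lambda>x. frechet_derivative f (at x) v + frechet_derivative g (at x) v)"
      using Suc by auto
  qed
  then show ?case using d by (auto simp: differentiable_def)
qed

lemma Ck_on_sum:
  assumes "open S" "\<And>i. i \<in> I \<Longrightarrow> Ck_on k S (f i)"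
  shows "Ck_on k S (\<lambda>x. \<Sum>i\<in>I. f i x)"
  using assms(2)
proof (induction I rule: infinite_finite_induct)
  case (insert i I)
  then show ?case by (simp add: Ck_on_add[OF assms(1)])
qed (simp_all add: Ck_on_const)

text \<open>The product rule leaves one factor underived, so the induction hypothesis needs each
  factor in the lower class as well; \<open>Ck_on_Suc_imp\<close> supplies it.\<close>

lemma Ck_on_bilinear:
  fixes prod :: "'a::euclidean_space \<Rightarrow> 'b::euclidean_space \<Rightarrow> 'c::euclidean_space"
  assumes bb: "bounded_bilinear prod" and "open S" "Ck_on k S f" "Ck_on k S g"
  shows "Ck_on k S (\<lambda>x. prod (f x) (g x))"
  using assms(3,4)
proof (induction k arbitrary: f g)
  case 0
  then show ?case by (auto intro: bounded_bilinear.continuous_on[OF bb])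
next
  case (Suc k)
  have d: "((\<lambda>x. prod (f x) (g x)) has_derivative
      (\<lambda>v. prod (f x) (frechet_derivative g (at x) v) + prod (frechet_derivative f (at x) v) (g x))) (at x)"
    if "x \<in> S" for x
    using Suc.prems that by (intro bounded_bilinear.FDERIV[OF bb] frechet_derivative_has) auto
  have "Ck_on k S (\<lambda>x. frechet_derivative (\<lambda>x. prod (f x) (g x)) (at x) v)" for v
  proof (subst Ck_on_cong[OF assms(2)])
    show "frechet_derivative (\<lambda>x. prod (f x) (g x)) (at x) v =
        prod (f x) (frechet_derivative g (at x) v) + prod (frechet_derivative f (at x) v) (g x)" if "x \<in> S" for x
      using has_derivative_frechet_eq[OF d[OF that]] by simp
    have "Ck_on k S f" "Ck_on k S g" using Suc.prems Ck_on_Suc_imp by blast+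
    then show "Ck_on k S (\<lambda>x. prod (f x) (frechet_derivative g (at x) v) + prod (frechet_derivative f (at x) v) (g x))"
      using Suc by (intro Ck_on_add[OF assms(2)] Suc.IH) auto
  qed
  then show ?case using d by (auto simp: differentiable_def)
qed

lemma Ck_on_linear_compose:
  assumes h: "bounded_linear h" and "open S" "Ck_on k S f"
  shows "Ck_on k S (\<lambda>x. h (f x))"
  using assms(3)
proof (induction k arbitrary: f)
  case 0
  then show ?case using bounded_linear.continuous_on[OF h] by auto
next
  case (Suc k)
  have d: "((\<lambda>x. h (f x)) has_derivative (\<lambda>v. h (frechet_derivative f (at x) v))) (at x)" if "x \<in> S" for x
    using Suc.prems that by (intro bounded_linear.has_derivative[OF h] frechet_derivative_has) auto
  have "Ck_on k S (\<lambda>x. frechet_derivative (\<lambda>x. h (f x)) (at x) v)" for v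
  proof (subst Ck_on_cong[OF assms(2)])
    show "frechet_derivative (\<lambda>x. h (f x)) (at x) v = h (frechet_derivative f (at x) v)" if "x \<in> S" for x
      using has_derivative_frechet_eq[OF d[OF that]] by simp
    show "Ck_on k S (\<lambda>x. h (frechet_derivative f (at x) v))"
      using Suc by auto
  qed
  then show ?case using d by (auto simp: differentiable_def)
qed

text \<open>A pair is a sum of two linear embeddings, so the result comes from sums and linear
  maps.\<close>

lemma Ck_on_Pair:
  assumes "open S" "Ck_on k S f" "Ck_on k S g"
  shows "Ck_on k S (\<lambda>x. (f x, g x))"
proof -
  have "bounded_linear (\<lambda>a. (a, 0))" "bounded_linear (\<lambda>a. (0, a))"
    by (simp_all add: bounded_linear_Pair bounded_linear_ident bounded_linear_zero)
  then have "Ck_on k S (\<lambda>x. (f x, 0) + (0, g x))"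
    using assms by (intro Ck_on_add Ck_on_linear_compose[where h="\<lambda>a. (a, 0)"]
       Ck_on_linear_compose[where h="\<lambda>a. (0, a)"])
  then show ?thesis by simp
qed

text \<open>The directional derivative is expanded in a basis, so that the chain rule becomes a sum of
  products of maps of the same class.\<close>

lemma linear_expand:
  assumes "bounded_linear (D :: 'a::euclidean_space \<Rightarrow> 'b::real_normed_vector)"
  shows "D v = (\<Sum>b\<in>Basis. (v \<bullet> b) *\<^sub>R D b)"
proof -
  interpret bounded_linear D by fact
  have "D v = D (\<Sum>b\<in>Basis. (v \<bullet> b) *\<^sub>R b)" by (simp add: euclidean_representation)
  then show ?thesis by (simp add: sum scaleR)
qed

text \<open>Finitely many basis values determine each L x, so regularity in x for every fixed v
  already gives regularity when the argument moves too. Jacobians and the left invariant frame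
  appear later in exactly this form.\<close>

lemma Ck_on_linear_family:
  fixes L :: "'x::euclidean_space \<Rightarrow> 'a::euclidean_space \<Rightarrow> 'b::euclidean_space"
  assumes "open S" "\<And>x. x \<in> S \<Longrightarrow> bounded_linear (L x)" "\<And>v. Ck_on k S (\<lambda>x. L x v)" "Ck_on k S g"
  shows "Ck_on k S (\<lambda>x. L x (g x))"
proof -
  have eq: "L x (g x) = (\<Sum>b\<in>Basis. (g x \<bullet> b) *\<^sub>R L x b)" if "x \<in> S" for x
    by (rule linear_expand[OF assms(2)[OF that]])
  have "Ck_on k S (\<lambda>x. \<Sum>b\<in>Basis. (g x \<bullet> b) *\<^sub>R L x b)"
    by (intro Ck_on_sum Ck_on_bilinear[OF bounded_bilinear_scaleR]
       Ck_on_linear_compose[OF bounded_linear_inner_left] assms)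
  then show ?thesis using Ck_on_cong[OF assms(1) eq] by simp
qed

lemma Ck_on_compose:
  assumes "open S" "Ck_on k S f" "Ck_on k T g" "open T" "f ` S \<subseteq> T"
  shows "Ck_on k S (\<lambda>x. g (f x))"
  using assms(2,3)
proof (induction k arbitrary: g)
  case 0
  then show ?case using assms(5) by (auto intro: continuous_on_compose2)
next
  case (Suc k)
  have d: "((\<lambda>x. g (f x)) has_derivative
      (\<lambda>v. frechet_derivative g (at (f x)) (frechet_derivative f (at x) v))) (at x)" if "x \<in> S" for x
  proof (rule has_derivative_compose[OF frechet_derivative_has frechet_derivative_has])
    show "f differentiable (at x)" "g differentiable (at (f x))"
      using Suc.prems that assms(5) by auto
  qed
  have "Ck_on k S (\<lambda>x. frechet_derivative (\<lambda>x. g (f x)) (at x) v)" for v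
  proof (subst Ck_on_cong[OF assms(1)])
    show "frechet_derivative (\<lambda>x. g (f x)) (at x) v =
       frechet_derivative g (at (f x)) (frechet_derivative f (at x) v)" if "x \<in> S" for x
      using has_derivative_frechet_eq[OF d[OF that]] by simp
    show "Ck_on k S (\<lambda>x. frechet_derivative g (at (f x)) (frechet_derivative f (at x) v))"
    proof (rule Ck_on_linear_family[OF assms(1), where L="\<lambda>x. frechet_derivative g (at (f x))"])
      show "bounded_linear (frechet_derivative g (at (f x)))" if "x \<in> S" for x
        using Suc.prems(2) assms(5) that
        by (intro has_derivative_bounded_linear[OF frechet_derivative_has]) auto
      show "Ck_on k S (\<lambda>x. frechet_derivative g (at (f x)) v)" for v
        using Suc.prems Ck_on_Suc_imp by (intro Suc.IH) auto
      show "Ck_on k S (\<lambda>x. frechet_derivative f (at x) v)" using Suc.prems by auto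
    qed
  qed
  then show ?case using d by (auto simp: differentiable_def)
qed

section \<open>Smooth maps and their derivatives\<close>

lemma smooth_on_Ck: "smooth_on S f \<Longrightarrow> Ck_on k S f"
  by (simp add: smooth_on_def)

lemma smooth_on_differentiable: "smooth_on S f \<Longrightarrow> x \<in> S \<Longrightarrow> f differentiable (at x)"
  using smooth_on_Ck[of S f "Suc 0"] by auto

lemma smooth_on_has_derivative:
  "smooth_on S f \<Longrightarrow> x \<in> S \<Longrightarrow> (f has_derivative frechet_derivative f (at x)) (at x)"
  by (intro frechet_derivative_has smooth_on_differentiable)

lemma smooth_on_bounded_linear:
  "smooth_on S f \<Longrightarrow> x \<in> S \<Longrightarrow> bounded_linear (frechet_derivative f (at x))"
  using smooth_on_has_derivative has_derivative_bounded_linear by blast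

lemma smooth_on_continuous_on: "smooth_on S f \<Longrightarrow> continuous_on S f"
  using smooth_on_Ck[of S f 0] by simp

lemma smooth_on_cong:
  "open S \<Longrightarrow> (\<And>x. x \<in> S \<Longrightarrow> f x = g x) \<Longrightarrow> smooth_on S f \<longleftrightarrow> smooth_on S g"
  using Ck_on_cong unfolding smooth_on_def by blast

lemma smooth_on_subset: "smooth_on S f \<Longrightarrow> T \<subseteq> S \<Longrightarrow> smooth_on T f"
  using Ck_on_subset unfolding smooth_on_def by blast

lemma smooth_on_local:
  assumes "\<And>x. x \<in> S \<Longrightarrow> \<exists>U. open U \<and> x \<in> U \<and> smooth_on U f"
  shows "smooth_on S f"
  unfolding smooth_on_def
proof
  show "Ck_on k S f" for k
    by (rule Ck_on_local) (use assms smooth_on_Ck in metis)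
qed

lemma smooth_on_const: "smooth_on S (\<lambda>x. c)"
  by (simp add: smooth_on_def Ck_on_const)

lemma smooth_on_linear: "bounded_linear f \<Longrightarrow> smooth_on S f"
  by (simp add: smooth_on_def Ck_on_bounded_linear)

lemmas smooth_on_id = smooth_on_linear[OF bounded_linear_ident]
  and smooth_on_fst = smooth_on_linear[OF bounded_linear_fst]
  and smooth_on_snd = smooth_on_linear[OF bounded_linear_snd]

lemma smooth_on_add:
  "open S \<Longrightarrow> smooth_on S f \<Longrightarrow> smooth_on S g \<Longrightarrow> smooth_on S (\<lambda>x. f x + g x)"
  by (simp add: smooth_on_def Ck_on_add)

lemma smooth_on_linear_compose:
  "bounded_linear h \<Longrightarrow> open S \<Longrightarrow> smooth_on S f \<Longrightarrow> smooth_on S (\<lambda>x. h (f x))"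
  by (simp add: smooth_on_def Ck_on_linear_compose)

lemma smooth_on_minus: "open S \<Longrightarrow> smooth_on S f \<Longrightarrow> smooth_on S (\<lambda>x. - f x)"
  by (rule smooth_on_linear_compose[OF bounded_linear_minus[OF bounded_linear_ident]])

lemma smooth_on_diff:
  "open S \<Longrightarrow> smooth_on S f \<Longrightarrow> smooth_on S g \<Longrightarrow> smooth_on S (\<lambda>x. f x - g x)"
  using smooth_on_add[of S f "\<lambda>x. - g x"] smooth_on_minus[of S g] by simp

lemma smooth_on_Pair:
  "open S \<Longrightarrow> smooth_on S f \<Longrightarrow> smooth_on S g \<Longrightarrow> smooth_on S (\<lambda>x. (f x, g x))"
  by (simp add: smooth_on_def Ck_on_Pair)

lemma smooth_on_linear_family:
  assumes "open S" "\<And>x. x \<in> S \<Longrightarrow> bounded_linear (L x)" "\<And>v. smooth_on S (\<lambda>x. L x v)" "smooth_on S g"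
  shows "smooth_on S (\<lambda>x. L x (g x))"
  using Ck_on_linear_family[OF assms(1,2) smooth_on_Ck[OF assms(3)] smooth_on_Ck[OF assms(4)]]
  by (simp add: smooth_on_def)

lemma smooth_on_compose:
  assumes "open S" "smooth_on S f" "smooth_on T g" "open T" "f ` S \<subseteq> T"
  shows "smooth_on S (\<lambda>x. g (f x))"
  using Ck_on_compose[OF assms(1) smooth_on_Ck[OF assms(2)] smooth_on_Ck[OF assms(3)] assms(4,5)]
  by (simp add: smooth_on_def)

lemma smooth_on_frechet_const:
  "smooth_on S f \<Longrightarrow> smooth_on S (\<lambda>x. frechet_derivative f (at x) v)"
  unfolding smooth_on_def using Ck_on.simps(2)[of _ S f] by blast

lemma smooth_on_frechet:
  assumes "open S" "open T" "smooth_on T f" "smooth_on S g" "smooth_on S h" "g ` S \<subseteq> T"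
  shows "smooth_on S (\<lambda>x. frechet_derivative f (at (g x)) (h x))"
proof (rule smooth_on_linear_family[OF assms(1), where L="\<lambda>x. frechet_derivative f (at (g x))"])
  show "bounded_linear (frechet_derivative f (at (g x)))" if "x \<in> S" for x
    using assms(6) that by (intro smooth_on_bounded_linear[OF assms(3)]) auto
  show "smooth_on S (\<lambda>x. frechet_derivative f (at (g x)) v)" for v
    by (rule smooth_on_compose[OF assms(1,4) smooth_on_frechet_const[OF assms(3)] assms(2,6)])
qed (rule assms(5))

section \<open>Derivatives along curves and partial derivatives\<close>

lemma has_vector_derivative_chain:
  assumes "(g has_vector_derivative g') (at t)" "f differentiable (at (g t))"
  shows "((\<lambda>s. f (g s)) has_vector_derivative frechet_derivative f (at (g t)) g') (at t)"
proof -
  interpret bounded_linear "frechet_derivative f (at (g t))"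
    using assms(2) frechet_derivative_has has_derivative_bounded_linear by blast
  show ?thesis
    using has_derivative_compose[OF assms(1)[unfolded has_vector_derivative_def]
      frechet_derivative_has[OF assms(2)]]
    unfolding has_vector_derivative_def by (simp add: scaleR)
qed

lemma vector_derivative_frechet:
  fixes f :: "real \<Rightarrow> 'a::real_normed_vector"
  assumes "f differentiable (at t)"
  shows "(f has_vector_derivative frechet_derivative f (at t) 1) (at t)"
proof -
  interpret bounded_linear "frechet_derivative f (at t)"
    using assms frechet_derivative_has has_derivative_bounded_linear by blast
  have "frechet_derivative f (at t) = (\<lambda>x. x *\<^sub>R frechet_derivative f (at t) 1)"
    by (rule ext) (metis scaleR mult.right_neutral real_scaleR_def)
  then show ?thesis
    unfolding has_vector_derivative_def by (rule has_derivative_eq_rhs[OF frechet_derivative_has[OF assms]])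
qed

text \<open>The product rule for \<open>L s (z s)\<close> when L is known to be differentiable only
  on each fixed vector: expanding in a basis reduces it to finitely many products of a scalar and a
  vector.\<close>

lemma linear_family_has_vector_derivative:
  fixes L :: "real \<Rightarrow> 'a::euclidean_space \<Rightarrow> 'b::real_normed_vector"
  assumes "open T" "t \<in> T" "\<And>s. s \<in> T \<Longrightarrow> bounded_linear (L s)"
    and L': "\<And>v. ((\<lambda>s. L s v) has_vector_derivative L' v) (at t)"
    and z: "(z has_vector_derivative z') (at t)"
  shows "((\<lambda>s. L s (z s)) has_vector_derivative L' (z t) + L t z') (at t)"
proof -
  have "((\<lambda>s. \<Sum>b\<in>Basis. (z s \<bullet> b) *\<^sub>R L s b) has_vector_derivative
     (\<Sum>b\<in>Basis. (z t \<bullet> b) *\<^sub>R L' b + (z' \<bullet> b) *\<^sub>R L t b)) (at t)"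
    by (intro has_vector_derivative_sum has_vector_derivative_scaleR L')
       (simp add: has_real_derivative_iff_has_vector_derivative
          bounded_linear.has_vector_derivative[OF bounded_linear_inner_left z])
  moreover have "(\<Sum>b\<in>Basis. (z' \<bullet> b) *\<^sub>R L t b) = L t z'"
    by (rule linear_expand[OF assms(3)[OF assms(2)], symmetric])
  \<comment> \<open>L' is an arbitrary function in the hypotheses; uniqueness of vector derivatives
    transfers linearity from the L s to it.\<close>
  moreover have "linear L'"
  proof (rule linearI)
    fix a b :: 'a and r :: real
    have "((\<lambda>s. L s a + L s b) has_vector_derivative L' (a + b)) (at t)"
      by (rule has_vector_derivative_transform_within_open[OF L' assms(1,2)])
        (rule linear_add[OF bounded_linear.linear[OF assms(3)]])
    moreover have "((\<lambda>s. L s a + L s b) has_vector_derivative L' a + L' b) (at t)"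
      by (intro has_vector_derivative_add L')
    ultimately show "L' (a + b) = L' a + L' b" by (rule vector_derivative_unique_at)
    have "((\<lambda>s. r *\<^sub>R L s a) has_vector_derivative L' (r *\<^sub>R a)) (at t)"
      by (rule has_vector_derivative_transform_within_open[OF L' assms(1,2)])
        (rule linear_scale[OF bounded_linear.linear[OF assms(3)]])
    moreover have "((\<lambda>s. r *\<^sub>R L s a) has_vector_derivative r *\<^sub>R L' a) (at t)"
      by (rule bounded_linear.has_vector_derivative[OF bounded_linear_scaleR_right L'])
    ultimately show "L' (r *\<^sub>R a) = r *\<^sub>R L' a" by (rule vector_derivative_unique_at)
  qed
  then have "bounded_linear L'" using linear_conv_bounded_linear by blast
  moreover from this have "(\<Sum>b\<in>Basis. (z t \<bullet> b) *\<^sub>R L' b) = L' (z t)"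
    by (rule linear_expand[symmetric])
  ultimately have "((\<lambda>s. \<Sum>b\<in>Basis. (z s \<bullet> b) *\<^sub>R L s b) has_vector_derivative L' (z t) + L t z') (at t)"
    by (simp add: sum.distrib)
  then show ?thesis
    by (rule has_vector_derivative_transform_within_open[OF _ assms(1,2)])
       (rule linear_expand[OF assms(3), symmetric])
qed

lemma partial_derivative_snd:
  fixes f :: "'a::euclidean_space \<times> 'b::euclidean_space \<Rightarrow> 'c::euclidean_space"
  assumes "f differentiable (at (x, y))"
  shows "((\<lambda>z. f (x, z)) has_derivative (\<lambda>w. frechet_derivative f (at (x, y)) (0, w))) (at y)"
proof -
  have "((\<lambda>z. (x, z)) has_derivative (\<lambda>w. (0, w))) (at y)"
    by (intro derivative_intros)
  from has_derivative_compose[OF this frechet_derivative_has[OF assms]] show ?thesis .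
qed

lemma partial_derivative_fst:
  fixes f :: "'a::euclidean_space \<times> 'b::euclidean_space \<Rightarrow> 'c::euclidean_space"
  assumes "f differentiable (at (x, y))"
  shows "((\<lambda>z. f (z, y)) has_derivative (\<lambda>w. frechet_derivative f (at (x, y)) (w, 0))) (at x)"
proof -
  have "((\<lambda>z. (z, y)) has_derivative (\<lambda>w. (w, 0))) (at x)"
    by (intro derivative_intros)
  from has_derivative_compose[OF this frechet_derivative_has[OF assms]] show ?thesis .
qed

lemma has_vector_derivative_imp_continuous_on:
  "(\<And>x. x \<in> S \<Longrightarrow> (f has_vector_derivative f' x) (at x)) \<Longrightarrow> continuous_on S f"
  by (rule continuous_on_vector_derivative[OF has_vector_derivative_at_within])

section \<open>Symmetry of second derivatives\<close>

text \<open>The second difference over the parallelogram with sides h y and h z is h^2 times the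
  iterated derivative up to o(h^2). Since this difference does not change when y and z are
  exchanged, the symmetry of second derivatives follows from it.\<close>

lemma second_difference_bound:
  fixes f :: "'a::euclidean_space \<Rightarrow> 'b::euclidean_space"
  assumes "smooth_on S f" "open S" "x \<in> S" "e > 0"
  shows "\<exists>d>0. \<forall>h. 0 < h \<and> h < d \<longrightarrow>
    norm ((f (x + h *\<^sub>R y + h *\<^sub>R z) - f (x + h *\<^sub>R y)) - (f (x + h *\<^sub>R z) - f x)
      - (h * h) *\<^sub>R frechet_derivative (\<lambda>x. frechet_derivative f (at x) z) (at x) y) \<le> e * (h * h)"
proof -
  define P where "P = (\<lambda>x. frechet_derivative f (at x) z)"
  define D where "D = frechet_derivative P (at x)"
  \<comment> \<open>Every point of the parallelogram lies within c h of x; the summand 1 keeps c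
    positive when y and z vanish.\<close>
  define c where "c = norm y + norm z + 1"
  have c: "c > 0" unfolding c_def by (simp add: add_nonneg_pos)
  have P: "smooth_on S P" unfolding P_def by (rule smooth_on_frechet_const[OF assms(1)])
  have D: "(P has_derivative D) (at x)"
    unfolding D_def by (rule smooth_on_has_derivative[OF P assms(3)])
  interpret D: bounded_linear D using D by (rule has_derivative_bounded_linear)
  obtain d1 where d1: "d1 > 0" "\<And>y. norm (y - x) < d1 \<Longrightarrow> norm (P y - P x - D (y - x)) \<le> e / (2 * c) * norm (y - x)"
    using D assms(4) c unfolding has_derivative_at_alt by (metis divide_pos_pos mult_pos_pos zero_less_numeral)
  obtain d2 where d2: "d2 > 0" "ball x d2 \<subseteq> S"
    using assms(2,3) open_contains_ball by blast
  define d where "d = min d1 d2 / c"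
  have "d > 0" using d1 d2 c by (simp add: d_def)
  moreover have "norm ((f (x + h *\<^sub>R y + h *\<^sub>R z) - f (x + h *\<^sub>R y)) - (f (x + h *\<^sub>R z) - f x) - (h * h) *\<^sub>R D y) \<le> e * (h * h)"
    if h: "0 < h" "h < d" for h
  proof -
    have ch: "c * h < d1" "c * h < d2"
      using h c by (auto simp: d_def field_simps min_def split: if_splits)
    have small: "norm (r *\<^sub>R y + s *\<^sub>R z) \<le> c * h" if "0 \<le> r" "r \<le> h" "0 \<le> s" "s \<le> h" for r s
    proof -
      have "norm (r *\<^sub>R y + s *\<^sub>R z) \<le> r * norm y + s * norm z"
        using that norm_triangle_ineq[of "r *\<^sub>R y" "s *\<^sub>R z"] by simp
      also have "\<dots> \<le> h * norm y + h * norm z"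
        using that by (intro add_mono mult_right_mono) auto
      also have "\<dots> \<le> c * h" using h by (simp add: c_def algebra_simps)
      finally show ?thesis .
    qed
    have inS: "x + r *\<^sub>R y + s *\<^sub>R z \<in> S" if "0 \<le> r" "r \<le> h" "0 \<le> s" "s \<le> h" for r s
    proof -
      have "dist x (x + (r *\<^sub>R y + s *\<^sub>R z)) = norm (r *\<^sub>R y + s *\<^sub>R z)"
        by (metis dist_commute dist_norm add_diff_cancel_left')
      then have "dist x (x + (r *\<^sub>R y + s *\<^sub>R z)) < d2"
        using small[OF that] ch by linarith
      then show ?thesis by (intro subsetD[OF d2(2)]) (simp add: add.assoc)
    qed
    \<comment> \<open>The tolerance e / (2 c) times the distance c h; the two points compared below
      use up e h together.\<close>
    have est: "norm (P (x + r *\<^sub>R y + s *\<^sub>R z) - P x - D (r *\<^sub>R y + s *\<^sub>R z)) \<le> e * h / 2"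
      if "0 \<le> r" "r \<le> h" "0 \<le> s" "s \<le> h" for r s
    proof -
      have "norm (P (x + r *\<^sub>R y + s *\<^sub>R z) - P x - D (x + r *\<^sub>R y + s *\<^sub>R z - x))
         \<le> e / (2 * c) * norm (x + r *\<^sub>R y + s *\<^sub>R z - x)"
        using small[OF that] ch by (intro d1(2)) (simp add: add.assoc)
      also have "\<dots> \<le> e / (2 * c) * (c * h)"
        using small[OF that] assms(4) c by (intro mult_left_mono) (simp_all add: add.assoc)
      finally show ?thesis using c by (simp add: add.assoc)
    qed
    \<comment> \<open>Its increment from 0 to h is the second difference minus the expected value.
      Its derivative compares P at two points with the linear part of P subtracted, so it is at most
      e h, and the mean value inequality over [0, h] gives e h^2.\<close>
    define \<psi> where "\<psi> = (\<lambda>s. f (x + h *\<^sub>R y + s *\<^sub>R z) - f (x + s *\<^sub>R z) - s *\<^sub>R (h *\<^sub>R D y))"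
    have der: "((\<lambda>s. f (q + s *\<^sub>R z)) has_vector_derivative P (q + s *\<^sub>R z)) (at s)" if "q + s *\<^sub>R z \<in> S" for q s
    proof -
      have "((\<lambda>s. q + s *\<^sub>R z) has_vector_derivative z) (at s)"
        by (auto intro!: derivative_eq_intros)
      from has_vector_derivative_chain[OF this smooth_on_differentiable[OF assms(1) that]]
      show ?thesis unfolding P_def .
    qed
    have d\<psi>: "(\<psi> has_vector_derivative P (x + h *\<^sub>R y + s *\<^sub>R z) - P (x + s *\<^sub>R z) - h *\<^sub>R D y) (at s)"
      if "0 \<le> s" "s \<le> h" for s
      unfolding \<psi>_def using inS[of h s] inS[of 0 s] that h
      by (intro has_vector_derivative_diff der) (auto intro!: derivative_eq_intros)
    have "norm (\<psi> h - \<psi> 0) \<le> (\<lambda>s. s * (e * h)) h - (\<lambda>s. s * (e * h)) 0"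
    proof (rule differentiable_bound_general[OF h(1)])
      show "continuous_on {0..h} \<psi>"
        by (rule has_vector_derivative_imp_continuous_on[OF d\<psi>]) auto
      show "(\<psi> has_vector_derivative P (x + h *\<^sub>R y + s *\<^sub>R z) - P (x + s *\<^sub>R z) - h *\<^sub>R D y) (at s)"
        if "0 < s" "s < h" for s using d\<psi> that by simp
      show "((\<lambda>s. s * (e * h)) has_vector_derivative e * h) (at s)" for s
        by (auto intro!: derivative_eq_intros simp: has_real_derivative_iff_has_vector_derivative[symmetric])
      show "norm (P (x + h *\<^sub>R y + s *\<^sub>R z) - P (x + s *\<^sub>R z) - h *\<^sub>R D y) \<le> e * h" if "0 < s" "s < h" for s
      proof -
        have "P (x + h *\<^sub>R y + s *\<^sub>R z) - P (x + s *\<^sub>R z) - h *\<^sub>R D y =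
           (P (x + h *\<^sub>R y + s *\<^sub>R z) - P x - D (h *\<^sub>R y + s *\<^sub>R z)) - (P (x + 0 *\<^sub>R y + s *\<^sub>R z) - P x - D (0 *\<^sub>R y + s *\<^sub>R z))"
          by (simp add: D.add D.scaleR)
        also have "norm \<dots> \<le> e * h / 2 + e * h / 2"
          using that h by (intro order.trans[OF norm_triangle_ineq4] add_mono est) auto
        finally show ?thesis by simp
      qed
    qed (intro continuous_intros)
    moreover have "\<psi> h - \<psi> 0 = (f (x + h *\<^sub>R y + h *\<^sub>R z) - f (x + h *\<^sub>R y)) - (f (x + h *\<^sub>R z) - f x) - (h * h) *\<^sub>R D y"
      by (simp add: \<psi>_def)
    ultimately show ?thesis by (simp add: mult_ac)
  qed
  ultimately show ?thesis unfolding D_def P_def by blast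
qed

lemma second_derivative_symmetric:
  fixes f :: "'a::euclidean_space \<Rightarrow> 'b::euclidean_space"
  assumes "smooth_on S f" "open S" "x \<in> S"
  shows "frechet_derivative (\<lambda>x. frechet_derivative f (at x) z) (at x) y =
         frechet_derivative (\<lambda>x. frechet_derivative f (at x) y) (at x) z" (is "?a = ?b")
proof (rule ccontr)
  assume "?a \<noteq> ?b"
  \<comment> \<open>A third of the gap: both iterated derivatives approximate one second difference
    with error e, so the gap would be at most 2 e.\<close>
  define e where "e = norm (?a - ?b) / 3"
  have e: "e > 0" using \<open>?a \<noteq> ?b\<close> by (simp add: e_def)
  obtain d1 where d1: "d1 > 0" "\<And>h. 0 < h \<Longrightarrow> h < d1 \<Longrightarrow>
      norm ((f (x + h *\<^sub>R y + h *\<^sub>R z) - f (x + h *\<^sub>R y)) - (f (x + h *\<^sub>R z) - f x) - (h * h) *\<^sub>R ?a) \<le> e * (h * h)"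
    using second_difference_bound[OF assms e, of y z] by blast
  obtain d2 where d2: "d2 > 0" "\<And>h. 0 < h \<Longrightarrow> h < d2 \<Longrightarrow>
      norm ((f (x + h *\<^sub>R z + h *\<^sub>R y) - f (x + h *\<^sub>R z)) - (f (x + h *\<^sub>R y) - f x) - (h * h) *\<^sub>R ?b) \<le> e * (h * h)"
    using second_difference_bound[OF assms e, of z y] by blast
  define h where "h = min d1 d2 / 2"
  have h: "0 < h" "h < d1" "h < d2" using d1 d2 by (auto simp: h_def)
  define u where "u = f (x + h *\<^sub>R y + h *\<^sub>R z) - f (x + h *\<^sub>R y) - f (x + h *\<^sub>R z) + f x"
  have "norm (u - (h * h) *\<^sub>R ?a) \<le> e * (h * h)" "norm (u - (h * h) *\<^sub>R ?b) \<le> e * (h * h)"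
    using d1(2)[OF h(1,2)] d2(2)[OF h(1,3)] by (simp_all add: u_def algebra_simps)
  then have "norm ((u - (h * h) *\<^sub>R ?b) - (u - (h * h) *\<^sub>R ?a)) \<le> e * (h * h) + e * (h * h)"
    using norm_triangle_ineq4 add_mono order.trans by blast
  moreover have "(u - (h * h) *\<^sub>R ?b) - (u - (h * h) *\<^sub>R ?a) = (h * h) *\<^sub>R (?a - ?b)"
    by (simp add: algebra_simps)
  ultimately have "(h * h) * norm (?a - ?b) \<le> (h * h) * (2 * e)" by (simp add: mult_ac)
  then have "norm (?a - ?b) \<le> 2 * e" using h by simp
  then show False using e by (simp add: e_def)
qed

section \<open>Ordinary differential equations\<close>

text \<open>An oriented integral from 0. To differentiate it across the case split at 0, it is
  compared near each t with an integral from a fixed left endpoint -a.\<close>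

lemma antiderivative_exists:
  fixes g :: "real \<Rightarrow> 'a::euclidean_space"
  assumes "continuous_on UNIV g"
  shows "\<exists>h. h 0 = 0 \<and> (\<forall>t. (h has_vector_derivative g t) (at t))"
proof -
  define I where "I = (\<lambda>t. if t \<ge> 0 then integral {0..t} g else - integral {t..0} g)"
  have int: "g integrable_on {a..b}" for a b
    by (intro integrable_continuous_interval continuous_on_subset[OF assms]) auto
  have "(I has_vector_derivative g t) (at t)" for t
  proof -
    define a where "a = \<bar>t\<bar> + 1"
    have a: "t \<in> {-a<..<a}" "a > 0" by (auto simp: a_def)
    have eq: "integral {-a..u} g - integral {-a..0} g = I u" if "u \<in> {-a<..<a}" for u
    proof (cases "u \<ge> 0")
      case True
      then have "integral {-a..0} g + integral {0..u} g = integral {-a..u} g"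
        using a by (intro Henstock_Kurzweil_Integration.integral_combine int) auto
      then show ?thesis using True by (simp add: I_def algebra_simps)
    next
      case False
      then have "integral {-a..u} g + integral {u..0} g = integral {-a..0} g"
        using that by (intro Henstock_Kurzweil_Integration.integral_combine int) auto
      then show ?thesis using False by (simp add: I_def algebra_simps)
    qed
    have "((\<lambda>u. integral {-a..u} g) has_vector_derivative g t) (at t within {-a..a})"
      using a by (intro integral_has_vector_derivative continuous_on_subset[OF assms]) auto
    then have "((\<lambda>u. integral {-a..u} g) has_vector_derivative g t) (at t)"
      using a by (simp add: at_within_Icc_at)
    then have "((\<lambda>u. integral {-a..u} g - integral {-a..0} g) has_vector_derivative g t - 0) (at t)"
      by (intro has_vector_derivative_diff has_vector_derivative_const)
    then have "((\<lambda>u. integral {-a..u} g - integral {-a..0} g) has_vector_derivative g t) (at t)"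
      by simp
    then show ?thesis
      by (rule has_vector_derivative_transform_within_open[OF _ open_greaterThanLessThan a(1) eq])
  qed
  moreover have "I 0 = 0" by (simp add: I_def)
  ultimately show ?thesis by blast
qed

lemma has_vector_derivative_reflect:
  assumes "(u has_vector_derivative u') (at (- s))"
  shows "((\<lambda>s. u (- s)) has_vector_derivative - u') (at (s::real))"
proof -
  have "((\<lambda>s. - s) has_vector_derivative - 1) (at s)"
    by (auto intro!: derivative_eq_intros)
  from vector_diff_chain_at[OF this assms] show ?thesis by (simp add: o_def)
qed

lemma has_vector_derivative_shift:
  assumes "(u has_vector_derivative u') (at (a + s))"
  shows "((\<lambda>s. u (a + s)) has_vector_derivative u') (at (s::real))"
proof -
  have "((\<lambda>s. a + s) has_vector_derivative 1) (at s)"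
    by (auto intro!: derivative_eq_intros)
  from vector_diff_chain_at[OF this assms] show ?thesis by (simp add: o_def)
qed

section \<open>Gronwall estimates and uniqueness\<close>

text \<open>The norm need not be differentiable where u vanishes, so the estimate is run for the
  squared norm. The inequality 2 e |u| \<le> |u|^2 + e^2 absorbs the inhomogeneity and is the origin
  of the 1 in 2 L + 1.\<close>

lemma gronwall_forward:
  fixes u :: "real \<Rightarrow> 'a::real_inner"
  assumes "t \<ge> 0" "L \<ge> 0"
    and u': "\<And>s. 0 \<le> s \<Longrightarrow> s \<le> t \<Longrightarrow> (u has_vector_derivative u' s) (at s)"
    and bnd: "\<And>s. 0 \<le> s \<Longrightarrow> s \<le> t \<Longrightarrow> norm (u' s) \<le> L * norm (u s) + e"
  shows "(norm (u t))\<^sup>2 \<le> exp ((2 * L + 1) * t) * ((norm (u 0))\<^sup>2 + e\<^sup>2 * t)"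
proof -
  let ?c = "2 * L + 1"
  \<comment> \<open>Nonincreasing by construction: the weight cancels the growth rate 2 L + 1, and
    the linear term pays for e^2, as the weight is at most 1 for s \<ge> 0.\<close>
  define v where "v = (\<lambda>s. exp (- ?c * s) * (u s \<bullet> u s) - e\<^sup>2 * s)"
  have "v t \<le> v 0"
  proof (rule DERIV_nonpos_imp_nonincreasing[OF assms(1)])
    fix s assume s: "0 \<le> s" "s \<le> t"
    have "((\<lambda>s. u s \<bullet> u s) has_vector_derivative (u s \<bullet> u' s + u' s \<bullet> u s)) (at s)"
      by (rule bounded_bilinear.has_vector_derivative[OF bounded_bilinear_inner u'[OF s] u'[OF s]])
    then have uu: "((\<lambda>s. u s \<bullet> u s) has_real_derivative (2 * (u s \<bullet> u' s))) (at s)"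
      by (simp add: has_real_derivative_iff_has_vector_derivative inner_commute)
    have "(v has_real_derivative exp (- ?c * s) * (2 * (u s \<bullet> u' s) - ?c * (u s \<bullet> u s)) - e\<^sup>2) (at s)"
      unfolding v_def by (auto intro!: derivative_eq_intros uu simp: algebra_simps)
    moreover have "exp (- ?c * s) * (2 * (u s \<bullet> u' s) - ?c * (u s \<bullet> u s)) - e\<^sup>2 \<le> 0"
    proof -
      have "2 * (u s \<bullet> u' s) \<le> 2 * (norm (u s) * norm (u' s))"
        using norm_cauchy_schwarz[of "u s" "u' s"] by simp
      also have "\<dots> \<le> 2 * (norm (u s) * (L * norm (u s) + e))"
        using bnd[OF s] by (intro mult_left_mono) auto
      also have "\<dots> \<le> ?c * (u s \<bullet> u s) + e\<^sup>2"
        using zero_le_power2[of "norm (u s) - e"]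
        by (simp add: dot_square_norm power2_eq_square algebra_simps)
      finally have "2 * (u s \<bullet> u' s) - ?c * (u s \<bullet> u s) \<le> e\<^sup>2" by simp
      then have "exp (- ?c * s) * (2 * (u s \<bullet> u' s) - ?c * (u s \<bullet> u s)) \<le> exp (- ?c * s) * e\<^sup>2"
        by (intro mult_left_mono) auto
      also have "\<dots> \<le> 1 * e\<^sup>2"
      proof (rule mult_right_mono)
        have "0 \<le> ?c * s" using s assms(2) by (intro mult_nonneg_nonneg) auto
        then have "- ?c * s \<le> 0" by (simp only: mult_minus_left neg_le_0_iff_le)
        then show "exp (- ?c * s) \<le> 1" by (simp only: exp_le_one_iff)
      qed simp
      finally show ?thesis by simp
    qed
    ultimately show "\<exists>y. (v has_real_derivative y) (at s) \<and> y \<le> 0" by blast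
  qed
  then have "exp (- ?c * t) * (u t \<bullet> u t) \<le> (u 0 \<bullet> u 0) + e\<^sup>2 * t"
    by (simp add: v_def)
  then have "exp (?c * t) * (exp (- ?c * t) * (u t \<bullet> u t)) \<le> exp (?c * t) * ((u 0 \<bullet> u 0) + e\<^sup>2 * t)"
    by (intro mult_left_mono) auto
  moreover have "exp (?c * t) * (exp (- ?c * t) * (u t \<bullet> u t)) = u t \<bullet> u t"
  proof -
    have "exp (?c * t) * exp (- ?c * t) = exp (?c * t + - ?c * t)" by (rule exp_add[symmetric])
    also have "?c * t + - ?c * t = 0" by (simp add: algebra_simps)
    finally show ?thesis by (simp only: mult.assoc[symmetric]) simp
  qed
  ultimately have "u t \<bullet> u t \<le> exp (?c * t) * ((u 0 \<bullet> u 0) + e\<^sup>2 * t)" by (simp only:)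
  then show ?thesis by (simp only: power2_norm_eq_inner)
qed

lemma gronwall:
  fixes u :: "real \<Rightarrow> 'a::real_inner"
  assumes "L \<ge> 0"
    and u': "\<And>s. \<bar>s\<bar> \<le> \<bar>t\<bar> \<Longrightarrow> (u has_vector_derivative u' s) (at s)"
    and bnd: "\<And>s. \<bar>s\<bar> \<le> \<bar>t\<bar> \<Longrightarrow> norm (u' s) \<le> L * norm (u s) + e"
  shows "(norm (u t))\<^sup>2 \<le> exp ((2 * L + 1) * \<bar>t\<bar>) * ((norm (u 0))\<^sup>2 + e\<^sup>2 * \<bar>t\<bar>)"
proof (cases "t \<ge> 0")
  case True
  then show ?thesis using gronwall_forward[of t L u u' e] assms by auto
next
  case False
  have "(norm (u (- (- t))))\<^sup>2 \<le> exp ((2 * L + 1) * (- t)) * ((norm (u (- 0)))\<^sup>2 + e\<^sup>2 * (- t))"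
    using False assms
    by (intro gronwall_forward[where u="\<lambda>s. u (- s)" and u'="\<lambda>s. - u' (- s)"] has_vector_derivative_reflect) auto
  then show ?thesis using False by simp
qed

text \<open>The Lipschitz bound is asked only along the two solutions; it can thus be met by fields
  that are merely locally Lipschitz, once the solutions stay in a compact set.\<close>

lemma ode_unique:
  fixes y z :: "real \<Rightarrow> 'a::real_inner"
  assumes "L \<ge> 0" "y 0 = z 0"
    and y: "\<And>s. \<bar>s\<bar> \<le> \<bar>t\<bar> \<Longrightarrow> (y has_vector_derivative f s (y s)) (at s)"
    and z: "\<And>s. \<bar>s\<bar> \<le> \<bar>t\<bar> \<Longrightarrow> (z has_vector_derivative f s (z s)) (at s)"
    and lip: "\<And>s. \<bar>s\<bar> \<le> \<bar>t\<bar> \<Longrightarrow> norm (f s (y s) - f s (z s)) \<le> L * norm (y s - z s)"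
  shows "y t = z t"
proof -
  have "(norm (y t - z t))\<^sup>2 \<le> exp ((2 * L + 1) * \<bar>t\<bar>) * ((norm (y 0 - z 0))\<^sup>2 + 0\<^sup>2 * \<bar>t\<bar>)"
    using lip
    by (intro gronwall[where u="\<lambda>s. y s - z s" and u'="\<lambda>s. f s (y s) - f s (z s)"]
        has_vector_derivative_diff y z assms(1)) auto
  then show ?thesis using assms(2) by simp
qed

section \<open>Global existence by Picard iteration\<close>

text \<open>Integrating an exponential of rate c gains the factor 1 / c. With c = 2 L this becomes
  the contraction factor 1/2 of the Picard operator.\<close>

lemma exp_growth_bound_forward:
  fixes h :: "real \<Rightarrow> 'a::euclidean_space"
  assumes "c > 0" "K \<ge> 0" "h 0 = 0" "t \<ge> 0"
    and h': "\<And>s. (h has_vector_derivative h' s) (at s)" and bnd: "\<And>s. norm (h' s) \<le> K * exp (c * \<bar>s\<bar>)"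
  shows "norm (h t) \<le> K / c * exp (c * t)"
proof (cases "t = 0")
  case True
  then show ?thesis using assms by simp
next
  case False
  then have "t > 0" using assms by simp
  have "norm (h t - h 0) \<le> K / c * exp (c * t) - K / c * exp (c * 0)"
  proof (rule differentiable_bound_general[OF \<open>t > 0\<close>])
    show "continuous_on {0..t} h"
      by (rule has_vector_derivative_imp_continuous_on[OF h'])
    show "continuous_on {0..t} (\<lambda>s. K / c * exp (c * s))" by (intro continuous_intros)
    show "((\<lambda>s. K / c * exp (c * s)) has_vector_derivative K * exp (c * s)) (at s)" for s
      unfolding has_real_derivative_iff_has_vector_derivative[symmetric]
      using assms(1) by (auto intro!: derivative_eq_intros)
    show "norm (h' s) \<le> K * exp (c * s)" if "0 < s" "s < t" for s
      using bnd[of s] that by simp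
  qed (rule h')
  moreover have "K / c * exp (c * 0) \<ge> 0" using assms by simp
  ultimately show ?thesis using assms(3) by (simp only: diff_zero)
qed

lemma exp_growth_bound:
  fixes h :: "real \<Rightarrow> 'a::euclidean_space"
  assumes "c > 0" "K \<ge> 0" "h 0 = 0"
    and h': "\<And>s. (h has_vector_derivative h' s) (at s)" and bnd: "\<And>s. norm (h' s) \<le> K * exp (c * \<bar>s\<bar>)"
  shows "norm (h t) \<le> K / c * exp (c * \<bar>t\<bar>)"
proof (cases "t \<ge> 0")
  case True
  then show ?thesis using exp_growth_bound_forward[of c K h t h'] assms by auto
next
  case False
  have "norm (h (- (- t))) \<le> K / c * exp (c * (- t))"
  proof (rule exp_growth_bound_forward[where h="\<lambda>s. h (- s)" and h'="\<lambda>s. - h' (- s)"])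
    show "norm (- h' (- s)) \<le> K * exp (c * \<bar>s\<bar>)" for s using bnd[of "- s"] by simp
  qed (use False assms in \<open>auto intro: has_vector_derivative_reflect\<close>)
  then show ?thesis using False by simp
qed

text \<open>The weight \<open>exp (- 2 L \<bar>t\<bar>)\<close> makes the Picard operator a contraction on the bounded
  continuous functions on the whole line.\<close>

lemma picard_global:
  fixes f :: "real \<Rightarrow> 'a::euclidean_space \<Rightarrow> 'a"
  assumes "L > 0" and cont: "continuous_on UNIV (\<lambda>(t, x). f t x)"
    and lip: "\<And>t x y. norm (f t x - f t y) \<le> L * norm (x - y)"
    and bnd: "\<And>t. norm (f t 0) \<le> B"
  shows "\<exists>z. z 0 = x0 \<and> (\<forall>t. (z has_vector_derivative f t (z t)) (at t))"
proof -
  define w where "w = (\<lambda>t::real. exp (2 * L * \<bar>t\<bar>))"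
  have w1: "w t \<ge> 1" for t using assms(1) by (simp add: w_def)
  have wpos: "w t > 0" for t by (simp add: w_def)
  have wcont: "continuous_on UNIV w" unfolding w_def by (intro continuous_intros)
  have B: "B \<ge> 0" using bnd[of 0] norm_ge_zero order.trans by blast
  \<comment> \<open>The unknown is the solution divided by the weight w, so that it is bounded even
    if the solution grows exponentially; g is the right-hand side along the restored curve.\<close>
  define g where "g = (\<lambda>(y :: real \<Rightarrow>\<^sub>C 'a) s. f s (w s *\<^sub>R y s))"
  have gcont: "continuous_on UNIV (g y)" for y
  proof -
    have "continuous_on UNIV (\<lambda>s. (s, w s *\<^sub>R y s))" by (intro continuous_intros wcont) auto
    from continuous_on_compose2[OF cont this] show ?thesis by (simp add: g_def)
  qed
  obtain h where h0: "\<And>y. h y 0 = 0" and h': "\<And>y t. (h y has_vector_derivative g y t) (at t)"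
    using antiderivative_exists[OF gcont] by metis
  define p where "p = (\<lambda>y t. (1 / w t) *\<^sub>R (x0 + h y t))"
  \<comment> \<open>The antiderivative grows no faster than w, so dividing by w lands in the bounded
    continuous functions again.\<close>
  have hb: "norm (h y t) \<le> (B + L * M) / (2 * L) * w t" if M: "\<And>s. norm (y s) \<le> M" for y :: "real \<Rightarrow>\<^sub>C 'a" and M t
    unfolding w_def
  proof (rule exp_growth_bound[where h'="g y"])
    have "M \<ge> 0" using M[of 0] norm_ge_zero order.trans by blast
    then show "0 \<le> B + L * M" using B assms(1) by simp
    show "norm (g y s) \<le> (B + L * M) * exp (2 * L * \<bar>s\<bar>)" for s
    proof -
      have "norm (g y s) \<le> norm (f s (w s *\<^sub>R y s) - f s 0) + norm (f s 0)"
        unfolding g_def by (metis norm_triangle_sub add.commute)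
      also have "\<dots> \<le> L * (w s * M) + B"
        using lip[of s "w s *\<^sub>R y s" 0] bnd[of s] M[of s] wpos[of s] assms(1)
        by (smt (verit) abs_of_pos diff_zero mult_left_mono norm_scaleR real_norm_def)
      also have "\<dots> \<le> L * (w s * M) + B * w s"
        using w1[of s] B mult_left_mono[of 1 "w s" B] by simp
      finally show ?thesis by (simp add: w_def algebra_simps)
    qed
  qed (use assms(1) h0 h' in auto)
  have pb: "p y \<in> bcontfun" for y
    unfolding bcontfun_def mem_Collect_eq
  proof
    have "continuous_on UNIV (h y)"
      by (rule has_vector_derivative_imp_continuous_on[OF h'])
    then show "continuous_on UNIV (p y)"
      unfolding p_def using wpos by (intro continuous_intros wcont) (auto simp: less_imp_neq[OF wpos, symmetric])
    obtain M where M: "\<And>s. norm (y s) \<le> M"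
      using bounded_apply_bcontfun[of y] unfolding bounded_iff by blast
    have "norm (p y t) \<le> norm x0 + (B + L * M) / (2 * L)" for t
    proof -
      have "norm (p y t) = (1 / w t) * norm (x0 + h y t)" unfolding p_def using wpos[of t] by simp
      also have "\<dots> \<le> (1 / w t) * (norm x0 * w t + (B + L * M) / (2 * L) * w t)"
      proof (rule mult_left_mono)
        show "norm (x0 + h y t) \<le> norm x0 * w t + (B + L * M) / (2 * L) * w t"
          using norm_triangle_ineq[of x0 "h y t"] hb[OF M, of t] w1[of t] mult_left_mono[of 1 "w t" "norm x0"] by simp
      qed (use wpos[of t] in simp)
      also have "\<dots> = norm x0 + (B + L * M) / (2 * L)" using wpos[of t] by (simp add: field_simps)
      finally show ?thesis .
    qed
    then show "bounded (range (p y))" unfolding bounded_iff by blast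
  qed
  define P where "P = (\<lambda>y. Bcontfun (p y))"
  have P: "apply_bcontfun (P y) = p y" for y unfolding P_def using pb by (simp add: Bcontfun_inverse)
  have "\<exists>!y. P y = y"
  proof (rule banach_fix_type[of "1/2"]; (intro allI)?)
    fix y z :: "real \<Rightarrow>\<^sub>C 'a"
    show "dist (P y) (P z) \<le> 1 / 2 * dist y z"
    proof (rule dist_bound)
      fix t
      have "norm (h y t - h z t) \<le> (L * dist y z) / (2 * L) * exp (2 * L * \<bar>t\<bar>)"
      proof (rule exp_growth_bound[where h'="\<lambda>s. g y s - g z s" and h="\<lambda>t. h y t - h z t"])
        fix s
        have "norm (g y s - g z s) \<le> L * norm (w s *\<^sub>R y s - w s *\<^sub>R z s)"
          unfolding g_def by (rule lip)
        also have "\<dots> = L * (w s * dist (y s) (z s))"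
          using wpos[of s] by (simp add: scaleR_diff_right[symmetric] dist_norm)
        also have "\<dots> \<le> L * (w s * dist y z)"
          using wpos[of s] assms(1) dist_bounded[of y s z] by (intro mult_left_mono) auto
        finally show "norm (g y s - g z s) \<le> L * dist y z * exp (2 * L * \<bar>s\<bar>)" by (simp add: w_def algebra_simps)
      qed (use assms(1) h0 h' in \<open>auto intro: has_vector_derivative_diff\<close>)
      then have *: "norm (h y t - h z t) \<le> dist y z / 2 * w t" using assms(1) by (simp add: w_def)
      have "dist (P y t) (P z t) = (1 / w t) * norm (h y t - h z t)"
        unfolding P p_def dist_norm using wpos[of t]
        by (simp add: scaleR_diff_right[symmetric])
      also have "\<dots> \<le> (1 / w t) * (dist y z / 2 * w t)"
        using * wpos[of t] by (intro mult_left_mono) auto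
      finally show "dist (P y t) (P z t) \<le> 1 / 2 * dist y z" using wpos[of t] by simp
    qed
  qed auto
  then obtain y where y: "P y = y" by blast
  \<comment> \<open>The fixed point equation with the weight removed: the curve x0 + h y is the
    solution.\<close>
  have yt: "w t *\<^sub>R y t = x0 + h y t" for t
    using P[of y] wpos[of t] unfolding y p_def by simp
  have "((\<lambda>t. x0 + h y t) has_vector_derivative f t (x0 + h y t)) (at t)" for t
  proof -
    have "((\<lambda>t. x0 + h y t) has_vector_derivative 0 + g y t) (at t)"
      by (intro has_vector_derivative_add has_vector_derivative_const h')
    then show ?thesis by (simp add: g_def yt)
  qed
  moreover have "x0 + h y 0 = x0" using h0 by simp
  ultimately show ?thesis by (intro exI[of _ "\<lambda>t. x0 + h y t"]) simp
qed

section \<open>Uniform estimates on compact sets\<close>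

text \<open>Compactness bounds each of the finitely many basis values, and their sum bounds the
  operator norm uniformly, although only the values on fixed vectors are known to be
  continuous.\<close>

lemma linear_family_bound:
  fixes L :: "'x::metric_space \<Rightarrow> 'a::euclidean_space \<Rightarrow> 'b::real_normed_vector"
  assumes "compact K" "\<And>x. x \<in> K \<Longrightarrow> bounded_linear (L x)" "\<And>v. continuous_on K (\<lambda>x. L x v)"
  shows "\<exists>M\<ge>0. \<forall>x\<in>K. \<forall>v. norm (L x v) \<le> M * norm v"
proof -
  have "\<exists>M\<ge>0. \<forall>x\<in>K. norm (L x b) \<le> M" for b
  proof -
    have "bounded ((\<lambda>x. L x b) ` K)"
      using compact_imp_bounded compact_continuous_image[OF assms(3,1)] by blast
    then obtain M where "\<forall>x\<in>K. norm (L x b) \<le> M" unfolding bounded_iff by blast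
    then show ?thesis by (intro exI[of _ "max M 0"]) auto
  qed
  then obtain M where M: "\<And>b. M b \<ge> 0" "\<And>b x. x \<in> K \<Longrightarrow> norm (L x b) \<le> M b" by metis
  have "norm (L x v) \<le> (\<Sum>b\<in>Basis. M b) * norm v" if x: "x \<in> K" for x v
  proof -
    have "norm (L x v) \<le> (\<Sum>b\<in>Basis. norm ((v \<bullet> b) *\<^sub>R L x b))"
      by (subst linear_expand[OF assms(2)[OF x]]) (rule norm_sum)
    also have "\<dots> \<le> (\<Sum>b\<in>Basis. norm v * M b)"
      using M x by (intro sum_mono) (auto intro!: mult_mono Basis_le_norm)
    finally show ?thesis by (simp add: sum_distrib_left mult.commute)
  qed
  then show ?thesis using M(1) by (intro exI[of _ "\<Sum>b\<in>Basis. M b"]) (auto intro: sum_nonneg)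
qed

text \<open>Continuity of the derivative makes the first order expansion uniform in the base point.
  On a small ball this is the mean value inequality for g minus its linear part at q; a Lebesgue
  number of the cover of K by such balls makes the radius uniform.\<close>

lemma uniform_differentiable_on_compact:
  fixes g :: "'a::euclidean_space \<Rightarrow> 'b::euclidean_space"
  assumes "compact K" "K \<subseteq> W" "open W" and g: "Ck_on (Suc 0) W g" and "e > 0"
  shows "\<exists>d>0. \<forall>p\<in>K. \<forall>k. norm k < d \<longrightarrow>
    norm (g (p + k) - g p - frechet_derivative g (at p) k) \<le> e * norm k"
proof -
  let ?D = "\<lambda>p. frechet_derivative g (at p)"
  have der: "(g has_derivative ?D p) (at p)" if "p \<in> W" for p
    using g that by (auto intro: frechet_derivative_has)
  then have bl: "bounded_linear (?D p)" if "p \<in> W" for p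
    using that has_derivative_bounded_linear by blast
  have "\<exists>r>0. \<forall>y\<in>ball p r. \<forall>q\<in>ball p r. norm (g y - g q - ?D q (y - q)) \<le> e * norm (y - q)"
    if p: "p \<in> W" for p
  proof -
    \<comment> \<open>Both x and q are compared with the centre p, so each basis value of the
      difference of the derivatives is at most 2 c, and summing over the basis gives e.\<close>
    define c where "c = e / (2 * real DIM('a))"
    have c: "c > 0" using assms(5) by (simp add: c_def)
    have "\<forall>\<^sub>F y in nhds p. \<forall>b\<in>Basis. dist (?D y b) (?D p b) < c"
    proof (rule eventually_ball_finite[OF finite_Basis], rule ballI)
      fix b :: 'a
      have "continuous_on W (\<lambda>y. ?D y b)" using g by simp
      then have "continuous (at p) (\<lambda>y. ?D y b)"
        using p assms(3) continuous_on_eq_continuous_at by blast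
      then have "((\<lambda>y. ?D y b) \<longlongrightarrow> ?D p b) (nhds p)"
        using tendsto_at_iff_tendsto_nhds[of "\<lambda>y. ?D y b" p] by (simp only: continuous_at)
      then show "\<forall>\<^sub>F y in nhds p. dist (?D y b) (?D p b) < c"
        using c by (rule tendstoD)
    qed
    then obtain r1 where r1: "r1 > 0" "\<And>y b. dist y p < r1 \<Longrightarrow> b \<in> Basis \<Longrightarrow> dist (?D y b) (?D p b) < c"
      unfolding eventually_nhds_metric by blast
    obtain r2 where r2: "r2 > 0" "ball p r2 \<subseteq> W" using assms(3) p open_contains_ball by blast
    define r where "r = min r1 r2"
    have "norm (g y - g q - ?D q (y - q)) \<le> e * norm (y - q)" if y: "y \<in> ball p r" and q: "q \<in> ball p r" for y q
    proof -
      have qW: "q \<in> W" using q r2 by (auto simp: r_def)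
      have "norm ((g y - ?D q y) - (g q - ?D q q)) \<le> e * norm (y - q)"
      proof (rule differentiable_bound[where S="ball p r" and f="\<lambda>y. g y - ?D q y" and f'="\<lambda>y v. ?D y v - ?D q v"])
        fix x assume x: "x \<in> ball p r"
        then have xW: "x \<in> W" using r2 by (auto simp: r_def)
        show "((\<lambda>y. g y - ?D q y) has_derivative (\<lambda>v. ?D x v - ?D q v)) (at x within ball p r)"
          by (intro has_derivative_diff has_derivative_at_withinI[OF der[OF xW]]
              bounded_linear_imp_has_derivative bl qW)
        show "onorm (\<lambda>v. ?D x v - ?D q v) \<le> e"
        proof (rule onorm_bound)
          fix v :: 'a
          have "bounded_linear (\<lambda>v. ?D x v - ?D q v)" by (intro bounded_linear_sub bl xW qW)
          from linear_expand[OF this, of v]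
          have "norm (?D x v - ?D q v) \<le> (\<Sum>b\<in>Basis. norm ((v \<bullet> b) *\<^sub>R (?D x b - ?D q b)))"
            by (simp only: norm_sum)
          also have "\<dots> \<le> (\<Sum>b\<in>(Basis :: 'a set). norm v * (c + c))"
          proof (intro sum_mono)
            fix b :: 'a assume b: "b \<in> Basis"
            have "dist (?D x b) (?D q b) \<le> dist (?D x b) (?D p b) + dist (?D q b) (?D p b)"
              by (rule dist_triangle2)
            also have "\<dots> \<le> c + c"
              using r1(2)[of x b] r1(2)[of q b] b x q by (simp add: r_def dist_commute)
            finally have "norm (?D x b - ?D q b) \<le> c + c" by (simp add: dist_norm)
            then show "norm ((v \<bullet> b) *\<^sub>R (?D x b - ?D q b)) \<le> norm v * (c + c)"
              using Basis_le_norm[OF b, of v] by (auto intro: mult_mono)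
          qed
          also have "\<dots> = e * norm v" by (simp add: c_def)
          finally show "norm (?D x v - ?D q v) \<le> e * norm v" .
        qed (use assms(5) in simp)
      qed (use y q in auto)
      moreover have "?D q y - ?D q q = ?D q (y - q)"
        using linear_diff[OF bounded_linear.linear[OF bl[OF qW]]] by simp
      ultimately show ?thesis by (simp add: algebra_simps)
    qed
    then show ?thesis using r1 r2 by (intro exI[of _ r]) (auto simp: r_def)
  qed
  then obtain r where r: "\<And>p. p \<in> W \<Longrightarrow> r p > 0"
    "\<And>p y q. p \<in> W \<Longrightarrow> y \<in> ball p (r p) \<Longrightarrow> q \<in> ball p (r p) \<Longrightarrow> norm (g y - g q - ?D q (y - q)) \<le> e * norm (y - q)"
    by metis
  \<comment> \<open>d is a Lebesgue number: the ball of radius d around any point of K lies inside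
    one ball of the cover.\<close>
  obtain d where d: "d > 0" "\<And>p. p \<in> K \<Longrightarrow> \<exists>G\<in>(\<lambda>p. ball p (r p)) ` K. ball p d \<subseteq> G"
  proof (rule Heine_Borel_lemma[OF assms(1), of "(\<lambda>p. ball p (r p)) ` K"])
    show "K \<subseteq> \<Union> ((\<lambda>p. ball p (r p)) ` K)" using r(1) assms(2) by force
  qed auto
  have "norm (g (p + k) - g p - ?D p k) \<le> e * norm k" if p: "p \<in> K" and k: "norm k < d" for p k
  proof -
    obtain q where q: "q \<in> K" "ball p d \<subseteq> ball q (r q)" using d(2)[OF p] by blast
    have "p + k \<in> ball p d" "p \<in> ball p d" using k d(1) by (simp_all add: dist_norm)
    then have "p + k \<in> ball q (r q)" "p \<in> ball q (r q)" using q(2) by blast+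
    then have "norm (g (p + k) - g p - ?D p (p + k - p)) \<le> e * norm (p + k - p)"
      using r(2)[of q "p + k" p] q(1) assms(2) by blast
    then show ?thesis by simp
  qed
  then show ?thesis using d(1) by blast
qed

section \<open>Dependence of solutions on parameters\<close>

lemma power2_bound_imp: "(a::real)\<^sup>2 \<le> c * b\<^sup>2 \<Longrightarrow> b \<ge> 0 \<Longrightarrow> c \<ge> 0 \<Longrightarrow> a \<le> sqrt c * b"
  by (metis abs_le_D1 abs_of_nonneg real_sqrt_abs real_sqrt_le_mono real_sqrt_mult)

text \<open>The candidate derivative \<open>D t h\<close> solves the variational equation. The
  remainder z t (x + h) - z t x - D t h satisfies a Gronwall inequality whose inhomogeneity is the
  first order error of g at a displacement of size O(|h|), hence o(|h|).\<close>

lemma ode_differentiable_in_parameter: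
  fixes g :: "real \<times> 'a::euclidean_space \<times> 'b::euclidean_space \<Rightarrow> 'b" and z :: "real \<Rightarrow> 'a \<Rightarrow> 'b"
  assumes "open U" "x \<in> U" "open W" "Ck_on (Suc 0) W g" "T \<ge> 0" "L \<ge> 0"
    and sol: "\<And>y t. y \<in> U \<Longrightarrow> \<bar>t\<bar> \<le> T \<Longrightarrow> ((\<lambda>s. z s y) has_vector_derivative g (t, y, z t y)) (at t)"
    and inW: "\<And>t. \<bar>t\<bar> \<le> T \<Longrightarrow> (t, x, z t x) \<in> W"
    and lip: "\<And>t y. \<bar>t\<bar> \<le> T \<Longrightarrow> y \<in> U \<Longrightarrow> norm (g (t, y, z t y) - g (t, y, z t x)) \<le> L * norm (z t y - z t x)"
    and init: "(z 0 has_derivative D0) (at x)"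
  shows "\<exists>D. (\<forall>h. D 0 h = D0 h) \<and> (\<forall>t. \<bar>t\<bar> \<le> T \<longrightarrow> (z t has_derivative D t) (at x) \<and>
     (\<forall>h. ((\<lambda>s. D s h) has_vector_derivative frechet_derivative g (at (t, x, z t x)) (0, h, D t h)) (at t)))"
proof -
  define p where "p = (\<lambda>t. (t, x, z t x))"
  let ?D = "\<lambda>p. frechet_derivative g (at p)"
  have contz: "continuous_on {-T..T} (\<lambda>t. z t x)"
    by (rule has_vector_derivative_imp_continuous_on[OF sol[OF assms(2)]]) auto
  have contp: "continuous_on {-T..T} p"
    unfolding p_def by (intro continuous_intros contz)
  \<comment> \<open>The graph of the base solution over the time interval; its compactness turns the
    local expansion and the bound on the derivative into uniform ones.\<close>
  define K where "K = p ` {-T..T}"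
  have K: "compact K" "K \<subseteq> W"
    unfolding K_def using contp inW by (auto intro: compact_continuous_image simp: p_def abs_le_iff)
  have pK: "p t \<in> K" if "\<bar>t\<bar> \<le> T" for t using that by (auto simp: K_def abs_le_iff)
  have bl: "bounded_linear (?D q)" if "q \<in> K" for q
    using assms(4) K that by (auto intro!: has_derivative_bounded_linear frechet_derivative_has)
  have Dcont: "continuous_on K (\<lambda>q. ?D q v)" for v
  proof -
    have "Ck_on 0 W (\<lambda>q. ?D q v)" using assms(4) unfolding Ck_on.simps(2) by blast
    then show ?thesis using continuous_on_subset[OF _ K(2)] by simp
  qed
  obtain M0 where M0: "M0 \<ge> 0" "\<And>q v. q \<in> K \<Longrightarrow> norm (?D q v) \<le> M0 * norm v"
    using linear_family_bound[OF K(1) bl Dcont] by blast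
  \<comment> \<open>\<open>picard_global\<close> asks for a strictly positive Lipschitz
    constant.\<close>
  define M where "M = M0 + 1"
  have M: "M > 0" "\<And>q v. q \<in> K \<Longrightarrow> norm (?D q v) \<le> M * norm v"
    using M0 by (auto simp: M_def distrib_right intro: order.trans add_increasing2)
  note ud = uniform_differentiable_on_compact[OF K(1,2) assms(3,4)]

  obtain dU where dU: "dU > 0" "ball x dU \<subseteq> U" using assms(1,2) open_contains_ball by blast
  have inU: "x + h \<in> U" if "norm h < dU" for h using that by (intro subsetD[OF dU(2)]) (simp add: dist_norm)
  have init': "\<forall>e>0. \<exists>d>0. \<forall>h. norm h < d \<longrightarrow> norm (z 0 (x + h) - z 0 x - D0 h) \<le> e * norm h"
    using init unfolding has_derivative_at_alt by (metis add_diff_cancel_left')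
  interpret D0: bounded_linear D0 using init by (rule has_derivative_bounded_linear)

  \<comment> \<open>Solutions are Lipschitz in the parameter near x; tolerance 1 in the two
    expansions is enough for this. The crude bound is what makes the displacement O(|h|) in the
    final estimate.\<close>
  have apriori: "\<exists>d>0. \<exists>C\<ge>0. \<forall>h t. norm h < d \<and> \<bar>t\<bar> \<le> T \<longrightarrow> norm (z t (x + h) - z t x) \<le> C * norm h"
  proof -
    obtain d1 where d1: "d1 > 0" "\<And>q k. q \<in> K \<Longrightarrow> norm k < d1 \<Longrightarrow> norm (g (q + k) - g q - ?D q k) \<le> 1 * norm k"
      using ud[OF zero_less_one] by blast
    obtain d2 where d2: "d2 > 0" "\<And>h. norm h < d2 \<Longrightarrow> norm (z 0 (x + h) - z 0 x - D0 h) \<le> 1 * norm h"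
      using init' zero_less_one by blast
    obtain C0 where C0: "C0 > 0" "\<And>h. norm (D0 h) \<le> norm h * C0" using D0.pos_bounded by blast
    \<comment> \<open>The square of the Lipschitz constant: 1 + C0 bounds the change of the initial
      value, M + 1 the change of g under the shift of the parameter alone.\<close>
    define c where "c = exp ((2 * L + 1) * T) * ((1 + C0)\<^sup>2 + (M + 1)\<^sup>2 * T)"
    have c: "c \<ge> 0" using assms(5) by (simp add: c_def)
    have "norm (z t (x + h) - z t x) \<le> sqrt c * norm h" if h: "norm h < min dU (min d1 d2)" and t: "\<bar>t\<bar> \<le> T" for h t
    proof (rule power2_bound_imp)
      have "(norm (z t (x + h) - z t x))\<^sup>2 \<le>
        exp ((2 * L + 1) * \<bar>t\<bar>) * ((norm (z 0 (x + h) - z 0 x))\<^sup>2 + ((M + 1) * norm h)\<^sup>2 * \<bar>t\<bar>)"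
      proof (rule gronwall[OF assms(6), where u="\<lambda>t. z t (x + h) - z t x"
           and u'="\<lambda>t. g (t, x + h, z t (x + h)) - g (t, x, z t x)"])
        fix s assume "\<bar>s\<bar> \<le> \<bar>t\<bar>"
        then have s: "\<bar>s\<bar> \<le> T" using t by simp
        show "((\<lambda>t. z t (x + h) - z t x) has_vector_derivative g (s, x + h, z s (x + h)) - g (s, x, z s x)) (at s)"
          using inU[of h] h s assms(2) by (intro has_vector_derivative_diff sol) auto
        have "norm (g (p s + (0, h, 0)) - g (p s)) \<le> norm (g (p s + (0, h, 0)) - g (p s) - ?D (p s) (0, h, 0)) + norm (?D (p s) (0, h, 0))"
          by (metis diff_add_cancel norm_triangle_ineq)
        also have "\<dots> \<le> 1 * norm (0::real, h, 0::'b) + M * norm (0::real, h, 0::'b)"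
          using h by (intro add_mono d1(2) M(2) pK s) (simp add: norm_Pair)
        also have "\<dots> = (M + 1) * norm h" by (simp add: norm_Pair algebra_simps)
        finally have 1: "norm (g (s, x + h, z s x) - g (s, x, z s x)) \<le> (M + 1) * norm h"
          by (simp add: p_def)
        have "norm (g (s, x + h, z s (x + h)) - g (s, x + h, z s x)) \<le> L * norm (z s (x + h) - z s x)"
          using inU[of h] h s by (intro lip) auto
        with 1 have "norm ((g (s, x + h, z s (x + h)) - g (s, x + h, z s x)) + (g (s, x + h, z s x) - g (s, x, z s x)))
            \<le> L * norm (z s (x + h) - z s x) + (M + 1) * norm h"
          by (intro order.trans[OF norm_triangle_ineq] add_mono)
        then show "norm (g (s, x + h, z s (x + h)) - g (s, x, z s x)) \<le> L * norm (z s (x + h) - z s x) + (M + 1) * norm h"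
          by simp
      qed
      also have "\<dots> \<le> exp ((2 * L + 1) * T) * (((1 + C0) * norm h)\<^sup>2 + ((M + 1) * norm h)\<^sup>2 * T)"
      proof (intro mult_mono add_mono)
        show "exp ((2 * L + 1) * \<bar>t\<bar>) \<le> exp ((2 * L + 1) * T)" using t assms(6) by (simp add: mult_left_mono)
        have "norm (z 0 (x + h) - z 0 x) \<le> norm (z 0 (x + h) - z 0 x - D0 h) + norm (D0 h)"
          by (metis diff_add_cancel norm_triangle_ineq)
        also have "\<dots> \<le> 1 * norm h + norm h * C0" using h by (intro add_mono d2(2) C0(2)) auto
        finally show "(norm (z 0 (x + h) - z 0 x))\<^sup>2 \<le> ((1 + C0) * norm h)\<^sup>2"
          by (intro power_mono) (auto simp: algebra_simps)
      qed (use t assms in auto)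
      also have "\<dots> = c * (norm h)\<^sup>2" 
        unfolding c_def power_mult_distrib by (simp add: algebra_simps)
      finally show "(norm (z t (x + h) - z t x))\<^sup>2 \<le> c * (norm h)\<^sup>2" .
    qed (use c in auto)
    then show ?thesis using dU d1 d2 c
      by (intro exI[of _ "min dU (min d1 d2)"] conjI exI[of _ "sqrt c"]) auto
  qed

  \<comment> \<open>Times are clamped to [-T, T], because the base solution is known only there
    while the Picard result wants coefficients on the whole line. Inside the interval nothing
    changes.\<close>
  define cl where "cl = (\<lambda>t. max (- T) (min T t))"
  have cl: "\<bar>cl t\<bar> \<le> T" for t using assms(5) by (auto simp: cl_def)
  have cl_id: "cl t = t" if "\<bar>t\<bar> \<le> T" for t using that by (auto simp: cl_def)
  have clK: "p (cl t) \<in> K" for t by (rule pK[OF cl])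
  have fcont: "continuous_on UNIV (\<lambda>(t, v). ?D (p (cl t)) (0, h, v))" for h
  proof -
    have "continuous_on UNIV (\<lambda>t. p (cl t))"
    proof (rule continuous_on_compose2[OF contp])
      show "continuous_on UNIV cl" unfolding cl_def by (intro continuous_intros)
      show "cl ` UNIV \<subseteq> {-T..T}" using assms(5) by (auto simp: cl_def)
    qed
    then have 1: "continuous_on UNIV (\<lambda>t. ?D (p (cl t)) b)" for b
      by (rule continuous_on_compose2[OF Dcont]) (use clK in auto)
    then have "continuous_on UNIV (\<lambda>q::real \<times> 'b. ?D (p (cl (fst q))) b)" for b
      by (rule continuous_on_compose2) (auto intro: continuous_intros)
    then have "continuous_on UNIV (\<lambda>q::real \<times> 'b. \<Sum>b\<in>Basis. ((0, h, snd q) \<bullet> b) *\<^sub>R ?D (p (cl (fst q))) b)"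
      by (intro continuous_intros)
    moreover have "?D (p (cl (fst q))) (0, h, snd q) = (\<Sum>b\<in>Basis. ((0, h, snd q) \<bullet> b) *\<^sub>R ?D (p (cl (fst q))) b)" for q :: "real \<times> 'b"
      by (rule linear_expand[OF bl[OF clK]])
    ultimately show ?thesis unfolding case_prod_unfold by simp
  qed
  have split: "?D q (a + b) = ?D q a + ?D q b" if "q \<in> K" for q a b
    using linear_add[OF bounded_linear.linear[OF bl[OF that]]] .
  have splitd: "?D q (a - b) = ?D q a - ?D q b" if "q \<in> K" for q a b
    using linear_diff[OF bounded_linear.linear[OF bl[OF that]]] .
  have lipD: "norm (?D q (0, h, v) - ?D q (0, h, v')) \<le> M * norm (v - v')" if "q \<in> K" for q h v v'
  proof -
    have "?D q (0, h, v) - ?D q (0, h, v') = ?D q (0, 0, v - v')"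
      by (simp add: splitd[OF that, symmetric])
    then show ?thesis using M(2)[OF that, of "(0, 0, v - v')"] by (simp add: norm_Pair)
  qed
  have "\<exists>\<zeta>. \<zeta> 0 = D0 h \<and> (\<forall>t. (\<zeta> has_vector_derivative ?D (p (cl t)) (0, h, \<zeta> t)) (at t))" for h
  proof (rule picard_global[OF M(1) fcont lipD[OF clK]])
    show "norm (?D (p (cl t)) (0, h, 0)) \<le> M * norm h" for t
      using M(2)[OF clK, of t "(0, h, 0)"] by (simp add: norm_Pair)
  qed
  then obtain D where D: "\<And>h. D h 0 = D0 h" "\<And>h t. (D h has_vector_derivative ?D (p (cl t)) (0, h, D h t)) (at t)"
    by metis
  have D': "(D h has_vector_derivative ?D (p t) (0, h, D h t)) (at t)" if "\<bar>t\<bar> \<le> T" for h t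
    using D(2)[of h t] cl_id[OF that] by simp
  \<comment> \<open>Sums and multiples of solutions solve the equation with the combined parameter
    and initial value, so uniqueness gives linearity in h.\<close>
  have lin: "linear (\<lambda>h. D h t)" for t
  proof (rule linearI)
    fix h k :: 'a and r :: real
    show "D (h + k) t = D h t + D k t"
    proof (rule ode_unique[where f="\<lambda>t v. ?D (p (cl t)) (0, h + k, v)" and L=M])
      show "((\<lambda>t. D h t + D k t) has_vector_derivative ?D (p (cl s)) (0, h + k, D h s + D k s)) (at s)" for s
        using has_vector_derivative_add[OF D(2)[of h s] D(2)[of k s]] by (simp add: split[OF clK, symmetric])
    qed (use M D lipD[OF clK] D0.add in auto)
    show "D (r *\<^sub>R h) t = r *\<^sub>R D h t"
    proof (rule ode_unique[where f="\<lambda>t v. ?D (p (cl t)) (0, r *\<^sub>R h, v)" and L=M])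
      show "((\<lambda>t. r *\<^sub>R D h t) has_vector_derivative ?D (p (cl s)) (0, r *\<^sub>R h, r *\<^sub>R D h s)) (at s)" for s
        using bounded_linear.has_vector_derivative[OF bounded_linear_scaleR_right D(2)[of h s], of r]
          linear_scale[OF bounded_linear.linear[OF bl[OF clK[of s]]], of r "(0, h, D h s)"] by simp
    qed (use M D lipD[OF clK] D0.scaleR in auto)
  qed
  obtain d0 C where d0: "d0 > 0" and C: "C \<ge> 0"
    "\<And>h t. norm h < d0 \<Longrightarrow> \<bar>t\<bar> \<le> T \<Longrightarrow> norm (z t (x + h) - z t x) \<le> C * norm h"
    using apriori by blast
  have "(z t has_derivative (\<lambda>h. D h t)) (at x)" if t: "\<bar>t\<bar> \<le> T" for t
    unfolding has_derivative_at_alt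
  proof (intro conjI allI impI)
    show "bounded_linear (\<lambda>h. D h t)" using lin linear_conv_bounded_linear by blast
    fix e :: real assume e: "e > 0"
    \<comment> \<open>Chosen so that Gronwall bounds the squared remainder by c times (e' |h|)^2;
      then e' = e / sqrt c yields e |h|.\<close>
    define c where "c = exp ((2 * M + 1) * T) * (1 + (1 + C)\<^sup>2 * T)"
    have c: "c > 0" unfolding c_def using assms(5) by (simp add: add_pos_nonneg)
    define e' where "e' = e / sqrt c"
    have e': "e' > 0" using e c by (simp add: e'_def)
    obtain d1 where d1: "d1 > 0" "\<And>q k. q \<in> K \<Longrightarrow> norm k < d1 \<Longrightarrow> norm (g (q + k) - g q - ?D q k) \<le> e' * norm k"
      using ud[OF e'] by blast
    obtain d2 where d2: "d2 > 0" "\<And>h. norm h < d2 \<Longrightarrow> norm (z 0 (x + h) - z 0 x - D0 h) \<le> e' * norm h"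
      using init' e' by blast
    define d where "d = min (min dU d0) (min (d1 / (1 + C)) d2)"
    have d: "d > 0" using dU d0 d1 d2 C by (simp add: d_def)
    have est: "norm (z t (x + h) - z t x - D h t) \<le> e * norm h" if h: "norm h < d" for h
    proof -
      have h': "norm h < dU" "norm h < d0" "norm h < d2" "(1 + C) * norm h < d1"
        using h C by (auto simp: d_def field_simps)
      have "norm (z t (x + h) - z t x - D h t) \<le> sqrt c * (e' * norm h)"
      proof (rule power2_bound_imp)
        have "(norm (z t (x + h) - z t x - D h t))\<^sup>2 \<le>
          exp ((2 * M + 1) * \<bar>t\<bar>) * ((norm (z 0 (x + h) - z 0 x - D h 0))\<^sup>2 + (e' * ((1 + C) * norm h))\<^sup>2 * \<bar>t\<bar>)"
        proof (rule gronwall[where u="\<lambda>t. z t (x + h) - z t x - D h t"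
             and u'="\<lambda>t. g (t, x + h, z t (x + h)) - g (t, x, z t x) - ?D (p t) (0, h, D h t)"])
          fix s assume "\<bar>s\<bar> \<le> \<bar>t\<bar>"
          then have s: "\<bar>s\<bar> \<le> T" using t by simp
          show "((\<lambda>t. z t (x + h) - z t x - D h t) has_vector_derivative
             g (s, x + h, z s (x + h)) - g (s, x, z s x) - ?D (p s) (0, h, D h s)) (at s)"
            using inU[of h] h' s assms(2) by (intro has_vector_derivative_diff sol D') auto
          define k where "k = (0::real, h, z s (x + h) - z s x)"
          have nk: "norm k \<le> (1 + C) * norm h"
          proof -
            have "norm k \<le> norm h + norm (z s (x + h) - z s x)"
              unfolding k_def norm_Pair by (simp add: sqrt_sum_squares_le_sum)
            then show ?thesis using C(2)[OF h'(2) s] by (simp add: algebra_simps)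
          qed
          have "norm (g (p s + k) - g (p s) - ?D (p s) k) \<le> e' * norm k"
            using nk h' by (intro d1(2) pK s) auto
          also have "\<dots> \<le> e' * ((1 + C) * norm h)" using nk e' by (intro mult_left_mono) auto
          finally have 1: "norm (g (p s + k) - g (p s) - ?D (p s) k) \<le> e' * ((1 + C) * norm h)" .
          have 2: "norm (?D (p s) k - ?D (p s) (0, h, D h s)) \<le> M * norm (z s (x + h) - z s x - D h s)"
            unfolding k_def by (rule lipD[OF pK[OF s]])
          \<comment> \<open>The first summand is the expansion error of g, small compared with |h|;
            the second is the linear part applied to the remainder itself, the term that Gronwall
            handles.\<close>
          have "norm ((g (p s + k) - g (p s) - ?D (p s) k) + (?D (p s) k - ?D (p s) (0, h, D h s)))
             \<le> e' * ((1 + C) * norm h) + M * norm (z s (x + h) - z s x - D h s)"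
            by (rule order.trans[OF norm_triangle_ineq add_mono[OF 1 2]])
          then show "norm (g (s, x + h, z s (x + h)) - g (s, x, z s x) - ?D (p s) (0, h, D h s))
             \<le> M * norm (z s (x + h) - z s x - D h s) + e' * ((1 + C) * norm h)"
            by (simp add: p_def k_def)
        qed (use M in simp)
        also have "\<dots> \<le> exp ((2 * M + 1) * T) * ((e' * norm h)\<^sup>2 + (e' * ((1 + C) * norm h))\<^sup>2 * T)"
        proof (intro mult_mono add_mono)
          show "exp ((2 * M + 1) * \<bar>t\<bar>) \<le> exp ((2 * M + 1) * T)" using t M by (simp add: mult_left_mono)
          show "(norm (z 0 (x + h) - z 0 x - D h 0))\<^sup>2 \<le> (e' * norm h)\<^sup>2"
            using d2(2)[OF h'(3)] D(1) by (intro power_mono) auto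
        qed (use t assms in auto)
        also have "\<dots> = c * (e' * norm h)\<^sup>2" 
        unfolding c_def power_mult_distrib by (simp add: algebra_simps)
        finally show "(norm (z t (x + h) - z t x - D h t))\<^sup>2 \<le> c * (e' * norm h)\<^sup>2" .
      qed (use c e' in auto)
      then show ?thesis using c by (simp add: e'_def)
    qed
    show "\<exists>d>0. \<forall>y. norm (y - x) < d \<longrightarrow> norm (z t y - z t x - D (y - x) t) \<le> e * norm (y - x)"
      using d est by (intro exI[of _ d]) (metis add.commute diff_add_cancel)
  qed
  then show ?thesis using D D' by (intro exI[of _ "\<lambda>t h. D h t"]) (auto simp: p_def)
qed

lemma Ck_on_le: "Ck_on m S f \<Longrightarrow> k \<le> m \<Longrightarrow> Ck_on k S f"
proof (induction m)
  case (Suc m)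
  then show ?case using Ck_on_Suc_imp[of m S f] by (cases "k = Suc m") auto
qed simp

text \<open>Gronwall against one fixed solution: the inhomogeneity is the change of g in its
  parameter, evaluated along that solution, and uniform continuity on a compact set makes it small.
  Hence the form of the continuity hypothesis, which keeps the last argument on a fixed
  solution.\<close>

lemma ode_continuous_in_parameter:
  fixes g :: "real \<Rightarrow> 'a::euclidean_space \<Rightarrow> 'b::euclidean_space \<Rightarrow> 'b" and z :: "real \<Rightarrow> 'a \<Rightarrow> 'b"
  assumes "open U"
    and sol: "\<And>x t. x \<in> U \<Longrightarrow> ((\<lambda>s. z s x) has_vector_derivative g t x (z t x)) (at t)"
    and lip: "\<And>x T. x \<in> U \<Longrightarrow> \<exists>V L. open V \<and> x \<in> V \<and> V \<subseteq> U \<and> L \<ge> 0 \<and>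
       (\<forall>t y \<zeta> \<zeta>'. \<bar>t\<bar> \<le> T \<and> y \<in> V \<longrightarrow> norm (g t y \<zeta> - g t y \<zeta>') \<le> L * norm (\<zeta> - \<zeta>'))"
    and contG: "\<And>x. x \<in> U \<Longrightarrow> continuous_on (UNIV \<times> U) (\<lambda>(t, y). g t y (z t x))"
    and init: "continuous_on U (z 0)"
  shows "continuous_on (UNIV \<times> U) (\<lambda>(t, x). z t x)"
proof (rule continuous_at_imp_continuous_on, clarify)
  fix t0 :: real and x assume x: "x \<in> U"
  define T where "T = \<bar>t0\<bar> + 1"
  obtain V L where V: "open V" "x \<in> V" "V \<subseteq> U" "L \<ge> 0"
    "\<And>t y \<zeta> \<zeta>'. \<bar>t\<bar> \<le> T \<Longrightarrow> y \<in> V \<Longrightarrow> norm (g t y \<zeta> - g t y \<zeta>') \<le> L * norm (\<zeta> - \<zeta>')"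
    using lip[OF x, of T] by blast
  obtain r where r: "r > 0" "cball x r \<subseteq> V" using V open_contains_cball by blast
  define K where "K = {-T..T} \<times> cball x r"
  define G where "G = (\<lambda>(t, y). g t y (z t x))"
  have "uniformly_continuous_on K G"
    unfolding K_def G_def
    using r V by (intro compact_uniformly_continuous continuous_on_subset[OF contG[OF x]] compact_Times) auto
  then have uc: "\<exists>d>0. \<forall>p\<in>K. \<forall>q\<in>K. dist q p < d \<longrightarrow> dist (G q) (G p) < e" if "e > 0" for e
    using that unfolding uniformly_continuous_on_def by blast
  have unif: "\<exists>d>0. \<forall>y t. dist y x < d \<and> \<bar>t\<bar> \<le> T \<longrightarrow> norm (z t y - z t x) \<le> e" if e: "e > 0" for e
  proof -
    define c where "c = exp ((2 * L + 1) * T) * (1 + T)"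
    have c: "c > 0" by (simp add: c_def T_def add_pos_nonneg)
    define e' where "e' = e / sqrt c"
    have e': "e' > 0" using e c by (simp add: e'_def)
    obtain d1 where d1: "d1 > 0" "\<forall>p\<in>K. \<forall>q\<in>K. dist q p < d1 \<longrightarrow> dist (G q) (G p) < e'"
      using uc[OF e'] by blast
    obtain d2 where d2: "d2 > 0" "\<And>y. y \<in> U \<Longrightarrow> dist y x < d2 \<Longrightarrow> dist (z 0 y) (z 0 x) < e'"
      using init x e' unfolding continuous_on_iff by blast
    have "norm (z t y - z t x) \<le> e" if y: "dist y x < min r (min d1 d2)" and t: "\<bar>t\<bar> \<le> T" for y t
    proof -
      have yr: "y \<in> cball x r" using y by (simp add: dist_commute)
      then have yV: "y \<in> V" using r(2) by blast
      then have yU: "y \<in> U" using V(3) by blast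
      have "norm (z t y - z t x) \<le> sqrt c * e'"
      proof (rule power2_bound_imp)
        have "(norm (z t y - z t x))\<^sup>2 \<le> exp ((2 * L + 1) * \<bar>t\<bar>) * ((norm (z 0 y - z 0 x))\<^sup>2 + e'\<^sup>2 * \<bar>t\<bar>)"
        proof (rule gronwall[OF V(4), where u="\<lambda>t. z t y - z t x" and u'="\<lambda>t. g t y (z t y) - g t x (z t x)"])
          fix s assume "\<bar>s\<bar> \<le> \<bar>t\<bar>"
          then have s: "\<bar>s\<bar> \<le> T" using t by simp
          show "((\<lambda>t. z t y - z t x) has_vector_derivative g s y (z s y) - g s x (z s x)) (at s)"
            by (intro has_vector_derivative_diff sol x yU)
          have "dist (G (s, y)) (G (s, x)) < e'"
            using d1(2) s y yr r(1) by (auto simp: K_def dist_Pair_Pair abs_le_iff)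
          then have 1: "norm (g s y (z s x) - g s x (z s x)) \<le> e'" by (simp add: G_def dist_norm)
          have "norm ((g s y (z s y) - g s y (z s x)) + (g s y (z s x) - g s x (z s x))) \<le> L * norm (z s y - z s x) + e'"
            by (rule order.trans[OF norm_triangle_ineq add_mono[OF V(5)[OF s yV] 1]])
          then show "norm (g s y (z s y) - g s x (z s x)) \<le> L * norm (z s y - z s x) + e'" by simp
        qed
        also have "\<dots> \<le> exp ((2 * L + 1) * T) * (e'\<^sup>2 + e'\<^sup>2 * T)"
        proof (intro mult_mono add_mono)
          show "exp ((2 * L + 1) * \<bar>t\<bar>) \<le> exp ((2 * L + 1) * T)" using t V(4) by (simp add: mult_left_mono)
          show "(norm (z 0 y - z 0 x))\<^sup>2 \<le> e'\<^sup>2"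
            using d2(2)[OF yU] y by (intro power_mono) (auto simp: dist_norm)
        qed (use t in auto)
        also have "\<dots> = c * e'\<^sup>2" by (simp add: c_def algebra_simps)
        finally show "(norm (z t y - z t x))\<^sup>2 \<le> c * e'\<^sup>2" .
      qed (use c e' in auto)
      then show ?thesis using c by (simp add: e'_def)
    qed
    then show ?thesis using r(1) d1(1) d2(1) by (intro exI[of _ "min r (min d1 d2)"]) auto
  qed
  show "isCont (\<lambda>(t, x). z t x) (t0, x)"
    unfolding continuous_at_eps_delta
  proof (intro allI impI)
    fix e :: real assume e: "e > 0"
    obtain d1 where d1: "d1 > 0" "\<And>y t. dist y x < d1 \<Longrightarrow> \<bar>t\<bar> \<le> T \<Longrightarrow> norm (z t y - z t x) \<le> e / 3"
      using unif[of "e / 3"] e by auto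
    have "isCont (\<lambda>t. z t x) t0" by (rule has_vector_derivative_continuous[OF sol[OF x]])
    then obtain d2 where d2: "d2 > 0" "\<And>t. dist t t0 < d2 \<Longrightarrow> dist (z t x) (z t0 x) < e / 3"
      using e unfolding continuous_at_eps_delta by (metis divide_pos_pos zero_less_numeral)
    have "dist (z t y) (z t0 x) < e" if "dist (t, y) (t0, x) < min 1 (min d1 d2)" for t y
    proof -
      have "dist t t0 < min 1 (min d1 d2)" "dist y x < min 1 (min d1 d2)"
        using that dist_fst_le[of "(t, y)" "(t0, x)"] dist_snd_le[of "(t, y)" "(t0, x)"] by simp_all
      then have "dist (z t y) (z t x) \<le> e / 3" "dist (z t x) (z t0 x) < e / 3"
        using d1(2)[of y t] d2(2)[of t] by (auto simp: dist_norm T_def)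
      then show ?thesis using dist_triangle[of "z t y" "z t0 x" "z t x"] e by linarith
    qed
    then show "\<exists>d>0. \<forall>x'. dist x' (t0, x) < d \<longrightarrow> dist (case x' of (t, x) \<Rightarrow> z t x) (case (t0, x) of (t, x) \<Rightarrow> z t x) < e"
      using d1(1) d2(1) by (intro exI[of _ "min 1 (min d1 d2)"]) auto
  qed
qed

text \<open>The derivative found on a bounded time interval is the Frechet derivative by uniqueness,
  so the variational equation can be stated for \<open>frechet_derivative\<close> at every time;
  this is the form that can be iterated.\<close>

lemma ode_frechet_in_parameter:
  fixes g :: "real \<times> 'a::euclidean_space \<times> 'b::euclidean_space \<Rightarrow> 'b" and z :: "real \<Rightarrow> 'a \<Rightarrow> 'b"
  assumes "open U" "open W" "Ck_on (Suc 0) W g"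
    and sol: "\<And>x t. x \<in> U \<Longrightarrow> ((\<lambda>s. z s x) has_vector_derivative g (t, x, z t x)) (at t)"
    and inW: "\<And>x t. x \<in> U \<Longrightarrow> (t, x, z t x) \<in> W"
    and lip: "\<And>x T. x \<in> U \<Longrightarrow> \<exists>V L. open V \<and> x \<in> V \<and> V \<subseteq> U \<and> L \<ge> 0 \<and>
       (\<forall>t y \<zeta> \<zeta>'. \<bar>t\<bar> \<le> T \<and> y \<in> V \<longrightarrow> norm (g (t, y, \<zeta>) - g (t, y, \<zeta>')) \<le> L * norm (\<zeta> - \<zeta>'))"
    and init: "\<And>x. x \<in> U \<Longrightarrow> z 0 differentiable (at x)"
    and x: "x \<in> U"
  shows "z t differentiable (at x)"
    and "((\<lambda>s. frechet_derivative (z s) (at x) h) has_vector_derivative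
       frechet_derivative g (at (t, x, z t x)) (0, h, frechet_derivative (z t) (at x) h)) (at t)"
proof -
  \<comment> \<open>The extra 1 makes t an interior time, so that the identification with D holds
    near t and the derivative in time carries over.\<close>
  define T where "T = \<bar>t\<bar> + 1"
  obtain V L where V: "open V" "x \<in> V" "V \<subseteq> U" "L \<ge> 0"
    "\<And>t y \<zeta> \<zeta>'. \<bar>t\<bar> \<le> T \<Longrightarrow> y \<in> V \<Longrightarrow> norm (g (t, y, \<zeta>) - g (t, y, \<zeta>')) \<le> L * norm (\<zeta> - \<zeta>')"
    using lip[OF x, of T] by blast
  have "\<exists>D. (\<forall>h. D 0 h = frechet_derivative (z 0) (at x) h) \<and> (\<forall>t. \<bar>t\<bar> \<le> T \<longrightarrow> (z t has_derivative D t) (at x) \<and>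
     (\<forall>h. ((\<lambda>s. D s h) has_vector_derivative frechet_derivative g (at (t, x, z t x)) (0, h, D t h)) (at t)))"
  proof (rule ode_differentiable_in_parameter[OF V(1,2) assms(2,3) _ V(4)])
    show "(z 0 has_derivative frechet_derivative (z 0) (at x)) (at x)"
      by (rule frechet_derivative_has[OF init[OF x]])
  qed (use V sol inW x in \<open>auto simp: T_def\<close>)
  then obtain D where D: "\<And>t. \<bar>t\<bar> \<le> T \<Longrightarrow> (z t has_derivative D t) (at x)"
     "\<And>t h. \<bar>t\<bar> \<le> T \<Longrightarrow> ((\<lambda>s. D s h) has_vector_derivative frechet_derivative g (at (t, x, z t x)) (0, h, D t h)) (at t)"
    by blast
  have eq: "frechet_derivative (z s) (at x) = D s" if "\<bar>s\<bar> \<le> T" for s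
    by (rule has_derivative_frechet_eq[OF D(1)[OF that]])
  have tT: "\<bar>t\<bar> \<le> T" by (simp add: T_def)
  show "z t differentiable (at x)" using D(1)[OF tT] by (auto simp: differentiable_def)
  have "((\<lambda>s. frechet_derivative (z s) (at x) h) has_vector_derivative
     frechet_derivative g (at (t, x, z t x)) (0, h, D t h)) (at t)"
    by (rule has_vector_derivative_transform_within_open[OF D(2)[OF tT], of "{-T<..<T}"])
      (auto simp: eq T_def)
  then show "((\<lambda>s. frechet_derivative (z s) (at x) h) has_vector_derivative
       frechet_derivative g (at (t, x, z t x)) (0, h, frechet_derivative (z t) (at x) h)) (at t)"
    by (simp add: eq[OF tT])
qed

text \<open>Raises the order by one: the time derivative is q and the parameter derivative is of
  class C^k by hypothesis, and joint differentiability comes from the continuity of one partial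
  derivative.\<close>

lemma Ck_on_Suc_time_parameter:
  fixes z :: "real \<Rightarrow> 'a::euclidean_space \<Rightarrow> 'b::euclidean_space"
  assumes "open U"
    and zx: "\<And>x t. x \<in> U \<Longrightarrow> z t differentiable (at x)"
    and zt: "\<And>x t. x \<in> U \<Longrightarrow> ((\<lambda>s. z s x) has_vector_derivative q (t, x)) (at t)"
    and "\<And>v. Ck_on k (UNIV \<times> U) (\<lambda>(t, x). frechet_derivative (z t) (at x) v)"
    and q: "Ck_on k (UNIV \<times> U) q"
  shows "Ck_on (Suc k) (UNIV \<times> U) (\<lambda>(t, x). z t x)"
proof -
  have oU: "open (UNIV \<times> U :: (real \<times> 'a) set)" using assms(1) by (intro open_Times) auto
  have qc: "continuous_on (UNIV \<times> U) q" using Ck_on_le[OF q, of 0] by simp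
  have der: "((\<lambda>(t, x). z t x) has_derivative (\<lambda>(s, v). frechet_derivative (z t) (at x) v + s *\<^sub>R q (t, x))) (at (t, x))"
    if x: "x \<in> U" for t x
  proof -
    have fx: "((\<lambda>x. z t x) has_derivative frechet_derivative (z t) (at x)) (at x within U)"
      by (rule has_derivative_at_withinI[OF frechet_derivative_has[OF zx[OF x]]])
    have fy: "((\<lambda>t. z t x) has_derivative blinfun_apply (blinfun_scaleR_left (q (t, x)))) (at t within UNIV)"
      if "x \<in> U" "t \<in> UNIV" for x t
      by (rule has_derivative_eq_rhs[OF zt[OF that(1), of t, unfolded has_vector_derivative_def]])
        (rule ext, simp only: blinfun_scaleR_left.rep_eq)
    \<comment> \<open>Time is made the second variable, because that is the one whose partial
      derivative must be continuous in the criterion for joint differentiability; B swaps the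
      variables back.\<close>
    have "continuous_on (U \<times> UNIV) (\<lambda>p. q (snd p, fst p))"
      by (rule continuous_on_compose2[OF qc]) (auto intro!: continuous_intros)
    then have "continuous_on (U \<times> UNIV) (\<lambda>p. blinfun_scaleR_left (q (snd p, fst p)))"
      by (rule bounded_linear.continuous_on[OF bounded_linear_blinfun_scaleR_left])
    then have "\<forall>p\<in>U \<times> UNIV. continuous (at p within U \<times> UNIV) (\<lambda>p. blinfun_scaleR_left (q (snd p, fst p)))"
      by (simp only: continuous_on_eq_continuous_within)
    then have "continuous (at (x, t) within U \<times> UNIV) (\<lambda>p. blinfun_scaleR_left (q (snd p, fst p)))"
      using x by blast
    then have fc: "continuous (at (x, t) within U \<times> UNIV) (\<lambda>(x, t). blinfun_scaleR_left (q (t, x)))"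
      by (simp only: case_prod_unfold)
    have "((\<lambda>(x, t). z t x) has_derivative
      (\<lambda>(v, s). frechet_derivative (z t) (at x) v + blinfun_apply (blinfun_scaleR_left (q (t, x))) s)) (at (x, t) within U \<times> UNIV)"
      by (rule has_derivative_partialsI[OF fx fy fc UNIV_I convex_UNIV])
    moreover have "open (U \<times> (UNIV :: real set))" "(x, t) \<in> U \<times> UNIV" using assms(1) x by (auto intro: open_Times)
    ultimately have A: "((\<lambda>(x, t). z t x) has_derivative (\<lambda>(v, s). frechet_derivative (z t) (at x) v + s *\<^sub>R q (t, x))) (at (x, t))"
      by (simp only: at_within_open blinfun_scaleR_left.rep_eq)
    have B: "((\<lambda>p::real \<times> 'a. (snd p, fst p)) has_derivative (\<lambda>p. (snd p, fst p))) (at (t, x))"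
      by (intro bounded_linear_imp_has_derivative bounded_linear_intros)
    have "((\<lambda>p. (\<lambda>(x, t). z t x) (snd p, fst p)) has_derivative
       (\<lambda>p. (\<lambda>(v, s). frechet_derivative (z t) (at x) v + s *\<^sub>R q (t, x)) (snd p, fst p))) (at (t, x))"
      by (rule has_derivative_compose[OF B]) (simp only: fst_conv snd_conv, rule A)
    then show ?thesis by (simp only: case_prod_unfold fst_conv snd_conv)
  qed
  have "Ck_on k (UNIV \<times> U) (\<lambda>p. frechet_derivative (\<lambda>(t, x). z t x) (at p) (s, v))" for s v
  proof (subst Ck_on_cong[OF oU])
    show "frechet_derivative (\<lambda>(t, x). z t x) (at p) (s, v) =
       (\<lambda>(t, x). frechet_derivative (z t) (at x) v) p + s *\<^sub>R q p" if "p \<in> UNIV \<times> U" for p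
      using that has_derivative_frechet_eq[OF der] by (cases p) auto
    show "Ck_on k (UNIV \<times> U) (\<lambda>p. (\<lambda>(t, x). frechet_derivative (z t) (at x) v) p + s *\<^sub>R q p)"
      by (intro Ck_on_add oU assms(4) Ck_on_linear_compose[OF bounded_linear_scaleR_right] q)
  qed
  moreover have "(\<lambda>(t, x). z t x) differentiable (at p)" if "p \<in> UNIV \<times> U" for p
    using that der unfolding differentiable_def by (cases p) blast
  ultimately show ?thesis by simp
qed

text \<open>The inhomogeneity b cancels in the difference, and the linear part is uniformly bounded
  over bounded times and a compact neighbourhood of x.\<close>

lemma linear_ode_lipschitz:
  fixes \<alpha> :: "'b::euclidean_space \<Rightarrow> real \<times> 'a::euclidean_space \<Rightarrow> 'b"
  assumes "open U" "\<And>i. continuous_on (UNIV \<times> U) (\<alpha> i)" "x \<in> U"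
  shows "\<exists>V L. open V \<and> x \<in> V \<and> V \<subseteq> U \<and> L \<ge> 0 \<and>
     (\<forall>t y \<zeta> \<zeta>'. \<bar>t\<bar> \<le> T \<and> y \<in> V \<longrightarrow>
        norm (((\<Sum>i\<in>Basis. (\<zeta> \<bullet> i) *\<^sub>R \<alpha> i (t, y)) + b (t, y)) - ((\<Sum>i\<in>Basis. (\<zeta>' \<bullet> i) *\<^sub>R \<alpha> i (t, y)) + b (t, y)))
          \<le> L * norm (\<zeta> - \<zeta>'))"
proof -
  obtain r where r: "r > 0" "cball x r \<subseteq> U" using assms open_contains_cball by blast
  define K where "K = {-T..T} \<times> cball x r"
  have K: "K \<subseteq> UNIV \<times> U" using r by (auto simp: K_def)
  have "\<exists>M\<ge>0. \<forall>p\<in>K. \<forall>v. norm (\<Sum>i\<in>Basis. (v \<bullet> i) *\<^sub>R \<alpha> i p) \<le> M * norm v"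
  proof (rule linear_family_bound[where L="\<lambda>p v. \<Sum>i\<in>Basis. (v \<bullet> i) *\<^sub>R \<alpha> i p"])
    show "compact K" unfolding K_def by (intro compact_Times) auto
    show "bounded_linear (\<lambda>v. \<Sum>i\<in>Basis. (v \<bullet> i) *\<^sub>R \<alpha> i p)" for p
      by (intro bounded_linear_sum bounded_linear_scaleR_const bounded_linear_inner_left)
    show "continuous_on K (\<lambda>p. \<Sum>i\<in>Basis. (v \<bullet> i) *\<^sub>R \<alpha> i p)" for v
      by (intro continuous_intros continuous_on_subset[OF assms(2) K])
  qed
  then obtain M where M: "M \<ge> 0" "\<And>p v. p \<in> K \<Longrightarrow> norm (\<Sum>i\<in>Basis. (v \<bullet> i) *\<^sub>R \<alpha> i p) \<le> M * norm v" by blast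
  have "norm (((\<Sum>i\<in>Basis. (\<zeta> \<bullet> i) *\<^sub>R \<alpha> i (t, y)) + b (t, y)) - ((\<Sum>i\<in>Basis. (\<zeta>' \<bullet> i) *\<^sub>R \<alpha> i (t, y)) + b (t, y))) \<le> M * norm (\<zeta> - \<zeta>')"
    if "\<bar>t\<bar> \<le> T" "y \<in> ball x r" for t y \<zeta> \<zeta>'
  proof -
    have "(\<Sum>i\<in>Basis. (\<zeta> \<bullet> i) *\<^sub>R \<alpha> i (t, y)) - (\<Sum>i\<in>Basis. (\<zeta>' \<bullet> i) *\<^sub>R \<alpha> i (t, y)) = (\<Sum>i\<in>Basis. ((\<zeta> - \<zeta>') \<bullet> i) *\<^sub>R \<alpha> i (t, y))"
      by (simp add: sum_subtractf inner_diff_left scaleR_diff_left)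
    moreover have "(t, y) \<in> K" using that by (auto simp: K_def)
    ultimately show ?thesis using M(2)[of "(t, y)" "\<zeta> - \<zeta>'"] by simp
  qed
  then show ?thesis using r M(1) by (intro exI[of _ "ball x r"] exI[of _ M]) auto
qed

text \<open>Differentiating in x reproduces an equation with the same coefficients \<alpha> and a
  new inhomogeneity built from z and the derivatives of \<alpha> and b. So the induction keeps
  \<alpha> and generalises over b, z and c; a constant initial value is differentiated to 0.\<close>

lemma linear_ode_Ck_on:
  fixes \<alpha> :: "'b::euclidean_space \<Rightarrow> real \<times> 'a::euclidean_space \<Rightarrow> 'b" and z :: "real \<Rightarrow> 'a \<Rightarrow> 'b"
  assumes U: "open U"
    and "\<And>i. Ck_on k (UNIV \<times> U) (\<alpha> i)" "Ck_on k (UNIV \<times> U) b"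
    and "\<And>x t. x \<in> U \<Longrightarrow> ((\<lambda>s. z s x) has_vector_derivative (\<Sum>i\<in>Basis. (z t x \<bullet> i) *\<^sub>R \<alpha> i (t, x)) + b (t, x)) (at t)"
    and "\<And>x. x \<in> U \<Longrightarrow> z 0 x = c"
  shows "Ck_on k (UNIV \<times> U) (\<lambda>(t, x). z t x)"
  using assms(2-)
proof (induction k arbitrary: b z c)
  case (0 b z c)
  have oU: "open (UNIV \<times> U :: (real \<times> 'a) set)" using assms(1) by (intro open_Times) auto
  define h where "h = (\<lambda>t x \<zeta>. (\<Sum>i\<in>Basis. (\<zeta> \<bullet> i) *\<^sub>R \<alpha> i (t, x)) + b (t, x))"
  have "continuous_on (UNIV \<times> U) (\<lambda>(t, x). z t x)"
  proof (rule ode_continuous_in_parameter[OF U, where g=h])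
    show "((\<lambda>s. z s x) has_vector_derivative h t x (z t x)) (at t)" if "x \<in> U" for x t
      unfolding h_def by (rule "0.prems"(3)[OF that])
    show "\<exists>V L. open V \<and> x \<in> V \<and> V \<subseteq> U \<and> L \<ge> 0 \<and>
       (\<forall>t y \<zeta> \<zeta>'. \<bar>t\<bar> \<le> T \<and> y \<in> V \<longrightarrow> norm (h t y \<zeta> - h t y \<zeta>') \<le> L * norm (\<zeta> - \<zeta>'))" if x: "x \<in> U" for x T
      unfolding h_def using "0.prems"(1) by (intro linear_ode_lipschitz[OF U _ x]) simp
    show "continuous_on (UNIV \<times> U) (\<lambda>(t, y). h t y (z t x))" if x: "x \<in> U" for x
    proof -
      have "continuous_on UNIV (\<lambda>t. z t x)"
        by (rule has_vector_derivative_imp_continuous_on[OF "0.prems"(3)[OF x]])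
      then have "continuous_on (UNIV \<times> U) (\<lambda>p. z (fst p) x)"
        by (rule continuous_on_compose2) (auto intro: continuous_intros)
      then show ?thesis
        using "0.prems"(1,2) unfolding h_def case_prod_unfold by (auto intro!: continuous_intros)
    qed
    show "continuous_on U (z 0)" using "0.prems"(4) by (simp cong: continuous_on_cong)
  qed
  then show ?case by simp
next
  case (Suc k b z c)
  have oU: "open (UNIV \<times> U :: (real \<times> 'a) set)" using assms(1) by (intro open_Times) auto
  define W where "W = (UNIV \<times> U \<times> UNIV :: (real \<times> 'a \<times> 'b) set)"
  have W: "open W" unfolding W_def using assms(1) by (intro open_Times) auto
  define g where "g = (\<lambda>p::real \<times> 'a \<times> 'b. (\<Sum>i\<in>Basis. (snd (snd p) \<bullet> i) *\<^sub>R \<alpha> i (fst p, fst (snd p))) + b (fst p, fst (snd p)))"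
  have \<alpha>k: "Ck_on k (UNIV \<times> U) (\<alpha> i)" and bk: "Ck_on k (UNIV \<times> U) b" for i
    using Suc.prems(1,2) Ck_on_Suc_imp by blast+
  have \<alpha>1: "Ck_on (Suc 0) (UNIV \<times> U) (\<alpha> i)" and b1: "Ck_on (Suc 0) (UNIV \<times> U) b" for i
    using Ck_on_le[OF Suc.prems(1)] Ck_on_le[OF Suc.prems(2)] by blast+
  \<comment> \<open>z itself enters the inhomogeneity of the differentiated equation, so its class k
    is secured first, from the induction hypothesis for the original equation.\<close>
  have zk: "Ck_on k (UNIV \<times> U) (\<lambda>(t, x). z t x)"
    by (rule Suc.IH[OF \<alpha>k bk Suc.prems(3,4)])
  have pr: "bounded_linear (\<lambda>p::real \<times> 'a \<times> 'b. (fst p, fst (snd p)))"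
    by (intro bounded_linear_intros)
  have gC: "Ck_on (Suc 0) W g"
    unfolding g_def
  proof (intro Ck_on_add Ck_on_sum Ck_on_bilinear[OF bounded_bilinear_scaleR] W)
    show "Ck_on (Suc 0) W (\<lambda>p. snd (snd p) \<bullet> i)" for i
      by (intro Ck_on_bounded_linear bounded_linear_intros)
    show "Ck_on (Suc 0) W (\<lambda>p. \<alpha> i (fst p, fst (snd p)))" for i
      by (rule Ck_on_compose[OF W Ck_on_bounded_linear[OF pr] \<alpha>1 oU]) (auto simp: W_def)
    show "Ck_on (Suc 0) W (\<lambda>p. b (fst p, fst (snd p)))"
      by (rule Ck_on_compose[OF W Ck_on_bounded_linear[OF pr] b1 oU]) (auto simp: W_def)
  qed
  have sol: "((\<lambda>s. z s x) has_vector_derivative g (t, x, z t x)) (at t)" if "x \<in> U" for x t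
    using Suc.prems(3)[OF that] by (simp add: g_def)
  have lip: "\<exists>V L. open V \<and> x \<in> V \<and> V \<subseteq> U \<and> L \<ge> 0 \<and>
       (\<forall>t y \<zeta> \<zeta>'. \<bar>t\<bar> \<le> T \<and> y \<in> V \<longrightarrow> norm (g (t, y, \<zeta>) - g (t, y, \<zeta>')) \<le> L * norm (\<zeta> - \<zeta>'))" if x: "x \<in> U" for x T
    unfolding g_def fst_conv snd_conv using Ck_on_le[OF Suc.prems(1), of 0]
    by (intro linear_ode_lipschitz[OF U _ x]) simp
  have z0: "(z 0 has_derivative (\<lambda>_. 0)) (at x)" if "x \<in> U" for x
    by (rule has_derivative_transform_within_open[OF has_derivative_const U that]) (simp add: Suc.prems(4))
  have z0d: "z 0 differentiable (at x)" if "x \<in> U" for x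
    using z0[OF that] unfolding differentiable_def by blast
  have inW: "(t, x, z t x) \<in> W" if "x \<in> U" for x t using that by (simp add: W_def)
  have zx: "z t differentiable (at x)" if "x \<in> U" for x t
    by (rule ode_frechet_in_parameter(1)[OF U W gC sol inW lip z0d that])
  have zv: "((\<lambda>s. frechet_derivative (z s) (at x) h) has_vector_derivative
       frechet_derivative g (at (t, x, z t x)) (0, h, frechet_derivative (z t) (at x) h)) (at t)" if "x \<in> U" for x t h
    by (rule ode_frechet_in_parameter(2)[OF U W gC sol inW lip z0d that])
  \<comment> \<open>The product rule: the first sum is the linear part of the equation for the
    derivative, the rest its inhomogeneity.\<close>
  have Dg: "frechet_derivative g (at (t, x, \<zeta>)) (0, h, \<eta>) = (\<Sum>i\<in>Basis. (\<eta> \<bullet> i) *\<^sub>R \<alpha> i (t, x)) +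
      ((\<Sum>i\<in>Basis. (\<zeta> \<bullet> i) *\<^sub>R frechet_derivative (\<alpha> i) (at (t, x)) (0, h)) + frechet_derivative b (at (t, x)) (0, h))"
    if x: "x \<in> U" for t x \<zeta> h \<eta>
  proof -
    have d\<alpha>: "((\<lambda>p. \<alpha> i (fst p, fst (snd p))) has_derivative (\<lambda>v. frechet_derivative (\<alpha> i) (at (t, x)) (fst v, fst (snd v)))) (at (t, x, \<zeta>))" for i
    proof (rule has_derivative_compose[OF bounded_linear_imp_has_derivative[OF pr], where g="\<alpha> i"])
      show "(\<alpha> i has_derivative frechet_derivative (\<alpha> i) (at (t, x))) (at (fst (t, x, \<zeta>), fst (snd (t, x, \<zeta>))))"
        using \<alpha>1[of i] x by (auto intro: frechet_derivative_has)
    qed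
    have db: "((\<lambda>p. b (fst p, fst (snd p))) has_derivative (\<lambda>v. frechet_derivative b (at (t, x)) (fst v, fst (snd v)))) (at (t, x, \<zeta>))"
    proof (rule has_derivative_compose[OF bounded_linear_imp_has_derivative[OF pr], where g=b])
      show "(b has_derivative frechet_derivative b (at (t, x))) (at (fst (t, x, \<zeta>), fst (snd (t, x, \<zeta>))))"
        using b1 x by (auto intro: frechet_derivative_has)
    qed
    have dz: "((\<lambda>p::real \<times> 'a \<times> 'b. snd (snd p) \<bullet> i) has_derivative (\<lambda>v. snd (snd v) \<bullet> i)) (at (t, x, \<zeta>))" for i
      by (intro bounded_linear_imp_has_derivative bounded_linear_intros)
    have "(g has_derivative (\<lambda>v. (\<Sum>i\<in>Basis. (snd (snd (t, x, \<zeta>)) \<bullet> i) *\<^sub>R frechet_derivative (\<alpha> i) (at (t, x)) (fst v, fst (snd v))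
       + (snd (snd v) \<bullet> i) *\<^sub>R \<alpha> i (fst (t, x, \<zeta>), fst (snd (t, x, \<zeta>)))) + frechet_derivative b (at (t, x)) (fst v, fst (snd v)))) (at (t, x, \<zeta>))"
      unfolding g_def by (intro has_derivative_add has_derivative_sum has_derivative_scaleR d\<alpha> db dz)
    from has_derivative_frechet_eq[OF this] show ?thesis by (simp add: sum.distrib)
  qed
  show ?case
  proof (rule Ck_on_Suc_time_parameter[OF U zx])
    show "((\<lambda>s. z s x) has_vector_derivative (\<lambda>p. g (fst p, snd p, (\<lambda>(t, x). z t x) p)) (t, x)) (at t)" if "x \<in> U" for x t
      using sol[OF that] by simp
    show "Ck_on k (UNIV \<times> U) (\<lambda>p. g (fst p, snd p, (\<lambda>(t, x). z t x) p))"
      unfolding g_def fst_conv snd_conv prod.collapse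
      by (intro Ck_on_add Ck_on_sum Ck_on_bilinear[OF bounded_bilinear_scaleR] oU \<alpha>k bk
         Ck_on_linear_compose[OF bounded_linear_inner_left] zk)
    show "Ck_on k (UNIV \<times> U) (\<lambda>(t, x). frechet_derivative (z t) (at x) v)" for v
    proof (rule Suc.IH[OF \<alpha>k])
      show "Ck_on k (UNIV \<times> U) (\<lambda>p. (\<Sum>i\<in>Basis. ((\<lambda>(t, x). z t x) p \<bullet> i) *\<^sub>R frechet_derivative (\<alpha> i) (at p) (0, v)) + frechet_derivative b (at p) (0, v))"
        using Suc.prems(1,2)
        by (intro Ck_on_add Ck_on_sum Ck_on_bilinear[OF bounded_bilinear_scaleR] oU
         Ck_on_linear_compose[OF bounded_linear_inner_left] zk) auto
      show "((\<lambda>s. frechet_derivative (z s) (at x) v) has_vector_derivative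
          (\<Sum>i\<in>Basis. (frechet_derivative (z t) (at x) v \<bullet> i) *\<^sub>R \<alpha> i (t, x)) +
          ((\<Sum>i\<in>Basis. ((\<lambda>(t, x). z t x) (t, x) \<bullet> i) *\<^sub>R frechet_derivative (\<alpha> i) (at (t, x)) (0, v)) + frechet_derivative b (at (t, x)) (0, v))) (at t)"
        if "x \<in> U" for x t
        using zv[OF that, where h=v and t=t] Dg[OF that] by simp
      show "frechet_derivative (z 0) (at x) v = 0" if "x \<in> U" for x
        using has_derivative_frechet_eq[OF z0[OF that]] by simp
    qed
  qed
qed

text \<open>The smoothness of a flow is bootstrapped: if \<open>\<phi>\<close> is of class \<open>C\<^sup>k\<close>, then so are the
  coefficients of the variational equation, hence the derivative of \<open>\<phi>\<close>.\<close>

lemma flow_smooth_on: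
  fixes f :: "'a::euclidean_space \<Rightarrow> 'a"
  assumes U: "open U" and f: "smooth_on U f"
    and lip: "\<And>x y. norm (f x - f y) \<le> L * norm (x - y)" "L \<ge> 0"
    and inU: "\<And>x t. x \<in> U \<Longrightarrow> \<phi> t x \<in> U"
    and sol: "\<And>x t. x \<in> U \<Longrightarrow> ((\<lambda>s. \<phi> s x) has_vector_derivative f (\<phi> t x)) (at t)"
    and init: "\<And>x. x \<in> U \<Longrightarrow> \<phi> 0 x = x"
  shows "smooth_on (UNIV \<times> U) (\<lambda>(t, x). \<phi> t x)"
  unfolding smooth_on_def
proof
  fix k
  have oU: "open (UNIV \<times> U :: (real \<times> 'a) set)" using U by (intro open_Times) auto
  \<comment> \<open>The autonomous field is seen as one depending on time and parameter, to fit the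
    results on parameter dependence; the parameter is the initial value and enters only through
    \<open>\<phi> 0\<close>.\<close>
  define W where "W = (UNIV \<times> UNIV \<times> U :: (real \<times> 'a \<times> 'a) set)"
  have W: "open W" unfolding W_def using U by (intro open_Times) auto
  define g where "g = (\<lambda>p::real \<times> 'a \<times> 'a. f (snd (snd p)))"
  have pr: "bounded_linear (\<lambda>p::real \<times> 'a \<times> 'a. snd (snd p))"
    by (intro bounded_linear_intros)
  have gC: "Ck_on (Suc 0) W g"
    unfolding g_def
    by (rule Ck_on_compose[OF W Ck_on_bounded_linear[OF pr] smooth_on_Ck[OF f] U]) (auto simp: W_def)
  have lip': "\<exists>V L. open V \<and> x \<in> V \<and> V \<subseteq> U \<and> L \<ge> 0 \<and>
       (\<forall>t y \<zeta> \<zeta>'. \<bar>t\<bar> \<le> T \<and> y \<in> V \<longrightarrow> norm (f \<zeta> - f \<zeta>') \<le> L * norm (\<zeta> - \<zeta>'))" if "x \<in> U" for x and T :: real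
    using U that lip by blast
  have id: "(\<phi> 0 has_derivative (\<lambda>v. v)) (at x)" if "x \<in> U" for x
    by (rule has_derivative_transform_within_open[OF has_derivative_ident U that]) (simp add: init)
  have id': "\<phi> 0 differentiable (at x)" if "x \<in> U" for x
    using id[OF that] unfolding differentiable_def by blast
  have inW: "(t, x, \<phi> t x) \<in> W" if "x \<in> U" for x t using that inU by (simp add: W_def)
  have solg: "((\<lambda>s. \<phi> s x) has_vector_derivative g (t, x, \<phi> t x)) (at t)" if "x \<in> U" for x t
    using sol[OF that] by (simp add: g_def)
  have lipg: "\<exists>V L. open V \<and> x \<in> V \<and> V \<subseteq> U \<and> L \<ge> 0 \<and>
       (\<forall>t y \<zeta> \<zeta>'. \<bar>t\<bar> \<le> T \<and> y \<in> V \<longrightarrow> norm (g (t, y, \<zeta>) - g (t, y, \<zeta>')) \<le> L * norm (\<zeta> - \<zeta>'))" if "x \<in> U" for x and T :: real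
    unfolding g_def fst_conv snd_conv by (rule lip'[OF that])
  have \<phi>x: "\<phi> t differentiable (at x)" if "x \<in> U" for x t
    by (rule ode_frechet_in_parameter(1)[OF U W gC solg inW lipg id' that])
  have \<phi>v: "((\<lambda>s. frechet_derivative (\<phi> s) (at x) h) has_vector_derivative
       frechet_derivative g (at (t, x, \<phi> t x)) (0, h, frechet_derivative (\<phi> t) (at x) h)) (at t)" if "x \<in> U" for x t h
    by (rule ode_frechet_in_parameter(2)[OF U W gC solg inW lipg id' that])
  have Dg: "frechet_derivative g (at (t, x, \<zeta>)) (0, h, \<eta>) = frechet_derivative f (at \<zeta>) \<eta>" if "\<zeta> \<in> U" for t x \<zeta> h \<eta>
  proof -
    have "(g has_derivative (\<lambda>v. frechet_derivative f (at \<zeta>) (snd (snd v)))) (at (t, x, \<zeta>))"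
      unfolding g_def
    proof (rule has_derivative_compose[OF bounded_linear_imp_has_derivative[OF pr], where g=f])
      show "(f has_derivative frechet_derivative f (at \<zeta>)) (at (snd (snd (t, x, \<zeta>))))"
        using smooth_on_has_derivative[OF f that] by simp
    qed
    from has_derivative_frechet_eq[OF this] show ?thesis by simp
  qed
  show "Ck_on k (UNIV \<times> U) (\<lambda>(t, x). \<phi> t x)"
  proof (induction k)
    case 0
    have "continuous_on (UNIV \<times> U) (\<lambda>(t, x). \<phi> t x)"
    proof (rule ode_continuous_in_parameter[OF U sol lip'])
      show "continuous_on (UNIV \<times> U) (\<lambda>(t, y). f (\<phi> t x))" if x: "x \<in> U" for x
      proof -
        have "continuous_on UNIV (\<lambda>t. \<phi> t x)"
          by (rule has_vector_derivative_imp_continuous_on[OF sol[OF x]])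
        then have "continuous_on (UNIV \<times> U) (\<lambda>p. \<phi> (fst p) x)"
          by (rule continuous_on_compose2) (auto intro: continuous_intros)
        then show ?thesis
          unfolding case_prod_unfold
          by (rule continuous_on_compose2[OF smooth_on_continuous_on[OF f]]) (use inU[OF x] in auto)
      qed
      show "continuous_on U (\<phi> 0)" using init by (simp cong: continuous_on_cong)
    qed
    then show ?case by simp
  next
    case (Suc k)
    have comp: "Ck_on k (UNIV \<times> U) (\<lambda>p. h ((\<lambda>(t, x). \<phi> t x) p))" if "smooth_on U h" for h :: "'a \<Rightarrow> 'a"
      by (rule Ck_on_compose[OF oU Suc smooth_on_Ck[OF that] U]) (auto intro: inU)
    show ?case
    proof (rule Ck_on_Suc_time_parameter[OF U \<phi>x])
      show "((\<lambda>s. \<phi> s x) has_vector_derivative (\<lambda>p. f ((\<lambda>(t, x). \<phi> t x) p)) (t, x)) (at t)" if "x \<in> U" for x t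
        using sol[OF that] by simp
      show "Ck_on k (UNIV \<times> U) (\<lambda>p. f ((\<lambda>(t, x). \<phi> t x) p))" by (rule comp[OF f])
      show "Ck_on k (UNIV \<times> U) (\<lambda>(t, x). frechet_derivative (\<phi> t) (at x) v)" for v
      proof (rule linear_ode_Ck_on[OF U])
        show "Ck_on k (UNIV \<times> U) (\<lambda>p. frechet_derivative f (at ((\<lambda>(t, x). \<phi> t x) p)) i)" for i
          by (rule comp[OF smooth_on_frechet_const[OF f]])
        show "((\<lambda>s. frechet_derivative (\<phi> s) (at x) v) has_vector_derivative
           (\<Sum>i\<in>Basis. (frechet_derivative (\<phi> t) (at x) v \<bullet> i) *\<^sub>R frechet_derivative f (at ((\<lambda>(t, x). \<phi> t x) (t, x))) i) + (\<lambda>_. 0) (t, x)) (at t)"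
          if "x \<in> U" for x t
        proof -
          have "frechet_derivative f (at (\<phi> t x)) (frechet_derivative (\<phi> t) (at x) v) =
             (\<Sum>i\<in>Basis. (frechet_derivative (\<phi> t) (at x) v \<bullet> i) *\<^sub>R frechet_derivative f (at (\<phi> t x)) i)"
            by (rule linear_expand[OF smooth_on_bounded_linear[OF f inU[OF that]]])
          then show ?thesis using \<phi>v[OF that, where h=v and t=t] Dg[OF inU[OF that]] by simp
        qed
        show "frechet_derivative (\<phi> 0) (at x) v = v" if "x \<in> U" for x
          using has_derivative_frechet_eq[OF id[OF that]] by simp
      qed (rule Ck_on_const)
    qed
  qed
qed

section \<open>Flows of homogeneous fields\<close>

text \<open>Off the origin the derivative is homogeneous of degree 0, hence bounded; a segment through
  the origin is handled by the linear growth of the field.\<close>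

lemma homogeneous_field_lipschitz:
  fixes X :: "'a::euclidean_space \<Rightarrow> 'a"
  assumes X: "smooth_on (- {0}) X" and X0: "X 0 = 0"
    and hom: "\<And>r y. r > 0 \<Longrightarrow> y \<noteq> 0 \<Longrightarrow> X (r *\<^sub>R y) = r *\<^sub>R X y"
  shows "\<exists>L>0. \<forall>x y. norm (X x - X y) \<le> L * norm (x - y)"
proof -
  let ?D = "\<lambda>y. frechet_derivative X (at y)"
  have op: "open (- {0 :: 'a})" by (intro open_Compl closed_singleton)
  have homD: "?D (r *\<^sub>R y) v = ?D y v" if r: "r > 0" and y: "y \<noteq> 0" for r y v
  proof -
    have ry: "r *\<^sub>R y \<in> - {0}" and y': "y \<in> - {0}" using r y by auto
    have "((\<lambda>y. X (r *\<^sub>R y)) has_derivative (\<lambda>v. ?D (r *\<^sub>R y) (r *\<^sub>R v))) (at y)"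
      by (rule has_derivative_compose[where f="\<lambda>y. r *\<^sub>R y" and g=X,
            OF bounded_linear_imp_has_derivative[OF bounded_linear_scaleR_right] smooth_on_has_derivative[OF X ry]])
    moreover have "((\<lambda>y. X (r *\<^sub>R y)) has_derivative (\<lambda>v. r *\<^sub>R ?D y v)) (at y)"
      by (rule has_derivative_transform_within_open[OF bounded_linear.has_derivative[OF bounded_linear_scaleR_right
          smooth_on_has_derivative[OF X y']] op y']) (simp add: hom r)
    ultimately have "?D (r *\<^sub>R y) (r *\<^sub>R v) = r *\<^sub>R ?D y v"
      using has_derivative_unique by metis
    moreover have "?D (r *\<^sub>R y) (r *\<^sub>R v) = r *\<^sub>R ?D (r *\<^sub>R y) v"
      by (rule linear_scale[OF bounded_linear.linear[OF smooth_on_bounded_linear[OF X ry]]])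
    ultimately show ?thesis using r by simp
  qed
  have sub: "sphere (0 :: 'a) 1 \<subseteq> - {0}" by auto
  have "\<exists>M\<ge>0. \<forall>x\<in>sphere 0 1. \<forall>v. norm (?D x v) \<le> M * norm v"
  proof (rule linear_family_bound[OF compact_sphere])
    show "bounded_linear (?D x)" if "x \<in> sphere 0 1" for x
      using smooth_on_bounded_linear[OF X] sub that by blast
    show "continuous_on (sphere 0 1) (\<lambda>x. ?D x v)" for v
      by (rule continuous_on_subset[OF smooth_on_continuous_on[OF smooth_on_frechet_const[OF X]] sub])
  qed
  then obtain M1 where M1: "M1 \<ge> 0" "\<And>x v. x \<in> sphere 0 1 \<Longrightarrow> norm (?D x v) \<le> M1 * norm v" by blast
  have M1': "norm (?D y v) \<le> M1 * norm v" if "y \<noteq> 0" for y v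
    using homD[of "inverse (norm y)" y v] M1(2)[of "inverse (norm y) *\<^sub>R y" v] that by simp
  have "bounded (X ` sphere 0 1)"
    by (intro compact_imp_bounded compact_continuous_image compact_sphere
        continuous_on_subset[OF smooth_on_continuous_on[OF X] sub])
  then obtain M2 where M2: "\<And>x. x \<in> sphere 0 1 \<Longrightarrow> norm (X x) \<le> M2"
    unfolding bounded_iff by blast
  \<comment> \<open>M1 bounds the derivative and M2 the field on the unit sphere; homogeneity
    carries both bounds to all nonzero vectors.\<close>
  define L where "L = max M1 M2 + 1"
  have L: "L > 0" "M1 \<le> L" "M2 \<le> L" using M1(1) by (auto simp: L_def)
  have growth: "norm (X y) \<le> L * norm y" for y
  proof (cases "y = 0")
    case True
    then show ?thesis using X0 by simp
  next
    case False
    then have "X (norm y *\<^sub>R (inverse (norm y) *\<^sub>R y)) = norm y *\<^sub>R X (inverse (norm y) *\<^sub>R y)"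
      by (intro hom) auto
    moreover have "norm (X (inverse (norm y) *\<^sub>R y)) \<le> M2" using False by (intro M2) simp
    ultimately have "norm (X y) \<le> norm y * M2" using False by (simp add: mult_left_mono)
    also have "\<dots> \<le> norm y * L" using L by (intro mult_left_mono) auto
    finally show ?thesis by (simp add: mult.commute)
  qed
  have "norm (X x - X y) \<le> L * norm (x - y)" for x y
  proof (cases "0 \<in> closed_segment x y")
    case True
    \<comment> \<open>The origin lies between x and y, so the norms add up exactly and the growth
      bound gives the Lipschitz estimate with the same constant.\<close>
    then have "dist x y = dist x 0 + dist 0 y"
      using between between_mem_segment by blast
    then have "norm (x - y) = norm x + norm y" by (simp add: dist_norm)
    moreover have "norm (X x - X y) \<le> L * norm x + L * norm y"
      by (rule order.trans[OF norm_triangle_ineq4 add_mono[OF growth growth]])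
    ultimately show ?thesis by (simp add: distrib_left)
  next
    case False
    show ?thesis
    proof (rule differentiable_bound[OF convex_closed_segment])
      fix u assume "u \<in> closed_segment x y"
      then have u: "u \<noteq> 0" using False by auto
      then have "(X has_derivative ?D u) (at u)" by (intro smooth_on_has_derivative[OF X]) simp
      then show "(X has_derivative ?D u) (at u within closed_segment x y)"
        by (rule has_derivative_at_withinI)
      show "onorm (?D u) \<le> L"
      proof (rule onorm_bound)
        show "norm (?D u v) \<le> L * norm v" for v
          using M1'[OF u, of v] mult_right_mono[OF L(2), of "norm v"] by simp
      qed (use L in simp)
    qed auto
  qed
  then show ?thesis using L(1) by blast
qed

text \<open>The last conclusion is uniqueness among nowhere vanishing trajectories of X; it will
  single out the parallel field with a given initial vector. The group law and the invariance of the
  complement of 0 come from the same uniqueness for the extension by 0.\<close>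

lemma homogeneous_field_flow:
  fixes X :: "'a::euclidean_space \<Rightarrow> 'a"
  assumes X: "smooth_on (- {0}) X"
    and hom: "\<And>r y. r > 0 \<Longrightarrow> y \<noteq> 0 \<Longrightarrow> X (r *\<^sub>R y) = r *\<^sub>R X y"
  obtains \<phi> :: "real \<Rightarrow> 'a \<Rightarrow> 'a" where
    "\<And>x. \<phi> 0 x = x"
    "\<And>t x. x \<noteq> 0 \<Longrightarrow> \<phi> t x \<noteq> 0"
    "\<And>t x. x \<noteq> 0 \<Longrightarrow> ((\<lambda>s. \<phi> s x) has_vector_derivative X (\<phi> t x)) (at t)"
    "\<And>s t x. \<phi> (s + t) x = \<phi> s (\<phi> t x)"
    "smooth_on (UNIV \<times> - {0}) (\<lambda>(t, x). \<phi> t x)"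
    "\<And>y t. \<forall>t. y t \<noteq> 0 \<and> (y has_vector_derivative X (y t)) (at t) \<Longrightarrow> y t = \<phi> t (y 0)"
proof -
  define Z where "Z = (\<lambda>x. if x = 0 then 0 else X x)"
  have op: "open (- {0 :: 'a})" by (intro open_Compl closed_singleton)
  have Zs: "smooth_on (- {0}) Z"
    using smooth_on_cong[OF op, of Z X] X by (simp add: Z_def)
  obtain L where L: "L > 0" and lip: "\<And>x y. norm (Z x - Z y) \<le> L * norm (x - y)"
    using homogeneous_field_lipschitz[OF Zs] hom by (auto simp: Z_def)
  have cont: "continuous_on UNIV (\<lambda>(t::real, x). Z x)"
  proof -
    have "continuous_on UNIV Z"
      unfolding continuous_on_iff
    proof (intro ballI allI impI)
      fix x :: 'a and e :: real assume "e > 0"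
      then show "\<exists>d>0. \<forall>x'\<in>UNIV. dist x' x < d \<longrightarrow> dist (Z x') (Z x) < e"
        using L lip by (intro exI[of _ "e / L"])
          (auto simp: dist_norm field_simps intro: le_less_trans[OF lip])
    qed
    then have "continuous_on UNIV (\<lambda>p::real \<times> 'a. Z (snd p))"
      by (rule continuous_on_compose2) (auto intro: continuous_intros)
    then show ?thesis by (simp add: case_prod_unfold)
  qed
  have "\<exists>z. z 0 = x \<and> (\<forall>t. (z has_vector_derivative Z (z t)) (at t))" for x
    using picard_global[OF L cont lip, of 0 x] by (simp add: Z_def)
  then obtain \<phi> where \<phi>0: "\<And>x. \<phi> x 0 = x" and \<phi>': "\<And>x t. (\<phi> x has_vector_derivative Z (\<phi> x t)) (at t)"
    by metis
  have uniq: "y t = \<phi> (y 0) t" if "\<And>t. (y has_vector_derivative Z (y t)) (at t)" for y t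
    by (rule ode_unique[where f="\<lambda>s. Z" and L=L]) (use L \<phi>0 \<phi>' that lip in auto)
  have group: "\<phi> x (s + t) = \<phi> (\<phi> x t) s" for x s t
  proof -
    have "((\<lambda>s. \<phi> x (t + s)) has_vector_derivative Z (\<phi> x (t + s))) (at s)" for s
      by (rule has_vector_derivative_shift[OF \<phi>'])
    from uniq[OF this, of s] show ?thesis by (simp add: add.commute)
  qed
  have zero: "\<phi> 0 t = 0" for t
    using uniq[of "\<lambda>_. 0" t] by (simp add: Z_def)
  \<comment> \<open>The origin is a rest point of the extended field; flowing back from it would
    give x = 0.\<close>
  have nz: "\<phi> x t \<noteq> 0" if "x \<noteq> 0" for x t
  proof
    assume "\<phi> x t = 0"
    then have "\<phi> x (- t + t) = 0" using group[of x "- t" t] zero by simp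
    then show False using \<phi>0 that by simp
  qed
  show ?thesis
  proof (rule that[of "\<lambda>t x. \<phi> x t"])
    show "((\<lambda>s. \<phi> x s) has_vector_derivative X (\<phi> x t)) (at t)" if "x \<noteq> 0" for t x
      using \<phi>'[of x t] nz[OF that] by (simp add: Z_def)
    show "smooth_on (UNIV \<times> - {0}) (\<lambda>(t, x). \<phi> x t)"
      using nz by (intro flow_smooth_on[OF op Zs lip] \<phi>' \<phi>0 less_imp_le[OF L]) auto
    show "y t = \<phi> (y 0) t" if "\<forall>t. y t \<noteq> 0 \<and> (y has_vector_derivative X (y t)) (at t)" for y t
      using uniq[of y t] that by (simp add: Z_def)
  qed (use \<phi>0 nz group in auto)
qed

section \<open>Local solutions of smooth equations\<close>

text \<open>Composition with the nearest point projection onto a closed ball around x0 makes the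
  field globally Lipschitz, so the global result applies. By continuity the solution stays in the
  ball for a short time, where the projection is the identity.\<close>

lemma local_ode_exists:
  fixes f :: "'a::euclidean_space \<Rightarrow> 'a"
  assumes "open U" "smooth_on U f" "x0 \<in> U"
  obtains \<epsilon> x where "\<epsilon> > 0" "x 0 = x0" "\<And>t. \<bar>t\<bar> < \<epsilon> \<Longrightarrow> x t \<in> U"
    "\<And>t. \<bar>t\<bar> < \<epsilon> \<Longrightarrow> (x has_vector_derivative f (x t)) (at t)"
proof -
  obtain r where r: "r > 0" "cball x0 r \<subseteq> U" using assms open_contains_cball by blast
  let ?D = "\<lambda>y. frechet_derivative f (at y)"
  let ?p = "closest_point (cball x0 r)"
  have ne: "cball x0 r \<noteq> {}" using r by auto
  have pin: "?p x \<in> cball x0 r" for x by (rule closest_point_in_set[OF closed_cball ne])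
  have "\<exists>M\<ge>0. \<forall>x\<in>cball x0 r. \<forall>v. norm (?D x v) \<le> M * norm v"
    using r(2) by (intro linear_family_bound compact_cball smooth_on_bounded_linear[OF assms(2)]
        continuous_on_subset[OF smooth_on_continuous_on[OF smooth_on_frechet_const[OF assms(2)]]]) auto
  then obtain M where M: "M \<ge> 0" "\<And>x v. x \<in> cball x0 r \<Longrightarrow> norm (?D x v) \<le> M * norm v" by blast
  have lipf: "norm (f x - f y) \<le> M * norm (x - y)" if "x \<in> cball x0 r" "y \<in> cball x0 r" for x y
  proof (rule differentiable_bound[OF convex_cball _ _ that])
    fix u assume u: "u \<in> cball x0 r"
    then show "(f has_derivative ?D u) (at u within cball x0 r)"
      using r by (intro has_derivative_at_withinI[OF smooth_on_has_derivative[OF assms(2)]]) auto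
    show "onorm (?D u) \<le> M" by (rule onorm_bound[OF M(1) M(2)[OF u]])
  qed
  have contp: "continuous_on UNIV ?p"
    by (rule continuous_on_closest_point[OF convex_cball closed_cball ne])
  have contf: "continuous_on (cball x0 r) f"
    by (rule continuous_on_subset[OF smooth_on_continuous_on[OF assms(2)] r(2)])
  have "continuous_on UNIV (\<lambda>x. f (?p x))"
    by (rule continuous_on_compose2[OF contf contp]) (use pin in auto)
  then have cont: "continuous_on UNIV (\<lambda>q::real \<times> 'a. f (?p (snd q)))"
    by (rule continuous_on_compose2) (auto intro: continuous_intros)
  have lip: "norm (f (?p x) - f (?p y)) \<le> (M + 1) * norm (x - y)" for x y
  proof -
    have "norm (f (?p x) - f (?p y)) \<le> M * norm (?p x - ?p y)" by (rule lipf[OF pin pin])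
    also have "\<dots> \<le> M * norm (x - y)"
      using closest_point_lipschitz[OF convex_cball closed_cball ne, of x y] M(1)
      by (intro mult_left_mono) (auto simp: dist_norm)
    also have "\<dots> \<le> (M + 1) * norm (x - y)" by (intro mult_right_mono) auto
    finally show ?thesis .
  qed
  obtain x where x: "x 0 = x0" "\<And>t. (x has_vector_derivative f (?p (x t))) (at t)"
    using picard_global[of "M + 1" "\<lambda>t x. f (?p x)" "norm (f (?p 0))" x0] M(1) cont lip
    by (auto simp: case_prod_unfold)
  have "isCont x 0" by (rule has_vector_derivative_continuous[OF x(2)])
  then obtain \<epsilon> where \<epsilon>: "\<epsilon> > 0" "\<And>t. dist t 0 < \<epsilon> \<Longrightarrow> dist (x t) (x 0) < r"
    using r(1) unfolding continuous_at_eps_delta by blast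
  have "x t \<in> cball x0 r" if "\<bar>t\<bar> < \<epsilon>" for t
    using \<epsilon>(2)[of t] that x(1) by (simp add: dist_commute)
  moreover from this have "(x has_vector_derivative f (x t)) (at t)" if "\<bar>t\<bar> < \<epsilon>" for t
    using x(2)[of t] that by (simp add: closest_point_self)
  ultimately show ?thesis using r(2) by (intro that[of \<epsilon> x] \<epsilon>(1) x(1)) auto
qed

text \<open>f is Lipschitz on the compact union K of the two trajectories. K need not be convex, so
  the uniform expansion serves for pairs closer than d, and the bound 2 B on differences of values
  for the others.\<close>

lemma local_ode_unique:
  fixes f :: "'a::euclidean_space \<Rightarrow> 'a"
  assumes "open U" "smooth_on U f"
    and y: "\<And>t. \<bar>t\<bar> < \<epsilon> \<Longrightarrow> y t \<in> U" "\<And>t. \<bar>t\<bar> < \<epsilon> \<Longrightarrow> (y has_vector_derivative f (y t)) (at t)"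
    and z: "\<And>t. \<bar>t\<bar> < \<epsilon> \<Longrightarrow> z t \<in> U" "\<And>t. \<bar>t\<bar> < \<epsilon> \<Longrightarrow> (z has_vector_derivative f (z t)) (at t)"
    and "y 0 = z 0" "\<bar>t\<bar> < \<epsilon>"
  shows "y t = z t"
proof -
  define I where "I = {-\<bar>t\<bar>..\<bar>t\<bar>}"
  have I: "\<bar>s\<bar> < \<epsilon>" if "s \<in> I" for s using that assms(8) by (auto simp: I_def)
  define K where "K = y ` I \<union> z ` I"
  have "continuous_on I y" "continuous_on I z"
    using has_vector_derivative_imp_continuous_on[OF y(2)[OF I]] has_vector_derivative_imp_continuous_on[OF z(2)[OF I]] by auto
  then have K: "compact K" "K \<subseteq> U"
    unfolding K_def using y(1) z(1) I by (auto intro!: compact_Un compact_continuous_image simp: I_def)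
  let ?D = "\<lambda>y. frechet_derivative f (at y)"
  have "\<exists>M\<ge>0. \<forall>x\<in>K. \<forall>v. norm (?D x v) \<le> M * norm v"
    using K(2) by (intro linear_family_bound K(1) smooth_on_bounded_linear[OF assms(2)]
        continuous_on_subset[OF smooth_on_continuous_on[OF smooth_on_frechet_const[OF assms(2)]]]) auto
  then obtain M where M: "M \<ge> 0" "\<And>x v. x \<in> K \<Longrightarrow> norm (?D x v) \<le> M * norm v" by blast
  obtain d where d: "d > 0" "\<And>p k. p \<in> K \<Longrightarrow> norm k < d \<Longrightarrow> norm (f (p + k) - f p - ?D p k) \<le> 1 * norm k"
    using uniform_differentiable_on_compact[OF K assms(1) smooth_on_Ck[OF assms(2)] zero_less_one] by blast
  have "bounded (f ` K)"
    by (intro compact_imp_bounded compact_continuous_image K(1) continuous_on_subset[OF smooth_on_continuous_on[OF assms(2)] K(2)])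
  then obtain B where B: "\<And>x. x \<in> K \<Longrightarrow> norm (f x) \<le> B" unfolding bounded_iff by blast
  define L where "L = max (M + 1) (2 * B / d)"
  have L: "L \<ge> 0" using M(1) by (auto simp: L_def)
  have lip: "norm (f p - f q) \<le> L * norm (p - q)" if "p \<in> K" "q \<in> K" for p q
  proof (cases "norm (p - q) < d")
    case True
    have "norm (f (q + (p - q)) - f q - ?D q (p - q)) \<le> 1 * norm (p - q)"
      by (rule d(2)[OF that(2) True])
    then have "norm (f p - f q - ?D q (p - q)) + norm (?D q (p - q)) \<le> 1 * norm (p - q) + M * norm (p - q)"
      using M(2)[OF that(2), of "p - q"] by simp
    then have "norm (f p - f q) \<le> (M + 1) * norm (p - q)"
      using norm_triangle_ineq[of "f p - f q - ?D q (p - q)" "?D q (p - q)"] by (simp add: algebra_simps)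
    also have "\<dots> \<le> L * norm (p - q)" by (intro mult_right_mono) (auto simp: L_def)
    finally show ?thesis .
  next
    case False
    have "norm (f p - f q) \<le> B + B"
      by (rule order.trans[OF norm_triangle_ineq4 add_mono[OF B[OF that(1)] B[OF that(2)]]])
    also have "\<dots> = 2 * B / d * d" using d(1) by simp
    also have "\<dots> \<le> L * d" using d(1) by (intro mult_right_mono) (auto simp: L_def)
    also have "\<dots> \<le> L * norm (p - q)" using False L by (intro mult_left_mono) auto
    finally show ?thesis .
  qed
  show ?thesis
  proof (rule ode_unique[where f="\<lambda>s. f" and y=y and z=z and L=L, OF L assms(7)])
    fix s assume "\<bar>s\<bar> \<le> \<bar>t\<bar>"
    then have s: "s \<in> I" by (auto simp: I_def)
    show "(y has_vector_derivative f (y s)) (at s)" "(z has_vector_derivative f (z s)) (at s)"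
      using y(2) z(2) I[OF s] by auto
    show "norm (f (y s) - f (z s)) \<le> L * norm (y s - z s)"
      using s by (intro lip) (auto simp: K_def)
  qed
qed

text \<open>Bootstrapping: if x is of class C^k, then so is its derivative f(x).\<close>

lemma ode_solution_smooth_on:
  fixes f :: "'a::euclidean_space \<Rightarrow> 'a" and x :: "real \<Rightarrow> 'a"
  assumes "open T" "open U" "smooth_on U f" "\<And>t. t \<in> T \<Longrightarrow> x t \<in> U"
    and x': "\<And>t. t \<in> T \<Longrightarrow> (x has_vector_derivative f (x t)) (at t)"
  shows "smooth_on T x"
  unfolding smooth_on_def
proof
  show "Ck_on k T x" for k
  proof (induction k)
    case 0
    then show ?case using has_vector_derivative_imp_continuous_on[OF x'] by simp
  next
    case (Suc k)
    have "Ck_on k T (\<lambda>t. frechet_derivative x (at t) v)" for v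
    proof (subst Ck_on_cong[OF assms(1)])
      show "frechet_derivative x (at t) v = v *\<^sub>R f (x t)" if "t \<in> T" for t
        using has_derivative_frechet_eq[OF x'[OF that, unfolded has_vector_derivative_def]] by simp
      show "Ck_on k T (\<lambda>t. v *\<^sub>R f (x t))"
        using assms(4) by (intro Ck_on_linear_compose[OF bounded_linear_scaleR_right assms(1)]
            Ck_on_compose[OF assms(1) Suc smooth_on_Ck[OF assms(3)] assms(2)]) auto
    qed
    moreover have "x differentiable (at t)" if "t \<in> T" for t
      using x'[OF that] unfolding has_vector_derivative_def differentiable_def by blast
    ultimately show ?case by simp
  qed
qed

lemma smooth_on_congI:
  "smooth_on S g \<Longrightarrow> open S \<Longrightarrow> (\<And>x. x \<in> S \<Longrightarrow> f x = g x) \<Longrightarrow> smooth_on S f"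
  using smooth_on_cong[of S f g] by simp

section \<open>Smooth maps between manifolds\<close>

text \<open>Charts and transitions without the separation and countability axioms. The atlases of
  products, of the slit bundle and of tangent spaces are shown to satisfy this, and the results on
  smooth maps are stated for it.\<close>

definition smooth_atlas :: "('a, 'e::euclidean_space) atlas \<Rightarrow> bool" where
  "smooth_atlas A \<longleftrightarrow>
     (\<forall>c\<in>A. inj_on (snd c) (fst c)) \<and>
     (\<forall>c\<in>A. \<forall>d\<in>A. open (snd c ` (fst c \<inter> fst d)) \<and>
                smooth_on (snd c ` (fst c \<inter> fst d)) (snd d \<circ> chart_inv c))"

lemma smooth_manifold_imp_smooth_atlas: "smooth_manifold A \<Longrightarrow> smooth_atlas A"
  by (simp add: smooth_manifold_def smooth_atlas_def)

lemma chart_inv_in: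
  assumes "x \<in> snd c ` fst c"
  shows "chart_inv c x \<in> fst c" "snd c (chart_inv c x) = x"
  unfolding chart_inv_def using assms by (simp_all add: inv_into_into f_inv_into_f)

lemma smooth_atlas_inj: "smooth_atlas A \<Longrightarrow> c \<in> A \<Longrightarrow> inj_on (snd c) (fst c)"
  by (simp add: smooth_atlas_def)

lemma chart_inv_chart: "smooth_atlas A \<Longrightarrow> c \<in> A \<Longrightarrow> p \<in> fst c \<Longrightarrow> chart_inv c (snd c p) = p"
  unfolding chart_inv_def by (simp add: smooth_atlas_inj)

lemma smooth_atlas_open_overlap:
  "smooth_atlas A \<Longrightarrow> c \<in> A \<Longrightarrow> d \<in> A \<Longrightarrow> open (snd c ` (fst c \<inter> fst d))"
  by (simp add: smooth_atlas_def)

lemma smooth_atlas_open: "smooth_atlas A \<Longrightarrow> c \<in> A \<Longrightarrow> open (snd c ` fst c)"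
  using smooth_atlas_open_overlap[of A c c] by simp

lemma smooth_atlas_transition:
  "smooth_atlas A \<Longrightarrow> c \<in> A \<Longrightarrow> d \<in> A \<Longrightarrow> smooth_on (snd c ` (fst c \<inter> fst d)) (\<lambda>x. snd d (chart_inv c x))"
  by (simp add: smooth_atlas_def o_def)

lemma openin_smooth_atlas:
  assumes "smooth_atlas A"
  shows "openin (atlas_topology A) W \<longleftrightarrow> W \<subseteq> points A \<and> (\<forall>c\<in>A. open (snd c ` (W \<inter> fst c)))"
  by (rule openin_atlas_topology) (use assms smooth_atlas_inj in blast)

lemma topspace_smooth_atlas:
  assumes "smooth_atlas A" shows "topspace (atlas_topology A) = points A"
proof -
  have "points A \<inter> fst c = fst c" if "c \<in> A" for c using that by (auto simp: points_def)
  then have "openin (atlas_topology A) (points A)"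
    unfolding openin_smooth_atlas[OF assms] using smooth_atlas_open[OF assms] by auto
  moreover have "W \<subseteq> points A" if "openin (atlas_topology A) W" for W
    using that openin_smooth_atlas[OF assms] by blast
  ultimately show ?thesis by (simp add: openin_subset openin_topspace subset_antisym)
qed

lemma openin_chart_domain:
  assumes "smooth_atlas A" "d \<in> A" shows "openin (atlas_topology A) (fst d)"
  unfolding openin_smooth_atlas[OF assms(1)]
proof (intro conjI ballI)
  show "fst d \<subseteq> points A" using assms(2) by (auto simp: points_def)
  show "open (snd c ` (fst d \<inter> fst c))" if "c \<in> A" for c
    using smooth_atlas_open_overlap[OF assms(1) that assms(2)] by (simp add: Int_commute)
qed

lemma open_vimage_chart:
  assumes "open V" "smooth_on V F" "open Z" shows "open {x \<in> V. F x \<in> Z}"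
proof -
  have "V \<inter> F -` Z = {x \<in> V. F x \<in> Z}" by auto
  then show ?thesis
    using continuous_open_preimage[OF smooth_on_continuous_on[OF assms(2)] assms(1,3)] by simp
qed

text \<open>In the new charts f is \<sigma> \<circ> F \<circ> \<tau> with smooth transitions \<tau>
  and \<sigma>; V' consists of the points at which this composition is defined.\<close>

lemma local_representation_change:
  assumes A: "smooth_atlas A" and B: "smooth_atlas B"
    and c: "c \<in> A" "p \<in> fst c" and d: "d \<in> B"
    and V: "open V" "snd c p \<in> V" "V \<subseteq> snd c ` fst c" "\<And>x. x \<in> V \<Longrightarrow> f (chart_inv c x) \<in> fst d"
      "smooth_on V (\<lambda>x. snd d (f (chart_inv c x)))"
    and c': "c' \<in> A" "p \<in> fst c'" and d': "d' \<in> B" "f p \<in> fst d'"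
  shows "\<exists>V'. open V' \<and> snd c' p \<in> V' \<and> V' \<subseteq> snd c' ` fst c' \<and> (\<forall>x\<in>V'. f (chart_inv c' x) \<in> fst d') \<and>
    smooth_on V' (\<lambda>x. snd d' (f (chart_inv c' x)))"
proof -
  define W0 where "W0 = snd c' ` (fst c' \<inter> fst c)"
  define \<tau> where "\<tau> = (\<lambda>x. snd c (chart_inv c' x))"
  define Z where "Z = snd d ` (fst d \<inter> fst d')"
  define \<sigma> where "\<sigma> = (\<lambda>x. snd d' (chart_inv d x))"
  define F where "F = (\<lambda>x. snd d (f (chart_inv c x)))"
  have W0: "open W0" unfolding W0_def by (rule smooth_atlas_open_overlap[OF A c'(1) c(1)])
  have \<tau>: "smooth_on W0 \<tau>" unfolding W0_def \<tau>_def by (rule smooth_atlas_transition[OF A c'(1) c(1)])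
  have Z: "open Z" unfolding Z_def by (rule smooth_atlas_open_overlap[OF B d d'(1)])
  have \<sigma>: "smooth_on Z \<sigma>" unfolding Z_def \<sigma>_def by (rule smooth_atlas_transition[OF B d d'(1)])
  have F: "smooth_on V F" unfolding F_def by (rule V(5))
  define V2 where "V2 = {x \<in> V. F x \<in> Z}"
  have V2: "open V2" unfolding V2_def by (rule open_vimage_chart[OF V(1) F Z])
  define V' where "V' = {x \<in> W0. \<tau> x \<in> V2}"
  have V': "open V'" unfolding V'_def by (rule open_vimage_chart[OF W0 \<tau> V2])
  have eq: "chart_inv c (\<tau> x) = chart_inv c' x" if x: "x \<in> W0" for x
  proof -
    obtain q where q: "x = snd c' q" "q \<in> fst c'" "q \<in> fst c" using x by (auto simp: W0_def)
    then show ?thesis by (simp add: \<tau>_def chart_inv_chart[OF A c'(1)] chart_inv_chart[OF A c(1)])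
  qed
  have Fd: "chart_inv d (F x) = f (chart_inv c x)" if "x \<in> V" for x
    unfolding F_def by (rule chart_inv_chart[OF B d V(4)[OF that]])
  have in_d': "f (chart_inv c' x) \<in> fst d'" "snd d' (f (chart_inv c' x)) = \<sigma> (F (\<tau> x))" if x: "x \<in> V'" for x
  proof -
    have x': "x \<in> W0" "\<tau> x \<in> V" "F (\<tau> x) \<in> Z" using x by (auto simp: V'_def V2_def)
    have e: "f (chart_inv c' x) = chart_inv d (F (\<tau> x))"
      using Fd[OF x'(2)] eq[OF x'(1)] by simp
    obtain q where q: "F (\<tau> x) = snd d q" "q \<in> fst d" "q \<in> fst d'" using x'(3) by (auto simp: Z_def)
    then have "chart_inv d (F (\<tau> x)) = q" by (simp add: chart_inv_chart[OF B d])
    then show "f (chart_inv c' x) \<in> fst d'" using e q by simp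
    show "snd d' (f (chart_inv c' x)) = \<sigma> (F (\<tau> x))" by (simp add: \<sigma>_def e)
  qed
  have p: "\<tau> (snd c' p) = snd c p" by (simp add: \<tau>_def chart_inv_chart[OF A c'])
  have "smooth_on V' (\<lambda>x. \<sigma> (F (\<tau> x)))"
  proof (rule smooth_on_compose[OF V' _ \<sigma> Z])
    show "smooth_on V' (\<lambda>x. F (\<tau> x))"
      by (rule smooth_on_compose[OF V' smooth_on_subset[OF \<tau>] F V(1)]) (auto simp: V'_def V2_def)
  qed (auto simp: V'_def V2_def)
  then have "smooth_on V' (\<lambda>x. snd d' (f (chart_inv c' x)))"
    using smooth_on_cong[OF V', of "\<lambda>x. snd d' (f (chart_inv c' x))" "\<lambda>x. \<sigma> (F (\<tau> x))"] in_d'(2) by blast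
  moreover have "snd c' p \<in> V'"
  proof -
    have "F (snd c p) = snd d (f p)" by (simp add: F_def chart_inv_chart[OF A c])
    moreover have "f p \<in> fst d" using V(4)[OF V(2)] by (simp add: chart_inv_chart[OF A c])
    ultimately have "F (snd c p) \<in> Z" using d'(2) by (auto simp: Z_def)
    then show ?thesis using c c' V(2) p by (auto simp: V'_def V2_def W0_def)
  qed
  moreover have "V' \<subseteq> snd c' ` fst c'" by (auto simp: V'_def W0_def)
  ultimately show ?thesis using V' in_d'(1) by blast
qed

text \<open>One good pair of charts at each point suffices, by
  \<open>local_representation_change\<close>; continuity in the atlas topologies is also read off
  the local representations.\<close>

lemma smooth_mapI:
  assumes A: "smooth_atlas A" and B: "smooth_atlas B"
    and loc: "\<And>p. p \<in> points A \<Longrightarrow> \<exists>c d V. c \<in> A \<and> d \<in> B \<and> p \<in> fst c \<and> open V \<and> snd c p \<in> V \<and> V \<subseteq> snd c ` fst c \<and>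
       (\<forall>x\<in>V. f (chart_inv c x) \<in> fst d) \<and> smooth_on V (\<lambda>x. snd d (f (chart_inv c x)))"
  shows "smooth_map A B f"
proof -
  have loc': "\<exists>V. open V \<and> snd c' p \<in> V \<and> V \<subseteq> snd c' ` fst c' \<and> (\<forall>x\<in>V. f (chart_inv c' x) \<in> fst d') \<and>
    smooth_on V (\<lambda>x. snd d' (f (chart_inv c' x)))"
    if c': "c' \<in> A" "p \<in> fst c'" and d': "d' \<in> B" "f p \<in> fst d'" for p c' d'
  proof -
    have "p \<in> points A" using c' by (auto simp: points_def)
    from loc[OF this] obtain c d V where *: "c \<in> A" "d \<in> B" "p \<in> fst c" "open V" "snd c p \<in> V" "V \<subseteq> snd c ` fst c"
       "\<forall>x\<in>V. f (chart_inv c x) \<in> fst d" "smooth_on V (\<lambda>x. snd d (f (chart_inv c x)))" by blast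
    show ?thesis
      by (rule local_representation_change[OF A B *(1,3,2,4,5,6) bspec[OF *(7)] *(8) c' d'])
  qed
  have into: "f p \<in> points B" if "p \<in> points A" for p
  proof -
    from loc[OF that] obtain c d V where *: "c \<in> A" "d \<in> B" "p \<in> fst c" "snd c p \<in> V" "\<forall>x\<in>V. f (chart_inv c x) \<in> fst d"
      by blast
    have "f (chart_inv c (snd c p)) \<in> fst d" using *(4,5) by blast
    then show ?thesis using *(2) by (auto simp: points_def chart_inv_chart[OF A *(1,3)])
  qed
  show ?thesis
    unfolding smooth_map_def
  proof (intro conjI ballI)
    show "continuous_map (atlas_topology A) (atlas_topology B) f"
      unfolding continuous_map_def topspace_smooth_atlas[OF A] topspace_smooth_atlas[OF B]
    proof (intro conjI allI impI)
      show "f \<in> points A \<rightarrow> points B" using into by auto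
      fix W assume "openin (atlas_topology B) W"
      then have W: "W \<subseteq> points B" "\<And>c. c \<in> B \<Longrightarrow> open (snd c ` (W \<inter> fst c))"
        using openin_smooth_atlas[OF B] by auto
      show "openin (atlas_topology A) {x \<in> points A. f x \<in> W}"
        unfolding openin_smooth_atlas[OF A]
      proof (intro conjI ballI)
        fix c' assume c': "c' \<in> A"
        show "open (snd c' ` ({x \<in> points A. f x \<in> W} \<inter> fst c'))"
        proof (subst open_subopen, rule ballI)
          fix y assume "y \<in> snd c' ` ({x \<in> points A. f x \<in> W} \<inter> fst c')"
          then obtain p where p: "y = snd c' p" "p \<in> points A" "f p \<in> W" "p \<in> fst c'" by blast
          then obtain d' where d': "d' \<in> B" "f p \<in> fst d'" using W(1) by (auto simp: points_def)
          obtain V where V: "open V" "snd c' p \<in> V" "V \<subseteq> snd c' ` fst c'" "\<And>x. x \<in> V \<Longrightarrow> f (chart_inv c' x) \<in> fst d'"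
            "smooth_on V (\<lambda>x. snd d' (f (chart_inv c' x)))" using loc'[OF c' p(4) d'] by blast
          \<comment> \<open>The coordinates whose image has coordinates in those of W; injectivity
            of d' on its domain then puts the image itself into W.\<close>
          define V' where "V' = {x \<in> V. snd d' (f (chart_inv c' x)) \<in> snd d' ` (W \<inter> fst d')}"
          have "open V'" unfolding V'_def by (rule open_vimage_chart[OF V(1,5) W(2)[OF d'(1)]])
          moreover have "y \<in> V'" using p d' V(2) by (auto simp: V'_def chart_inv_chart[OF A c'])
          moreover have "V' \<subseteq> snd c' ` ({x \<in> points A. f x \<in> W} \<inter> fst c')"
          proof
            fix x assume x: "x \<in> V'"
            then have xV: "x \<in> V" by (simp add: V'_def)
            then have xi: "chart_inv c' x \<in> fst c'" "snd c' (chart_inv c' x) = x"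
              using chart_inv_in[OF subsetD[OF V(3) xV]] by auto
            obtain q where q: "snd d' (f (chart_inv c' x)) = snd d' q" "q \<in> W" "q \<in> fst d'"
              using x by (auto simp: V'_def)
            then have "f (chart_inv c' x) = q"
              using inj_onD[OF smooth_atlas_inj[OF B d'(1)] q(1) V(4)[OF xV] q(3)] by simp
            then have "chart_inv c' x \<in> {x \<in> points A. f x \<in> W} \<inter> fst c'"
              using q xi c' by (auto simp: points_def)
            then show "x \<in> snd c' ` ({x \<in> points A. f x \<in> W} \<inter> fst c')" using xi(2) by (metis imageI)
          qed
          ultimately show "\<exists>T. open T \<and> y \<in> T \<and> T \<subseteq> snd c' ` ({x \<in> points A. f x \<in> W} \<inter> fst c')" by blast
        qed
      qed blast
    qed
    fix c' d' assume c': "c' \<in> A" and d': "d' \<in> B"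
    show "smooth_on (snd c' ` {p \<in> fst c'. f p \<in> fst d'}) (snd d' \<circ> f \<circ> chart_inv c')"
    proof (rule smooth_on_local)
      fix y assume "y \<in> snd c' ` {p \<in> fst c'. f p \<in> fst d'}"
      then obtain p where p: "y = snd c' p" "p \<in> fst c'" "f p \<in> fst d'" by blast
      show "\<exists>U. open U \<and> y \<in> U \<and> smooth_on U (snd d' \<circ> f \<circ> chart_inv c')"
        using loc'[OF c' p(2) d' p(3)] unfolding p(1) o_def by blast
    qed
  qed
qed

text \<open>Openness of the domain is the part that comes from continuity: chart domains are open,
  hence so is the preimage of one.\<close>

lemma smooth_mapD:
  assumes A: "smooth_atlas A" and B: "smooth_atlas B" and f: "smooth_map A B f"
    and c: "c \<in> A" and d: "d \<in> B"
  shows "open (snd c ` {p \<in> fst c. f p \<in> fst d})"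
    and "smooth_on (snd c ` {p \<in> fst c. f p \<in> fst d}) (\<lambda>x. snd d (f (chart_inv c x)))"
proof -
  have "openin (atlas_topology A) {p \<in> topspace (atlas_topology A). f p \<in> fst d}"
    using f openin_chart_domain[OF B d] unfolding smooth_map_def continuous_map_def by blast
  then have "open (snd c ` ({p \<in> points A. f p \<in> fst d} \<inter> fst c))"
    using c unfolding openin_smooth_atlas[OF A] topspace_smooth_atlas[OF A] by blast
  moreover have "{p \<in> points A. f p \<in> fst d} \<inter> fst c = {p \<in> fst c. f p \<in> fst d}"
    using c by (auto simp: points_def)
  ultimately show "open (snd c ` {p \<in> fst c. f p \<in> fst d})" by simp
  show "smooth_on (snd c ` {p \<in> fst c. f p \<in> fst d}) (\<lambda>x. snd d (f (chart_inv c x)))"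
    using f c d unfolding smooth_map_def o_def by blast
qed

lemma smooth_map_into: 
  assumes "smooth_atlas A" "smooth_atlas B" "smooth_map A B f" "p \<in> points A"
  shows "f p \<in> points B"
  using assms unfolding smooth_map_def continuous_map_def
  by (auto simp: topspace_smooth_atlas[OF assms(1)] topspace_smooth_atlas[OF assms(2)])

lemma smooth_map_representation:
  assumes A: "smooth_atlas A" and B: "smooth_atlas B" and f: "smooth_map A B f"
    and c: "c \<in> A" "p \<in> fst c" and d: "d \<in> B" "f p \<in> fst d"
  obtains V where "open V" "snd c p \<in> V" "V \<subseteq> snd c ` fst c" "\<And>x. x \<in> V \<Longrightarrow> f (chart_inv c x) \<in> fst d"
    "smooth_on V (\<lambda>x. snd d (f (chart_inv c x)))"
proof (rule that[OF smooth_mapD(1)[OF A B f c(1) d(1)] _ _ _ smooth_mapD(2)[OF A B f c(1) d(1)]])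
  show "f (chart_inv c x) \<in> fst d" if "x \<in> snd c ` {p \<in> fst c. f p \<in> fst d}" for x
    using that by (auto simp: chart_inv_chart[OF A c(1)])
qed (use c d in auto)

text \<open>Equality is asked on the points only, since group identities hold on the carrier
  only.\<close>

lemma smooth_map_cong:
  assumes A: "smooth_atlas A" and B: "smooth_atlas B" and f: "smooth_map A B f"
    and eq: "\<And>p. p \<in> points A \<Longrightarrow> f p = g p"
  shows "smooth_map A B g"
proof (rule smooth_mapI[OF A B])
  fix p assume p: "p \<in> points A"
  then obtain c where c: "c \<in> A" "p \<in> fst c" by (auto simp: points_def)
  obtain d where d: "d \<in> B" "f p \<in> fst d" using smooth_map_into[OF A B f p] by (auto simp: points_def)
  obtain V where V: "open V" "snd c p \<in> V" "V \<subseteq> snd c ` fst c" "\<And>x. x \<in> V \<Longrightarrow> f (chart_inv c x) \<in> fst d"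
    "smooth_on V (\<lambda>x. snd d (f (chart_inv c x)))"
    by (rule smooth_map_representation[OF A B f c d]) blast
  have e: "f (chart_inv c x) = g (chart_inv c x)" if "x \<in> V" for x
    using chart_inv_in(1)[of x c] V(3) that c(1) by (intro eq) (auto simp: points_def)
  have "smooth_on V (\<lambda>x. snd d (g (chart_inv c x)))"
    using V(5) smooth_on_cong[OF V(1), of "\<lambda>x. snd d (f (chart_inv c x))" "\<lambda>x. snd d (g (chart_inv c x))"] e by auto
  then show "\<exists>c d V. c \<in> A \<and> d \<in> B \<and> p \<in> fst c \<and> open V \<and> snd c p \<in> V \<and> V \<subseteq> snd c ` fst c \<and>
       (\<forall>x\<in>V. g (chart_inv c x) \<in> fst d) \<and> smooth_on V (\<lambda>x. snd d (g (chart_inv c x)))"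
    using c d V e by metis
qed

lemma smooth_map_id:
  assumes A: "smooth_atlas A" shows "smooth_map A A id"
proof (rule smooth_mapI[OF A A])
  fix p assume "p \<in> points A"
  then obtain c where c: "c \<in> A" "p \<in> fst c" by (auto simp: points_def)
  have "smooth_on (snd c ` fst c) (\<lambda>x. snd c (id (chart_inv c x)))"
    using smooth_atlas_transition[OF A c(1) c(1)] by simp
  then show "\<exists>c d V. c \<in> A \<and> d \<in> A \<and> p \<in> fst c \<and> open V \<and> snd c p \<in> V \<and> V \<subseteq> snd c ` fst c \<and>
       (\<forall>x\<in>V. id (chart_inv c x) \<in> fst d) \<and> smooth_on V (\<lambda>x. snd d (id (chart_inv c x)))"
    using c smooth_atlas_open[OF A c(1)]
    by (intro exI[of _ c] exI[of _ "snd c ` fst c"]) (auto intro: chart_inv_in(1))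
qed

lemma smooth_map_compose:
  assumes A: "smooth_atlas A" and B: "smooth_atlas B" and C: "smooth_atlas C"
    and f: "smooth_map A B f" and g: "smooth_map B C g"
  shows "smooth_map A C (\<lambda>x. g (f x))"
proof (rule smooth_mapI[OF A C])
  fix p assume p: "p \<in> points A"
  then obtain c where c: "c \<in> A" "p \<in> fst c" by (auto simp: points_def)
  obtain d where d: "d \<in> B" "f p \<in> fst d" using smooth_map_into[OF A B f p] by (auto simp: points_def)
  then have "f p \<in> points B" by (auto simp: points_def)
  then obtain e where e: "e \<in> C" "g (f p) \<in> fst e" using smooth_map_into[OF B C g, of "f p"] by (auto simp: points_def)
  obtain V where V: "open V" "snd c p \<in> V" "V \<subseteq> snd c ` fst c" "\<And>x. x \<in> V \<Longrightarrow> f (chart_inv c x) \<in> fst d"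
    "smooth_on V (\<lambda>x. snd d (f (chart_inv c x)))"
    by (rule smooth_map_representation[OF A B f c d]) blast
  obtain W where W: "open W" "snd d (f p) \<in> W" "W \<subseteq> snd d ` fst d" "\<And>x. x \<in> W \<Longrightarrow> g (chart_inv d x) \<in> fst e"
    "smooth_on W (\<lambda>x. snd e (g (chart_inv d x)))"
    by (rule smooth_map_representation[OF B C g d e]) blast
  define V' where "V' = {x \<in> V. snd d (f (chart_inv c x)) \<in> W}"
  have V': "open V'" unfolding V'_def by (rule open_vimage_chart[OF V(1,5) W(1)])
  have inv: "chart_inv d (snd d (f (chart_inv c x))) = f (chart_inv c x)" if "x \<in> V" for x
    by (rule chart_inv_chart[OF B d(1) V(4)[OF that]])
  have into: "g (f (chart_inv c x)) \<in> fst e" if "x \<in> V'" for x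
    using that W(4)[of "snd d (f (chart_inv c x))"] inv[of x] by (simp add: V'_def)
  have "smooth_on V' (\<lambda>x. snd e (g (chart_inv d (snd d (f (chart_inv c x))))))"
    by (rule smooth_on_compose[OF V' smooth_on_subset[OF V(5)] W(5,1)]) (auto simp: V'_def)
  then have "smooth_on V' (\<lambda>x. snd e (g (f (chart_inv c x))))"
    using smooth_on_cong[OF V', of "\<lambda>x. snd e (g (chart_inv d (snd d (f (chart_inv c x)))))" "\<lambda>x. snd e (g (f (chart_inv c x)))"] inv
    by (auto simp: V'_def)
  moreover have "snd c p \<in> V'" using V(2) W(2) by (simp add: V'_def chart_inv_chart[OF A c])
  moreover have "V' \<subseteq> snd c ` fst c" using V(3) by (auto simp: V'_def)
  ultimately show "\<exists>c e V. c \<in> A \<and> e \<in> C \<and> p \<in> fst c \<and> open V \<and> snd c p \<in> V \<and> V \<subseteq> snd c ` fst c \<and>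
       (\<forall>x\<in>V. g (f (chart_inv c x)) \<in> fst e) \<and> smooth_on V (\<lambda>x. snd e (g (f (chart_inv c x))))"
    using c e V' into by blast
qed

section \<open>Euclidean and product atlases\<close>

lemma smooth_atlas_euclidean: "open S \<Longrightarrow> smooth_atlas (euclidean_atlas S)"
  and points_euclidean: "points (euclidean_atlas S) = S"
  and chart_inv_euclidean: "x \<in> S \<Longrightarrow> chart_inv (S, \<lambda>x. x) x = x"
proof -
  show inv: "chart_inv (S, \<lambda>x. x) x = x" if "x \<in> S" for x :: 'a and S
    using that chart_inv_in(2)[of x "(S, \<lambda>x. x)"] by simp
  show "points (euclidean_atlas S) = S" by (simp add: points_def euclidean_atlas_def)
  assume S: "open S"
  have "smooth_on S (chart_inv (S, \<lambda>x. x))"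
    using smooth_on_cong[OF S, of "chart_inv (S, \<lambda>x. x)" "\<lambda>x. x"] inv smooth_on_id by blast
  then show "smooth_atlas (euclidean_atlas S)"
    using S by (simp add: smooth_atlas_def euclidean_atlas_def o_def)
qed

definition prod_chart :: "('a, 'e) chart \<Rightarrow> ('b, 'f) chart \<Rightarrow> ('a \<times> 'b, 'e \<times> 'f) chart" where
  "prod_chart c d = (fst c \<times> fst d, \<lambda>(p, q). (snd c p, snd d q))"

lemma prod_atlas_eq: "prod_atlas A B = {prod_chart c d | c d. c \<in> A \<and> d \<in> B}"
  by (simp add: prod_atlas_def prod_chart_def)

lemma prod_chart_simps: "fst (prod_chart c d) = fst c \<times> fst d" "snd (prod_chart c d) (p, q) = (snd c p, snd d q)"
  by (simp_all add: prod_chart_def)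

lemma points_prod_atlas: "points (prod_atlas A B) = points A \<times> points B"
proof -
  have "z \<in> points (prod_atlas A B) \<longleftrightarrow> (\<exists>c\<in>A. \<exists>d\<in>B. z \<in> fst c \<times> fst d)" for z
  proof -
    have "z \<in> points (prod_atlas A B) \<longleftrightarrow> (\<exists>c\<in>A. \<exists>d\<in>B. z \<in> fst (prod_chart c d))"
      unfolding points_def prod_atlas_eq by blast
    then show ?thesis by (simp only: prod_chart_simps)
  qed
  moreover have "(\<exists>c\<in>A. \<exists>d\<in>B. z \<in> fst c \<times> fst d) \<longleftrightarrow> z \<in> points A \<times> points B" for z
    unfolding points_def mem_Times_iff UN_iff by blast
  ultimately show ?thesis by (simp only: set_eq_iff) simp
qed

lemma prod_chart_image: "snd (prod_chart c d) ` (P \<times> Q) = snd c ` P \<times> snd d ` Q"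
  by (force simp: prod_chart_def)

lemma chart_inv_prod:
  assumes "inj_on (snd c) (fst c)" "inj_on (snd d) (fst d)" "x \<in> snd c ` fst c" "y \<in> snd d ` fst d"
  shows "chart_inv (prod_chart c d) (x, y) = (chart_inv c x, chart_inv d y)"
proof -
  have "inj_on (snd (prod_chart c d)) (fst (prod_chart c d))"
    using assms(1,2) by (auto simp: inj_on_def prod_chart_def)
  moreover have "(chart_inv c x, chart_inv d y) \<in> fst (prod_chart c d)"
    using chart_inv_in(1)[OF assms(3)] chart_inv_in(1)[OF assms(4)] by (simp add: prod_chart_def)
  moreover have "snd (prod_chart c d) (chart_inv c x, chart_inv d y) = (x, y)"
    using chart_inv_in(2)[OF assms(3)] chart_inv_in(2)[OF assms(4)] by (simp add: prod_chart_def)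
  ultimately show ?thesis unfolding chart_inv_def[of "prod_chart c d"] by (metis inv_into_f_f)
qed

lemma smooth_atlas_prod:
  assumes A: "smooth_atlas A" and B: "smooth_atlas B"
  shows "smooth_atlas (prod_atlas A B)"
proof -
  have 1: "inj_on (snd (prod_chart c d)) (fst (prod_chart c d))" if "c \<in> A" "d \<in> B" for c d
    using smooth_atlas_inj[OF A that(1)] smooth_atlas_inj[OF B that(2)] by (auto simp: inj_on_def prod_chart_def)
  have 2: "open (snd (prod_chart c d) ` (fst (prod_chart c d) \<inter> fst (prod_chart c' d')))"
    "smooth_on (snd (prod_chart c d) ` (fst (prod_chart c d) \<inter> fst (prod_chart c' d'))) (snd (prod_chart c' d') \<circ> chart_inv (prod_chart c d))"
    if "c \<in> A" "d \<in> B" "c' \<in> A" "d' \<in> B" for c d c' d'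
  proof -
    let ?V = "snd c ` (fst c \<inter> fst c')" and ?W = "snd d ` (fst d \<inter> fst d')"
    have o1: "open ?V" "open ?W"
      by (rule smooth_atlas_open_overlap[OF A that(1,3)], rule smooth_atlas_open_overlap[OF B that(2,4)])
    have eq: "snd (prod_chart c d) ` (fst (prod_chart c d) \<inter> fst (prod_chart c' d')) = ?V \<times> ?W"
      by (simp add: prod_chart_simps Times_Int_Times prod_chart_image)
    show "open (snd (prod_chart c d) ` (fst (prod_chart c d) \<inter> fst (prod_chart c' d')))"
      unfolding eq using o1 by (rule open_Times)
    have oVW: "open (?V \<times> ?W)" using o1 by (rule open_Times)
    have "smooth_on (?V \<times> ?W) (\<lambda>z. (snd c' (chart_inv c (fst z)), snd d' (chart_inv d (snd z))))"
      by (intro smooth_on_Pair oVW smooth_on_compose[OF oVW smooth_on_fst smooth_atlas_transition[OF A that(1,3)] o1(1)]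
          smooth_on_compose[OF oVW smooth_on_snd smooth_atlas_transition[OF B that(2,4)] o1(2)]) auto
    then show "smooth_on (snd (prod_chart c d) ` (fst (prod_chart c d) \<inter> fst (prod_chart c' d'))) (snd (prod_chart c' d') \<circ> chart_inv (prod_chart c d))"
      unfolding eq
    proof (rule smooth_on_congI[OF _ oVW])
      fix z assume zVW: "z \<in> ?V \<times> ?W"
      obtain x y where z: "z = (x, y)" by (cases z)
      have "x \<in> snd c ` fst c" "y \<in> snd d ` fst d" using zVW z by auto
      then show "(snd (prod_chart c' d') \<circ> chart_inv (prod_chart c d)) z = (snd c' (chart_inv c (fst z)), snd d' (chart_inv d (snd z)))"
        using chart_inv_prod[OF smooth_atlas_inj[OF A \<open>c \<in> A\<close>] smooth_atlas_inj[OF B \<open>d \<in> B\<close>]]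
        by (simp add: z prod_chart_simps)
    qed
  qed
  show ?thesis
    unfolding smooth_atlas_def
  proof (intro conjI ballI)
    fix C D assume "C \<in> prod_atlas A B" "D \<in> prod_atlas A B"
    then obtain c d c' d' where "C = prod_chart c d" "c \<in> A" "d \<in> B" "D = prod_chart c' d'" "c' \<in> A" "d' \<in> B"
      unfolding prod_atlas_eq by auto
    then show "open (snd C ` (fst C \<inter> fst D))" "smooth_on (snd C ` (fst C \<inter> fst D)) (snd D \<circ> chart_inv C)"
      using 2[of c d c' d'] by simp_all
  next
    fix C assume "C \<in> prod_atlas A B"
    then obtain c d where "C = prod_chart c d" "c \<in> A" "d \<in> B" unfolding prod_atlas_eq by auto
    then show "inj_on (snd C) (fst C)" using 1 by simp
  qed
qed

text \<open>The matrix of the differential of \<open>f\<close> at \<open>p\<close> with respect to the charts \<open>c\<close> and \<open>d\<close>.\<close>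

definition jac :: "('a \<Rightarrow> 'b) \<Rightarrow> ('a, 'e::euclidean_space) chart \<Rightarrow> ('b, 'f::euclidean_space) chart \<Rightarrow> 'a \<Rightarrow> 'e \<Rightarrow> 'f" where
  "jac f c d p = frechet_derivative (snd d \<circ> f \<circ> chart_inv c) (at (snd c p))"

lemma smooth_map_has_jac:
  assumes A: "smooth_atlas A" and B: "smooth_atlas B" and f: "smooth_map A B f"
    and c: "c \<in> A" "p \<in> fst c" and d: "d \<in> B" "f p \<in> fst d"
  shows "((\<lambda>x. snd d (f (chart_inv c x))) has_derivative jac f c d p) (at (snd c p))"
proof -
  obtain V where V: "open V" "snd c p \<in> V" "V \<subseteq> snd c ` fst c" "\<And>x. x \<in> V \<Longrightarrow> f (chart_inv c x) \<in> fst d"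
    "smooth_on V (\<lambda>x. snd d (f (chart_inv c x)))"
    by (rule smooth_map_representation[OF A B f c d]) blast
  show ?thesis using smooth_on_has_derivative[OF V(5,2)] by (simp add: jac_def o_def)
qed

lemma jac_linear:
  assumes A: "smooth_atlas A" and B: "smooth_atlas B" and f: "smooth_map A B f"
    and c: "c \<in> A" "p \<in> fst c" and d: "d \<in> B" "f p \<in> fst d"
  shows "bounded_linear (jac f c d p)"
  by (rule has_derivative_bounded_linear[OF smooth_map_has_jac[OF assms]])

lemma jac_cong:
  assumes A: "smooth_atlas A" and c: "c \<in> A" "p \<in> fst c" and eq: "\<And>q. q \<in> points A \<Longrightarrow> f q = g q"
  shows "jac f c d p = jac g c d p"
  unfolding jac_def
proof (rule frechet_derivative_cong_open[OF smooth_atlas_open[OF A c(1)]])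
  show "(snd d \<circ> f \<circ> chart_inv c) x = (snd d \<circ> g \<circ> chart_inv c) x" if "x \<in> snd c ` fst c" for x
    using chart_inv_in(1)[OF that] c(1) by (auto simp: points_def intro!: arg_cong[where f="snd d"] eq)
qed (use c in auto)

lemma jac_chain:
  assumes A: "smooth_atlas A" and B: "smooth_atlas B" and C: "smooth_atlas C"
    and f: "smooth_map A B f" and g: "smooth_map B C g"
    and c: "c \<in> A" "p \<in> fst c" and d: "d \<in> B" "f p \<in> fst d" and e: "e \<in> C" "g (f p) \<in> fst e"
  shows "jac (\<lambda>x. g (f x)) c e p v = jac g d e (f p) (jac f c d p v)"
proof -
  obtain V where V: "open V" "snd c p \<in> V" "V \<subseteq> snd c ` fst c" "\<And>x. x \<in> V \<Longrightarrow> f (chart_inv c x) \<in> fst d"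
    "smooth_on V (\<lambda>x. snd d (f (chart_inv c x)))"
    by (rule smooth_map_representation[OF A B f c d]) blast
  have "snd d (f (chart_inv c (snd c p))) = snd d (f p)" by (simp add: chart_inv_chart[OF A c])
  with smooth_map_has_jac[OF B C g d e]
  have "((\<lambda>y. snd e (g (chart_inv d y))) has_derivative jac g d e (f p)) (at (snd d (f (chart_inv c (snd c p)))))" by simp
  from has_derivative_compose[OF smooth_map_has_jac[OF A B f c d] this]
  have "((\<lambda>x. snd e (g (chart_inv d (snd d (f (chart_inv c x)))))) has_derivative (\<lambda>v. jac g d e (f p) (jac f c d p v))) (at (snd c p))" .
  then have "((\<lambda>x. snd e (g (f (chart_inv c x)))) has_derivative (\<lambda>v. jac g d e (f p) (jac f c d p v))) (at (snd c p))"
    by (rule has_derivative_transform_within_open[OF _ V(1,2)]) (simp add: chart_inv_chart[OF B d(1) V(4)])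
  from has_derivative_frechet_eq[OF this] show ?thesis by (simp add: jac_def o_def)
qed

lemma jac_id:
  assumes A: "smooth_atlas A" and c: "c \<in> A" "p \<in> fst c"
  shows "jac id c c p v = v"
proof -
  have "((\<lambda>x. snd c (id (chart_inv c x))) has_derivative (\<lambda>v. v)) (at (snd c p))"
    by (rule has_derivative_transform_within_open[OF has_derivative_ident smooth_atlas_open[OF A c(1)]])
      (use c in \<open>auto simp: chart_inv_in\<close>)
  from has_derivative_frechet_eq[OF this] show ?thesis by (simp add: jac_def o_def)
qed

section \<open>Tangent vectors\<close>

text \<open>Inverse of the evaluation at c: the transition rule forces the components in all other
  charts around p, and the encoding of tangent vectors asks for 0 elsewhere.\<close>

definition tvec :: "('a, 'e::euclidean_space) atlas \<Rightarrow> 'a \<Rightarrow> ('a, 'e) chart \<Rightarrow> 'e \<Rightarrow> ('a, 'e) tvec" where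
  "tvec A p c y = (\<lambda>d. if d \<in> A \<and> p \<in> fst d then jac id c d p y else 0)"

lemma tangent_space_iff:
  "v \<in> tangent_space A p \<longleftrightarrow>
     (\<forall>c\<in>A. \<forall>d\<in>A. p \<in> fst c \<and> p \<in> fst d \<longrightarrow> v d = jac id c d p (v c)) \<and> (\<forall>c. c \<notin> A \<or> p \<notin> fst c \<longrightarrow> v c = 0)"
  by (simp add: tangent_space_def jac_def)

lemma tangent_space_change:
  "v \<in> tangent_space A p \<Longrightarrow> c \<in> A \<Longrightarrow> p \<in> fst c \<Longrightarrow> d \<in> A \<Longrightarrow> p \<in> fst d \<Longrightarrow> v d = jac id c d p (v c)"
  unfolding tangent_space_iff by blast

lemma tangent_space_outside: "v \<in> tangent_space A p \<Longrightarrow> c \<notin> A \<or> p \<notin> fst c \<Longrightarrow> v c = 0"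
  unfolding tangent_space_iff by blast

lemma tvec_in_tangent_space:
  assumes A: "smooth_atlas A" and c: "c \<in> A" "p \<in> fst c"
  shows "tvec A p c y \<in> tangent_space A p"
  unfolding tangent_space_iff
proof (intro conjI ballI impI)
  fix d e assume d: "d \<in> A" and e: "e \<in> A" and "p \<in> fst d \<and> p \<in> fst e"
  then have p: "p \<in> fst d" "p \<in> fst e" by auto
  have "jac (\<lambda>x. id (id x)) c e p y = jac id d e (id p) (jac id c d p y)"
    using c d e p by (intro jac_chain[OF A A A smooth_map_id[OF A] smooth_map_id[OF A]]) auto
  then show "tvec A p c y e = jac id d e p (tvec A p c y d)"
    using d e p by (simp add: tvec_def id_def)
qed (simp add: tvec_def)

lemma tvec_chart: "smooth_atlas A \<Longrightarrow> c \<in> A \<Longrightarrow> p \<in> fst c \<Longrightarrow> tvec A p c y c = y"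
  by (simp add: tvec_def jac_id)

lemma tangent_space_eq_tvec:
  assumes "v \<in> tangent_space A p" "c \<in> A" "p \<in> fst c" shows "v = tvec A p c (v c)"
proof
  fix d show "v d = tvec A p c (v c) d"
  proof (cases "d \<in> A \<and> p \<in> fst d")
    case True
    then have "v d = jac id c d p (v c)" using tangent_space_change[OF assms] by blast
    then show ?thesis unfolding tvec_def if_P[OF True] .
  next
    case False
    then have "v d = 0" using tangent_space_outside[OF assms(1)] by blast
    then show ?thesis unfolding tvec_def if_not_P[OF False] .
  qed
qed

lemma tangent_space_eqI:
  assumes "v \<in> tangent_space A p" "v' \<in> tangent_space A p" "c \<in> A" "p \<in> fst c" "v c = v' c" shows "v = v'"
  using tangent_space_eq_tvec[OF assms(1,3,4)] tangent_space_eq_tvec[OF assms(2,3,4)] assms(5) by simp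

lemma tvec_linear:
  assumes A: "smooth_atlas A" and c: "c \<in> A" "p \<in> fst c" 
  shows "bounded_linear (\<lambda>y. tvec A p c y d)"
proof (cases "d \<in> A \<and> p \<in> fst d")
  case True
  then show ?thesis using jac_linear[OF A A smooth_map_id[OF A] c, of d] by (simp add: tvec_def)
next
  case False
  then show ?thesis by (auto simp: tvec_def intro: bounded_linear_zero)
qed

text \<open>A tangent vector is determined by a single component, so it vanishes as soon as that one
  does.\<close>

lemma slit_tangent_space_iff:
  assumes A: "smooth_atlas A" and c: "c \<in> A" "p \<in> fst c"
  shows "v \<in> slit_tangent_space A p \<longleftrightarrow> v \<in> tangent_space A p \<and> v c \<noteq> 0"
proof -
  have "(\<lambda>_. 0) = tvec A p c 0" 
    using linear_0[OF bounded_linear.linear[OF tvec_linear[OF A c]]] by (simp add: fun_eq_iff)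
  then have z: "(\<lambda>_. 0) \<in> tangent_space A p" using tvec_in_tangent_space[OF A c] by metis
  show ?thesis
    unfolding slit_tangent_space_def using tangent_space_eqI[OF _ z c] by auto
qed

text \<open>\<open>differential\<close> uses a chosen chart; the chain rule through the transition
  to c shows that the choice does not matter.\<close>

lemma differential_chart:
  assumes A: "smooth_atlas A" and B: "smooth_atlas B" and f: "smooth_map A B f"
    and v: "v \<in> tangent_space A p" and c: "c \<in> A" "p \<in> fst c" and d: "d \<in> B" "f p \<in> fst d"
  shows "differential A B f p v d = jac f c d p (v c)"
proof -
  define c1 where "c1 = (SOME c. c \<in> A \<and> p \<in> fst c)"
  have c1: "c1 \<in> A" "p \<in> fst c1" unfolding c1_def using someI[of "\<lambda>c. c \<in> A \<and> p \<in> fst c" c] c by auto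
  have "differential A B f p v d = jac f c1 d p (v c1)"
    using d by (simp add: differential_def c1_def Let_def jac_def)
  also have "\<dots> = jac f c1 d (id p) (jac id c c1 p (v c))"
    by (subst tangent_space_change[OF v c c1]) simp
  also have "\<dots> = jac (\<lambda>x. f (id x)) c d p (v c)"
    using c c1 d by (intro jac_chain[OF A A B smooth_map_id[OF A] f, symmetric]) auto
  finally show ?thesis by simp
qed

lemma differential_eq_tvec:
  assumes A: "smooth_atlas A" and B: "smooth_atlas B" and f: "smooth_map A B f"
    and v: "v \<in> tangent_space A p" and c: "c \<in> A" "p \<in> fst c" and d: "d \<in> B" "f p \<in> fst d"
  shows "differential A B f p v = tvec B (f p) d (jac f c d p (v c))"
proof
  fix e show "differential A B f p v e = tvec B (f p) d (jac f c d p (v c)) e"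
  proof (cases "e \<in> B \<and> f p \<in> fst e")
    case True
    have "jac (\<lambda>x. id (f x)) c e p (v c) = jac id d e (f p) (jac f c d p (v c))"
      using c d True by (intro jac_chain[OF A B B f smooth_map_id[OF B]]) auto
    then show ?thesis using True differential_chart[OF A B f v c, of e] by (simp add: tvec_def)
  next
    case False
    then show ?thesis by (auto simp: differential_def tvec_def)
  qed
qed

lemma differential_in_tangent_space:
  assumes A: "smooth_atlas A" and B: "smooth_atlas B" and f: "smooth_map A B f"
    and v: "v \<in> tangent_space A p" and p: "p \<in> points A"
  shows "differential A B f p v \<in> tangent_space B (f p)"
proof -
  obtain c where c: "c \<in> A" "p \<in> fst c" using p by (auto simp: points_def)
  obtain d where d: "d \<in> B" "f p \<in> fst d" using smooth_map_into[OF A B f p] by (auto simp: points_def)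
  show ?thesis unfolding differential_eq_tvec[OF A B f v c d] by (rule tvec_in_tangent_space[OF B d])
qed

lemma differential_compose:
  assumes A: "smooth_atlas A" and B: "smooth_atlas B" and C: "smooth_atlas C"
    and f: "smooth_map A B f" and g: "smooth_map B C g"
    and v: "v \<in> tangent_space A p" and p: "p \<in> points A"
  shows "differential B C g (f p) (differential A B f p v) = differential A C (\<lambda>x. g (f x)) p v"
proof -
  obtain c where c: "c \<in> A" "p \<in> fst c" using p by (auto simp: points_def)
  have fp: "f p \<in> points B" by (rule smooth_map_into[OF A B f p])
  then obtain d where d: "d \<in> B" "f p \<in> fst d" by (auto simp: points_def)
  obtain e where e: "e \<in> C" "g (f p) \<in> fst e" using smooth_map_into[OF B C g fp] by (auto simp: points_def)
  note fv = differential_in_tangent_space[OF A B f v p]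
  have "differential B C g (f p) (differential A B f p v) = tvec C (g (f p)) e (jac g d e (f p) (differential A B f p v d))"
    by (rule differential_eq_tvec[OF B C g fv d e])
  also have "\<dots> = tvec C (g (f p)) e (jac (\<lambda>x. g (f x)) c e p (v c))"
    by (simp add: differential_chart[OF A B f v c d] jac_chain[OF A B C f g c d e])
  also have "\<dots> = differential A C (\<lambda>x. g (f x)) p v"
    by (rule differential_eq_tvec[OF A C smooth_map_compose[OF A B C f g] v c e, symmetric])
  finally show ?thesis .
qed

lemma differential_ident:
  assumes A: "smooth_atlas A" and f: "\<And>q. q \<in> points A \<Longrightarrow> f q = q"
    and v: "v \<in> tangent_space A p" and p: "p \<in> points A"
  shows "differential A A f p v = v"
proof -
  obtain c where c: "c \<in> A" "p \<in> fst c" using p by (auto simp: points_def)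
  have sf: "smooth_map A A f" by (rule smooth_map_cong[OF A A smooth_map_id[OF A]]) (simp add: f)
  have "differential A A f p v = tvec A (f p) c (jac f c c p (v c))"
    using c f[OF p] by (intro differential_eq_tvec[OF A A sf v c]) auto
  also have "jac f c c p (v c) = v c"
    using jac_cong[OF A c, of f id c] f jac_id[OF A c] by simp
  finally show ?thesis using tangent_space_eq_tvec[OF v c] f[OF p] by simp
qed

lemma jac_representation:
  assumes "x \<in> snd c ` fst c"
  shows "jac f c d (chart_inv c x) = frechet_derivative (\<lambda>x. snd d (f (chart_inv c x))) (at x)"
  using chart_inv_in(2)[OF assms] by (simp add: jac_def o_def)

lemma smooth_on_tangent_map:
  fixes \<phi> :: "'e::euclidean_space \<Rightarrow> 'f::euclidean_space"
  assumes "open V" "smooth_on V \<phi>"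
  shows "smooth_on (V \<times> UNIV) (\<lambda>z. (\<phi> (fst z), frechet_derivative \<phi> (at (fst z)) (snd z)))"
proof -
  have o: "open (V \<times> (UNIV :: 'e set))" using assms(1) by (intro open_Times) auto
  show ?thesis
    by (intro smooth_on_Pair o smooth_on_compose[OF o smooth_on_fst assms(2,1)]
        smooth_on_frechet[OF o assms(1,2) smooth_on_fst smooth_on_snd]) auto
qed

text \<open>The lower left block, the second derivative of \<phi> contracted with y, is the term
  through which second derivatives of left translations enter the invariance of the spray.\<close>

lemma tangent_map_derivative:
  fixes \<phi> :: "'e::euclidean_space \<Rightarrow> 'f::euclidean_space"
  assumes "open V" "smooth_on V \<phi>" "x \<in> V"
  shows "((\<lambda>z. (\<phi> (fst z), frechet_derivative \<phi> (at (fst z)) (snd z))) has_derivative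
     (\<lambda>w. (frechet_derivative \<phi> (at x) (fst w),
        frechet_derivative (\<lambda>x. frechet_derivative \<phi> (at x) y) (at x) (fst w) + frechet_derivative \<phi> (at x) (snd w)))) (at (x, y))"
proof -
  let ?F = "\<lambda>z::'e \<times> 'e. frechet_derivative \<phi> (at (fst z)) (snd z)"
  have "smooth_on (V \<times> UNIV) (\<lambda>z. snd (\<phi> (fst z), ?F z))"
    by (rule smooth_on_linear_compose[OF bounded_linear_snd _ smooth_on_tangent_map[OF assms(1,2)]])
      (use assms(1) in \<open>auto intro: open_Times\<close>)
  then have dF: "?F differentiable (at (x, y))"
    using smooth_on_differentiable[of "V \<times> UNIV" ?F "(x, y)"] assms(3) by simp
  let ?D = "frechet_derivative ?F (at (x, y))"
  have lin: "linear ?D" using frechet_derivative_has[OF dF] has_derivative_bounded_linear bounded_linear.linear by blast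
  \<comment> \<open>The derivative is split along the two factors so that it can be read off the
    partial derivatives.\<close>
  have s1: "?D (a, b) = ?D (a, 0) + ?D (0, b)" for a b
    using linear_add[OF lin, of "(a, 0)" "(0, b)"] by simp
  have s2: "?D (a, 0) = frechet_derivative (\<lambda>x. frechet_derivative \<phi> (at x) y) (at x) a" for a
    using has_derivative_frechet_eq[OF partial_derivative_fst[OF dF]] by (simp add: fun_eq_iff)
  have s3: "?D (0, b) = frechet_derivative \<phi> (at x) b" for b
  proof -
    have "((\<lambda>z. ?F (x, z)) has_derivative frechet_derivative \<phi> (at x)) (at y)"
      using bounded_linear_imp_has_derivative[OF smooth_on_bounded_linear[OF assms(2,3)]] by simp
    then show ?thesis
      using has_derivative_unique[OF partial_derivative_snd[OF dF]] by (simp add: fun_eq_iff)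
  qed
  have Deq: "?D = (\<lambda>w. frechet_derivative (\<lambda>x. frechet_derivative \<phi> (at x) y) (at x) (fst w) + frechet_derivative \<phi> (at x) (snd w))"
  proof
    fix w :: "'e \<times> 'e"
    have "?D (fst w, snd w) = frechet_derivative (\<lambda>x. frechet_derivative \<phi> (at x) y) (at x) (fst w) + frechet_derivative \<phi> (at x) (snd w)"
      by (rule trans[OF s1 arg_cong2[where f="(+)", OF s2 s3]])
    then show "?D w = frechet_derivative (\<lambda>x. frechet_derivative \<phi> (at x) y) (at x) (fst w) + frechet_derivative \<phi> (at x) (snd w)"
      by (simp only: prod.collapse)
  qed
  have "((\<lambda>z. \<phi> (fst z)) has_derivative (\<lambda>w. frechet_derivative \<phi> (at x) (fst w))) (at (x, y))"
    by (rule has_derivative_compose[where f=fst and g=\<phi>, OF bounded_linear_imp_has_derivative[OF bounded_linear_fst]])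
      (use smooth_on_has_derivative[OF assms(2,3)] in simp)
  from has_derivative_Pair[OF this frechet_derivative_has[OF dF]] show ?thesis unfolding Deq .
qed

section \<open>The slit tangent bundle and the tangent spaces as manifolds\<close>

lemma slit_chart_simps:
  "(p, v) \<in> fst (slit_chart A c) \<longleftrightarrow> p \<in> fst c \<and> v \<in> slit_tangent_space A p"
  "snd (slit_chart A c) (p, v) = (snd c p, v c)"
  by (simp_all add: slit_chart_def)

lemma slit_chart_in: "c \<in> A \<Longrightarrow> slit_chart A c \<in> slit_bundle A"
  by (simp add: slit_bundle_def)

lemma inj_slit_chart: "inj_on (slit_chart A) A"
proof (rule inj_onI)
  fix c d :: "('a, 'b) chart" assume "slit_chart A c = slit_chart A d"
  then have *: "snd (slit_chart A c) (p, v) = snd (slit_chart A d) (p, v)" for p v by simp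
  \<comment> \<open>Coordinate maps are total functions, so they may be evaluated at families that
    are not tangent vectors; below, a family supported at c separates c from d.\<close>
  have e: "v c = v d" for v :: "('a, 'b) tvec" using *[of undefined v] by (simp add: slit_chart_simps)
  show "c = d"
  proof (rule ccontr)
    assume "c \<noteq> d"
    obtain b :: 'b where "b \<in> Basis" using nonempty_Basis by blast
    then have "b \<noteq> 0" by auto
    then show False using e[of "\<lambda>c'. if c' = c then b else 0"] \<open>c \<noteq> d\<close> by simp
  qed
qed

lemma tvec_slit:
  assumes A: "smooth_atlas A" and c: "c \<in> A" "p \<in> fst c" and "y \<noteq> 0"
  shows "tvec A p c y \<in> slit_tangent_space A p"
  unfolding slit_tangent_space_iff[OF A c]
  using tvec_in_tangent_space[OF A c] assms(4) by (simp add: tvec_chart[OF A c])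

lemma slit_tangent_in: "v \<in> slit_tangent_space A p \<Longrightarrow> v \<in> tangent_space A p"
  by (simp add: slit_tangent_space_def)

lemma points_slit_bundle: "(p, v) \<in> points (slit_bundle A) \<longleftrightarrow> p \<in> points A \<and> v \<in> slit_tangent_space A p"
  by (auto simp: points_def slit_bundle_def slit_chart_def)

lemma slit_chart_overlap_image:
  assumes A: "smooth_atlas A" and c: "c \<in> A"
  shows "snd (slit_chart A c) ` (fst (slit_chart A c) \<inter> fst (slit_chart A d)) = snd c ` (fst c \<inter> fst d) \<times> - {0}"
proof (intro equalityI subsetI)
  fix z assume "z \<in> snd (slit_chart A c) ` (fst (slit_chart A c) \<inter> fst (slit_chart A d))"
  then obtain p v where "z = (snd c p, v c)" "p \<in> fst c" "p \<in> fst d" "v \<in> slit_tangent_space A p"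
    by (auto simp: slit_chart_def)
  then show "z \<in> snd c ` (fst c \<inter> fst d) \<times> - {0}"
    using slit_tangent_space_iff[OF A c] by auto
next
  fix z assume "z \<in> snd c ` (fst c \<inter> fst d) \<times> - {0 :: 'b}"
  then obtain p y where z: "z = (snd c p, y)" "p \<in> fst c" "p \<in> fst d" "y \<noteq> 0" by auto
  have "z = snd (slit_chart A c) (p, tvec A p c y)" by (simp add: z slit_chart_simps tvec_chart[OF A c])
  moreover have "(p, tvec A p c y) \<in> fst (slit_chart A c) \<inter> fst (slit_chart A d)"
    using z tvec_slit[OF A c z(2,4)] by (simp add: slit_chart_simps)
  ultimately show "z \<in> snd (slit_chart A c) ` (fst (slit_chart A c) \<inter> fst (slit_chart A d))" by (rule image_eqI)
qed

lemma slit_chart_image: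
  assumes "smooth_atlas A" "c \<in> A"
  shows "snd (slit_chart A c) ` fst (slit_chart A c) = snd c ` fst c \<times> - {0}"
  using slit_chart_overlap_image[OF assms, of c] by simp

lemma inj_on_slit_chart:
  assumes A: "smooth_atlas A" and c: "c \<in> A"
  shows "inj_on (snd (slit_chart A c)) (fst (slit_chart A c))"
proof (rule inj_onI, clarsimp simp: slit_chart_simps)
  fix p v q u assume *: "p \<in> fst c" "v \<in> slit_tangent_space A p" "q \<in> fst c" "u \<in> slit_tangent_space A q"
    "snd c p = snd c q" "v c = u c"
  then have "p = q" using inj_onD[OF smooth_atlas_inj[OF A c]] by simp
  then show "p = q \<and> v = u"
    using tangent_space_eqI[OF slit_tangent_in slit_tangent_in c] * by blast
qed

lemma chart_inv_slit:
  assumes A: "smooth_atlas A" and c: "c \<in> A" and x: "x \<in> snd c ` fst c" and "y \<noteq> 0"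
  shows "chart_inv (slit_chart A c) (x, y) = (chart_inv c x, tvec A (chart_inv c x) c y)"
proof -
  have p: "chart_inv c x \<in> fst c" "snd c (chart_inv c x) = x" using chart_inv_in[OF x] by auto
  have "chart_inv (slit_chart A c) (snd (slit_chart A c) (chart_inv c x, tvec A (chart_inv c x) c y)) = (chart_inv c x, tvec A (chart_inv c x) c y)"
    unfolding chart_inv_def[of "slit_chart A c"]
    by (rule inv_into_f_f[OF inj_on_slit_chart[OF A c]]) (simp add: slit_chart_simps p tvec_slit[OF A c p(1) assms(4)])
  then show ?thesis by (simp add: slit_chart_simps p tvec_chart[OF A c p(1)])
qed

lemma open_Times_slit: "open V \<Longrightarrow> open (V \<times> - {0 :: 'e::euclidean_space})"
  by (intro open_Times open_Compl closed_singleton)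

text \<open>A transition between slit charts is the tangent map of the transition below it,
  restricted to nonzero vectors.\<close>

lemma smooth_atlas_slit_bundle:
  assumes A: "smooth_atlas A" shows "smooth_atlas (slit_bundle A)"
  unfolding smooth_atlas_def
proof (intro conjI ballI)
  fix C assume "C \<in> slit_bundle A"
  then obtain c where "C = slit_chart A c" "c \<in> A" by (auto simp: slit_bundle_def)
  then show "inj_on (snd C) (fst C)" using inj_on_slit_chart[OF A] by simp
next
  fix C D assume "C \<in> slit_bundle A" "D \<in> slit_bundle A"
  then obtain c d where C: "C = slit_chart A c" "c \<in> A" and D: "D = slit_chart A d" "d \<in> A" by (auto simp: slit_bundle_def)
  let ?V = "snd c ` (fst c \<inter> fst d)"
  have V: "open ?V" by (rule smooth_atlas_open_overlap[OF A C(2) D(2)])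
  have oV: "open (?V \<times> - {0 :: 'b})" by (rule open_Times_slit[OF V])
  show "open (snd C ` (fst C \<inter> fst D))"
    unfolding C(1) D(1) slit_chart_overlap_image[OF A C(2)] by (rule oV)
  show "smooth_on (snd C ` (fst C \<inter> fst D)) (snd D \<circ> chart_inv C)"
    unfolding C(1) D(1) slit_chart_overlap_image[OF A C(2)]
  proof (rule smooth_on_congI[OF smooth_on_subset[OF smooth_on_tangent_map[OF V smooth_atlas_transition[OF A C(2) D(2)]]] oV])
    fix z assume "z \<in> ?V \<times> - {0 :: 'b}"
    then obtain x y where z: "z = (x, y)" "x \<in> ?V" "y \<noteq> 0" by auto
    have x: "x \<in> snd c ` fst c" using z by auto
    have "chart_inv c x \<in> fst d" using z(2) by (auto simp: chart_inv_chart[OF A C(2)])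
    then have "tvec A (chart_inv c x) c y d = jac id c d (chart_inv c x) y"
      using D(2) by (simp add: tvec_def)
    also have "\<dots> = frechet_derivative (\<lambda>x. snd d (chart_inv c x)) (at x) y"
      unfolding jac_representation[OF x] by simp
    finally show "(snd (slit_chart A d) \<circ> chart_inv (slit_chart A c)) z =
      (snd d (chart_inv c (fst z)), frechet_derivative (\<lambda>x. snd d (chart_inv c x)) (at (fst z)) (snd z))"
      using chart_inv_slit[OF A C(2) x z(3)] by (simp add: z slit_chart_simps)
  qed auto
qed

definition tangent_map :: "('a, 'e::euclidean_space) atlas \<Rightarrow> ('a \<Rightarrow> 'a) \<Rightarrow> 'a \<times> ('a, 'e) tvec \<Rightarrow> 'a \<times> ('a, 'e) tvec" where
  "tangent_map A f = (\<lambda>(p, v). (f p, differential A A f p v))"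

text \<open>The left inverse h makes the Jacobian of f injective.\<close>

lemma differential_slit:
  assumes A: "smooth_atlas A" and f: "smooth_map A A f" and h: "smooth_map A A h"
    and hf: "\<And>q. q \<in> points A \<Longrightarrow> h (f q) = q"
    and p: "p \<in> points A" and v: "v \<in> slit_tangent_space A p"
  shows "differential A A f p v \<in> slit_tangent_space A (f p)"
proof -
  have vT: "v \<in> tangent_space A p" by (rule slit_tangent_in[OF v])
  have d: "differential A A f p v \<in> tangent_space A (f p)"
    by (rule differential_in_tangent_space[OF A A f vT p])
  obtain c where c: "c \<in> A" "p \<in> fst c" using p by (auto simp: points_def)
  obtain d where d': "d \<in> A" "f p \<in> fst d" using smooth_map_into[OF A A f p] by (auto simp: points_def)
  have v0: "v c \<noteq> 0" using v slit_tangent_space_iff[OF A c] by simp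
  have "jac (\<lambda>q. h (f q)) c c p (v c) = jac h d c (f p) (jac f c d p (v c))"
    using c d' hf[OF p] by (intro jac_chain[OF A A A f h]) auto
  moreover have "jac (\<lambda>q. h (f q)) c c p (v c) = v c"
    using jac_cong[OF A c, of "\<lambda>q. h (f q)" id c] hf jac_id[OF A c] by simp
  moreover have "linear (jac h d c (f p))"
    using jac_linear[OF A A h d', of c] c hf[OF p] by (simp add: bounded_linear.linear)
  ultimately have "jac f c d p (v c) \<noteq> 0" using v0 linear_0 by metis
  then have "differential A A f p v d \<noteq> 0"
    by (simp add: differential_chart[OF A A f vT c d'])
  then show ?thesis using slit_tangent_space_iff[OF A d'] d by simp
qed

lemma tangent_map_representation:
  assumes A: "smooth_atlas A" and f: "smooth_map A A f"
    and c: "c \<in> A" and d: "d \<in> A" and x: "x \<in> snd c ` fst c" "f (chart_inv c x) \<in> fst d" and y: "y \<noteq> 0"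
  shows "snd (slit_chart A d) (tangent_map A f (chart_inv (slit_chart A c) (x, y))) =
     (snd d (f (chart_inv c x)), frechet_derivative (\<lambda>x. snd d (f (chart_inv c x))) (at x) y)"
proof -
  have p: "chart_inv c x \<in> fst c" using chart_inv_in[OF x(1)] by auto
  have "differential A A f (chart_inv c x) (tvec A (chart_inv c x) c y) d = jac f c d (chart_inv c x) y"
    using differential_chart[OF A A f tvec_in_tangent_space[OF A c p] c p d x(2)] by (simp add: tvec_chart[OF A c p])
  then show ?thesis
    by (simp add: chart_inv_slit[OF A c x(1) y] tangent_map_def slit_chart_simps jac_representation[OF x(1)])
qed

lemma smooth_map_tangent_map:
  assumes A: "smooth_atlas A" and f: "smooth_map A A f" and h: "smooth_map A A h"
    and hf: "\<And>q. q \<in> points A \<Longrightarrow> h (f q) = q"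
  shows "smooth_map (slit_bundle A) (slit_bundle A) (tangent_map A f)"
proof (rule smooth_mapI[OF smooth_atlas_slit_bundle[OF A] smooth_atlas_slit_bundle[OF A]])
  fix q assume q: "q \<in> points (slit_bundle A)"
  obtain p v where pv: "q = (p, v)" by (cases q)
  then have p: "p \<in> points A" and v: "v \<in> slit_tangent_space A p" using q by (simp_all add: points_slit_bundle)
  obtain c where c: "c \<in> A" "p \<in> fst c" using p by (auto simp: points_def)
  obtain d where d: "d \<in> A" "f p \<in> fst d" using smooth_map_into[OF A A f p] by (auto simp: points_def)
  obtain V where V: "open V" "snd c p \<in> V" "V \<subseteq> snd c ` fst c" "\<And>x. x \<in> V \<Longrightarrow> f (chart_inv c x) \<in> fst d"
    "smooth_on V (\<lambda>x. snd d (f (chart_inv c x)))"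
    by (rule smooth_map_representation[OF A A f c d]) blast
  have oV: "open (V \<times> - {0 :: 'b})" by (rule open_Times_slit[OF V(1)])
  have sm: "smooth_on (V \<times> - {0}) (\<lambda>z. snd (slit_chart A d) (tangent_map A f (chart_inv (slit_chart A c) z)))"
  proof (rule smooth_on_congI[OF smooth_on_subset[OF smooth_on_tangent_map[OF V(1,5)]] oV])
    fix z assume "z \<in> V \<times> - {0 :: 'b}"
    then obtain x y where z: "z = (x, y)" "x \<in> V" "y \<noteq> 0" by auto
    then show "snd (slit_chart A d) (tangent_map A f (chart_inv (slit_chart A c) z)) =
       (snd d (f (chart_inv c (fst z))), frechet_derivative (\<lambda>x. snd d (f (chart_inv c x))) (at (fst z)) (snd z))"
      using tangent_map_representation[OF A f c(1) d(1) subsetD[OF V(3) z(2)] V(4)[OF z(2)] z(3)] by simp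
  qed auto
  have into: "tangent_map A f (chart_inv (slit_chart A c) z) \<in> fst (slit_chart A d)" if z: "z \<in> V \<times> - {0}" for z
  proof -
    obtain x y where z: "z = (x, y)" "x \<in> V" "y \<noteq> 0" using z by auto
    note x = subsetD[OF V(3) z(2)]
    have ci: "chart_inv c x \<in> fst c" using chart_inv_in(1)[OF x] .
    have cp: "chart_inv c x \<in> points A" using c(1) ci by (auto simp: points_def)
    show ?thesis
      using differential_slit[OF A f h hf cp tvec_slit[OF A c(1) ci z(3)]] V(4)[OF z(2)]
      by (simp add: z(1) chart_inv_slit[OF A c(1) x z(3)] tangent_map_def slit_chart_simps)
  qed
  have inV: "snd (slit_chart A c) q \<in> V \<times> - {0}"
    using V(2) v slit_tangent_space_iff[OF A c] by (simp add: pv slit_chart_simps)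
  show "\<exists>C D V. C \<in> slit_bundle A \<and> D \<in> slit_bundle A \<and> q \<in> fst C \<and> open V \<and> snd C q \<in> V \<and> V \<subseteq> snd C ` fst C \<and>
     (\<forall>x\<in>V. tangent_map A f (chart_inv C x) \<in> fst D) \<and> smooth_on V (\<lambda>x. snd D (tangent_map A f (chart_inv C x)))"
    using slit_chart_in[OF c(1)] slit_chart_in[OF d(1)] oV sm into inV c(2) v V(3)
    by (intro exI[of _ "slit_chart A c"] exI[of _ "slit_chart A d"] exI[of _ "V \<times> - {0}"])
      (auto simp: pv slit_chart_simps slit_chart_image[OF A c(1)])
qed

lemma tangent_map_jac:
  assumes A: "smooth_atlas A" and f: "smooth_map A A f"
    and c: "c \<in> A" "p \<in> fst c" and d: "d \<in> A" "f p \<in> fst d" and v: "v \<in> slit_tangent_space A p"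
    and \<phi>: "\<phi> = (\<lambda>x. snd d (f (chart_inv c x)))"
  shows "jac (tangent_map A f) (slit_chart A c) (slit_chart A d) (p, v) (a, b) =
     (jac f c d p a, frechet_derivative (\<lambda>x. frechet_derivative \<phi> (at x) (v c)) (at (snd c p)) a + jac f c d p b)"
proof -
  obtain V where V: "open V" "snd c p \<in> V" "V \<subseteq> snd c ` fst c" "\<And>x. x \<in> V \<Longrightarrow> f (chart_inv c x) \<in> fst d"
    "smooth_on V (\<lambda>x. snd d (f (chart_inv c x)))"
    by (rule smooth_map_representation[OF A A f c d]) blast
  note V5 = V(5)[folded \<phi>]
  have v0: "v c \<noteq> 0" using v slit_tangent_space_iff[OF A c] by simp
  have oV: "open (V \<times> - {0 :: 'b})" by (rule open_Times_slit[OF V(1)])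
  have "((\<lambda>z. snd (slit_chart A d) (tangent_map A f (chart_inv (slit_chart A c) z))) has_derivative
      (\<lambda>w. (frechet_derivative \<phi> (at (snd c p)) (fst w),
        frechet_derivative (\<lambda>x. frechet_derivative \<phi> (at x) (v c)) (at (snd c p)) (fst w) + frechet_derivative \<phi> (at (snd c p)) (snd w)))) (at (snd c p, v c))"
  proof (rule has_derivative_transform_within_open[OF tangent_map_derivative[OF V(1) V5 V(2)] oV])
    fix z assume "z \<in> V \<times> - {0 :: 'b}"
    then obtain x y where z: "z = (x, y)" "x \<in> V" "y \<noteq> 0" by auto
    then show "(\<phi> (fst z), frechet_derivative \<phi> (at (fst z)) (snd z)) = snd (slit_chart A d) (tangent_map A f (chart_inv (slit_chart A c) z))"
      using tangent_map_representation[OF A f c(1) d(1) subsetD[OF V(3) z(2)] V(4)[OF z(2)] z(3)] by (simp add: \<phi>)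
  qed (use V(2) v0 in simp)
  from has_derivative_frechet_eq[OF this] show ?thesis
    by (simp add: jac_def[of "tangent_map A f"] jac_def[of f] o_def slit_chart_simps \<phi>)
qed

section \<open>Atlases of tangent spaces\<close>

text \<open>Transitions are restrictions of the linear maps \<open>jac id c d p\<close>. Openness of
  the coordinate image is left to the two cases, the whole space and the complement of 0.\<close>

lemma tangent_space_atlas_smooth:
  assumes A: "smooth_atlas A" and S: "S \<subseteq> tangent_space A p"
    and op: "\<And>c. c \<in> A \<Longrightarrow> p \<in> fst c \<Longrightarrow> open ((\<lambda>v. v c) ` S)"
  shows "smooth_atlas (tangent_space_atlas A p S)"
    and "c \<in> A \<Longrightarrow> p \<in> fst c \<Longrightarrow> v \<in> S \<Longrightarrow> chart_inv (S, \<lambda>v. v c) (v c) = v"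
proof -
  have inj: "inj_on (\<lambda>v. v c) S" if "c \<in> A" "p \<in> fst c" for c
    using tangent_space_eqI[OF _ _ that] S by (intro inj_onI) blast
  show inv: "chart_inv (S, \<lambda>v. v c) (v c) = v" if "c \<in> A" "p \<in> fst c" "v \<in> S" for c v
    unfolding chart_inv_def using inv_into_f_f[OF inj[OF that(1,2)] that(3)] by simp
  show "smooth_atlas (tangent_space_atlas A p S)"
    unfolding smooth_atlas_def
  proof (intro conjI ballI)
    fix C assume "C \<in> tangent_space_atlas A p S"
    then show "inj_on (snd C) (fst C)" using inj by (auto simp: tangent_space_atlas_def)
  next
    fix C D assume "C \<in> tangent_space_atlas A p S" "D \<in> tangent_space_atlas A p S"
    then obtain c d where C: "C = (S, \<lambda>v. v c)" "c \<in> A" "p \<in> fst c" and D: "D = (S, \<lambda>v. v d)" "d \<in> A" "p \<in> fst d"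
      by (auto simp: tangent_space_atlas_def)
    show o: "open (snd C ` (fst C \<inter> fst D))" using op[OF C(2,3)] by (simp add: C(1) D(1))
    have "smooth_on (snd C ` (fst C \<inter> fst D)) (jac id c d p)"
      by (rule smooth_on_linear) (use jac_linear[OF A A smooth_map_id[OF A] C(2,3), of d] D in simp)
    then show "smooth_on (snd C ` (fst C \<inter> fst D)) (snd D \<circ> chart_inv C)"
    proof (rule smooth_on_congI[OF _ o])
      fix y assume "y \<in> snd C ` (fst C \<inter> fst D)"
      then obtain v where v: "y = v c" "v \<in> S" by (auto simp: C(1) D(1))
      have "v \<in> tangent_space A p" using v(2) S by blast
      then show "(snd D \<circ> chart_inv C) y = jac id c d p y"
        using tangent_space_change[OF _ C(2,3) D(2,3)] by (simp add: C(1) D(1) v inv[OF C(2,3)])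
    qed
  qed
qed

lemma points_tangent_space_atlas:
  assumes "p \<in> points A" shows "points (tangent_space_atlas A p S) = S"
proof -
  obtain c where "c \<in> A" "p \<in> fst c" using assms by (auto simp: points_def)
  then have "(S, \<lambda>v. v c) \<in> tangent_space_atlas A p S" unfolding tangent_space_atlas_def by blast
  moreover have "fst C = S" if "C \<in> tangent_space_atlas A p S" for C
    using that by (auto simp: tangent_space_atlas_def)
  ultimately show ?thesis unfolding points_def by auto
qed

lemma tangent_space_image:
  assumes A: "smooth_atlas A" and c: "c \<in> A" "p \<in> fst c"
  shows "(\<lambda>v. v c) ` tangent_space A p = UNIV"
proof -
  have "y = (\<lambda>v. v c) (tvec A p c y)" for y by (simp add: tvec_chart[OF A c])
  then show ?thesis using tvec_in_tangent_space[OF A c] by blast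
qed

lemma slit_tangent_space_image:
  assumes A: "smooth_atlas A" and c: "c \<in> A" "p \<in> fst c"
  shows "(\<lambda>v. v c) ` slit_tangent_space A p = - {0}"
proof (intro equalityI subsetI)
  fix y assume "y \<in> - {0 :: 'b}"
  then have "y = (\<lambda>v. v c) (tvec A p c y)" "tvec A p c y \<in> slit_tangent_space A p"
    using tvec_slit[OF A c] by (simp_all add: tvec_chart[OF A c])
  then show "y \<in> (\<lambda>v. v c) ` slit_tangent_space A p" by (rule image_eqI)
qed (use slit_tangent_space_iff[OF A c] in auto)

section \<open>Constant maps, pairs and projections\<close>

lemma smooth_map_const:
  assumes A: "smooth_atlas A" and B: "smooth_atlas B" and q: "q \<in> points B"
  shows "smooth_map A B (\<lambda>_. q)"
proof (rule smooth_mapI[OF A B])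
  fix p assume "p \<in> points A"
  then obtain c where c: "c \<in> A" "p \<in> fst c" by (auto simp: points_def)
  obtain d where d: "d \<in> B" "q \<in> fst d" using q by (auto simp: points_def)
  show "\<exists>c d V. c \<in> A \<and> d \<in> B \<and> p \<in> fst c \<and> open V \<and> snd c p \<in> V \<and> V \<subseteq> snd c ` fst c \<and>
       (\<forall>x\<in>V. q \<in> fst d) \<and> smooth_on V (\<lambda>x. snd d q)"
    using c d smooth_atlas_open[OF A c(1)] smooth_on_const
    by (intro exI[of _ c] exI[of _ d] exI[of _ "snd c ` fst c"]) auto
qed

lemma prod_chart_in: "c \<in> A \<Longrightarrow> d \<in> B \<Longrightarrow> prod_chart c d \<in> prod_atlas A B"
  unfolding prod_atlas_eq by blast

lemma smooth_map_Pair: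
  assumes A: "smooth_atlas A" and B: "smooth_atlas B" and C: "smooth_atlas C"
    and f: "smooth_map A B f" and h: "smooth_map A C h"
  shows "smooth_map A (prod_atlas B C) (\<lambda>p. (f p, h p))"
proof (rule smooth_mapI[OF A smooth_atlas_prod[OF B C]])
  fix p assume p: "p \<in> points A"
  then obtain c where c: "c \<in> A" "p \<in> fst c" by (auto simp: points_def)
  obtain d where d: "d \<in> B" "f p \<in> fst d" using smooth_map_into[OF A B f p] by (auto simp: points_def)
  obtain e where e: "e \<in> C" "h p \<in> fst e" using smooth_map_into[OF A C h p] by (auto simp: points_def)
  obtain V where V: "open V" "snd c p \<in> V" "V \<subseteq> snd c ` fst c" "\<And>x. x \<in> V \<Longrightarrow> f (chart_inv c x) \<in> fst d"
    "smooth_on V (\<lambda>x. snd d (f (chart_inv c x)))"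
    by (rule smooth_map_representation[OF A B f c d]) blast
  obtain W where W: "open W" "snd c p \<in> W" "W \<subseteq> snd c ` fst c" "\<And>x. x \<in> W \<Longrightarrow> h (chart_inv c x) \<in> fst e"
    "smooth_on W (\<lambda>x. snd e (h (chart_inv c x)))"
    by (rule smooth_map_representation[OF A C h c e]) blast
  have o: "open (V \<inter> W)" using V(1) W(1) by (rule open_Int)
  have "smooth_on (V \<inter> W) (\<lambda>x. (snd d (f (chart_inv c x)), snd e (h (chart_inv c x))))"
    by (intro smooth_on_Pair o smooth_on_subset[OF V(5)] smooth_on_subset[OF W(5)]) auto
  then have "smooth_on (V \<inter> W) (\<lambda>x. snd (prod_chart d e) (f (chart_inv c x), h (chart_inv c x)))"
    by (simp add: prod_chart_simps)
  then show "\<exists>c d V. c \<in> A \<and> d \<in> prod_atlas B C \<and> p \<in> fst c \<and> open V \<and> snd c p \<in> V \<and> V \<subseteq> snd c ` fst c \<and>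
       (\<forall>x\<in>V. (f (chart_inv c x), h (chart_inv c x)) \<in> fst d) \<and> smooth_on V (\<lambda>x. snd d (f (chart_inv c x), h (chart_inv c x)))"
    using c prod_chart_in[OF d(1) e(1)] o V(2-4) W(2,4)
    by (intro exI[of _ c] exI[of _ "prod_chart d e"] exI[of _ "V \<inter> W"]) (auto simp: prod_chart_simps)
qed

lemma smooth_map_fst:
  assumes A: "smooth_atlas A" and B: "smooth_atlas B" shows "smooth_map (prod_atlas A B) A fst"
proof (rule smooth_mapI[OF smooth_atlas_prod[OF A B] A])
  fix z assume z: "z \<in> points (prod_atlas A B)"
  then obtain c d where c: "c \<in> A" "fst z \<in> fst c" and d: "d \<in> B" "snd z \<in> fst d"
    unfolding points_prod_atlas by (auto simp: points_def)
  let ?V = "snd c ` fst c \<times> snd d ` fst d"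
  have o: "open ?V" by (intro open_Times smooth_atlas_open[OF A c(1)] smooth_atlas_open[OF B d(1)])
  have inv: "chart_inv (prod_chart c d) x = (chart_inv c (fst x), chart_inv d (snd x))" if "x \<in> ?V" for x
    using chart_inv_prod[OF smooth_atlas_inj[OF A c(1)] smooth_atlas_inj[OF B d(1)], of "fst x" "snd x"] that by (auto simp: mem_Times_iff)
  have "smooth_on ?V (\<lambda>x. snd c (fst (chart_inv (prod_chart c d) x)))"
    by (rule smooth_on_congI[OF smooth_on_fst o]) (auto simp: inv chart_inv_in(2))
  moreover have "fst (chart_inv (prod_chart c d) x) \<in> fst c" if "x \<in> ?V" for x
    using inv[OF that] chart_inv_in(1)[of "fst x" c] that by (auto simp: mem_Times_iff)
  moreover have "snd (prod_chart c d) z \<in> ?V" using c d by (cases z) (simp add: prod_chart_simps)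
  moreover have "?V = snd (prod_chart c d) ` fst (prod_chart c d)" by (simp add: prod_chart_simps prod_chart_image)
  moreover have "z \<in> fst (prod_chart c d)" using c d by (cases z) (simp add: prod_chart_simps)
  ultimately show "\<exists>C d V. C \<in> prod_atlas A B \<and> d \<in> A \<and> z \<in> fst C \<and> open V \<and> snd C z \<in> V \<and> V \<subseteq> snd C ` fst C \<and>
       (\<forall>x\<in>V. fst (chart_inv C x) \<in> fst d) \<and> smooth_on V (\<lambda>x. snd d (fst (chart_inv C x)))"
    using prod_chart_in[OF c(1) d(1)] c(1) o
    by (intro exI[of _ "prod_chart c d"] exI[of _ c] exI[of _ ?V]) simp
qed

lemma smooth_map_snd:
  assumes A: "smooth_atlas A" and B: "smooth_atlas B" shows "smooth_map (prod_atlas A B) B snd"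
proof (rule smooth_mapI[OF smooth_atlas_prod[OF A B] B])
  fix z assume z: "z \<in> points (prod_atlas A B)"
  then obtain c d where c: "c \<in> A" "fst z \<in> fst c" and d: "d \<in> B" "snd z \<in> fst d"
    unfolding points_prod_atlas by (auto simp: points_def)
  let ?V = "snd c ` fst c \<times> snd d ` fst d"
  have o: "open ?V" by (intro open_Times smooth_atlas_open[OF A c(1)] smooth_atlas_open[OF B d(1)])
  have inv: "chart_inv (prod_chart c d) x = (chart_inv c (fst x), chart_inv d (snd x))" if "x \<in> ?V" for x
    using chart_inv_prod[OF smooth_atlas_inj[OF A c(1)] smooth_atlas_inj[OF B d(1)], of "fst x" "snd x"] that by (auto simp: mem_Times_iff)
  have "smooth_on ?V (\<lambda>x. snd d (snd (chart_inv (prod_chart c d) x)))"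
    by (rule smooth_on_congI[OF smooth_on_snd o]) (auto simp: inv chart_inv_in(2))
  moreover have "snd (chart_inv (prod_chart c d) x) \<in> fst d" if "x \<in> ?V" for x
    using inv[OF that] chart_inv_in(1)[of "snd x" d] that by (auto simp: mem_Times_iff)
  moreover have "snd (prod_chart c d) z \<in> ?V" using c d by (cases z) (simp add: prod_chart_simps)
  moreover have "?V = snd (prod_chart c d) ` fst (prod_chart c d)" by (simp add: prod_chart_simps prod_chart_image)
  moreover have "z \<in> fst (prod_chart c d)" using c d by (cases z) (simp add: prod_chart_simps)
  ultimately show "\<exists>C e V. C \<in> prod_atlas A B \<and> e \<in> B \<and> z \<in> fst C \<and> open V \<and> snd C z \<in> V \<and> V \<subseteq> snd C ` fst C \<and>
       (\<forall>x\<in>V. snd (chart_inv C x) \<in> fst e) \<and> smooth_on V (\<lambda>x. snd e (snd (chart_inv C x)))"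
    using prod_chart_in[OF c(1) d(1)] d(1) o
    by (intro exI[of _ "prod_chart c d"] exI[of _ d] exI[of _ ?V]) simp
qed

text \<open>The Jacobian in the second factor is a partial derivative of the smooth coordinate
  expression of m on the product, so it depends smoothly on the first factor as well. Multiplication
  will give the frame, and (g, h) \<mapsto> g^-1 h the coframe.\<close>

lemma jac_partial_smooth:
  fixes A :: "('a, 'e::euclidean_space) atlas" and m :: "'a \<times> 'a \<Rightarrow> 'a" and a :: "'e \<Rightarrow> 'e"
  assumes A: "smooth_atlas A" and m: "smooth_map (prod_atlas A A) A m"
    and c: "c \<in> A" and d: "d \<in> A" and e: "e \<in> A" and S: "open S"
    and a: "smooth_on S a" "\<And>x. x \<in> S \<Longrightarrow> a x \<in> snd c ` fst c"
    and b: "smooth_on S b" "\<And>x. x \<in> S \<Longrightarrow> b x \<in> snd d ` fst d"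
    and me: "\<And>x. x \<in> S \<Longrightarrow> m (chart_inv c (a x), chart_inv d (b x)) \<in> fst e"
  shows "smooth_on S (\<lambda>x. jac (\<lambda>h. m (chart_inv c (a x), h)) d e (chart_inv d (b x)) w)"
proof -
  note PA = smooth_atlas_prod[OF A A]
  let ?C = "prod_chart c d"
  define W where "W = snd ?C ` {z \<in> fst ?C. m z \<in> fst e}"
  define \<mu> where "\<mu> = (\<lambda>z. snd e (m (chart_inv ?C z)))"
  have W: "open W" and \<mu>: "smooth_on W \<mu>"
    unfolding W_def \<mu>_def using smooth_mapD[OF PA A m prod_chart_in[OF c d] e] by auto
  have abW: "(a x, b x) \<in> W" if x: "x \<in> S" for x
  proof -
    note ax = chart_inv_in[OF a(2)[OF x]] and bx = chart_inv_in[OF b(2)[OF x]]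
    have "(a x, b x) = snd ?C (chart_inv c (a x), chart_inv d (b x))" by (simp add: prod_chart_simps ax bx)
    then show ?thesis unfolding W_def using ax bx me[OF x] by (intro image_eqI) (auto simp: prod_chart_simps)
  qed
  have eq: "jac (\<lambda>h. m (chart_inv c (a x), h)) d e (chart_inv d (b x)) w = frechet_derivative \<mu> (at (a x, b x)) (0, w)"
    if x: "x \<in> S" for x
  proof -
    have "((\<lambda>y. \<mu> (a x, y)) has_derivative (\<lambda>w. frechet_derivative \<mu> (at (a x, b x)) (0, w))) (at (b x))"
      by (rule partial_derivative_snd[OF smooth_on_differentiable[OF \<mu> abW[OF x]]])
    then have "((\<lambda>y. snd e (m (chart_inv c (a x), chart_inv d y))) has_derivative (\<lambda>w. frechet_derivative \<mu> (at (a x, b x)) (0, w))) (at (b x))"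
      by (rule has_derivative_transform_within_open[OF _ smooth_atlas_open[OF A d] b(2)[OF x]])
        (simp add: \<mu>_def chart_inv_prod[OF smooth_atlas_inj[OF A c] smooth_atlas_inj[OF A d] a(2)[OF x]])
    from has_derivative_frechet_eq[OF this] show ?thesis
      by (simp add: jac_representation[OF b(2)[OF x]])
  qed
  have "smooth_on S (\<lambda>x. frechet_derivative \<mu> (at (a x, b x)) (0, w))"
    by (rule smooth_on_frechet[OF S W \<mu> smooth_on_Pair[OF S a(1) b(1)] smooth_on_const]) (use abW in auto)
  then show ?thesis by (rule smooth_on_congI[OF _ S eq])
qed

section \<open>Left invariant frames\<close>

locale lie_group_chart =
  fixes G :: "('a, 'm) monoid_scheme" (structure) and A :: "('a, 'e::euclidean_space) atlas"
    and c0 :: "('a, 'e) chart"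
  assumes lie: "lie_group G A" and c0: "c0 \<in> A" "\<one> \<in> fst c0"
begin

abbreviation "L \<equiv> left_translation G"

sublocale group G using lie by (simp add: lie_group_def)

lemma atlas: "smooth_atlas A" using lie by (simp add: lie_group_def smooth_manifold_imp_smooth_atlas)

lemma points_carrier: "points A = carrier G" using lie by (simp add: lie_group_def)

lemma chart_carrier: "c \<in> A \<Longrightarrow> g \<in> fst c \<Longrightarrow> g \<in> carrier G"
  using points_carrier by (auto simp: points_def)

lemma chart_inv_carrier: "c \<in> A \<Longrightarrow> x \<in> snd c ` fst c \<Longrightarrow> chart_inv c x \<in> carrier G"
  by (rule chart_carrier[OF _ chart_inv_in(1)])

lemma carrier_chart: assumes "g \<in> carrier G" obtains c where "c \<in> A" "g \<in> fst c"
proof -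
  have "g \<in> points A" using assms points_carrier by simp
  then show ?thesis unfolding points_def using that by blast
qed

lemma smooth_mult: "smooth_map (prod_atlas A A) A (\<lambda>(g, h). g \<otimes> h)"
  and smooth_inv: "smooth_map A A (\<lambda>g. inv g)"
  using lie by (simp_all add: lie_group_def)

lemma smooth_left_quotient: "smooth_map (prod_atlas A A) A (\<lambda>(g, h). inv g \<otimes> h)"
proof -
  note PA = smooth_atlas_prod[OF atlas atlas]
  have "smooth_map (prod_atlas A A) A (\<lambda>z. (\<lambda>(g, h). g \<otimes> h) (inv (fst z), snd z))"
    by (intro smooth_map_compose[OF PA PA atlas _ smooth_mult] smooth_map_Pair[OF PA atlas atlas]
        smooth_map_compose[OF PA atlas atlas smooth_map_fst[OF atlas atlas] smooth_inv] smooth_map_snd[OF atlas atlas])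
  then show ?thesis by (simp add: case_prod_unfold)
qed

lemma L_apply: "L g h = g \<otimes> h" by (simp add: left_translation_def)

lemma smooth_L: assumes "g \<in> carrier G" shows "smooth_map A A (L g)"
proof -
  have "smooth_map A A (\<lambda>h. (\<lambda>(g, h). g \<otimes> h) (g, id h))"
    using assms by (intro smooth_map_compose[OF atlas smooth_atlas_prod[OF atlas atlas] atlas _ smooth_mult]
        smooth_map_Pair[OF atlas atlas atlas] smooth_map_const[OF atlas atlas] smooth_map_id[OF atlas])
      (simp add: points_carrier)
  then show ?thesis by (simp add: left_translation_def)
qed

lemma L_inv: "g \<in> carrier G \<Longrightarrow> h \<in> points A \<Longrightarrow> L (inv g) (L g h) = h"
  and L_inv': "g \<in> carrier G \<Longrightarrow> h \<in> points A \<Longrightarrow> L g (L (inv g) h) = h"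
  by (simp_all add: L_apply points_carrier m_assoc[symmetric])

section \<open>Frame and coframe in coordinates\<close>

definition "x0 = snd c0 \<one>"

lemma x0: "x0 \<in> snd c0 ` fst c0" "chart_inv c0 x0 = \<one>"
  using c0 by (auto simp: x0_def chart_inv_chart[OF atlas c0])

text \<open>In coordinates, \<open>frm c x\<close> is the differential of the translation by the point \<open>x\<close> at the
  identity and \<open>cofrm c x\<close> is its inverse; the Lie algebra is identified with the model space
  by the chart \<open>c0\<close>.\<close>

definition frm :: "('a, 'e) chart \<Rightarrow> 'e \<Rightarrow> 'e \<Rightarrow> 'e" where
  "frm c x = jac (L (chart_inv c x)) c0 c \<one>"

definition cofrm :: "('a, 'e) chart \<Rightarrow> 'e \<Rightarrow> 'e \<Rightarrow> 'e" where
  "cofrm c x = jac (L (inv (chart_inv c x))) c c0 (chart_inv c x)"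

lemma frm_smooth:
  assumes c: "c \<in> A" shows "smooth_on (snd c ` fst c) (\<lambda>x. frm c x w)"
proof -
  have "smooth_on (snd c ` fst c) (\<lambda>x. jac (\<lambda>h. (\<lambda>(g, h). g \<otimes> h) (chart_inv c x, h)) c0 c (chart_inv c0 x0) w)"
  proof (rule jac_partial_smooth[OF atlas smooth_mult c c0(1) c smooth_atlas_open[OF atlas c] smooth_on_id _ smooth_on_const])
    show "(\<lambda>(g, h). g \<otimes> h) (chart_inv c x, chart_inv c0 x0) \<in> fst c" if "x \<in> snd c ` fst c" for x
      using chart_inv_in(1)[OF that] chart_inv_carrier[OF c that] by (simp add: x0)
  qed (use x0 in simp_all)
  then show ?thesis by (simp add: frm_def x0 left_translation_def)
qed

lemma cofrm_smooth:
  assumes c: "c \<in> A" shows "smooth_on (snd c ` fst c) (\<lambda>x. cofrm c x w)"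
proof -
  have "smooth_on (snd c ` fst c) (\<lambda>x. jac (\<lambda>h. (\<lambda>(g, h). inv g \<otimes> h) (chart_inv c x, h)) c c0 (chart_inv c x) w)"
    by (rule jac_partial_smooth[OF atlas smooth_left_quotient c c c0(1) smooth_atlas_open[OF atlas c] smooth_on_id _ smooth_on_id])
      (use c0 chart_inv_carrier[OF c] in auto)
  then show ?thesis by (simp add: cofrm_def left_translation_def)
qed

lemma L_one_chart: "c \<in> A \<Longrightarrow> x \<in> snd c ` fst c \<Longrightarrow> L (chart_inv c x) \<one> \<in> fst c"
  using chart_inv_carrier chart_inv_in(1) by (simp add: L_apply)

lemma L_inv_chart: "c \<in> A \<Longrightarrow> x \<in> snd c ` fst c \<Longrightarrow> L (inv (chart_inv c x)) (chart_inv c x) \<in> fst c0"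
  using chart_inv_carrier c0 by (simp add: L_apply)

lemma frm_linear: assumes "c \<in> A" "x \<in> snd c ` fst c" shows "bounded_linear (frm c x)"
  unfolding frm_def
  by (rule jac_linear[OF atlas atlas smooth_L[OF chart_inv_carrier[OF assms]] c0 assms(1) L_one_chart[OF assms]])

lemma cofrm_linear: assumes "c \<in> A" "x \<in> snd c ` fst c" shows "bounded_linear (cofrm c x)"
  unfolding cofrm_def
  by (rule jac_linear[OF atlas atlas smooth_L[OF inv_closed[OF chart_inv_carrier[OF assms]]] assms(1) chart_inv_in(1)[OF assms(2)]
     c0(1) L_inv_chart[OF assms]])

lemma cofrm_frm: assumes "c \<in> A" "x \<in> snd c ` fst c" shows "cofrm c x (frm c x w) = w"
proof -
  let ?g = "chart_inv c x"
  have g: "?g \<in> carrier G" by (rule chart_inv_carrier[OF assms])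
  have "jac (\<lambda>h. L (inv ?g) (L ?g h)) c0 c0 \<one> w = jac (L (inv ?g)) c c0 (L ?g \<one>) (jac (L ?g) c0 c \<one> w)"
    using c0 g by (intro jac_chain[OF atlas atlas atlas smooth_L[OF g] smooth_L[OF inv_closed[OF g]] c0 assms(1) L_one_chart[OF assms]])
      (auto simp: L_apply)
  moreover have "jac (\<lambda>h. L (inv ?g) (L ?g h)) c0 c0 \<one> w = w"
    using jac_cong[OF atlas c0, of "\<lambda>h. L (inv ?g) (L ?g h)" id c0] L_inv[OF g] jac_id[OF atlas c0] by simp
  moreover have "L ?g \<one> = ?g" using g by (simp add: L_apply)
  ultimately show ?thesis by (simp add: frm_def cofrm_def)
qed

lemma frm_cofrm: assumes "c \<in> A" "x \<in> snd c ` fst c" shows "frm c x (cofrm c x y) = y"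
proof -
  let ?g = "chart_inv c x"
  have g: "?g \<in> carrier G" by (rule chart_inv_carrier[OF assms])
  have gc: "?g \<in> fst c" by (rule chart_inv_in(1)[OF assms(2)])
  have e: "L (inv ?g) ?g = \<one>" using g by (simp add: L_apply)
  have "jac (\<lambda>h. L ?g (L (inv ?g) h)) c c ?g y = jac (L ?g) c0 c (L (inv ?g) ?g) (jac (L (inv ?g)) c c0 ?g y)"
    using gc by (intro jac_chain[OF atlas atlas atlas smooth_L[OF inv_closed[OF g]] smooth_L[OF g] assms(1) gc c0(1) L_inv_chart[OF assms] assms(1)])
      (use g in \<open>simp add: L_apply\<close>)
  moreover have "jac (\<lambda>h. L ?g (L (inv ?g) h)) c c ?g y = y"
    using jac_cong[OF atlas assms(1) gc, of "\<lambda>h. L ?g (L (inv ?g) h)" id c] L_inv'[OF g] jac_id[OF atlas assms(1) gc] by simp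
  ultimately show ?thesis by (simp add: frm_def cofrm_def e)
qed

lemma frm_x0: "frm c0 x0 w = w"
proof -
  have "jac (L \<one>) c0 c0 \<one> = jac id c0 c0 \<one>"
    by (rule jac_cong[OF atlas c0]) (simp add: L_apply points_carrier)
  then show ?thesis by (simp add: frm_def x0 jac_id[OF atlas c0])
qed

text \<open>Left translation by g read from c0 to c. Its first derivative at x0 is the frame at g;
  its second derivative there records how the frame varies with the base point, up to a term from
  the identity.\<close>

definition trl :: "('a, 'e) chart \<Rightarrow> 'a \<Rightarrow> 'e \<Rightarrow> 'e" where
  "trl c g = (\<lambda>x. snd c (L g (chart_inv c0 x)))"

lemma trl_representation:
  assumes c: "c \<in> A" and g: "g \<in> fst c"
  obtains V where "open V" "x0 \<in> V" "V \<subseteq> snd c0 ` fst c0" "\<And>x. x \<in> V \<Longrightarrow> L g (chart_inv c0 x) \<in> fst c" "smooth_on V (trl c g)"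
proof -
  have "L g \<one> \<in> fst c" using chart_carrier[OF c g] g by (simp add: L_apply)
  from smooth_map_representation[OF atlas atlas smooth_L[OF chart_carrier[OF c g]] c0 c this]
  show ?thesis using that unfolding trl_def x0_def by blast
qed

lemma trl_x0: "c \<in> A \<Longrightarrow> g \<in> fst c \<Longrightarrow> trl c g x0 = snd c g"
  using chart_carrier by (simp add: trl_def x0 L_apply)

text \<open>Translation by g h is translation by h followed by translation by g; the chain rule at
  the identity does the rest.\<close>

lemma frm_trl:
  assumes c: "c \<in> A" and g: "g \<in> fst c" and x: "x \<in> snd c0 ` fst c0" "L g (chart_inv c0 x) \<in> fst c"
  shows "frm c (trl c g x) u = frechet_derivative (trl c g) (at x) (frm c0 x u)"
proof -
  let ?h = "chart_inv c0 x"
  have gG: "g \<in> carrier G" by (rule chart_carrier[OF c g])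
  have h: "?h \<in> carrier G" by (rule chart_inv_carrier[OF c0(1) x(1)])
  have ci: "chart_inv c (trl c g x) = g \<otimes> ?h"
    unfolding trl_def using chart_inv_chart[OF atlas c x(2)] by (simp add: L_apply)
  have "jac (L (g \<otimes> ?h)) c0 c \<one> u = jac (\<lambda>q. L g (L ?h q)) c0 c \<one> u"
    using jac_cong[OF atlas c0, of "L (g \<otimes> ?h)" "\<lambda>q. L g (L ?h q)" c] gG h
    by (simp add: L_apply points_carrier m_assoc)
  also have "\<dots> = jac (L g) c0 c (L ?h \<one>) (jac (L ?h) c0 c0 \<one> u)"
    using h x by (intro jac_chain[OF atlas atlas atlas smooth_L[OF h] smooth_L[OF gG] c0 c0(1) L_one_chart[OF c0(1) x(1)] c])
      (simp add: L_apply)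
  also have "L ?h \<one> = ?h" using h by (simp add: L_apply)
  also have "jac (L g) c0 c ?h = frechet_derivative (trl c g) (at x)"
    unfolding jac_representation[OF x(1)] trl_def ..
  finally show ?thesis by (simp add: frm_def[of c] ci) (simp add: frm_def)
qed

lemma frm_eq_trl: "c \<in> A \<Longrightarrow> g \<in> fst c \<Longrightarrow> frm c (snd c g) u = frechet_derivative (trl c g) (at x0) u"
  using frm_trl[of c g x0 u] trl_x0[of c g] x0 chart_carrier[of c g] by (simp add: frm_x0 L_apply)

text \<open>The argument a is the frame vector and y the direction of differentiation; brackets
  exchange the two roles.\<close>

definition dfrm :: "('a, 'e) chart \<Rightarrow> 'e \<Rightarrow> 'e \<Rightarrow> 'e \<Rightarrow> 'e" where
  "dfrm c x a y = frechet_derivative (\<lambda>x. frm c x a) (at x) y"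

text \<open>\<open>frm_trl\<close> is differentiated in x at x0 on both sides. This splits the
  derivative of the frame at g into a second derivative, symmetric in a and z, and the translate of
  its value at the identity; both the bracket and the spray are computed from this
  splitting.\<close>

lemma dfrm_trl:
  assumes c: "c \<in> A" and g: "g \<in> fst c"
  shows "dfrm c (snd c g) a (frm c (snd c g) z) =
     frechet_derivative (\<lambda>x. frechet_derivative (trl c g) (at x) a) (at x0) z + frm c (snd c g) (dfrm c0 x0 a z)"
proof -
  obtain V where V: "open V" "x0 \<in> V" "V \<subseteq> snd c0 ` fst c0" "\<And>x. x \<in> V \<Longrightarrow> L g (chart_inv c0 x) \<in> fst c" "smooth_on V (trl c g)"
    by (rule trl_representation[OF c g]) blast
  note eq = frm_eq_trl[OF c g]
  have cim: "snd c g \<in> snd c ` fst c" using g by simp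
  have "((\<lambda>x. frm c x a) has_derivative dfrm c (snd c g) a) (at (trl c g x0))"
    unfolding trl_x0[OF c g] dfrm_def by (rule smooth_on_has_derivative[OF frm_smooth[OF c] cim])
  from has_derivative_compose[OF smooth_on_has_derivative[OF V(5,2)] this]
  have 1: "((\<lambda>x. frm c (trl c g x) a) has_derivative (\<lambda>z. dfrm c (snd c g) a (frm c (snd c g) z))) (at x0)"
    by (simp add: eq)
  let ?T = "\<lambda>z. (trl c g (fst z), frechet_derivative (trl c g) (at (fst z)) (snd z))"
  have "((\<lambda>x. (x, frm c0 x a)) has_derivative (\<lambda>z. (z, dfrm c0 x0 a z))) (at x0)"
    unfolding dfrm_def by (intro has_derivative_Pair has_derivative_ident smooth_on_has_derivative[OF frm_smooth[OF c0(1)] x0(1)])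
  from has_derivative_compose[OF this tangent_map_derivative[OF V(1,5,2)]]
  have "((\<lambda>x. ?T (x, frm c0 x a)) has_derivative
     (\<lambda>z. (frechet_derivative (trl c g) (at x0) z,
       frechet_derivative (\<lambda>x. frechet_derivative (trl c g) (at x) (frm c0 x0 a)) (at x0) z + frechet_derivative (trl c g) (at x0) (dfrm c0 x0 a z)))) (at x0)"
    by (simp only: fst_conv snd_conv)
  from bounded_linear.has_derivative[OF bounded_linear_snd this]
  have "((\<lambda>x. frechet_derivative (trl c g) (at x) (frm c0 x a)) has_derivative
     (\<lambda>z. frechet_derivative (\<lambda>x. frechet_derivative (trl c g) (at x) a) (at x0) z + frm c (snd c g) (dfrm c0 x0 a z))) (at x0)"
    by (simp add: frm_x0 eq)
  then have "((\<lambda>x. frm c (trl c g x) a) has_derivative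
     (\<lambda>z. frechet_derivative (\<lambda>x. frechet_derivative (trl c g) (at x) a) (at x0) z + frm c (snd c g) (dfrm c0 x0 a z))) (at x0)"
    by (rule has_derivative_transform_within_open[OF _ V(1,2)])
      (use V(3,4) frm_trl[OF c g] in \<open>auto simp: subset_iff\<close>)
  from has_derivative_unique[OF 1 this] show ?thesis by (simp add: fun_eq_iff)
qed

text \<open>Value at the identity of the bracket of the left invariant fields through v and w, in
  the chart c0, where the frame at x0 is the identity map.\<close>

definition brk :: "'e \<Rightarrow> 'e \<Rightarrow> 'e" where "brk v w = dfrm c0 x0 w v - dfrm c0 x0 v w"

text \<open>The symmetric second derivatives of the left translation cancel in the bracket of two left
  invariant fields.\<close>

lemma frm_brk:
  assumes c: "c \<in> A" and x: "x \<in> snd c ` fst c"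
  shows "dfrm c x w (frm c x v) - dfrm c x v (frm c x w) = frm c x (brk v w)"
proof -
  obtain g where g: "x = snd c g" "g \<in> fst c" using x by auto
  obtain V where V: "open V" "x0 \<in> V" "V \<subseteq> snd c0 ` fst c0" "\<And>x. x \<in> V \<Longrightarrow> L g (chart_inv c0 x) \<in> fst c" "smooth_on V (trl c g)"
    by (rule trl_representation[OF c g(2)]) blast
  have "frm c x (brk v w) = frm c x (dfrm c0 x0 w v) - frm c x (dfrm c0 x0 v w)"
    unfolding brk_def by (rule linear_diff[OF bounded_linear.linear[OF frm_linear[OF c x]]])
  then show ?thesis
    using second_derivative_symmetric[OF V(5,1,2), of w v]
    unfolding g(1) dfrm_trl[OF c g(2)] by simp
qed

lemma left_invariant_field_chart:
  assumes v: "v \<in> lie_algebra G A" and d: "d \<in> A" "g \<in> fst d"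
  shows "left_invariant_field G A v g d = frm d (snd d g) (v c0)"
proof -
  have g: "g \<in> carrier G" by (rule chart_carrier[OF d])
  have "differential A A (L g) \<one> v d = jac (L g) c0 d \<one> (v c0)"
    using v d g by (intro differential_chart[OF atlas atlas smooth_L[OF g] _ c0]) (auto simp: lie_algebra_def L_apply)
  then show ?thesis by (simp add: left_invariant_field_def frm_def chart_inv_chart[OF atlas d])
qed

lemma field_rep_left_invariant:
  assumes v: "v \<in> lie_algebra G A" and d: "d \<in> A" "x \<in> snd d ` fst d"
  shows "field_rep (left_invariant_field G A v) d x = frm d x (v c0)"
  using left_invariant_field_chart[OF v d(1) chart_inv_in(1)[OF d(2)]] chart_inv_in(2)[OF d(2)] by (simp add: field_rep_def)

lemma field_rep_left_invariant_derivative: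
  assumes v: "v \<in> lie_algebra G A" and d: "d \<in> A" "x \<in> snd d ` fst d"
  shows "frechet_derivative (field_rep (left_invariant_field G A v) d) (at x) y = dfrm d x (v c0) y"
  unfolding dfrm_def
  using frechet_derivative_cong_open[OF smooth_atlas_open[OF atlas d(1)] d(2) field_rep_left_invariant[OF v d(1)]] by simp

end

lemma tangent_space_add:
  assumes A: "smooth_atlas A" and "v \<in> tangent_space A p" "w \<in> tangent_space A p" "p \<in> points A"
  shows "(\<lambda>d. v d + s *\<^sub>R w d) \<in> tangent_space A p"
proof -
  obtain c where c: "c \<in> A" "p \<in> fst c" using assms(4) by (auto simp: points_def)
  have "(\<lambda>d. v d + s *\<^sub>R w d) = tvec A p c (v c + s *\<^sub>R w c)"
  proof
    fix d
    have lin: "linear (\<lambda>y. tvec A p c y d)" by (rule bounded_linear.linear[OF tvec_linear[OF A c]])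
    have "v d = tvec A p c (v c) d" "w d = tvec A p c (w c) d"
      using tangent_space_eq_tvec[OF assms(2) c] tangent_space_eq_tvec[OF assms(3) c] by metis+
    then show "v d + s *\<^sub>R w d = tvec A p c (v c + s *\<^sub>R w c) d"
      by (simp add: linear_add[OF lin] linear_scale[OF lin])
  qed
  then show ?thesis using tvec_in_tangent_space[OF A c] by metis
qed

lemma zero_in_tangent_space: "p \<in> points A \<Longrightarrow> smooth_atlas A \<Longrightarrow> (\<lambda>_. 0) \<in> tangent_space A p"
proof -
  assume p: "p \<in> points A" and A: "smooth_atlas A"
  then obtain c where c: "c \<in> A" "p \<in> fst c" by (auto simp: points_def)
  have "(\<lambda>_. 0) = tvec A p c 0"
    using linear_0[OF bounded_linear.linear[OF tvec_linear[OF A c]]] by (simp add: fun_eq_iff)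
  then show ?thesis using tvec_in_tangent_space[OF A c] by metis
qed

lemma tangent_space_scale:
  assumes A: "smooth_atlas A" and "w \<in> tangent_space A p" "p \<in> points A"
  shows "(\<lambda>d. s *\<^sub>R w d) \<in> tangent_space A p"
  using tangent_space_add[OF A zero_in_tangent_space[OF assms(3) A] assms(2,3), of s] by simp

lemma lin_comb_in_tangent_space:
  assumes A: "smooth_atlas A" and "\<And>i. i \<in> {1..n} \<Longrightarrow> b i \<in> tangent_space A p" "p \<in> points A"
  shows "lin_comb n a b \<in> tangent_space A p"
  using assms(2)
proof (induction n)
  case 0
  then show ?case using zero_in_tangent_space[OF assms(3) A] by (simp add: lin_comb_def)
next
  case (Suc n)
  have "lin_comb (Suc n) a b = (\<lambda>d. lin_comb n a b d + a (Suc n) *\<^sub>R b (Suc n) d)"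
    by (simp add: lin_comb_def fun_eq_iff)
  then show ?case using tangent_space_add[OF A _ _ assms(3), of "lin_comb n a b" "b (Suc n)" "a (Suc n)"] Suc by simp
qed

context lie_group_chart
begin

lemma dfrm_linear: assumes "c \<in> A" "x \<in> snd c ` fst c" shows "bounded_linear (dfrm c x a)"
  unfolding dfrm_def by (rule smooth_on_bounded_linear[OF frm_smooth[OF assms(1)] assms(2)])

text \<open>Linearity of the frame in its vector survives differentiation in the base point.\<close>

lemma dfrm_linear_field: assumes c: "c \<in> A" and x: "x \<in> snd c ` fst c" shows "linear (\<lambda>a. dfrm c x a y)"
proof (rule linearI)
  fix a b and r :: real
  note o = smooth_atlas_open[OF atlas c]
  have lin: "linear (frm c z)" if "z \<in> snd c ` fst c" for z by (rule bounded_linear.linear[OF frm_linear[OF c that]])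
  have d: "((\<lambda>x. frm c x a) has_derivative dfrm c x a) (at x)" for a
    unfolding dfrm_def by (rule smooth_on_has_derivative[OF frm_smooth[OF c] x])
  have "((\<lambda>x. frm c x (a + b)) has_derivative (\<lambda>y. dfrm c x a y + dfrm c x b y)) (at x)"
    by (rule has_derivative_transform_within_open[OF has_derivative_add[OF d d] o x]) (simp add: linear_add[OF lin])
  from has_derivative_frechet_eq[OF this] show "dfrm c x (a + b) y = dfrm c x a y + dfrm c x b y" by (simp add: dfrm_def)
  have "((\<lambda>x. frm c x (r *\<^sub>R a)) has_derivative (\<lambda>y. r *\<^sub>R dfrm c x a y)) (at x)"
    by (rule has_derivative_transform_within_open[OF bounded_linear.has_derivative[OF bounded_linear_scaleR_right d] o x])
      (simp add: linear_scale[OF lin])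
  from has_derivative_frechet_eq[OF this] show "dfrm c x (r *\<^sub>R a) y = r *\<^sub>R dfrm c x a y" by (simp add: dfrm_def)
qed

lemma one_points: "\<one> \<in> points A" by (simp add: points_carrier)

lemma left_invariant_field_in:
  assumes v: "v \<in> lie_algebra G A" and g: "g \<in> carrier G"
  shows "left_invariant_field G A v g \<in> tangent_space A g"
  using differential_in_tangent_space[OF atlas atlas smooth_L[OF g], of v \<one>] v g one_points
  by (simp add: left_invariant_field_def lie_algebra_def L_apply)

text \<open>The bracket is defined in each chart separately; \<open>frm_brk\<close> shows that these
  components belong to one tangent vector.\<close>

lemma lie_bracket_tvec:
  assumes v: "v \<in> lie_algebra G A" and w: "w \<in> lie_algebra G A"
  shows "lie_bracket G A v w = tvec A \<one> c0 (brk (v c0) (w c0))"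
proof
  fix d
  show "lie_bracket G A v w d = tvec A \<one> c0 (brk (v c0) (w c0)) d"
  proof (cases "d \<in> A \<and> \<one> \<in> fst d")
    case True
    then have d: "d \<in> A" "\<one> \<in> fst d" and x: "snd d \<one> \<in> snd d ` fst d" by auto
    have "frm d (snd d \<one>) = jac id c0 d \<one>"
      using jac_cong[OF atlas c0, of "L \<one>" id d] by (simp add: frm_def chart_inv_chart[OF atlas d] L_apply points_carrier)
    then show ?thesis
      using frm_brk[OF d(1) x, of "w c0" "v c0"] d
      by (simp add: lie_bracket_def field_bracket_def tvec_def field_rep_left_invariant_derivative[OF v d(1) x]
          field_rep_left_invariant_derivative[OF w d(1) x] left_invariant_field_chart[OF v d] left_invariant_field_chart[OF w d])
  next
    case False
    then show ?thesis by (auto simp: lie_bracket_def field_bracket_def tvec_def)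
  qed
qed

text \<open>Left trivialisation of the tangent bundle, read in c0. Unlike \<open>cofrm\<close> it
  makes no reference to a chart around p, as functions on the whole slit bundle are to be built from
  it.\<close>

definition cof :: "'a \<times> ('a, 'e) tvec \<Rightarrow> 'e" where
  "cof = (\<lambda>(p, v). differential A A (L (inv p)) p v c0)"

lemma cof_chart:
  assumes "v \<in> tangent_space A p" "c \<in> A" "p \<in> fst c"
  shows "cof (p, v) = cofrm c (snd c p) (v c)"
proof -
  have p: "p \<in> carrier G" by (rule chart_carrier[OF assms(2,3)])
  have "differential A A (L (inv p)) p v c0 = jac (L (inv p)) c c0 p (v c)"
    using c0 p by (intro differential_chart[OF atlas atlas smooth_L[OF inv_closed[OF p]] assms]) (auto simp: L_apply)
  then show ?thesis by (simp add: cof_def cofrm_def chart_inv_chart[OF atlas assms(2,3)])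
qed

text \<open>On the group (g p)^-1 g = p^-1, so pulling back after a translation by g is the original
  pull-back.\<close>

lemma cof_left_invariant:
  assumes g: "g \<in> carrier G" and p: "p \<in> carrier G" and v: "v \<in> tangent_space A p"
  shows "cof (tangent_map A (L g) (p, v)) = cof (p, v)"
proof -
  have gp: "g \<otimes> p \<in> carrier G" using g p by simp
  have pp: "p \<in> points A" using p by (simp add: points_carrier)
  obtain c where c: "c \<in> A" "p \<in> fst c" by (rule carrier_chart[OF p])
  have e: "L (inv (g \<otimes> p)) (L g q) = L (inv p) q" if "q \<in> points A" for q
    using that g p by (simp add: L_apply points_carrier inv_mult_group m_assoc)
      (metis inv_closed l_inv l_one m_assoc)
  have "cof (tangent_map A (L g) (p, v)) = differential A A (L (inv (g \<otimes> p))) (L g p) (differential A A (L g) p v) c0"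
    by (simp add: cof_def tangent_map_def L_apply)
  also have "\<dots> = differential A A (\<lambda>q. L (inv (g \<otimes> p)) (L g q)) p v c0"
    by (simp add: differential_compose[OF atlas atlas atlas smooth_L[OF g] smooth_L[OF inv_closed[OF gp]] v pp])
  also have "\<dots> = jac (\<lambda>q. L (inv (g \<otimes> p)) (L g q)) c c0 p (v c)"
    using c0 e[OF pp] p
    by (intro differential_chart[OF atlas atlas smooth_map_compose[OF atlas atlas atlas smooth_L[OF g] smooth_L[OF inv_closed[OF gp]]] v c])
      (auto simp: L_apply)
  also have "\<dots> = jac (L (inv p)) c c0 p (v c)" by (rule fun_cong[OF jac_cong[OF atlas c]]) (rule e)
  also have "\<dots> = differential A A (L (inv p)) p v c0"
    using c0 p by (intro differential_chart[OF atlas atlas smooth_L[OF inv_closed[OF p]] v c, symmetric]) (auto simp: L_apply)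
  finally show ?thesis by (simp add: cof_def)
qed

end

section \<open>Left invariant sprays\<close>

locale left_invariant_spray_chart = lie_group_chart G A c0
  for G :: "('a, 'm) monoid_scheme" (structure) and A :: "('a, 'e::euclidean_space) atlas" and c0 +
  fixes S :: "'a \<times> ('a, 'e) tvec \<Rightarrow> ('a \<times> ('a, 'e) tvec, 'e \<times> 'e) tvec"
    and n :: nat and e :: "nat \<Rightarrow> ('a, 'e) tvec"
  assumes inv_spray: "left_invariant_spray G A S" and basis: "is_basis (lie_algebra G A) n e"
begin

declare One_nat_def [simp del]

lemma spray: "spray_structure A S" using inv_spray by (simp add: left_invariant_spray_def)

lemma e_in: "i \<in> {1..n} \<Longrightarrow> e i \<in> lie_algebra G A" using basis by (simp add: is_basis_def)

lemma e_in': "i \<in> {1..n} \<Longrightarrow> e i \<in> tangent_space A \<one>" using e_in by (simp add: lie_algebra_def)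

section \<open>Coordinates with respect to the basis and the frame\<close>

lemma lin_comb_e: "lin_comb n a e = tvec A \<one> c0 (\<Sum>i=1..n. a i *\<^sub>R e i c0)"
proof -
  have "lin_comb n a e \<in> tangent_space A \<one>"
    by (rule lin_comb_in_tangent_space[OF atlas e_in' one_points])
  from tangent_space_eq_tvec[OF this c0] show ?thesis unfolding lin_comb_def .
qed

lemma basis_expand: "\<exists>a. y = (\<Sum>i=1..n. a i *\<^sub>R e i c0) \<and> (\<forall>i. i \<notin> {1..n} \<longrightarrow> a i = 0)"
proof -
  have "tvec A \<one> c0 y \<in> lie_algebra G A" unfolding lie_algebra_def by (rule tvec_in_tangent_space[OF atlas c0])
  then obtain a where a: "tvec A \<one> c0 y = lin_comb n a e" using basis unfolding is_basis_def by blast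
  have "y = (\<Sum>i=1..n. a i *\<^sub>R e i c0)"
    using arg_cong[OF a, of "\<lambda>v. v c0"] by (simp add: tvec_chart[OF atlas c0] lin_comb_def)
  then show ?thesis by (intro exI[of _ "\<lambda>i. if i \<in> {1..n} then a i else 0"]) simp
qed

lemma basis_unique:
  assumes "(\<Sum>i=1..n. a i *\<^sub>R e i c0) = (\<Sum>i=1..n. b i *\<^sub>R e i c0)" "\<And>i. i \<notin> {1..n} \<Longrightarrow> a i = b i"
  shows "a = b"
proof
  fix i
  have "lin_comb n (\<lambda>i. a i - b i) e = tvec A \<one> c0 0"
    unfolding lin_comb_e using assms(1) by (simp add: scaleR_diff_left sum_subtractf)
  also have "\<dots> = (\<lambda>_. 0)"
    using linear_0[OF bounded_linear.linear[OF tvec_linear[OF atlas c0]]] by (simp add: fun_eq_iff)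
  finally have "\<forall>i\<in>{1..n}. a i - b i = 0" using basis unfolding is_basis_def by blast
  then show "a i = b i" using assms(2) by (cases "i \<in> {1..n}") auto
qed

text \<open>Normalised to vanish outside \<open>{1..n}\<close>, as in \<open>basis_coord\<close>.\<close>

definition crd :: "'e \<Rightarrow> nat \<Rightarrow> real" where
  "crd y = (SOME a. y = (\<Sum>i=1..n. a i *\<^sub>R e i c0) \<and> (\<forall>i. i \<notin> {1..n} \<longrightarrow> a i = 0))"

lemma crd: "(\<Sum>i=1..n. crd y i *\<^sub>R e i c0) = y" "i \<notin> {1..n} \<Longrightarrow> crd y i = 0"
  using someI_ex[OF basis_expand[of y]] unfolding crd_def[symmetric] by auto

lemma crd_eq: "y = (\<Sum>i=1..n. a i *\<^sub>R e i c0) \<Longrightarrow> (\<And>i. i \<notin> {1..n} \<Longrightarrow> a i = 0) \<Longrightarrow> crd y = a"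
  by (rule basis_unique) (simp_all add: crd)

lemma crd_linear: "bounded_linear (\<lambda>y. crd y i)"
proof -
  have "linear (\<lambda>y. crd y i)"
  proof (rule linearI)
    fix y z :: 'e and r :: real
    have "crd (y + z) = (\<lambda>i. crd y i + crd z i)"
      by (rule crd_eq) (simp_all add: crd scaleR_add_left sum.distrib)
    then show "crd (y + z) i = crd y i + crd z i" by simp
    have "r *\<^sub>R y = r *\<^sub>R (\<Sum>i=1..n. crd y i *\<^sub>R e i c0)" by (simp add: crd)
    then have "crd (r *\<^sub>R y) = (\<lambda>i. r * crd y i)"
      by (intro crd_eq) (simp_all add: crd(2) scaleR_sum_right)
    then show "crd (r *\<^sub>R y) i = r *\<^sub>R crd y i" by simp
  qed
  then show ?thesis using linear_conv_bounded_linear by blast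
qed

lemma frame_in: "i \<in> {1..n} \<Longrightarrow> g \<in> carrier G \<Longrightarrow> frame G A e i g \<in> tangent_space A g"
  unfolding frame_def by (rule left_invariant_field_in[OF e_in])

lemma frame_chart:
  "i \<in> {1..n} \<Longrightarrow> c \<in> A \<Longrightarrow> g \<in> fst c \<Longrightarrow> frame G A e i g c = frm c (snd c g) (e i c0)"
  unfolding frame_def by (rule left_invariant_field_chart[OF e_in])

lemma frm_sum:
  assumes "c \<in> A" "x \<in> snd c ` fst c"
  shows "(\<Sum>i=1..n. a i *\<^sub>R frm c x (e i c0)) = frm c x (\<Sum>i=1..n. a i *\<^sub>R e i c0)"
  using bounded_linear.linear[OF frm_linear[OF assms]] by (simp add: linear_sum linear_scale)

text \<open>Pulling back to the identity turns the frame into the basis e, so frame coordinates are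
  basis coordinates of the pulled back vector. The normalisation off {1..n} makes the definite
  description in \<open>basis_coord\<close> unique.\<close>

lemma frame_coord_chart:
  assumes p: "c \<in> A" "p \<in> fst c" and v: "v \<in> tangent_space A p"
  shows "frame_coord G A n e i (p, v) = crd (cofrm c (snd c p) (v c)) i"
proof -
  have x: "snd c p \<in> snd c ` fst c" using p by simp
  have pG: "p \<in> carrier G" by (rule chart_carrier[OF p])
  have pp: "p \<in> points A" using pG by (simp add: points_carrier)
  let ?F = "\<lambda>a. lin_comb n a (\<lambda>j. frame G A e j p)"
  have Fc: "?F a c = frm c (snd c p) (\<Sum>i=1..n. a i *\<^sub>R e i c0)" for a
    unfolding frm_sum[OF p(1) x, symmetric] lin_comb_def by (rule sum.cong) (simp_all add: frame_chart[OF _ p])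
  have FT: "?F a \<in> tangent_space A p" for a
    by (rule lin_comb_in_tangent_space[OF atlas frame_in[OF _ pG] pp])
  have iff: "v = ?F a \<longleftrightarrow> cofrm c (snd c p) (v c) = (\<Sum>i=1..n. a i *\<^sub>R e i c0)" for a
  proof
    assume va: "v = ?F a"
    show "cofrm c (snd c p) (v c) = (\<Sum>i=1..n. a i *\<^sub>R e i c0)"
      unfolding va Fc by (rule cofrm_frm[OF p(1) x])
  next
    assume "cofrm c (snd c p) (v c) = (\<Sum>i=1..n. a i *\<^sub>R e i c0)"
    then have "v c = ?F a c" using frm_cofrm[OF p(1) x, of "v c"] unfolding Fc by metis
    then show "v = ?F a" by (rule tangent_space_eqI[OF v FT p])
  qed
  have "basis_coord n (\<lambda>j. frame G A e j p) v = crd (cofrm c (snd c p) (v c))"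
    unfolding basis_coord_def iff
  proof (rule the_equality)
    show "cofrm c (snd c p) (v c) = (\<Sum>i=1..n. crd (cofrm c (snd c p) (v c)) i *\<^sub>R e i c0) \<and>
      (\<forall>i. i \<notin> {1..n} \<longrightarrow> crd (cofrm c (snd c p) (v c)) i = 0)" by (simp add: crd)
  next
    fix a assume "cofrm c (snd c p) (v c) = (\<Sum>i=1..n. a i *\<^sub>R e i c0) \<and> (\<forall>i. i \<notin> {1..n} \<longrightarrow> a i = 0)"
    then have "crd (cofrm c (snd c p) (v c)) = a" by (intro crd_eq) blast+
    then show "a = crd (cofrm c (snd c p) (v c))" ..
  qed
  then show ?thesis by (simp add: frame_coord_def)
qed

section \<open>The spray and its decomposition in coordinates\<close>

lemma slit_bundle_obtain_chart:
  assumes "(p, v) \<in> points (slit_bundle A)" obtains c where "c \<in> A" "p \<in> fst c"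
proof -
  have "p \<in> carrier G" using assms by (simp add: points_slit_bundle points_carrier)
  then show ?thesis by (rule carrier_chart) (rule that)
qed

lemma slit_bundle_chart:
  assumes "(p, v) \<in> points (slit_bundle A)" "c \<in> A" "p \<in> fst c"
  shows "v \<in> tangent_space A p" "v c \<noteq> 0" "(p, v) \<in> fst (slit_chart A c)" "snd c p \<in> snd c ` fst c"
  using assms slit_tangent_space_iff[OF atlas assms(2,3)] by (auto simp: points_slit_bundle slit_chart_simps)

text \<open>The complete lift of a frame field has second component
  \<open>dfrm c x (e i c0) (v c)\<close>. The coordinates u^i are coefficients at the point and are
  not differentiated, so linearity of \<open>dfrm\<close> in the frame vector collects them into
  u.\<close>

lemma canonical_spray_chart:
  assumes q: "(p, v) \<in> points (slit_bundle A)" and c: "c \<in> A" "p \<in> fst c"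
  shows "canonical_spray G A n e (p, v) (slit_chart A c) = (v c, dfrm c (snd c p) (cofrm c (snd c p) (v c)) (v c))"
proof -
  note q' = slit_bundle_chart[OF q c]
  let ?x = "snd c p"
  let ?a = "\<lambda>i. crd (cofrm c ?x (v c)) i"
  have lift: "complete_lift A (frame G A e i) (p, v) (slit_chart A c) = (frm c ?x (e i c0), dfrm c ?x (e i c0) (v c))"
    if i: "i \<in> {1..n}" for i
    using slit_chart_in[OF c(1)] q'(3) frame_chart[OF i c] field_rep_left_invariant_derivative[OF e_in[OF i] c(1) q'(4)]
    by (simp add: complete_lift_def inv_into_f_f[OF inj_slit_chart c(1)] frame_def)
  have "canonical_spray G A n e (p, v) (slit_chart A c) = (\<Sum>i=1..n. ?a i *\<^sub>R (frm c ?x (e i c0), dfrm c ?x (e i c0) (v c)))"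
    unfolding canonical_spray_def lin_comb_def by (rule sum.cong) (simp_all add: lift frame_coord_chart[OF c q'(1)])
  also have "\<dots> = (\<Sum>i=1..n. ?a i *\<^sub>R frm c ?x (e i c0), \<Sum>i=1..n. ?a i *\<^sub>R dfrm c ?x (e i c0) (v c))"
    by (simp add: prod_eq_iff fst_sum snd_sum)
  also have "(\<Sum>i=1..n. ?a i *\<^sub>R frm c ?x (e i c0)) = v c"
    by (simp add: frm_sum[OF c(1) q'(4)] crd frm_cofrm[OF c(1) q'(4)])
  also have "(\<Sum>i=1..n. ?a i *\<^sub>R dfrm c ?x (e i c0) (v c)) = dfrm c ?x (\<Sum>i=1..n. ?a i *\<^sub>R e i c0) (v c)"
    by (simp only: linear_sum[OF dfrm_linear_field[OF c(1) q'(4)]] linear_scale[OF dfrm_linear_field[OF c(1) q'(4)]])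
  finally show ?thesis by (simp add: crd)
qed

text \<open>A vertical frame field is the velocity of a line inside the fibre, so its base component
  is 0.\<close>

lemma vertical_chart:
  assumes q: "(p, v) \<in> points (slit_bundle A)" and c: "c \<in> A" "p \<in> fst c"
  shows "lin_comb n h (\<lambda>i. frame_vertical G A e i (p, v)) (slit_chart A c) = (0, frm c (snd c p) (\<Sum>i=1..n. h i *\<^sub>R e i c0))"
proof -
  note q' = slit_bundle_chart[OF q c]
  have vert: "frame_vertical G A e i (p, v) (slit_chart A c) = (0, frm c (snd c p) (e i c0))" if i: "i \<in> {1..n}" for i
  proof -
    have "((\<lambda>s. (snd c p, v c + s *\<^sub>R frame G A e i p c)) has_vector_derivative (0, frame G A e i p c)) (at 0)"
      by (intro has_vector_derivative_Pair) (auto intro!: derivative_eq_intros)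
    from vector_derivative_at[OF this] show ?thesis
      using slit_chart_in[OF c(1)] q'(3) frame_chart[OF i c]
      by (simp add: frame_vertical_def velocity_def slit_chart_simps)
  qed
  have "lin_comb n h (\<lambda>i. frame_vertical G A e i (p, v)) (slit_chart A c) = (\<Sum>i=1..n. h i *\<^sub>R (0, frm c (snd c p) (e i c0)))"
    unfolding lin_comb_def by (rule sum.cong) (simp_all add: vert)
  also have "\<dots> = (0, \<Sum>i=1..n. h i *\<^sub>R frm c (snd c p) (e i c0))"
    by (simp add: prod_eq_iff fst_sum snd_sum)
  finally show ?thesis by (simp add: frm_sum[OF c(1) q'(4)])
qed

text \<open>At the identity the vertical part of the canonical spray is \<open>dfrm c0 x0 u u\<close>, so \<open>\<eta>\<close> is the
  spray vector field in the coordinates \<open>c0\<close>, read off the values of \<open>S\<close> over the identity alone.\<close>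

definition \<sigma> :: "'e \<Rightarrow> 'e" where
  "\<sigma> u = snd (S (\<one>, tvec A \<one> c0 u) (slit_chart A c0))"

definition \<eta> :: "'e \<Rightarrow> 'e" where "\<eta> u = dfrm c0 x0 u u - \<sigma> u"

lemma one_slit: "u \<noteq> 0 \<Longrightarrow> (\<one>, tvec A \<one> c0 u) \<in> points (slit_bundle A)"
  by (simp add: points_slit_bundle one_points tvec_slit[OF atlas c0])

lemma spray_in: "q \<in> points (slit_bundle A) \<Longrightarrow> S q \<in> tangent_space (slit_bundle A) q"
  using spray by (simp add: spray_structure_def smooth_vector_field_def)

lemma spray_fst: "c \<in> A \<Longrightarrow> p \<in> fst c \<Longrightarrow> v \<in> slit_tangent_space A p \<Longrightarrow> fst (S (p, v) (slit_chart A c)) = v c"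
  using spray by (simp add: spray_structure_def)

lemma left_translation_bundle_eq: "left_translation_bundle G A g = tangent_map A (L g)"
  by (simp add: left_translation_bundle_def tangent_map_def)

text \<open>Left invariance transports the value of S over the identity by the tangent map of the
  translation by p. Its Jacobian contributes a second derivative of the translation, which
  \<open>dfrm_trl\<close> converts into derivatives of the frame at p and at the identity; the
  latter is what \<eta> corrects for.\<close>

lemma spray_chart:
  assumes q: "(p, v) \<in> points (slit_bundle A)" and c: "c \<in> A" "p \<in> fst c"
  defines "u \<equiv> cofrm c (snd c p) (v c)"
  shows "S (p, v) (slit_chart A c) = (v c, dfrm c (snd c p) u (v c) - frm c (snd c p) (\<eta> u))"
proof -
  note q' = slit_bundle_chart[OF q c]
  let ?x = "snd c p"
  have p: "p \<in> carrier G" by (rule chart_carrier[OF c])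
  have vu: "v c = frm c ?x u" by (simp add: u_def frm_cofrm[OF c(1) q'(4)])
  have u: "u \<noteq> 0" using q'(2) linear_0[OF bounded_linear.linear[OF frm_linear[OF c(1) q'(4)]]] unfolding vu by auto
  let ?q = "(\<one>, tvec A \<one> c0 u)"
  have uT: "tvec A \<one> c0 u \<in> tangent_space A \<one>" by (rule tvec_in_tangent_space[OF atlas c0])
  have uS: "tvec A \<one> c0 u \<in> slit_tangent_space A \<one>" by (rule tvec_slit[OF atlas c0 u])
  have L1: "L p \<one> = p" using p by (simp add: L_apply)
  have jacp: "jac (L p) c0 c \<one> = frm c ?x" by (simp add: frm_def chart_inv_chart[OF atlas c])
  have "differential A A (L p) \<one> (tvec A \<one> c0 u) = v"
  proof (rule tangent_space_eqI[OF _ q'(1) c])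
    show "differential A A (L p) \<one> (tvec A \<one> c0 u) \<in> tangent_space A p"
      using differential_in_tangent_space[OF atlas atlas smooth_L[OF p] uT one_points] by (simp add: L1)
    show "differential A A (L p) \<one> (tvec A \<one> c0 u) c = v c"
      using c by (simp add: differential_chart[OF atlas atlas smooth_L[OF p] uT c0] L1 jacp tvec_chart[OF atlas c0] vu)
  qed
  then have pv: "tangent_map A (L p) ?q = (p, v)" by (simp add: tangent_map_def L1)
  have SB: "smooth_atlas (slit_bundle A)" by (rule smooth_atlas_slit_bundle[OF atlas])
  have sm: "smooth_map (slit_bundle A) (slit_bundle A) (tangent_map A (L p))"
    by (rule smooth_map_tangent_map[OF atlas smooth_L[OF p] smooth_L[OF inv_closed[OF p]] L_inv[OF p]])
  have Sq: "S (p, v) = differential (slit_bundle A) (slit_bundle A) (tangent_map A (L p)) ?q (S ?q)"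
    using inv_spray p one_slit[OF u] unfolding left_invariant_spray_def left_translation_bundle_eq by (metis pv)
  have "S (p, v) (slit_chart A c) = differential (slit_bundle A) (slit_bundle A) (tangent_map A (L p)) ?q (S ?q) (slit_chart A c)"
    by (rule fun_cong[OF Sq])
  also have "\<dots> = jac (tangent_map A (L p)) (slit_chart A c0) (slit_chart A c) ?q (S ?q (slit_chart A c0))"
  proof (rule differential_chart[OF SB SB sm spray_in[OF one_slit[OF u]] slit_chart_in[OF c0(1)] _ slit_chart_in[OF c(1)]])
    show "?q \<in> fst (slit_chart A c0)" using c0 uS by (simp add: slit_chart_simps)
    show "tangent_map A (L p) ?q \<in> fst (slit_chart A c)" unfolding pv by (rule q'(3))
  qed
  also have "S ?q (slit_chart A c0) = (u, \<sigma> u)"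
    using spray_fst[OF c0 uS] by (simp add: prod_eq_iff \<sigma>_def tvec_chart[OF atlas c0])
  also have "jac (tangent_map A (L p)) (slit_chart A c0) (slit_chart A c) ?q (u, \<sigma> u) =
     (frm c ?x u, frechet_derivative (\<lambda>x. frechet_derivative (trl c p) (at x) u) (at x0) u + frm c ?x (\<sigma> u))"
    using tangent_map_jac[OF atlas smooth_L[OF p] c0 c(1) _ uS refl, of u "\<sigma> u"] c
    by (simp add: L1 jacp tvec_chart[OF atlas c0] x0_def trl_def)
  also have "frechet_derivative (\<lambda>x. frechet_derivative (trl c p) (at x) u) (at x0) u + frm c ?x (\<sigma> u) = dfrm c ?x u (v c) - frm c ?x (\<eta> u)"
    using dfrm_trl[OF c, of u u] linear_diff[OF bounded_linear.linear[OF frm_linear[OF c(1) q'(4)]], of "dfrm c0 x0 u u" "\<sigma> u"]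
    by (simp add: vu \<eta>_def)
  finally show ?thesis by (simp add: vu)
qed

lemma open_slit: "open (- {0 :: 'e})" by (intro open_Compl closed_singleton)

lemma \<eta>_smooth: "smooth_on (- {0}) \<eta>"
proof -
  let ?C = "slit_chart A c0"
  have oC: "open (snd ?C ` fst ?C)"
    by (rule smooth_atlas_open[OF smooth_atlas_slit_bundle[OF atlas] slit_chart_in[OF c0(1)]])
  have sub: "Pair x0 ` (- {0}) \<subseteq> snd ?C ` fst ?C" unfolding slit_chart_image[OF atlas c0(1)] using x0(1) by auto
  have S: "smooth_on (snd ?C ` fst ?C) (field_rep S ?C)"
    using spray slit_chart_in[OF c0(1)] unfolding spray_structure_def smooth_vector_field_def by blast
  have "smooth_on (- {0}) (\<lambda>y. snd (field_rep S ?C (x0, y)))"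
    by (intro smooth_on_linear_compose[OF bounded_linear_snd open_slit] smooth_on_compose[OF open_slit _ S oC sub]
       smooth_on_Pair open_slit smooth_on_const smooth_on_id)
  then have \<sigma>: "smooth_on (- {0}) \<sigma>"
    by (rule smooth_on_congI[OF _ open_slit]) (simp add: \<sigma>_def field_rep_def chart_inv_slit[OF atlas c0(1) x0(1)] x0(2))
  \<comment> \<open>The quadratic term is a linear family evaluated at its own parameter.\<close>
  have "smooth_on (- {0}) (\<lambda>u. (\<lambda>u v. dfrm c0 x0 v u) u u)"
  proof (rule smooth_on_linear_family[OF open_slit, where L="\<lambda>u v. dfrm c0 x0 v u"])
    show "bounded_linear (\<lambda>v. dfrm c0 x0 v u)" for u
      using dfrm_linear_field[OF c0(1) x0(1)] linear_conv_bounded_linear by blast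
    show "smooth_on (- {0}) (\<lambda>u. dfrm c0 x0 v u)" for v
      by (rule smooth_on_linear[OF dfrm_linear[OF c0(1) x0(1)]])
  qed (rule smooth_on_id)
  then have "smooth_on (- {0}) (\<lambda>u. dfrm c0 x0 u u - \<sigma> u)" by (intro smooth_on_diff open_slit \<sigma>)
  then show ?thesis by (simp add: \<eta>_def[abs_def])
qed

text \<open>\<open>\<sigma>\<close> is -2 times the spray coefficient over the identity, and the
  correction \<open>dfrm c0 x0 u u\<close> is quadratic in u.\<close>

lemma \<eta>_homogeneous: assumes "r > 0" "u \<noteq> 0" shows "\<eta> (r *\<^sub>R u) = r\<^sup>2 *\<^sub>R \<eta> u"
proof -
  have "spray_coeff A S c0 x0 (r *\<^sub>R u) = r\<^sup>2 *\<^sub>R spray_coeff A S c0 x0 u"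
    using spray assms c0(1) x0(1) unfolding spray_structure_def by blast
  moreover have "spray_coeff A S c0 x0 u = - (1/2) *\<^sub>R \<sigma> u" if "u \<noteq> 0" for u
    by (simp add: spray_coeff_def chart_inv_slit[OF atlas c0(1) x0(1) that] x0(2) \<sigma>_def)
  ultimately have "- (1/2) *\<^sub>R \<sigma> (r *\<^sub>R u) = r\<^sup>2 *\<^sub>R (- (1/2) *\<^sub>R \<sigma> u)" using assms by simp
  then have "- (1/2) *\<^sub>R \<sigma> (r *\<^sub>R u) = - (1/2) *\<^sub>R (r\<^sup>2 *\<^sub>R \<sigma> u)" by (rule trans[OF _ scaleR_left_commute])
  then have "\<sigma> (r *\<^sub>R u) = r\<^sup>2 *\<^sub>R \<sigma> u" by (simp only: scaleR_cancel_left) simp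
  moreover have "dfrm c0 x0 (r *\<^sub>R u) (r *\<^sub>R u) = r\<^sup>2 *\<^sub>R dfrm c0 x0 u u"
    using linear_scale[OF dfrm_linear_field[OF c0(1) x0(1)]] linear_scale[OF bounded_linear.linear[OF dfrm_linear[OF c0(1) x0(1)]]]
    by (simp add: power2_eq_square)
  ultimately show ?thesis by (simp add: \<eta>_def scaleR_diff_right)
qed

lemma cof_nonzero:
  assumes "(p, v) \<in> points (slit_bundle A)" shows "cof (p, v) \<noteq> 0"
proof -
  obtain c where c: "c \<in> A" "p \<in> fst c" by (rule slit_bundle_obtain_chart[OF assms])
  note q' = slit_bundle_chart[OF assms c]
  show ?thesis
    using frm_cofrm[OF c(1) q'(4), of "v c"] q'(2) linear_0[OF bounded_linear.linear[OF frm_linear[OF c(1) q'(4)]]]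
    by (auto simp: cof_chart[OF q'(1) c])
qed

text \<open>The functions H^i: basis coordinates of \<eta>, made left invariant by composing with
  the trivialisation \<open>cof\<close>.\<close>

definition coeff :: "nat \<Rightarrow> 'a \<times> ('a, 'e) tvec \<Rightarrow> real" where
  "coeff i q = crd (\<eta> (cof q)) i"

lemma coeff_smooth: "smooth_map (slit_bundle A) (euclidean_atlas UNIV) (coeff i)"
proof (rule smooth_mapI[OF smooth_atlas_slit_bundle[OF atlas] smooth_atlas_euclidean[OF open_UNIV]])
  fix q assume q: "q \<in> points (slit_bundle A)"
  obtain p v where pv: "q = (p, v)" by (cases q)
  obtain c where c: "c \<in> A" "p \<in> fst c" by (rule slit_bundle_obtain_chart[OF q[unfolded pv]])
  note q' = slit_bundle_chart[OF q[unfolded pv] c]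
  let ?I = "snd c ` fst c"
  have oI: "open (?I \<times> - {0 :: 'e})" by (rule open_Times_slit[OF smooth_atlas_open[OF atlas c(1)]])
  have nz: "cofrm c x y \<noteq> 0" if "x \<in> ?I" "y \<noteq> 0" for x y
    using frm_cofrm[OF c(1) that(1), of y] that(2) linear_0[OF bounded_linear.linear[OF frm_linear[OF c(1) that(1)]]] by auto
  have cof: "smooth_on (?I \<times> - {0}) (\<lambda>z. cofrm c (fst z) (snd z))"
  proof (rule smooth_on_linear_family[OF oI, where L="\<lambda>z. cofrm c (fst z)"])
    show "bounded_linear (cofrm c (fst z))" if "z \<in> ?I \<times> - {0 :: 'e}" for z
      using cofrm_linear[OF c(1), of "fst z"] that by auto
    show "smooth_on (?I \<times> - {0}) (\<lambda>z::'e \<times> 'e. cofrm c (fst z) v)" for v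
      by (rule smooth_on_compose[OF oI smooth_on_fst cofrm_smooth[OF c(1)] smooth_atlas_open[OF atlas c(1)]]) auto
  qed (rule smooth_on_snd)
  have "smooth_on (?I \<times> - {0}) (\<lambda>z. \<eta> (cofrm c (fst z) (snd z)))"
  proof (rule smooth_on_compose[OF oI cof \<eta>_smooth open_slit], rule image_subsetI)
    fix z assume "z \<in> ?I \<times> - {0 :: 'e}"
    then have "cofrm c (fst z) (snd z) \<noteq> 0" by (intro nz) auto
    then show "cofrm c (fst z) (snd z) \<in> - {0}" by simp
  qed
  then have sm: "smooth_on (?I \<times> - {0}) (\<lambda>z. crd (\<eta> (cofrm c (fst z) (snd z))) i)"
    by (rule smooth_on_linear_compose[OF crd_linear oI])
  have "smooth_on (?I \<times> - {0}) (\<lambda>z. coeff i (chart_inv (slit_chart A c) z))"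
  proof (rule smooth_on_congI[OF sm oI])
    fix z assume "z \<in> ?I \<times> - {0 :: 'e}"
    then obtain x y where z: "z = (x, y)" "x \<in> ?I" "y \<noteq> 0" by auto
    note ci = chart_inv_in[OF z(2)]
    show "coeff i (chart_inv (slit_chart A c) z) = crd (\<eta> (cofrm c (fst z) (snd z))) i"
      using cof_chart[OF tvec_in_tangent_space[OF atlas c(1) ci(1)] c(1) ci(1)]
      by (simp add: z(1) chart_inv_slit[OF atlas c(1) z(2,3)] coeff_def ci tvec_chart[OF atlas c(1) ci(1)])
  qed
  then show "\<exists>C d V. C \<in> slit_bundle A \<and> d \<in> euclidean_atlas UNIV \<and> q \<in> fst C \<and> open V \<and> snd C q \<in> V \<and> V \<subseteq> snd C ` fst C \<and>
     (\<forall>x\<in>V. coeff i (chart_inv C x) \<in> fst d) \<and> smooth_on V (\<lambda>x. snd d (coeff i (chart_inv C x)))"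
    using slit_chart_in[OF c(1)] oI q'(2-4)
    by (intro exI[of _ "slit_chart A c"] exI[of _ "(UNIV, \<lambda>x. x)"] exI[of _ "?I \<times> - {0}"])
      (simp add: euclidean_atlas_def slit_chart_image[OF atlas c(1)] pv slit_chart_simps)
qed

text \<open>\<open>spray_vector_field\<close> chooses a decomposition, so one has to exist. In slit
  charts around q it is a comparison of the three local expressions; at every other index all terms
  are 0 by the encoding of tangent vectors.\<close>

lemma spray_decomposition_exists: "spray_decomposition G A n e S coeff"
  unfolding spray_decomposition_def
proof (intro conjI ballI allI)
  show "smooth_map (slit_bundle A) (euclidean_atlas UNIV) (coeff i)" for i by (rule coeff_smooth)
next
  fix i g q assume g: "g \<in> carrier G" and q: "q \<in> points (slit_bundle A)"
  obtain p v where pv: "q = (p, v)" by (cases q)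
  have p: "p \<in> carrier G" and v: "v \<in> tangent_space A p"
    using q by (simp_all add: pv points_slit_bundle points_carrier slit_tangent_in)
  show "coeff i (left_translation_bundle G A g q) = coeff i q"
    using cof_left_invariant[OF g p v] by (simp add: left_translation_bundle_eq coeff_def pv)
next
  fix i q assume q: "q \<in> points (slit_bundle A)"
  obtain p v where pv: "q = (p, v)" by (cases q)
  obtain c where c: "c \<in> A" "p \<in> fst c" by (rule slit_bundle_obtain_chart[OF q[unfolded pv]])
  note q' = slit_bundle_chart[OF q[unfolded pv] c]
  have pp: "p \<in> points A" using q by (simp add: pv points_slit_bundle)
  have "coeff i (p, \<lambda>d. r *\<^sub>R v d) = r\<^sup>2 * coeff i (p, v)" if r: "r > 0" for r
  proof -
    have "cof (p, \<lambda>d. r *\<^sub>R v d) = r *\<^sub>R cof (p, v)"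
      using linear_scale[OF bounded_linear.linear[OF cofrm_linear[OF c(1) q'(4)]], of r "v c"]
      by (simp add: cof_chart[OF tangent_space_scale[OF atlas q'(1) pp] c] cof_chart[OF q'(1) c])
    then have "\<eta> (cof (p, \<lambda>d. r *\<^sub>R v d)) = r\<^sup>2 *\<^sub>R \<eta> (cof (p, v))"
      using \<eta>_homogeneous[OF r cof_nonzero] q pv by simp
    then show ?thesis
      using linear_scale[OF bounded_linear.linear[OF crd_linear[of i]], of "r\<^sup>2" "\<eta> (cof (p, v))"] by (simp add: coeff_def)
  qed
  then show "case q of (p, v) \<Rightarrow> \<forall>r>0. coeff i (p, \<lambda>d. r *\<^sub>R v d) = r\<^sup>2 * coeff i (p, v)" by (simp add: pv)
next
  fix q D assume q: "q \<in> points (slit_bundle A)"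
  obtain p v where pv: "q = (p, v)" by (cases q)
  show "S q D = canonical_spray G A n e q D - lin_comb n (\<lambda>i. coeff i q) (\<lambda>i. frame_vertical G A e i q) D"
  proof (cases "D \<in> slit_bundle A \<and> q \<in> fst D")
    case True
    then obtain c where c: "D = slit_chart A c" "c \<in> A" "p \<in> fst c"
      by (auto simp: slit_bundle_def pv slit_chart_simps)
    note q' = slit_bundle_chart[OF q[unfolded pv] c(2,3)]
    show ?thesis
      using spray_chart[OF q[unfolded pv] c(2,3)] canonical_spray_chart[OF q[unfolded pv] c(2,3)] vertical_chart[OF q[unfolded pv] c(2,3)]
      by (simp add: c(1) pv coeff_def crd cof_chart[OF q'(1) c(2,3)])
  next
    case False
    have "complete_lift A X q D = 0" for X using False by (auto simp: complete_lift_def)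
    moreover have "frame_vertical G A e i q D = 0" for i
      using False by (auto simp: frame_vertical_def velocity_def pv)
    moreover have "S q D = 0" by (rule tangent_space_outside[OF spray_in[OF q]]) (use False in blast)
    ultimately show ?thesis by (simp add: canonical_spray_def lin_comb_def)
  qed
qed

text \<open>Whichever H is chosen, every other term of the decomposition over the identity is known,
  and the equation there forces the sum of the H^i e_i to be \<eta>.\<close>

lemma spray_vector_field_tvec:
  assumes y: "y \<in> slit_tangent_space A \<one>"
  shows "spray_vector_field G A n e S y = tvec A \<one> c0 (\<eta> (y c0))"
proof -
  define H where "H = (SOME H. spray_decomposition G A n e S H)"
  have H: "spray_decomposition G A n e S H"
    unfolding H_def by (rule someI[of "\<lambda>H. spray_decomposition G A n e S H", OF spray_decomposition_exists])
  have q: "(\<one>, y) \<in> points (slit_bundle A)" using y one_points by (simp add: points_slit_bundle)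
  note q' = slit_bundle_chart[OF q c0]
  have cy: "cofrm c0 x0 (y c0) = y c0" using cofrm_frm[OF c0(1) x0(1), of "y c0"] by (simp add: frm_x0)
  have "S (\<one>, y) (slit_chart A c0) = canonical_spray G A n e (\<one>, y) (slit_chart A c0)
                - lin_comb n (\<lambda>i. H i (\<one>, y)) (\<lambda>i. frame_vertical G A e i (\<one>, y)) (slit_chart A c0)"
    using H q unfolding spray_decomposition_def by blast
  then have "(\<Sum>i=1..n. H i (\<one>, y) *\<^sub>R e i c0) = \<eta> (y c0)"
    unfolding spray_chart[OF q c0] canonical_spray_chart[OF q c0] vertical_chart[OF q c0]
    by (simp add: x0_def[symmetric] frm_x0 cy)
  then show ?thesis
    unfolding spray_vector_field_def Let_def H_def[symmetric] lin_comb_e by simp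
qed

section \<open>The connection operator and the coefficients N in coordinates\<close>

definition connop :: "'e \<Rightarrow> 'e \<Rightarrow> 'e" where
  "connop u w = (1/2) *\<^sub>R frechet_derivative \<eta> (at u) w - (1/2) *\<^sub>R brk u w"

lemma connection_operator_tvec:
  assumes y: "y \<in> slit_tangent_space A \<one>" and w: "w \<in> lie_algebra G A"
  shows "connection_operator G A n e S y w = tvec A \<one> c0 (connop (y c0) (w c0))"
proof
  fix d
  have yT: "y \<in> lie_algebra G A" using slit_tangent_in[OF y] by (simp add: lie_algebra_def)
  have y0: "y c0 \<noteq> 0" using y slit_tangent_space_iff[OF atlas c0] by simp
  let ?T = "\<lambda>z. tvec A \<one> c0 z d"
  have bl: "bounded_linear ?T" by (rule tvec_linear[OF atlas c0])
  define J where "J = (\<lambda>s. y c0 + s *\<^sub>R w c0) -` (- {0})"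
  have J: "open J" unfolding J_def by (intro continuous_open_vimage open_slit) (auto intro!: continuous_intros)
  have J0: "0 \<in> J" using y0 by (simp add: J_def)
  have eq: "?T (\<eta> (y c0 + s *\<^sub>R w c0)) = spray_vector_field G A n e S (\<lambda>c. y c + s *\<^sub>R w c) d" if "s \<in> J" for s
  proof -
    have "(\<lambda>c. y c + s *\<^sub>R w c) \<in> slit_tangent_space A \<one>"
      unfolding slit_tangent_space_iff[OF atlas c0]
      using that tangent_space_add[OF atlas slit_tangent_in[OF y] w[unfolded lie_algebra_def] one_points, of s] by (simp add: J_def)
    then show ?thesis by (simp add: spray_vector_field_tvec)
  qed
  have "((\<lambda>s. y c0 + s *\<^sub>R w c0) has_vector_derivative w c0) (at 0)" by (auto intro!: derivative_eq_intros)
  moreover have "\<eta> differentiable (at (y c0 + 0 *\<^sub>R w c0))"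
    using smooth_on_differentiable[OF \<eta>_smooth] y0 by simp
  ultimately have "((\<lambda>s. \<eta> (y c0 + s *\<^sub>R w c0)) has_vector_derivative frechet_derivative \<eta> (at (y c0 + 0 *\<^sub>R w c0)) (w c0)) (at 0)"
    by (rule has_vector_derivative_chain)
  then have "((\<lambda>s. \<eta> (y c0 + s *\<^sub>R w c0)) has_vector_derivative frechet_derivative \<eta> (at (y c0)) (w c0)) (at 0)" by simp
  from bounded_linear.has_vector_derivative[OF bl this]
  have "((\<lambda>s. spray_vector_field G A n e S (\<lambda>c. y c + s *\<^sub>R w c) d) has_vector_derivative ?T (frechet_derivative \<eta> (at (y c0)) (w c0))) (at 0)"
    by (rule has_vector_derivative_transform_within_open[OF _ J J0 eq])
  from vector_derivative_at[OF this] show "connection_operator G A n e S y w d = tvec A \<one> c0 (connop (y c0) (w c0)) d"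
    by (simp add: connection_operator_def lie_bracket_tvec[OF yT w] connop_def
        linear_diff[OF bounded_linear.linear[OF bl]] linear_scale[OF bounded_linear.linear[OF bl]])
qed

text \<open>The product rule for the bilinear term of the spray coefficient, in which u = F(x)^-1 y
  also depends on y, gives both orders of u and w. Together with the derivative of a field along the
  curve, only their difference will remain.\<close>

lemma spray_N_chart:
  assumes c: "c \<in> A" and x: "x \<in> snd c ` fst c" and u: "u \<noteq> 0"
  shows "spray_N A S c x (frm c x u) (frm c x w) =
    (1/2) *\<^sub>R (frm c x (frechet_derivative \<eta> (at u) w) - dfrm c x w (frm c x u) - dfrm c x u (frm c x w))"
proof -
  let ?K = "cofrm c x" and ?y = "frm c x u"
  have K: "bounded_linear ?K" by (rule cofrm_linear[OF c x])
  have F: "bounded_linear (frm c x)" by (rule frm_linear[OF c x])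
  have y0: "?y \<in> - {0}" using u cofrm_frm[OF c x, of u] linear_0[OF bounded_linear.linear[OF K]] by auto
  have coeff: "- (1/2) *\<^sub>R (dfrm c x (?K y) y - frm c x (\<eta> (?K y))) = spray_coeff A S c x y" if "y \<in> - {0}" for y
  proof -
    have y: "y \<noteq> 0" using that by simp
    note ci = chart_inv_in[OF x]
    have "(chart_inv c x, tvec A (chart_inv c x) c y) \<in> points (slit_bundle A)"
      using tvec_slit[OF atlas c ci(1) y] chart_inv_carrier[OF c x] by (simp add: points_slit_bundle points_carrier)
    from spray_chart[OF this c ci(1)] show ?thesis
      by (simp add: spray_coeff_def chart_inv_slit[OF atlas c x y] tvec_chart[OF atlas c ci(1)] ci(2))
  qed
  have bb: "bounded_bilinear (dfrm c x)"
    unfolding bilinear_conv_bounded_bilinear[symmetric] bilinear_def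
    using dfrm_linear_field[OF c x] bounded_linear.linear[OF dfrm_linear[OF c x]] by auto
  have 1: "((\<lambda>y. dfrm c x (?K y) y) has_derivative (\<lambda>h. dfrm c x (?K ?y) h + dfrm c x (?K h) ?y)) (at ?y)"
    by (rule bounded_bilinear.FDERIV[OF bb bounded_linear_imp_has_derivative[OF K] has_derivative_ident])
  have "(\<eta> has_derivative frechet_derivative \<eta> (at u)) (at (?K ?y))"
    using smooth_on_has_derivative[OF \<eta>_smooth] u by (simp add: cofrm_frm[OF c x])
  from bounded_linear.has_derivative[OF F has_derivative_compose[OF bounded_linear_imp_has_derivative[OF K] this]]
  have 2: "((\<lambda>y. frm c x (\<eta> (?K y))) has_derivative (\<lambda>h. frm c x (frechet_derivative \<eta> (at u) (?K h)))) (at ?y)" .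
  have "((\<lambda>y. - (1/2) *\<^sub>R (dfrm c x (?K y) y - frm c x (\<eta> (?K y)))) has_derivative
     (\<lambda>h. - (1/2) *\<^sub>R ((dfrm c x (?K ?y) h + dfrm c x (?K h) ?y) - frm c x (frechet_derivative \<eta> (at u) (?K h))))) (at ?y)"
    by (intro bounded_linear.has_derivative[OF bounded_linear_scaleR_right] has_derivative_diff 1 2)
  then have "(spray_coeff A S c x has_derivative
     (\<lambda>h. - (1/2) *\<^sub>R ((dfrm c x (?K ?y) h + dfrm c x (?K h) ?y) - frm c x (frechet_derivative \<eta> (at u) (?K h))))) (at ?y)"
    by (rule has_derivative_transform_within_open[OF _ open_slit y0 coeff])
  from has_derivative_frechet_eq[OF this]
  have "spray_N A S c x ?y (frm c x w) = - (1/2) *\<^sub>R ((dfrm c x u (frm c x w) + dfrm c x w ?y) - frm c x (frechet_derivative \<eta> (at u) w))"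
    by (simp add: spray_N_def cofrm_frm[OF c x])
  then show ?thesis by (simp add: algebra_simps)
qed

end

section \<open>One-parameter subgroups\<close>

context lie_group_chart
begin

lemma frm_natural:
  assumes c: "c \<in> A" "h \<in> fst c" and d: "d \<in> A" "g \<otimes> h \<in> fst d" and g: "g \<in> carrier G"
  shows "frm d (snd d (g \<otimes> h)) u = jac (L g) c d h (frm c (snd c h) u)"
proof -
  have h: "h \<in> carrier G" by (rule chart_carrier[OF c])
  have Lh: "L h \<one> \<in> fst c" "L g (L h \<one>) \<in> fst d" using h c d by (simp_all add: L_apply)
  have "jac (L (g \<otimes> h)) c0 d \<one> u = jac (\<lambda>q. L g (L h q)) c0 d \<one> u"
    using jac_cong[OF atlas c0, of "L (g \<otimes> h)" "\<lambda>q. L g (L h q)" d] g h by (simp add: L_apply points_carrier m_assoc)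
  also have "\<dots> = jac (L g) c d (L h \<one>) (jac (L h) c0 c \<one> u)"
    by (rule jac_chain[OF atlas atlas atlas smooth_L[OF h] smooth_L[OF g] c0 c(1) Lh(1) d(1) Lh(2)])
  finally show ?thesis using h
    by (simp add: frm_def chart_inv_chart[OF atlas c] chart_inv_chart[OF atlas d] L_apply)
qed

text \<open>A pointwise condition, tested in every chart around the point. Staying in the chart near
  t is a separate clause, because a coordinate map has arbitrary values off its domain.\<close>

definition integral_curve :: "'e \<Rightarrow> (real \<Rightarrow> 'a) \<Rightarrow> real \<Rightarrow> bool" where
  "integral_curve u \<gamma> t \<longleftrightarrow> \<gamma> t \<in> carrier G \<and>
     (\<forall>d\<in>A. \<gamma> t \<in> fst d \<longrightarrow> (\<forall>\<^sub>F s in nhds t. \<gamma> s \<in> fst d) \<and>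
        ((\<lambda>s. snd d (\<gamma> s)) has_vector_derivative frm d (snd d (\<gamma> t)) u) (at t))"

text \<open>Testing in a single chart suffices, because left translation carries the frame to the
  frame. The case g = 1 is a change of chart; the general case makes translates of integral curves
  integral curves.\<close>

lemma integral_curve_translate:
  assumes c: "c \<in> A" "\<gamma> t \<in> fst c" and ev: "\<forall>\<^sub>F s in nhds t. \<gamma> s \<in> fst c"
    and der: "((\<lambda>s. snd c (\<gamma> s)) has_vector_derivative frm c (snd c (\<gamma> t)) u) (at t)"
    and g: "g \<in> carrier G" and eq: "\<forall>\<^sub>F s in nhds t. \<beta> s = g \<otimes> \<gamma> s"
  shows "integral_curve u \<beta> t"
  unfolding integral_curve_def
proof (intro conjI ballI impI)
  have \<beta>t: "\<beta> t = g \<otimes> \<gamma> t" by (rule eventually_nhds_x_imp_x[OF eq])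
  have \<gamma>t: "\<gamma> t \<in> carrier G" by (rule chart_carrier[OF c])
  show "\<beta> t \<in> carrier G" using \<beta>t \<gamma>t g by simp
  fix d assume d: "d \<in> A" "\<beta> t \<in> fst d"
  have Lgd: "L g (\<gamma> t) \<in> fst d" using d(2) by (simp add: \<beta>t L_apply)
  obtain V where V: "open V" "snd c (\<gamma> t) \<in> V" "V \<subseteq> snd c ` fst c" "\<And>x. x \<in> V \<Longrightarrow> L g (chart_inv c x) \<in> fst d"
    "smooth_on V (\<lambda>x. snd d (L g (chart_inv c x)))"
    by (rule smooth_map_representation[OF atlas atlas smooth_L[OF g] c d(1) Lgd]) blast
  have "isCont (\<lambda>s. snd c (\<gamma> s)) t" by (rule has_vector_derivative_continuous[OF der])
  then have "\<forall>\<^sub>F s in at t. snd c (\<gamma> s) \<in> V" unfolding isCont_def using V(1,2) by (rule topological_tendstoD)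
  then have evV: "\<forall>\<^sub>F s in nhds t. snd c (\<gamma> s) \<in> V" using V(2) by (simp add: eventually_nhds_conv_at)
  have all: "\<forall>\<^sub>F s in nhds t. \<beta> s = L g (chart_inv c (snd c (\<gamma> s))) \<and> snd c (\<gamma> s) \<in> V"
    using eventually_conj[OF ev eventually_conj[OF eq evV]]
    by (rule eventually_mono) (simp add: chart_inv_chart[OF atlas c(1)] L_apply)
  show "\<forall>\<^sub>F s in nhds t. \<beta> s \<in> fst d" using all by (rule eventually_mono) (use V(4) in auto)
  obtain T where T: "open T" "t \<in> T" "\<And>s. s \<in> T \<Longrightarrow> \<beta> s = L g (chart_inv c (snd c (\<gamma> s)))"
    using all unfolding eventually_nhds by blast
  have "((\<lambda>s. snd d (L g (chart_inv c (snd c (\<gamma> s))))) has_vector_derivative jac (L g) c d (\<gamma> t) (frm c (snd c (\<gamma> t)) u)) (at t)"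
    using has_vector_derivative_chain[OF der smooth_on_differentiable[OF V(5,2)]] by (simp add: jac_def o_def)
  moreover have "jac (L g) c d (\<gamma> t) (frm c (snd c (\<gamma> t)) u) = frm d (snd d (\<beta> t)) u"
    using frm_natural[OF c d(1) _ g, of u] d(2) by (simp add: \<beta>t)
  ultimately have "((\<lambda>s. snd d (L g (chart_inv c (snd c (\<gamma> s))))) has_vector_derivative frm d (snd d (\<beta> t)) u) (at t)" by simp
  then show "((\<lambda>s. snd d (\<beta> s)) has_vector_derivative frm d (snd d (\<beta> t)) u) (at t)"
    by (rule has_vector_derivative_transform_within_open[OF _ T(1,2)]) (simp add: T(3))
qed

lemma integral_curve_chart:
  assumes "integral_curve u \<gamma> t"
  obtains c where "c \<in> A" "\<gamma> t \<in> fst c" "\<forall>\<^sub>F s in nhds t. \<gamma> s \<in> fst c"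
    "((\<lambda>s. snd c (\<gamma> s)) has_vector_derivative frm c (snd c (\<gamma> t)) u) (at t)"
proof -
  have "\<gamma> t \<in> carrier G" using assms by (simp add: integral_curve_def)
  then obtain c where "c \<in> A" "\<gamma> t \<in> fst c" by (rule carrier_chart)
  then show ?thesis using assms that unfolding integral_curve_def by blast
qed

lemma integral_curve_translate':
  assumes ic: "integral_curve u \<gamma> t" and g: "g \<in> carrier G" and eq: "\<forall>\<^sub>F s in nhds t. \<beta> s = g \<otimes> \<gamma> s"
  shows "integral_curve u \<beta> t"
  by (rule integral_curve_chart[OF ic]) (rule integral_curve_translate[OF _ _ _ _ g eq])

lemma eventually_nhds_shift:
  fixes t a :: real
  assumes "\<forall>\<^sub>F s in nhds (a + t). P s" shows "\<forall>\<^sub>F s in nhds t. P (a + s)"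
proof -
  have "((\<lambda>s. a + s) \<longlongrightarrow> a + t) (nhds t)" by (intro tendsto_intros) (simp add: tendsto_ident_at filterlim_ident)
  then show ?thesis using assms by (simp add: filterlim_iff)
qed

lemma integral_curve_shift:
  assumes "integral_curve u \<gamma> (a + t)" shows "integral_curve u (\<lambda>s. \<gamma> (a + s)) t"
  using assms unfolding integral_curve_def
  by (auto intro: eventually_nhds_shift has_vector_derivative_shift)

lemma integral_curve_smooth_map:
  assumes ic: "\<And>t. integral_curve u \<gamma> t"
  shows "smooth_map (euclidean_atlas UNIV) A \<gamma>"
    and "d \<in> A \<Longrightarrow> open {s. \<gamma> s \<in> fst d}" and "d \<in> A \<Longrightarrow> smooth_on {s. \<gamma> s \<in> fst d} (\<lambda>s. snd d (\<gamma> s))"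
proof -
  show op: "open {s. \<gamma> s \<in> fst d}" if d: "d \<in> A" for d
  proof (subst open_subopen, rule ballI)
    fix t assume "t \<in> {s. \<gamma> s \<in> fst d}"
    then have "\<forall>\<^sub>F s in nhds t. \<gamma> s \<in> fst d" using ic[of t] d by (simp add: integral_curve_def)
    then show "\<exists>T. open T \<and> t \<in> T \<and> T \<subseteq> {s. \<gamma> s \<in> fst d}" unfolding eventually_nhds by blast
  qed
  show sm: "smooth_on {s. \<gamma> s \<in> fst d} (\<lambda>s. snd d (\<gamma> s))" if d: "d \<in> A" for d
  proof (rule ode_solution_smooth_on[OF op[OF d] smooth_atlas_open[OF atlas d] frm_smooth[OF d]])
    show "((\<lambda>s. snd d (\<gamma> s)) has_vector_derivative frm d (snd d (\<gamma> t)) u) (at t)" if "t \<in> {s. \<gamma> s \<in> fst d}" for t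
      using ic[of t] d that by (simp add: integral_curve_def)
  qed simp
  show "smooth_map (euclidean_atlas UNIV) A \<gamma>"
  proof (rule smooth_mapI[OF smooth_atlas_euclidean[OF open_UNIV] atlas])
    fix t :: real
    obtain d where d: "d \<in> A" "\<gamma> t \<in> fst d" using integral_curve_chart[OF ic[of t]] by metis
    show "\<exists>C d V. C \<in> euclidean_atlas UNIV \<and> d \<in> A \<and> t \<in> fst C \<and> open V \<and> snd C t \<in> V \<and> V \<subseteq> snd C ` fst C \<and>
       (\<forall>x\<in>V. \<gamma> (chart_inv C x) \<in> fst d) \<and> smooth_on V (\<lambda>x. snd d (\<gamma> (chart_inv C x)))"
      using d op[OF d(1)] sm[OF d(1)]
      by (intro exI[of _ "(UNIV, \<lambda>x. x)"] exI[of _ d] exI[of _ "{s. \<gamma> s \<in> fst d}"])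
        (simp add: euclidean_atlas_def chart_inv_euclidean)
  qed
qed

lemma integral_curve_unique:
  assumes "\<And>t. \<bar>t\<bar> < \<epsilon> \<Longrightarrow> integral_curve u \<alpha> t \<and> \<alpha> t \<in> fst c0"
    and "\<And>t. \<bar>t\<bar> < \<epsilon> \<Longrightarrow> integral_curve u \<beta> t \<and> \<beta> t \<in> fst c0"
    and "\<alpha> 0 = \<beta> 0" "\<bar>t\<bar> < \<epsilon>"
  shows "\<alpha> t = \<beta> t"
proof -
  have "snd c0 (\<alpha> t) = snd c0 (\<beta> t)"
    by (rule local_ode_unique[OF smooth_atlas_open[OF atlas c0(1)] frm_smooth[OF c0(1)],
        where y="\<lambda>s. snd c0 (\<alpha> s)" and z="\<lambda>s. snd c0 (\<beta> s)" and \<epsilon>=\<epsilon> and w1=u])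
      (use assms c0(1) in \<open>auto simp: integral_curve_def\<close>)
  then show ?thesis using inj_onD[OF smooth_atlas_inj[OF atlas c0(1)]] assms by blast
qed

lemma hom_one:
  assumes "\<And>s t. \<gamma> (s + t) = \<gamma> s \<otimes> \<gamma> t" "\<And>t::real. \<gamma> t \<in> carrier G" shows "\<gamma> 0 = \<one>"
  using assms(1)[of 0 0] assms(2)[of 0] by (metis add_0 l_cancel_one)

lemma hom_pow:
  assumes "\<And>s t. \<gamma> (s + t) = \<gamma> s \<otimes> \<gamma> t" "\<And>t::real. \<gamma> t \<in> carrier G"
  shows "\<gamma> (real k * s) = \<gamma> s [^] k"
proof (induction k)
  case 0
  then show ?case using hom_one[of \<gamma>] assms by simp
next
  case (Suc k)
  have "\<gamma> (real (Suc k) * s) = \<gamma> (real k * s + s)" by (simp add: algebra_simps)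
  then show ?case using Suc assms(1) by simp
qed

text \<open>Near t the curve is the translate by \<gamma>(t) of itself near 0.\<close>

lemma hom_integral_curve:
  assumes hom: "\<And>s t. \<gamma> (s + t) = \<gamma> s \<otimes> \<gamma> t" and car: "\<And>t. \<gamma> t \<in> carrier G"
    and ic: "integral_curve u \<gamma> 0"
  shows "integral_curve u \<gamma> t"
proof -
  have "integral_curve u (\<lambda>s. \<gamma> (- t + s)) t" by (rule integral_curve_shift) (simp add: ic)
  then show ?thesis
    by (rule integral_curve_translate'[OF _ car[of t]]) (simp add: hom[symmetric])
qed

lemma exists_large:
  assumes "(\<delta>::real) > 0" obtains N :: nat where "N > 0" "\<bar>t\<bar> / real N < \<delta>"
proof -
  obtain N :: nat where "\<bar>t\<bar> / \<delta> < real N" using reals_Archimedean2 by blast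
  then have "\<bar>t\<bar> < real N * \<delta>" using assms by (simp add: field_simps)
  moreover have "N > 0"
    using \<open>\<bar>t\<bar> / \<delta> < real N\<close> assms by (metis abs_ge_zero divide_nonneg_pos gr0I not_less of_nat_0)
  ultimately show ?thesis using that[of N] by (simp add: field_simps)
qed

text \<open>The curves agree near 0 by uniqueness in c0, and the values near 0 determine a
  homomorphism, its value at t being the N-th power of that at t / N.\<close>

lemma hom_integral_curve_unique:
  assumes a: "\<And>s t. \<alpha> (s + t) = \<alpha> s \<otimes> \<alpha> t" "\<And>t. integral_curve u \<alpha> t"
    and b: "\<And>s t. \<beta> (s + t) = \<beta> s \<otimes> \<beta> t" "\<And>t. integral_curve u \<beta> t"
  shows "\<alpha> t = \<beta> t"
proof -
  have ca: "\<alpha> t \<in> carrier G" "\<beta> t \<in> carrier G" for t using a(2)[of t] b(2)[of t] by (auto simp: integral_curve_def)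
  have one: "\<alpha> 0 = \<one>" "\<beta> 0 = \<one>" using hom_one a(1) b(1) ca by blast+
  have "\<forall>\<^sub>F s in nhds 0. \<alpha> s \<in> fst c0 \<and> \<beta> s \<in> fst c0"
    using a(2)[of 0] b(2)[of 0] c0 one unfolding integral_curve_def by (intro eventually_conj) auto
  then obtain \<delta> where \<delta>: "\<delta> > 0" "\<And>s. \<bar>s\<bar> < \<delta> \<Longrightarrow> \<alpha> s \<in> fst c0 \<and> \<beta> s \<in> fst c0"
    unfolding eventually_nhds_metric by (auto simp: dist_real_def)
  obtain N :: nat where N: "N > 0" "\<bar>t\<bar> / real N < \<delta>" using exists_large[OF \<delta>(1)] by blast
  have "\<alpha> (t / real N) = \<beta> (t / real N)"
    by (rule integral_curve_unique[where \<epsilon>=\<delta> and u=u]) (use a b \<delta> N one in auto)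
  moreover have "\<alpha> (real N * (t / real N)) = \<alpha> (t / real N) [^] N" "\<beta> (real N * (t / real N)) = \<beta> (t / real N) [^] N"
    using hom_pow[of \<alpha>] hom_pow[of \<beta>] a(1) b(1) ca by blast+
  ultimately show ?thesis using N(1) by simp
qed

text \<open>For fixed s both t \<mapsto> \<gamma>(s + t) and t \<mapsto> \<gamma>(s) \<gamma>(t) are
  integral curves with the same start, so they coincide.\<close>

lemma local_one_parameter_subgroup:
  obtains \<delta> \<gamma> where "\<delta> > 0" "\<gamma> 0 = \<one>" "integral_curve u \<gamma> 0" "\<And>t. \<bar>t\<bar> < \<delta> \<Longrightarrow> \<gamma> t \<in> carrier G"
    "\<And>s t. \<bar>s\<bar> < \<delta> \<Longrightarrow> \<bar>t\<bar> < \<delta> \<Longrightarrow> \<gamma> (s + t) = \<gamma> s \<otimes> \<gamma> t"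
proof -
  let ?I = "snd c0 ` fst c0"
  note oI = smooth_atlas_open[OF atlas c0(1)]
  obtain \<epsilon> x where x: "\<epsilon> > 0" "x 0 = x0" "\<And>t. \<bar>t\<bar> < \<epsilon> \<Longrightarrow> x t \<in> ?I"
    "\<And>t. \<bar>t\<bar> < \<epsilon> \<Longrightarrow> (x has_vector_derivative frm c0 (x t) u) (at t)"
    by (rule local_ode_exists[OF oI frm_smooth[OF c0(1)] x0(1), of u]) blast
  define \<gamma> where "\<gamma> = (\<lambda>s. chart_inv c0 (x s))"
  have \<gamma>: "\<gamma> t \<in> fst c0" "snd c0 (\<gamma> t) = x t" if "\<bar>t\<bar> < \<epsilon>" for t
    using chart_inv_in[OF x(3)[OF that]] by (simp_all add: \<gamma>_def)
  have car: "\<gamma> t \<in> carrier G" if "\<bar>t\<bar> < \<epsilon>" for t using chart_carrier[OF c0(1)] \<gamma>(1)[OF that] by blast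
  have one: "\<gamma> 0 = \<one>" by (simp add: \<gamma>_def x(2) x0)
  define J where "J = {-\<epsilon><..<\<epsilon>}"
  have J: "open J" "\<And>t. t \<in> J \<longleftrightarrow> \<bar>t\<bar> < \<epsilon>" by (auto simp: J_def)
  have ic: "integral_curve u \<gamma> t" if t: "\<bar>t\<bar> < \<epsilon>" for t
  proof (rule integral_curve_translate[where \<gamma>=\<gamma> and t=t, OF c0(1) \<gamma>(1)[OF t] _ _ one_closed])
    show "\<forall>\<^sub>F s in nhds t. \<gamma> s \<in> fst c0" unfolding eventually_nhds using J t \<gamma>(1) by blast
    show "\<forall>\<^sub>F s in nhds t. \<gamma> s = \<one> \<otimes> \<gamma> s" unfolding eventually_nhds using J t car by (metis l_one)
    have "((\<lambda>s. snd c0 (\<gamma> s)) has_vector_derivative frm c0 (x t) u) (at t)"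
      by (rule has_vector_derivative_transform_within_open[OF x(4)[OF t] J(1)]) (use J t \<gamma>(2) in auto)
    then show "((\<lambda>s. snd c0 (\<gamma> s)) has_vector_derivative frm c0 (snd c0 (\<gamma> t)) u) (at t)" by (simp add: \<gamma>(2)[OF t])
  qed
  \<comment> \<open>Uniqueness is available only inside the chart c0; continuity of multiplication
    at the identity keeps the products there.\<close>
  obtain \<delta>1 where \<delta>1: "\<delta>1 > 0" "\<And>s t. \<bar>s\<bar> < \<delta>1 \<Longrightarrow> \<bar>t\<bar> < \<delta>1 \<Longrightarrow> \<gamma> s \<otimes> \<gamma> t \<in> fst c0"
  proof -
    note PA = smooth_atlas_prod[OF atlas atlas]
    let ?C = "prod_chart c0 c0"
    define D where "D = snd ?C ` {z \<in> fst ?C. (\<lambda>(g, h). g \<otimes> h) z \<in> fst c0}"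
    have D: "open D" unfolding D_def by (rule smooth_mapD(1)[OF PA atlas smooth_mult prod_chart_in[OF c0(1) c0(1)] c0(1)])
    have "(x0, x0) = snd ?C (\<one>, \<one>)" by (simp add: prod_chart_simps x0_def)
    then have inD: "(x0, x0) \<in> D" unfolding D_def using c0 by (intro image_eqI) (auto simp: prod_chart_simps)
    obtain P Q where PQ': "open P" "open Q" "(x0, x0) \<in> P \<times> Q" "P \<times> Q \<subseteq> D" by (rule open_prod_elim[OF D inD])
    then have PQ: "open P" "open Q" "x0 \<in> P" "x0 \<in> Q" "P \<times> Q \<subseteq> D" by simp_all
    have "isCont x 0" using has_vector_derivative_continuous[OF x(4)[of 0]] x(1) by simp
    then have "\<forall>\<^sub>F s in at 0. x s \<in> P \<inter> Q"
      unfolding isCont_def by (rule topological_tendstoD) (use PQ x(2) in auto)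
    then have "\<forall>\<^sub>F s in nhds 0. x s \<in> P \<inter> Q" using PQ x(2) by (simp add: eventually_nhds_conv_at)
    then obtain \<delta> where \<delta>: "\<delta> > 0" "\<And>s. \<bar>s\<bar> < \<delta> \<Longrightarrow> x s \<in> P \<inter> Q"
      unfolding eventually_nhds_metric by (auto simp: dist_real_def)
    have "\<gamma> s \<otimes> \<gamma> t \<in> fst c0" if s: "\<bar>s\<bar> < min \<delta> \<epsilon>" and t: "\<bar>t\<bar> < min \<delta> \<epsilon>" for s t
    proof -
      have "(x s, x t) \<in> D" using \<delta>(2)[of s] \<delta>(2)[of t] s t PQ(5) by auto
      then obtain g h where gh: "g \<in> fst c0" "h \<in> fst c0" "g \<otimes> h \<in> fst c0" "x s = snd c0 g" "x t = snd c0 h"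
        by (auto simp: D_def prod_chart_simps)
      then have "\<gamma> s = g" "\<gamma> t = h" by (simp_all add: \<gamma>_def chart_inv_chart[OF atlas c0(1)])
      then show ?thesis using gh by simp
    qed
    then show ?thesis using that[of "min \<delta> \<epsilon>"] \<delta>(1) x(1) by auto
  qed
  \<comment> \<open>Half of \<epsilon>, so that s + t is still in the interval on which the local
    solution is known.\<close>
  define \<delta> where "\<delta> = min \<delta>1 (\<epsilon> / 2)"
  have \<delta>: "\<delta> > 0" "\<delta> \<le> \<delta>1" "\<delta> + \<delta> \<le> \<epsilon>" "\<delta> \<le> \<epsilon>" using \<delta>1(1) x(1) by (auto simp: \<delta>_def)
  have add: "\<gamma> (s + t) = \<gamma> s \<otimes> \<gamma> t" if s: "\<bar>s\<bar> < \<delta>" and t: "\<bar>t\<bar> < \<delta>" for s t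
  proof (rule integral_curve_unique[where \<alpha>="\<lambda>t. \<gamma> (s + t)" and \<beta>="\<lambda>t. \<gamma> s \<otimes> \<gamma> t" and \<epsilon>=\<delta> and u=u])
    have sc: "\<gamma> s \<in> carrier G" using s \<delta> by (intro car) simp
    fix t assume t: "\<bar>t\<bar> < \<delta>"
    have st: "\<bar>s + t\<bar> < \<epsilon>" using s t \<delta> by linarith
    show "integral_curve u (\<lambda>t. \<gamma> (s + t)) t \<and> \<gamma> (s + t) \<in> fst c0"
      using integral_curve_shift[OF ic[OF st]] \<gamma>(1)[OF st] by simp
    have "integral_curve u (\<lambda>t. \<gamma> s \<otimes> \<gamma> t) t"
      by (rule integral_curve_translate'[OF ic sc]) (use t \<delta> in auto)
    then show "integral_curve u (\<lambda>t. \<gamma> s \<otimes> \<gamma> t) t \<and> \<gamma> s \<otimes> \<gamma> t \<in> fst c0"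
      using \<delta>1(2)[of s t] s t \<delta> by simp
  qed (use t s one \<delta> car[of s] in auto)
  show ?thesis
    by (rule that[of \<delta> \<gamma>]) (use \<delta> one ic[of 0] x(1) car add in auto)
qed

text \<open>The value \<gamma>(t / n)^n does not depend on n once |t| / n < \<delta>: two choices n
  and m are compared through n m. A common large n for s, t and s + t then gives the homomorphism
  law, since the local values commute.\<close>

lemma one_parameter_subgroup_exists:
  "\<exists>\<gamma>. (\<forall>s t. \<gamma> (s + t) = \<gamma> s \<otimes> \<gamma> t) \<and> (\<forall>t. integral_curve u \<gamma> t)"
proof -
  obtain \<delta> \<gamma> where \<gamma>: "\<delta> > 0" "\<gamma> 0 = \<one>" "integral_curve u \<gamma> 0" "\<And>t. \<bar>t\<bar> < \<delta> \<Longrightarrow> \<gamma> t \<in> carrier G"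
    "\<And>s t. \<bar>s\<bar> < \<delta> \<Longrightarrow> \<bar>t\<bar> < \<delta> \<Longrightarrow> \<gamma> (s + t) = \<gamma> s \<otimes> \<gamma> t"
    by (rule local_one_parameter_subgroup) blast
  have pow: "\<gamma> (real k * s) = \<gamma> s [^] k" if "real k * \<bar>s\<bar> < \<delta>" for k s
    using that
  proof (induction k)
    case 0
    then show ?case by (simp add: \<gamma>(2))
  next
    case (Suc k)
    have "real k * \<bar>s\<bar> + \<bar>s\<bar> < \<delta>" using Suc.prems by (simp add: algebra_simps)
    moreover have "0 \<le> real k * \<bar>s\<bar>" by simp
    ultimately have *: "real k * \<bar>s\<bar> < \<delta>" "\<bar>s\<bar> < \<delta>" by linarith+
    have "\<gamma> (real (Suc k) * s) = \<gamma> (real k * s + s)" by (simp add: algebra_simps)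
    also have "\<dots> = \<gamma> (real k * s) \<otimes> \<gamma> s" by (rule \<gamma>(5)) (use * in \<open>simp_all add: abs_mult\<close>)
    finally show ?case using Suc.IH[OF *(1)] by simp
  qed
  have refine: "\<gamma> (t / real n) [^] n = \<gamma> (t / real (n * m)) [^] (n * m)"
    if "n > 0" "m > 0" "\<bar>t\<bar> / real n < \<delta>" for t n m
  proof -
    have e: "t / real n = real m * (t / real (n * m))" using that by simp
    have "real m * \<bar>t / real (n * m)\<bar> < \<delta>" using that by (simp add: abs_mult)
    then have "\<gamma> (t / real n) = \<gamma> (t / real (n * m)) [^] m" unfolding e by (rule pow)
    moreover have "\<gamma> (t / real (n * m)) \<in> carrier G"
    proof (rule \<gamma>(4))
      have "\<bar>t\<bar> / real n / real m \<le> \<bar>t\<bar> / real n" using that by (simp add: divide_le_eq mult_le_cancel_left1)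
      then show "\<bar>t / real (n * m)\<bar> < \<delta>" using that by simp
    qed
    ultimately show ?thesis by (simp add: nat_pow_pow mult.commute)
  qed
  have indep: "\<gamma> (t / real n) [^] n = \<gamma> (t / real m) [^] m"
    if "n > 0" "m > 0" "\<bar>t\<bar> / real n < \<delta>" "\<bar>t\<bar> / real m < \<delta>" for t n m
    using refine[OF that(1,2,3)] refine[OF that(2,1,4)] by (simp add: mult.commute)
  define N where "N = (\<lambda>t. SOME n. n > 0 \<and> \<bar>t\<bar> / real n < \<delta>)"
  have N: "N t > 0" "\<bar>t\<bar> / real (N t) < \<delta>" for t
  proof -
    have "\<exists>n. n > 0 \<and> \<bar>t\<bar> / real n < \<delta>" using exists_large[OF \<gamma>(1)] by metis
    from someI_ex[OF this] show "N t > 0" "\<bar>t\<bar> / real (N t) < \<delta>" by (auto simp: N_def)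
  qed
  define \<Gamma> where "\<Gamma> = (\<lambda>t. \<gamma> (t / real (N t)) [^] N t)"
  have \<Gamma>: "\<Gamma> t = \<gamma> (t / real n) [^] n" if "n > 0" "\<bar>t\<bar> / real n < \<delta>" for t n
    unfolding \<Gamma>_def by (rule indep[OF N(1) that(1) N(2) that(2)])
  have car: "\<Gamma> t \<in> carrier G" for t unfolding \<Gamma>_def using N[of t] by (intro nat_pow_closed \<gamma>(4)) simp
  have hom: "\<Gamma> (s + t) = \<Gamma> s \<otimes> \<Gamma> t" for s t
  proof -
    obtain n where n: "n > 0" "\<bar>\<bar>s\<bar> + \<bar>t\<bar>\<bar> / real n < \<delta>" using exists_large[OF \<gamma>(1)] by metis
    have le: "\<bar>r\<bar> / real n < \<delta>" if "\<bar>r\<bar> \<le> \<bar>s\<bar> + \<bar>t\<bar>" for r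
    proof -
      have "\<bar>r\<bar> / real n \<le> \<bar>\<bar>s\<bar> + \<bar>t\<bar>\<bar> / real n" using that n(1) by (intro divide_right_mono) auto
      then show ?thesis using n(2) by linarith
    qed
    have s: "\<bar>s\<bar> / real n < \<delta>" and t: "\<bar>t\<bar> / real n < \<delta>" and st: "\<bar>s + t\<bar> / real n < \<delta>" by (rule le; linarith)+
    have s': "\<bar>s / real n\<bar> < \<delta>" and t': "\<bar>t / real n\<bar> < \<delta>" using s t by simp_all
    have "\<Gamma> (s + t) = \<gamma> (s / real n + t / real n) [^] n" using \<Gamma>[OF n(1) st] by (simp add: add_divide_distrib)
    also have "\<dots> = (\<gamma> (s / real n) \<otimes> \<gamma> (t / real n)) [^] n" by (simp add: \<gamma>(5)[OF s' t'])
    also have "\<dots> = \<gamma> (s / real n) [^] n \<otimes> \<gamma> (t / real n) [^] n"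
    proof (rule pow_mult_distrib)
      show "\<gamma> (s / real n) \<otimes> \<gamma> (t / real n) = \<gamma> (t / real n) \<otimes> \<gamma> (s / real n)"
        using \<gamma>(5)[OF s' t'] \<gamma>(5)[OF t' s'] by (simp add: add.commute)
    qed (use \<gamma>(4) s' t' in auto)
    also have "\<dots> = \<Gamma> s \<otimes> \<Gamma> t" by (simp add: \<Gamma>[OF n(1) s] \<Gamma>[OF n(1) t])
    finally show ?thesis .
  qed
  have "integral_curve u \<Gamma> 0"
  proof (rule integral_curve_translate'[OF \<gamma>(3) one_closed])
    \<comment> \<open>For |s| < \<delta> the choice n = 1 is admissible, so the extension agrees
      with \<gamma> near 0.\<close>
    have "\<Gamma> s = \<one> \<otimes> \<gamma> s" if "\<bar>s\<bar> < \<delta>" for s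
      using \<Gamma>[of 1 s] \<gamma>(4)[OF that] that by simp
    then show "\<forall>\<^sub>F s in nhds 0. \<Gamma> s = \<one> \<otimes> \<gamma> s"
      unfolding eventually_nhds_metric using \<gamma>(1) by (auto simp: dist_real_def)
  qed
  then have "integral_curve u \<Gamma> t" for t by (rule hom_integral_curve[OF hom car])
  then show ?thesis using hom by blast
qed

lemma frm_at_one: "d \<in> A \<Longrightarrow> \<one> \<in> fst d \<Longrightarrow> frm d (snd d \<one>) u = tvec A \<one> c0 u d"
  using jac_cong[OF atlas c0, of "L \<one>" id d]
  by (simp add: frm_def chart_inv_chart[OF atlas] L_apply points_carrier tvec_def)

lemma velocity_integral_curve:
  assumes "integral_curve u \<gamma> t" "d \<in> A" "\<gamma> t \<in> fst d"
  shows "velocity A \<gamma> t d = frm d (snd d (\<gamma> t)) u"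
  using assms by (simp add: velocity_def integral_curve_def vector_derivative_at)

text \<open>The definite description in \<open>lie_exp\<close> ranges over smooth homomorphisms with
  given velocity; this replaces them by solutions of an equation. Smoothness gives the equation at
  time 0 and the homomorphism law spreads it; conversely, smoothness comes by bootstrapping.\<close>

lemma one_parameter_subgroup_iff:
  assumes w: "w \<in> lie_algebra G A"
  shows "one_parameter_subgroup G A \<gamma> \<and> velocity A \<gamma> 0 = w \<longleftrightarrow>
    (\<forall>s t. \<gamma> (s + t) = \<gamma> s \<otimes> \<gamma> t) \<and> (\<forall>t. integral_curve (w c0) \<gamma> t)" (is "?l \<longleftrightarrow> ?r")
proof
  assume ?r
  then have hom: "\<And>s t. \<gamma> (s + t) = \<gamma> s \<otimes> \<gamma> t" and ic: "\<And>t. integral_curve (w c0) \<gamma> t" by auto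
  have one: "\<gamma> 0 = \<one>" using hom_one[of \<gamma>] hom ic by (auto simp: integral_curve_def)
  have "velocity A \<gamma> 0 d = w d" for d
  proof (cases "d \<in> A \<and> \<one> \<in> fst d")
    case True
    then show ?thesis
      using velocity_integral_curve[OF ic, of d 0] frm_at_one[of d "w c0"]
        fun_cong[OF tangent_space_eq_tvec[OF w[unfolded lie_algebra_def] c0], of d] by (simp add: one)
  next
    case False
    then have "velocity A \<gamma> 0 d = 0" unfolding velocity_def one by auto
    moreover have "w d = 0" by (rule tangent_space_outside[OF w[unfolded lie_algebra_def]]) (use False in blast)
    ultimately show ?thesis by simp
  qed
  then show ?l using integral_curve_smooth_map(1)[OF ic] hom by (auto simp: one_parameter_subgroup_def)
next
  assume l: ?l
  then have hom: "\<And>s t. \<gamma> (s + t) = \<gamma> s \<otimes> \<gamma> t" and sm: "smooth_map (euclidean_atlas UNIV) A \<gamma>"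
    and vel: "velocity A \<gamma> 0 = w" by (auto simp: one_parameter_subgroup_def)
  note EU = smooth_atlas_euclidean[OF open_UNIV]
  have car: "\<gamma> t \<in> carrier G" for t
    using smooth_map_into[OF EU atlas sm, of t] by (simp add: points_euclidean points_carrier)
  have one: "\<gamma> 0 = \<one>" by (rule hom_one[OF hom car])
  have C: "(UNIV, \<lambda>x. x) \<in> euclidean_atlas (UNIV :: real set)" by (simp add: euclidean_atlas_def)
  obtain V where V: "open V" "0 \<in> V" "\<And>s. s \<in> V \<Longrightarrow> \<gamma> s \<in> fst c0" "smooth_on V (\<lambda>s. snd c0 (\<gamma> s))"
  proof (rule smooth_map_representation[OF EU atlas sm C _ c0(1), of 0])
    show "\<gamma> 0 \<in> fst c0" using c0 one by simp
  qed (auto simp: chart_inv_euclidean)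
  have "((\<lambda>s. snd c0 (\<gamma> s)) has_vector_derivative vector_derivative (\<lambda>s. snd c0 (\<gamma> s)) (at 0)) (at 0)"
    using vector_derivative_frechet[OF smooth_on_differentiable[OF V(4,2)]] vector_derivative_at by metis
  moreover have "vector_derivative (\<lambda>s. snd c0 (\<gamma> s)) (at 0) = w c0"
    using fun_cong[OF vel, of c0] c0 one by (simp add: velocity_def)
  ultimately have der: "((\<lambda>s. snd c0 (\<gamma> s)) has_vector_derivative frm c0 (snd c0 (\<gamma> 0)) (w c0)) (at 0)"
    by (simp add: one x0_def[symmetric] frm_x0)
  have "integral_curve (w c0) \<gamma> 0"
  proof (rule integral_curve_translate[OF c0(1) _ _ der one_closed])
    show "\<forall>\<^sub>F s in nhds 0. \<gamma> s \<in> fst c0" unfolding eventually_nhds using V by blast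
  qed (use car c0 one in auto)
  then show ?r using hom_integral_curve[OF hom car] hom by blast
qed

text \<open>\<open>lie_exp\<close> is defined vector by vector, as a value at time 1. The curve s
  \<mapsto> \<gamma>(r s) is the subgroup of r w, so all these values lie on one curve
  \<gamma>.\<close>

lemma lie_exp_integral_curve:
  assumes w: "w \<in> lie_algebra G A"
  obtains \<gamma> where "\<And>t. lie_exp G A (\<lambda>d. t *\<^sub>R w d) = \<gamma> t" "\<And>s t. \<gamma> (s + t) = \<gamma> s \<otimes> \<gamma> t" "\<And>t. integral_curve (w c0) \<gamma> t"
proof -
  obtain \<gamma> where \<gamma>: "\<And>s t. \<gamma> (s + t) = \<gamma> s \<otimes> \<gamma> t" "\<And>t. integral_curve (w c0) \<gamma> t"
    using one_parameter_subgroup_exists[of "w c0"] by blast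
  have car: "\<gamma> t \<in> carrier G" for t using \<gamma>(2)[of t] by (simp add: integral_curve_def)
  have one: "\<gamma> 0 = \<one>" by (rule hom_one[OF \<gamma>(1) car])
  have "lie_exp G A (\<lambda>d. r *\<^sub>R w d) = \<gamma> r" for r
  proof -
    let ?\<beta> = "\<lambda>s. \<gamma> (r * s)"
    have rw: "(\<lambda>d. r *\<^sub>R w d) \<in> lie_algebra G A"
      using tangent_space_scale[OF atlas w[unfolded lie_algebra_def] one_points] by (simp add: lie_algebra_def)
    have hom: "?\<beta> (s + t) = ?\<beta> s \<otimes> ?\<beta> t" for s t by (simp add: distrib_left \<gamma>(1))
    \<comment> \<open>By the homomorphism law it suffices to look at time 0, where the chain rule
      multiplies the velocity by r.\<close>
    have "integral_curve (r *\<^sub>R w c0) ?\<beta> 0"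
    proof (rule integral_curve_translate[OF c0(1) _ _ _ one_closed])
      have ic0: "\<forall>\<^sub>F s in nhds 0. \<gamma> s \<in> fst c0" "((\<lambda>s. snd c0 (\<gamma> s)) has_vector_derivative w c0) (at 0)"
        using \<gamma>(2)[of 0] c0 one by (auto simp: integral_curve_def x0_def[symmetric] frm_x0)
      have "((\<lambda>s. r * s) \<longlongrightarrow> r * 0) (nhds 0)" by (intro tendsto_intros) (simp add: filterlim_ident)
      then have "filterlim (\<lambda>s. r * s) (nhds 0) (nhds 0)" by simp
      then show "\<forall>\<^sub>F s in nhds 0. ?\<beta> s \<in> fst c0" by (rule eventually_compose_filterlim[OF ic0(1)])
      have "((\<lambda>s. r * s) has_vector_derivative r) (at 0)" by (auto intro!: derivative_eq_intros)
      from vector_diff_chain_at[OF this, of "\<lambda>s. snd c0 (\<gamma> s)"] ic0(2)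
      show "((\<lambda>s. snd c0 (?\<beta> s)) has_vector_derivative frm c0 (snd c0 (?\<beta> 0)) (r *\<^sub>R w c0)) (at 0)"
        by (simp add: o_def one x0_def[symmetric] frm_x0)
    qed (use c0 one car in auto)
    then have ic: "integral_curve (r *\<^sub>R w c0) ?\<beta> t" for t by (rule hom_integral_curve[OF hom car])
    have "(THE \<beta>. one_parameter_subgroup G A \<beta> \<and> velocity A \<beta> 0 = (\<lambda>d. r *\<^sub>R w d)) = ?\<beta>"
      unfolding one_parameter_subgroup_iff[OF rw]
    proof (rule the_equality)
      show "(\<forall>s t. ?\<beta> (s + t) = ?\<beta> s \<otimes> ?\<beta> t) \<and> (\<forall>t. integral_curve (r *\<^sub>R w c0) ?\<beta> t)" using hom ic by blast
      fix \<alpha> assume "(\<forall>s t. \<alpha> (s + t) = \<alpha> s \<otimes> \<alpha> t) \<and> (\<forall>t. integral_curve (r *\<^sub>R w c0) \<alpha> t)"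
      then show "\<alpha> = ?\<beta>" using hom_integral_curve_unique[of \<alpha> "r *\<^sub>R w c0" ?\<beta>] hom ic by blast
    qed
    then show ?thesis by (simp add: lie_exp_def)
  qed
  then show ?thesis using that \<gamma> by blast
qed

end

section \<open>Parallel translation along one-parameter subgroups\<close>

context left_invariant_spray_chart
begin

definition nfield :: "'e \<Rightarrow> 'e \<Rightarrow> 'e" where "nfield w u = - connop u w"

lemma brk_linear: "bounded_linear (\<lambda>u. brk u w)"
proof -
  have "bounded_linear (\<lambda>a. dfrm c0 x0 a w)"
    using dfrm_linear_field[OF c0(1) x0(1)] linear_conv_bounded_linear by blast
  then show ?thesis
    unfolding brk_def by (rule bounded_linear_sub[OF dfrm_linear[OF c0(1) x0(1)]])
qed

lemma brk_antisym: "brk w u = - brk u w" by (simp add: brk_def)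

lemma nfield_smooth: "smooth_on (- {0}) (nfield w)"
proof -
  have "smooth_on (- {0}) (\<lambda>u. - ((1/2) *\<^sub>R frechet_derivative \<eta> (at u) w - (1/2) *\<^sub>R brk u w))"
    by (intro smooth_on_minus smooth_on_diff smooth_on_linear_compose[OF bounded_linear_scaleR_right]
        smooth_on_frechet_const[OF \<eta>_smooth] smooth_on_linear[OF brk_linear] open_slit)
  then show ?thesis by (simp add: nfield_def[abs_def] connop_def)
qed

lemma nfield_homogeneous: assumes r: "r > 0" and u: "u \<noteq> 0" shows "nfield w (r *\<^sub>R u) = r *\<^sub>R nfield w u"
proof -
  have ru: "r *\<^sub>R u \<in> - {0}" and u': "u \<in> - {0}" using r u by auto
  have "((\<lambda>u. \<eta> (r *\<^sub>R u)) has_derivative (\<lambda>v. frechet_derivative \<eta> (at (r *\<^sub>R u)) (r *\<^sub>R v))) (at u)"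
    by (rule has_derivative_compose[where f="\<lambda>u. r *\<^sub>R u" and g=\<eta>,
            OF bounded_linear_imp_has_derivative[OF bounded_linear_scaleR_right] smooth_on_has_derivative[OF \<eta>_smooth ru]])
  moreover have "((\<lambda>u. \<eta> (r *\<^sub>R u)) has_derivative (\<lambda>v. r\<^sup>2 *\<^sub>R frechet_derivative \<eta> (at u) v)) (at u)"
    by (rule has_derivative_transform_within_open[OF bounded_linear.has_derivative[OF bounded_linear_scaleR_right
          smooth_on_has_derivative[OF \<eta>_smooth u']] open_slit u']) (simp add: \<eta>_homogeneous r)
  ultimately have "(\<lambda>v. frechet_derivative \<eta> (at (r *\<^sub>R u)) (r *\<^sub>R v)) = (\<lambda>v. r\<^sup>2 *\<^sub>R frechet_derivative \<eta> (at u) v)"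
    by (rule has_derivative_unique)
  from fun_cong[OF this, of w]
  have "r *\<^sub>R frechet_derivative \<eta> (at (r *\<^sub>R u)) w = r *\<^sub>R (r *\<^sub>R frechet_derivative \<eta> (at u) w)"
    using linear_scale[OF bounded_linear.linear[OF smooth_on_bounded_linear[OF \<eta>_smooth ru]], of r w]
    by (simp add: power2_eq_square)
  then have "frechet_derivative \<eta> (at (r *\<^sub>R u)) w = r *\<^sub>R frechet_derivative \<eta> (at u) w"
    using r by (metis scaleR_cancel_left less_irrefl)
  moreover have "brk (r *\<^sub>R u) w = r *\<^sub>R brk u w"
    by (rule linear_scale[OF bounded_linear.linear[OF brk_linear]])
  ultimately show ?thesis by (simp add: nfield_def connop_def algebra_simps)
qed

text \<open>In the left invariant frame, the equation of parallel vector fields along an integral curve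
  of a left invariant field has constant coefficients.\<close>

lemma covariant_derivative_frame:
  assumes ic: "\<And>t. integral_curve w \<gamma> t"
    and Y: "\<And>t d. d \<in> A \<Longrightarrow> \<gamma> t \<in> fst d \<Longrightarrow> Y t d = frm d (snd d (\<gamma> t)) (u t)"
    and u': "(u has_vector_derivative u') (at t)" and u0: "u t \<noteq> 0"
    and d: "d \<in> A" "\<gamma> t \<in> fst d"
  shows "nl_covariant_derivative A S \<gamma> Y t d = frm d (snd d (\<gamma> t)) (u' - nfield w (u t))"
proof -
  let ?x = "snd d (\<gamma> t)"
  have x: "?x \<in> snd d ` fst d" using d by simp
  define T where "T = {s. \<gamma> s \<in> fst d}"
  have T: "open T" "t \<in> T" unfolding T_def using integral_curve_smooth_map(2)[OF ic d(1)] d(2) by auto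
  have lin: "linear (frm d ?x)" by (rule bounded_linear.linear[OF frm_linear[OF d(1) x]])
  have vel: "((\<lambda>s. snd d (\<gamma> s)) has_vector_derivative frm d ?x w) (at t)"
    using ic[of t] d by (simp add: integral_curve_def)
  have "((\<lambda>s. frm d (snd d (\<gamma> s)) (u s)) has_vector_derivative dfrm d ?x (u t) (frm d ?x w) + frm d ?x u') (at t)"
  proof (rule linear_family_has_vector_derivative[OF T _ _ u', where L="\<lambda>s. frm d (snd d (\<gamma> s))" and L'="\<lambda>v. dfrm d ?x v (frm d ?x w)"])
    show "bounded_linear (frm d (snd d (\<gamma> s)))" if "s \<in> T" for s
      using that by (intro frm_linear[OF d(1)]) (simp add: T_def)
    show "((\<lambda>s. frm d (snd d (\<gamma> s)) v) has_vector_derivative dfrm d ?x v (frm d ?x w)) (at t)" for v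
      unfolding dfrm_def by (rule has_vector_derivative_chain[OF vel smooth_on_differentiable[OF frm_smooth[OF d(1)] x]])
  qed
  then have "((\<lambda>s. Y s d) has_vector_derivative dfrm d ?x (u t) (frm d ?x w) + frm d ?x u') (at t)"
    by (rule has_vector_derivative_transform_within_open[OF _ T]) (simp add: Y[OF d(1)] T_def)
  then have "nl_covariant_derivative A S \<gamma> Y t d =
     dfrm d ?x (u t) (frm d ?x w) + frm d ?x u' + spray_N A S d ?x (frm d ?x (u t)) (frm d ?x w)"
    using d velocity_integral_curve[OF ic d] Y[OF d] by (simp add: nl_covariant_derivative_def vector_derivative_at)
  \<comment> \<open>The derivative of the field along the curve contributes
    \<open>dfrm d ?x (u t) (frm d ?x w)\<close> once and the spray takes away half of it; what
    remains pairs with the other half term of the spray to a bracket.\<close>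
  also have "\<dots> = frm d ?x u' + (1/2) *\<^sub>R frm d ?x (frechet_derivative \<eta> (at (u t)) w)
      + (1/2) *\<^sub>R (dfrm d ?x (u t) (frm d ?x w) - dfrm d ?x w (frm d ?x (u t)))"
  proof -
    have half: "a = (1/2) *\<^sub>R a + (1/2) *\<^sub>R a" for a :: 'e by (simp add: scaleR_add_left[symmetric])
    show ?thesis
      unfolding spray_N_chart[OF d(1) x u0]
      using half[of "dfrm d ?x (u t) (frm d ?x w)"] by (simp add: scaleR_diff_right algebra_simps)
  qed
  also have "dfrm d ?x (u t) (frm d ?x w) - dfrm d ?x w (frm d ?x (u t)) = frm d ?x (brk w (u t))"
    by (rule frm_brk[OF d(1) x])
  also have "frm d ?x u' + (1/2) *\<^sub>R frm d ?x (frechet_derivative \<eta> (at (u t)) w) + (1/2) *\<^sub>R frm d ?x (brk w (u t))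
      = frm d ?x (u' - nfield w (u t))"
    by (simp add: nfield_def connop_def brk_antisym[of w] linear_add[OF lin] linear_diff[OF lin] linear_scale[OF lin] linear_neg[OF lin])
  finally show ?thesis .
qed

section \<open>Parallel fields as trajectories in the Lie algebra\<close>

abbreviation "lif u g \<equiv> left_invariant_field G A (tvec A \<one> c0 u) g"

lemma tvec_lie: "tvec A \<one> c0 u \<in> lie_algebra G A"
  unfolding lie_algebra_def by (rule tvec_in_tangent_space[OF atlas c0])

lemma lif_chart: "d \<in> A \<Longrightarrow> g \<in> fst d \<Longrightarrow> lif u g d = frm d (snd d g) u"
  using left_invariant_field_chart[OF tvec_lie] by (simp add: tvec_chart[OF atlas c0])

lemma frm_nonzero: "d \<in> A \<Longrightarrow> x \<in> snd d ` fst d \<Longrightarrow> u \<noteq> 0 \<Longrightarrow> frm d x u \<noteq> 0"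
  using cofrm_frm[of d x u] linear_0[OF bounded_linear.linear[OF cofrm_linear[of d x]]] by auto

lemma lif_slit: assumes "g \<in> carrier G" "u \<noteq> 0" shows "lif u g \<in> slit_tangent_space A g"
proof -
  obtain d where d: "d \<in> A" "g \<in> fst d" by (rule carrier_chart[OF assms(1)])
  show ?thesis
    using left_invariant_field_in[OF tvec_lie assms(1)] frm_nonzero[OF d(1) _ assms(2)] d
    by (simp add: slit_tangent_space_iff[OF atlas d] lif_chart[OF d])
qed

lemma slit_eq_tvec:
  assumes "y \<in> slit_tangent_space A \<one>" shows "y c0 \<noteq> 0" "y = tvec A \<one> c0 (y c0)"
  using slit_tangent_space_iff[OF atlas c0] assms tangent_space_eq_tvec[OF slit_tangent_in[OF assms] c0] by auto

lemma lif_one: assumes "y \<in> slit_tangent_space A \<one>" shows "lif (y c0) \<one> = y"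
  unfolding slit_eq_tvec(2)[OF assms, symmetric] left_invariant_field_def
  by (rule differential_ident[OF atlas _ slit_tangent_in[OF assms] one_points]) (simp add: L_apply points_carrier)

lemma lif_back:
  assumes g: "g \<in> carrier G" shows "differential A A (L (inv g)) g (lif u g) = tvec A \<one> c0 u"
proof -
  have T: "tvec A \<one> c0 u \<in> tangent_space A \<one>" using tvec_lie by (simp add: lie_algebra_def)
  have "differential A A (L (inv g)) g (lif u g) = differential A A (\<lambda>q. L (inv g) (L g q)) \<one> (tvec A \<one> c0 u)"
    using differential_compose[OF atlas atlas atlas smooth_L[OF g] smooth_L[OF inv_closed[OF g]] T one_points] g
    by (simp add: left_invariant_field_def L_apply)
  also have "\<dots> = tvec A \<one> c0 u" by (rule differential_ident[OF atlas L_inv[OF g] T one_points])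
  finally show ?thesis .
qed

text \<open>Existence half: the covariant derivative of the translated trajectory is the frame
  applied to u' - nfield w u, which is 0.\<close>

lemma lif_parallel:
  assumes ic: "\<And>t. integral_curve w \<gamma> t" and u: "\<And>t. (u has_vector_derivative nfield w (u t)) (at t)" "\<And>t. u t \<noteq> 0"
  shows "nl_parallel A S UNIV \<gamma> (\<lambda>t. lif (u t) (\<gamma> t))"
  unfolding nl_parallel_def
proof (intro conjI ballI)
  have car: "\<gamma> t \<in> carrier G" for t using ic[of t] by (simp add: integral_curve_def)
  have us: "smooth_on UNIV u"
    by (rule ode_solution_smooth_on[OF open_UNIV open_slit nfield_smooth _ u(1)]) (simp add: u(2))
  show "smooth_map (euclidean_atlas UNIV) (slit_bundle A) (\<lambda>t. (\<gamma> t, lif (u t) (\<gamma> t)))"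
  proof (rule smooth_mapI[OF smooth_atlas_euclidean[OF open_UNIV] smooth_atlas_slit_bundle[OF atlas]])
    fix t :: real
    obtain d where d: "d \<in> A" "\<gamma> t \<in> fst d" by (rule carrier_chart[OF car])
    let ?T = "{s. \<gamma> s \<in> fst d}"
    have T: "open ?T" by (rule integral_curve_smooth_map(2)[OF ic d(1)])
    have sd: "smooth_on ?T (\<lambda>s. snd d (\<gamma> s))" by (rule integral_curve_smooth_map(3)[OF ic d(1)])
    have "smooth_on ?T (\<lambda>s. frm d (snd d (\<gamma> s)) (u s))"
    proof (rule smooth_on_linear_family[OF T, where L="\<lambda>s. frm d (snd d (\<gamma> s))"])
      show "bounded_linear (frm d (snd d (\<gamma> s)))" if "s \<in> ?T" for s using that by (intro frm_linear[OF d(1)]) simp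
      show "smooth_on ?T (\<lambda>s. frm d (snd d (\<gamma> s)) v)" for v
        by (rule smooth_on_compose[OF T sd frm_smooth[OF d(1)] smooth_atlas_open[OF atlas d(1)]]) auto
    qed (rule smooth_on_subset[OF us], simp)
    then have "smooth_on ?T (\<lambda>s. (snd d (\<gamma> s), frm d (snd d (\<gamma> s)) (u s)))" by (rule smooth_on_Pair[OF T sd])
    then have "smooth_on ?T (\<lambda>s. snd (slit_chart A d) (\<gamma> s, lif (u s) (\<gamma> s)))"
      by (rule smooth_on_congI[OF _ T]) (simp add: slit_chart_simps lif_chart[OF d(1)])
    then show "\<exists>C D V. C \<in> euclidean_atlas UNIV \<and> D \<in> slit_bundle A \<and> t \<in> fst C \<and> open V \<and> snd C t \<in> V \<and> V \<subseteq> snd C ` fst C \<and>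
       (\<forall>x\<in>V. (\<gamma> (chart_inv C x), lif (u (chart_inv C x)) (\<gamma> (chart_inv C x))) \<in> fst D) \<and>
       smooth_on V (\<lambda>x. snd D (\<gamma> (chart_inv C x), lif (u (chart_inv C x)) (\<gamma> (chart_inv C x))))"
      using d T slit_chart_in[OF d(1)] lif_slit[OF car u(2)]
      by (intro exI[of _ "(UNIV, \<lambda>x. x)"] exI[of _ "slit_chart A d"] exI[of _ ?T])
        (simp add: euclidean_atlas_def chart_inv_euclidean slit_chart_simps)
  qed
  fix t :: real
  show "nl_covariant_derivative A S \<gamma> (\<lambda>t. lif (u t) (\<gamma> t)) t = (\<lambda>_. 0)"
  proof
    fix d
    show "nl_covariant_derivative A S \<gamma> (\<lambda>t. lif (u t) (\<gamma> t)) t d = 0"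
    proof (cases "d \<in> A \<and> \<gamma> t \<in> fst d")
      case True
      then have d: "d \<in> A" "\<gamma> t \<in> fst d" by auto
      have "nl_covariant_derivative A S \<gamma> (\<lambda>t. lif (u t) (\<gamma> t)) t d = frm d (snd d (\<gamma> t)) (nfield w (u t) - nfield w (u t))"
        by (rule covariant_derivative_frame[OF ic lif_chart u(1,2) d])
      also have "\<dots> = 0" using linear_0[OF bounded_linear.linear[OF frm_linear[OF d(1), of "snd d (\<gamma> t)"]]] d by simp
      finally show ?thesis .
    qed (auto simp: nl_covariant_derivative_def)
  qed
qed

text \<open>Uniqueness half: a parallel field is pulled back by \<open>cof\<close>, which is shown
  to be differentiable through the smooth coframe; injectivity of the frame then cancels F(x) from
  the equation.\<close>

lemma parallel_frame_equation:
  assumes ic: "\<And>t. integral_curve w \<gamma> t" and par: "nl_parallel A S UNIV \<gamma> Y"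
  defines "u \<equiv> \<lambda>t. cof (\<gamma> t, Y t)"
  shows "u t \<noteq> 0" "(u has_vector_derivative nfield w (u t)) (at t)" "Y t = lif (u t) (\<gamma> t)"
proof -
  have car: "\<gamma> t \<in> carrier G" for t using ic[of t] by (simp add: integral_curve_def)
  note EU = smooth_atlas_euclidean[OF open_UNIV] and SB = smooth_atlas_slit_bundle[OF atlas]
  have sm: "smooth_map (euclidean_atlas UNIV) (slit_bundle A) (\<lambda>t. (\<gamma> t, Y t))"
    and cov: "nl_covariant_derivative A S \<gamma> Y t = (\<lambda>_. 0)" for t
    using par by (auto simp: nl_parallel_def)
  have pt: "(\<gamma> t, Y t) \<in> points (slit_bundle A)" for t
    using smooth_map_into[OF EU SB sm, of t] by (simp add: points_euclidean)
  show u0: "u t \<noteq> 0" for t unfolding u_def by (rule cof_nonzero[OF pt])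
  have uchart: "u t = cofrm d (snd d (\<gamma> t)) (Y t d)" if "d \<in> A" "\<gamma> t \<in> fst d" for t d
    unfolding u_def by (rule cof_chart[OF slit_bundle_chart(1)[OF pt that] that])
  have Ychart: "Y t d = frm d (snd d (\<gamma> t)) (u t)" if "d \<in> A" "\<gamma> t \<in> fst d" for t d
    using frm_cofrm[OF that(1), of "snd d (\<gamma> t)" "Y t d"] uchart[OF that] that(2) by simp
  show "Y t = lif (u t) (\<gamma> t)"
  proof -
    obtain d where d: "d \<in> A" "\<gamma> t \<in> fst d" by (rule carrier_chart[OF car])
    show ?thesis
      by (rule tangent_space_eqI[OF slit_bundle_chart(1)[OF pt d] left_invariant_field_in[OF tvec_lie car] d])
        (simp add: lif_chart[OF d] Ychart[OF d])
  qed
  show "(u has_vector_derivative nfield w (u t)) (at t)"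
  proof -
    obtain d where d: "d \<in> A" "\<gamma> t \<in> fst d" by (rule carrier_chart[OF car])
    have C: "(UNIV, \<lambda>x. x) \<in> euclidean_atlas (UNIV :: real set)" by (simp add: euclidean_atlas_def)
    obtain V where V: "open V" "t \<in> V" "\<And>s. s \<in> V \<Longrightarrow> (\<gamma> s, Y s) \<in> fst (slit_chart A d)"
      "smooth_on V (\<lambda>s. snd (slit_chart A d) (\<gamma> s, Y s))"
      by (rule smooth_map_representation[OF EU SB sm C _ slit_chart_in[OF d(1)] slit_bundle_chart(3)[OF pt d]])
        (simp_all add: chart_inv_euclidean)
    have Vd: "\<gamma> s \<in> fst d" if "s \<in> V" for s using V(3)[OF that] by (simp add: slit_chart_simps)
    have "smooth_on V (\<lambda>s. fst (snd (slit_chart A d) (\<gamma> s, Y s)))" "smooth_on V (\<lambda>s. snd (snd (slit_chart A d) (\<gamma> s, Y s)))"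
      by (rule smooth_on_linear_compose[OF bounded_linear_fst V(1,4)], rule smooth_on_linear_compose[OF bounded_linear_snd V(1,4)])
    then have s1: "smooth_on V (\<lambda>s. snd d (\<gamma> s))" and s2: "smooth_on V (\<lambda>s. Y s d)" by (simp_all add: slit_chart_simps)
    have "smooth_on V (\<lambda>s. cofrm d (snd d (\<gamma> s)) (Y s d))"
    proof (rule smooth_on_linear_family[OF V(1) _ _ s2, where L="\<lambda>s. cofrm d (snd d (\<gamma> s))"])
      show "bounded_linear (cofrm d (snd d (\<gamma> s)))" if "s \<in> V" for s using Vd[OF that] by (intro cofrm_linear[OF d(1)]) simp
      show "smooth_on V (\<lambda>s. cofrm d (snd d (\<gamma> s)) v)" for v
        by (rule smooth_on_compose[OF V(1) s1 cofrm_smooth[OF d(1)] smooth_atlas_open[OF atlas d(1)]]) (use Vd in auto)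
    qed
    then have "smooth_on V u" by (rule smooth_on_congI[OF _ V(1)]) (rule uchart[OF d(1) Vd])
    then have u': "(u has_vector_derivative frechet_derivative u (at t) 1) (at t)"
      by (intro vector_derivative_frechet smooth_on_differentiable[OF _ V(2)])
    have "frm d (snd d (\<gamma> t)) (frechet_derivative u (at t) 1 - nfield w (u t)) = 0"
      using covariant_derivative_frame[OF ic Ychart u' u0 d] by (simp add: cov)
    then have "frechet_derivative u (at t) 1 - nfield w (u t) = 0"
      using frm_nonzero[OF d(1), of "snd d (\<gamma> t)"] d(2) by blast
    then show ?thesis using u' by simp
  qed
qed

text \<open>Trajectories of \<open>nfield\<close> correspond to parallel fields along \<gamma>, so
  their existence and uniqueness make the definite description meaningful and identify it.\<close>

lemma parallel_translation_flow:
  assumes ic: "\<And>t. integral_curve w \<gamma> t" and one: "\<gamma> 0 = \<one>" and y: "y \<in> slit_tangent_space A \<one>"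
    and \<phi>: "\<And>x. \<phi> 0 x = x" "\<And>t x. x \<noteq> 0 \<Longrightarrow> \<phi> t x \<noteq> 0"
    "\<And>t x. x \<noteq> 0 \<Longrightarrow> ((\<lambda>s. \<phi> s x) has_vector_derivative nfield w (\<phi> t x)) (at t)"
    "\<And>y t. \<forall>t. y t \<noteq> 0 \<and> (y has_vector_derivative nfield w (y t)) (at t) \<Longrightarrow> y t = \<phi> t (y 0)"
  shows "nl_parallel_translation A S UNIV \<gamma> 0 t y = lif (\<phi> t (y c0)) (\<gamma> t)"
  unfolding nl_parallel_translation_def
proof (rule the_equality)
  note y0 = slit_eq_tvec(1)[OF y]
  show "\<exists>Y. nl_parallel A S UNIV \<gamma> Y \<and> Y 0 = y \<and> Y t = lif (\<phi> t (y c0)) (\<gamma> t)"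
    using lif_parallel[OF ic \<phi>(3)[OF y0] \<phi>(2)[OF y0]] lif_one[OF y]
    by (intro exI[of _ "\<lambda>t. lif (\<phi> t (y c0)) (\<gamma> t)"]) (simp add: \<phi>(1) one)
  fix v assume "\<exists>Y. nl_parallel A S UNIV \<gamma> Y \<and> Y 0 = y \<and> Y t = v"
  then obtain Y where Y: "nl_parallel A S UNIV \<gamma> Y" "Y 0 = y" "Y t = v" by blast
  note pf = parallel_frame_equation[OF ic Y(1)]
  have "cof (\<gamma> t, Y t) = \<phi> t (cof (\<gamma> 0, Y 0))"
    using pf(1,2) by (intro \<phi>(4)[of "\<lambda>t. cof (\<gamma> t, Y t)"]) blast
  also have "cof (\<gamma> 0, Y 0) = y c0"
    using cof_chart[OF slit_tangent_in[OF y] c0] cofrm_frm[OF c0(1) x0(1), of "y c0"] by (simp add: one Y(2) x0_def[symmetric] frm_x0)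
  finally show "v = lif (\<phi> t (y c0)) (\<gamma> t)" using pf(3)[of t] Y(3) by simp
qed

section \<open>The one-parameter group on the slit Lie algebra\<close>

lemma slit_atlas: "smooth_atlas (slit_lie_algebra_atlas G A)"
  and chart_inv_slit_lie: "u \<noteq> 0 \<Longrightarrow> chart_inv (slit_tangent_space A \<one>, \<lambda>v. v c0) u = tvec A \<one> c0 u"
proof -
  have sub: "slit_tangent_space A \<one> \<subseteq> tangent_space A \<one>" by (auto simp: slit_tangent_in)
  have op: "open ((\<lambda>v. v c) ` slit_tangent_space A \<one>)" if "c \<in> A" "\<one> \<in> fst c" for c
    unfolding slit_tangent_space_image[OF atlas that] by (rule open_slit)
  show "smooth_atlas (slit_lie_algebra_atlas G A)"
    unfolding slit_lie_algebra_atlas_def by (rule tangent_space_atlas_smooth(1)[OF atlas sub op])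
  show "chart_inv (slit_tangent_space A \<one>, \<lambda>v. v c0) u = tvec A \<one> c0 u" if "u \<noteq> 0" for u
    using tangent_space_atlas_smooth(2)[OF atlas sub op c0 tvec_slit[OF atlas c0 that]] by (simp add: tvec_chart[OF atlas c0])
qed

lemma full_atlas: "smooth_atlas (lie_algebra_atlas G A)"
  unfolding lie_algebra_atlas_def
  by (rule tangent_space_atlas_smooth(1)[OF atlas subset_refl]) (simp add: tangent_space_image[OF atlas])

lemma points_slit_lie: "points (slit_lie_algebra_atlas G A) = slit_tangent_space A \<one>"
  unfolding slit_lie_algebra_atlas_def by (rule points_tangent_space_atlas[OF one_points])

lemma slit_lie_chart: "(slit_tangent_space A \<one>, \<lambda>v. v c0) \<in> slit_lie_algebra_atlas G A"
  and full_lie_chart: "(tangent_space A \<one>, \<lambda>v. v c0) \<in> lie_algebra_atlas G A"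
  unfolding slit_lie_algebra_atlas_def lie_algebra_atlas_def tangent_space_atlas_def using c0 by blast+

text \<open>Transfers smoothness from the model space in the single chart c0. B and M are left open
  because the target is the slit Lie algebra for the flow and the full one for the field.\<close>

lemma smooth_map_from_slit:
  assumes B: "smooth_atlas B" and C: "(M, \<lambda>v. v c0) \<in> B"
    and f: "\<And>y. y \<in> slit_tangent_space A \<one> \<Longrightarrow> f y = tvec A \<one> c0 (F (y c0))"
    and M: "\<And>u. u \<noteq> 0 \<Longrightarrow> tvec A \<one> c0 (F u) \<in> M" and F: "smooth_on (- {0}) F"
  shows "smooth_map (slit_lie_algebra_atlas G A) B f"
proof (rule smooth_mapI[OF slit_atlas B])
  fix y assume "y \<in> points (slit_lie_algebra_atlas G A)"
  then have y: "y \<in> slit_tangent_space A \<one>" by (simp add: points_slit_lie)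
  have fx: "f (tvec A \<one> c0 u) = tvec A \<one> c0 (F u)" if "u \<noteq> 0" for u
    using f[OF tvec_slit[OF atlas c0 that]] by (simp add: tvec_chart[OF atlas c0])
  have "smooth_on (- {0}) (\<lambda>x. f (chart_inv (slit_tangent_space A \<one>, \<lambda>v. v c0) x) c0)"
    by (rule smooth_on_congI[OF F open_slit]) (simp add: chart_inv_slit_lie fx tvec_chart[OF atlas c0])
  then show "\<exists>C D V. C \<in> slit_lie_algebra_atlas G A \<and> D \<in> B \<and> y \<in> fst C \<and> open V \<and> snd C y \<in> V \<and> V \<subseteq> snd C ` fst C \<and>
       (\<forall>x\<in>V. f (chart_inv C x) \<in> fst D) \<and> smooth_on V (\<lambda>x. snd D (f (chart_inv C x)))"
    using slit_lie_chart C open_slit slit_eq_tvec(1)[OF y] y M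
    by (intro exI[of _ "(slit_tangent_space A \<one>, \<lambda>v. v c0)"] exI[of _ "(M, \<lambda>v. v c0)"] exI[of _ "- {0}"])
      (simp add: slit_tangent_space_image[OF atlas c0] chart_inv_slit_lie fx)
qed

lemma smooth_map_flow:
  fixes \<rho> :: "real \<Rightarrow> ('a, 'e) tvec \<Rightarrow> ('a, 'e) tvec"
  assumes \<rho>: "\<And>t y. y \<in> slit_tangent_space A \<one> \<Longrightarrow> \<rho> t y = tvec A \<one> c0 (\<phi> t (y c0))"
    and \<phi>: "\<And>t x. x \<noteq> 0 \<Longrightarrow> \<phi> t x \<noteq> 0" "smooth_on (UNIV \<times> - {0}) (\<lambda>(t, x). \<phi> t x)"
  shows "smooth_map (prod_atlas (euclidean_atlas UNIV) (slit_lie_algebra_atlas G A)) (slit_lie_algebra_atlas G A) (\<lambda>(t, y). \<rho> t y)"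
proof (rule smooth_mapI[OF smooth_atlas_prod[OF smooth_atlas_euclidean[OF open_UNIV] slit_atlas] slit_atlas])
  fix z assume "z \<in> points (prod_atlas (euclidean_atlas (UNIV :: real set)) (slit_lie_algebra_atlas G A))"
  then obtain t y where z: "z = (t, y)" and y: "y \<in> slit_tangent_space A \<one>"
    by (auto simp: points_prod_atlas points_slit_lie)
  let ?R = "(UNIV, \<lambda>x. x) :: (real, real) chart" and ?D = "(slit_tangent_space A \<one>, \<lambda>v. v c0)"
  let ?C = "prod_chart ?R ?D"
  have R: "?R \<in> euclidean_atlas UNIV" by (simp add: euclidean_atlas_def)
  have inv: "chart_inv ?C (s, u) = (s, tvec A \<one> c0 u)" if "u \<noteq> 0" for s u
    using chart_inv_prod[OF smooth_atlas_inj[OF smooth_atlas_euclidean[OF open_UNIV] R] smooth_atlas_inj[OF slit_atlas slit_lie_chart], of s u] that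
    by (simp add: slit_tangent_space_image[OF atlas c0] chart_inv_slit_lie chart_inv_euclidean)
  have rep: "\<rho> s (tvec A \<one> c0 u) = tvec A \<one> c0 (\<phi> s u)" if "u \<noteq> 0" for s u
    using \<rho>[OF tvec_slit[OF atlas c0 that]] by (simp add: tvec_chart[OF atlas c0])
  let ?V = "UNIV \<times> - {0} :: (real \<times> 'e) set"
  have oV: "open ?V" by (rule open_Times_slit[OF open_UNIV])
  have "smooth_on ?V (\<lambda>x. snd ?D ((\<lambda>(t, y). \<rho> t y) (chart_inv ?C x)))"
  proof (rule smooth_on_congI[OF \<phi>(2) oV])
    fix x assume "x \<in> ?V"
    then obtain s u where "x = (s, u)" "u \<noteq> 0" by auto
    then show "snd ?D ((\<lambda>(t, y). \<rho> t y) (chart_inv ?C x)) = (\<lambda>(t, x). \<phi> t x) x"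
      by (simp add: inv rep tvec_chart[OF atlas c0])
  qed
  moreover have "\<forall>x\<in>?V. (\<lambda>(t, y). \<rho> t y) (chart_inv ?C x) \<in> fst ?D"
    using \<phi>(1) by (auto simp: inv rep tvec_slit[OF atlas c0])
  moreover have "snd ?C z \<in> ?V" using slit_eq_tvec(1)[OF y] by (simp add: z prod_chart_simps)
  moreover have "?V \<subseteq> snd ?C ` fst ?C"
    by (simp add: prod_chart_simps prod_chart_image slit_tangent_space_image[OF atlas c0])
  moreover have "z \<in> fst ?C" using y by (simp add: z prod_chart_simps)
  ultimately show "\<exists>C D V. C \<in> prod_atlas (euclidean_atlas UNIV) (slit_lie_algebra_atlas G A) \<and> D \<in> slit_lie_algebra_atlas G A \<and>
      z \<in> fst C \<and> open V \<and> snd C z \<in> V \<and> V \<subseteq> snd C ` fst C \<and>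
      (\<forall>x\<in>V. (\<lambda>(t, y). \<rho> t y) (chart_inv C x) \<in> fst D) \<and> smooth_on V (\<lambda>x. snd D ((\<lambda>(t, y). \<rho> t y) (chart_inv C x)))"
    by (intro exI[of _ ?C] exI[of _ ?D] exI[of _ ?V] conjI prod_chart_in[OF R slit_lie_chart] slit_lie_chart oV)
qed

lemma flow_one_parameter_group:
  fixes \<rho> :: "real \<Rightarrow> ('a, 'e) tvec \<Rightarrow> ('a, 'e) tvec"
  assumes \<rho>: "\<And>t y. y \<in> slit_tangent_space A \<one> \<Longrightarrow> \<rho> t y = tvec A \<one> c0 (\<phi> t (y c0))"
    and \<phi>: "\<And>x. \<phi> 0 x = x" "\<And>t x. x \<noteq> 0 \<Longrightarrow> \<phi> t x \<noteq> 0" "\<And>s t x. \<phi> (s + t) x = \<phi> s (\<phi> t x)"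
      "smooth_on (UNIV \<times> - {0}) (\<lambda>(t, x). \<phi> t x)"
  shows "one_parameter_diffeo_group (slit_lie_algebra_atlas G A) \<rho>"
proof -
  let ?S = "slit_tangent_space A \<one>"
  have in_S: "\<rho> t y \<in> ?S" if "y \<in> ?S" for t y
    unfolding \<rho>[OF that] by (rule tvec_slit[OF atlas c0 \<phi>(2)[OF slit_eq_tvec(1)[OF that]]])
  have add: "\<rho> (s + t) y = \<rho> s (\<rho> t y)" if y: "y \<in> ?S" for s t y
  proof -
    have "\<rho> s (\<rho> t y) = tvec A \<one> c0 (\<phi> s (\<rho> t y c0))" by (rule \<rho>[OF in_S[OF y]])
    also have "\<rho> t y c0 = \<phi> t (y c0)" by (simp add: \<rho>[OF y] tvec_chart[OF atlas c0])
    finally show ?thesis by (simp add: \<rho>[OF y] \<phi>(3))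
  qed
  have zero: "\<rho> 0 y = y" if y: "y \<in> ?S" for y
    unfolding \<rho>[OF y] \<phi>(1) by (rule slit_eq_tvec(2)[OF y, symmetric])
  have inverse: "\<rho> (- t) (\<rho> t y) = y" if y: "y \<in> ?S" for t y
    using add[OF y, of "- t" t] zero[OF y] by simp
  have forth: "\<rho> t (\<rho> (- t) y) = y" if y: "y \<in> ?S" for t y
    using inverse[OF y, of "- t"] by simp
  have sm: "smooth_map (slit_lie_algebra_atlas G A) (slit_lie_algebra_atlas G A) (\<rho> t)" for t
  proof (rule smooth_map_from_slit[OF slit_atlas slit_lie_chart \<rho>])
    show "tvec A \<one> c0 (\<phi> t u) \<in> ?S" if "u \<noteq> 0" for u by (rule tvec_slit[OF atlas c0 \<phi>(2)[OF that]])
    have "smooth_on (- {0}) (\<lambda>u. (\<lambda>(t, x). \<phi> t x) (t, u))"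
      by (rule smooth_on_compose[OF open_slit smooth_on_Pair[OF open_slit smooth_on_const smooth_on_id] \<phi>(4) open_Times_slit[OF open_UNIV]]) auto
    then show "smooth_on (- {0}) (\<phi> t)" by simp
  qed
  have bij: "bij_betw (\<rho> t) ?S ?S" for t
    by (rule bij_betw_byWitness[where f'="\<rho> (- t)"]) (use inverse forth in_S in auto)
  have "diffeomorphism (slit_lie_algebra_atlas G A) (slit_lie_algebra_atlas G A) (\<rho> t)" for t
    unfolding diffeomorphism_def points_slit_lie
  proof (intro conjI bij sm)
    \<comment> \<open>The inverse is the map at time -t; the two are compared on the slit Lie
      algebra only, whence the congruence rule.\<close>
    show "smooth_map (slit_lie_algebra_atlas G A) (slit_lie_algebra_atlas G A) (inv_into ?S (\<rho> t))"
    proof (rule smooth_map_cong[OF slit_atlas slit_atlas sm[of "- t"]])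
      fix y assume "y \<in> points (slit_lie_algebra_atlas G A)"
      then have y: "y \<in> ?S" by (simp add: points_slit_lie)
      have "inv_into ?S (\<rho> t) (\<rho> t (\<rho> (- t) y)) = \<rho> (- t) y"
        by (rule inv_into_f_f[OF bij_betw_imp_inj_on[OF bij] in_S[OF y]])
      then show "\<rho> (- t) y = inv_into ?S (\<rho> t) y" by (simp add: forth[OF y])
    qed
  qed
  then show ?thesis
    unfolding one_parameter_diffeo_group_def points_slit_lie
    using smooth_map_flow[where \<rho>=\<rho> and \<phi>=\<phi>, OF \<rho> \<phi>(2,4)] zero add by simp
qed

text \<open>Translating back to the identity undoes \<open>lif\<close>, so \<rho> t is the flow of
  \<open>nfield\<close> read in c0, and the claims about \<rho> become claims about \<phi>.\<close>

lemma parallel_translation_generated: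
  assumes w: "w \<in> lie_algebra G A"
    and c: "\<And>t. c t = lie_exp G A (\<lambda>d. t *\<^sub>R w d)"
    and \<rho>: "\<And>t. \<rho> t = differential A A (L (inv (c t))) (c t) \<circ> nl_parallel_translation A S UNIV c 0 t"
  shows "generated_by_on_slit_lie_algebra G A \<rho> (\<lambda>y d. - connection_operator G A n e S y w d)"
proof -
  obtain \<gamma> where \<gamma>: "\<And>t. lie_exp G A (\<lambda>d. t *\<^sub>R w d) = \<gamma> t" "\<And>s t. \<gamma> (s + t) = \<gamma> s \<otimes> \<gamma> t" "\<And>t. integral_curve (w c0) \<gamma> t"
    by (rule lie_exp_integral_curve[OF w]) blast
  have c\<gamma>: "c = \<gamma>" using c \<gamma>(1) by auto
  have car: "\<gamma> t \<in> carrier G" for t using \<gamma>(3)[of t] by (simp add: integral_curve_def)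
  have one: "\<gamma> 0 = \<one>" by (rule hom_one[OF \<gamma>(2) car])
  let ?S = "slit_tangent_space A \<one>"
  obtain \<phi> where \<phi>: "\<And>x. \<phi> 0 x = x" "\<And>t x. x \<noteq> 0 \<Longrightarrow> \<phi> t x \<noteq> 0"
    "\<And>t x. x \<noteq> 0 \<Longrightarrow> ((\<lambda>s. \<phi> s x) has_vector_derivative nfield (w c0) (\<phi> t x)) (at t)"
    "\<And>s t x. \<phi> (s + t) x = \<phi> s (\<phi> t x)" "smooth_on (UNIV \<times> - {0}) (\<lambda>(t, x). \<phi> t x)"
    "\<And>y t. \<forall>t. y t \<noteq> 0 \<and> (y has_vector_derivative nfield (w c0) (y t)) (at t) \<Longrightarrow> y t = \<phi> t (y 0)"
  proof (rule homogeneous_field_flow[OF nfield_smooth[of "w c0"]])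
    show "nfield (w c0) (r *\<^sub>R y) = r *\<^sub>R nfield (w c0) y" if "r > 0" "y \<noteq> 0" for r y
      by (rule nfield_homogeneous[OF that])
  qed blast
  have \<rho>\<phi>: "\<rho> t y = tvec A \<one> c0 (\<phi> t (y c0))" if y: "y \<in> ?S" for t y
    by (simp add: \<rho> c\<gamma> parallel_translation_flow[OF \<gamma>(3) one y \<phi>(1,2,3,6)] lif_back[OF car])
  have X: "(\<lambda>d. - connection_operator G A n e S y w d) = tvec A \<one> c0 (nfield (w c0) (y c0))" if y: "y \<in> ?S" for y
    using linear_neg[OF bounded_linear.linear[OF tvec_linear[OF atlas c0]]]
    by (simp add: connection_operator_tvec[OF y w] nfield_def fun_eq_iff)
  show ?thesis
    unfolding generated_by_on_slit_lie_algebra_def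
  proof (intro conjI ballI allI)
    show "smooth_map (slit_lie_algebra_atlas G A) (lie_algebra_atlas G A) (\<lambda>y d. - connection_operator G A n e S y w d)"
      by (rule smooth_map_from_slit[where f="\<lambda>y d. - connection_operator G A n e S y w d" and F="nfield (w c0)",
            OF full_atlas full_lie_chart X _ nfield_smooth])
        (simp_all only: tvec_in_tangent_space[OF atlas c0])
    show "one_parameter_diffeo_group (slit_lie_algebra_atlas G A) \<rho>"
      by (rule flow_one_parameter_group[where \<rho>=\<rho> and \<phi>=\<phi>, OF \<rho>\<phi> \<phi>(1,2,4,5)])
    fix y t d assume y: "y \<in> ?S"
    \<comment> \<open>The coordinate form of the field is known on the slit Lie algebra, and it is
      evaluated at \<rho> t y.\<close>
    have \<rho>S: "\<rho> t y \<in> ?S" unfolding \<rho>\<phi>[OF y] by (rule tvec_slit[OF atlas c0 \<phi>(2)[OF slit_eq_tvec(1)[OF y]]])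
    have "((\<lambda>s. tvec A \<one> c0 (\<phi> s (y c0)) d) has_vector_derivative tvec A \<one> c0 (nfield (w c0) (\<phi> t (y c0))) d) (at t)"
      by (rule bounded_linear.has_vector_derivative[OF tvec_linear[OF atlas c0] \<phi>(3)[OF slit_eq_tvec(1)[OF y]]])
    moreover have "- connection_operator G A n e S (\<rho> t y) w d = tvec A \<one> c0 (nfield (w c0) (\<phi> t (y c0))) d"
      using fun_cong[OF X[OF \<rho>S], of d] by (simp add: \<rho>\<phi>[OF y] tvec_chart[OF atlas c0])
    ultimately show "((\<lambda>s. \<rho> s y d) has_vector_derivative - connection_operator G A n e S (\<rho> t y) w d) (at t)"
      by (simp add: \<rho>\<phi>[OF y])
  qed
qed

end

theorem theorem1p5:
  fixes G :: "('a, 'm) monoid_scheme"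
    and A :: "('a, 'e::euclidean_space) atlas"
    and S :: "'a \<times> ('a, 'e) tvec \<Rightarrow> ('a \<times> ('a, 'e) tvec, 'e \<times> 'e) tvec"
    and n :: nat
    and e :: "nat \<Rightarrow> ('a, 'e) tvec"
    and w :: "('a, 'e) tvec"
    and c :: "real \<Rightarrow> 'a"
    and \<rho> :: "real \<Rightarrow> ('a, 'e) tvec \<Rightarrow> ('a, 'e) tvec"
  assumes "lie_group G A"
    and "connected_space (atlas_topology A)"
    and "left_invariant_spray G A S"
    and "is_basis (lie_algebra G A) n e"
    and "w \<in> lie_algebra G A"
    and "\<And>t. c t = lie_exp G A (\<lambda>d. t *\<^sub>R w d)"
    and "\<And>t. \<rho> t = differential A A (left_translation G (inv\<^bsub>G\<^esub> (c t))) (c t)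
                    \<circ> nl_parallel_translation A S UNIV c 0 t"
  shows "generated_by_on_slit_lie_algebra G A \<rho>
           (\<lambda>y d. - connection_operator G A n e S y w d)"
proof -
  have "\<one>\<^bsub>G\<^esub> \<in> points A"
    using assms(1) by (simp add: lie_group_def group.is_monoid monoid.one_closed)
  then obtain c0 where c0: "c0 \<in> A" "\<one>\<^bsub>G\<^esub> \<in> fst c0" by (auto simp: points_def)
  interpret left_invariant_spray_chart G A c0 S n e
    by unfold_locales (use assms(1,3,4) c0 in auto)
  show ?thesis by (rule parallel_translation_generated[OF assms(5,6,7)])
qed

end
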